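(* Let $G$ be a compact quantum group, $\theta$ a continuous left action of the reduced form of $G$ on a C$^*$-algebra $B$, and $\mathcal B\subset B$ the $*$-subalgebra of regular elements. Let $\Omega$ be a unitary $2$-cocycle on the dual discrete quantum group $\hat G$, let $G_\Omega$ be the corresponding deformed compact quantum group, and let $u=m(\iota\otimes\hat S)(\Omega)\in\mathcal U(G)$. Then the following formulas define a new $*$-algebra $\mathcal B_\Omega$ with underlying space $\mathcal B$, product $\star$ and involution $\dagger$: $$x\star y=m\big((x\otimes y)\lhd\Omega\big),\qquad x^\dagger=x^*\lhd u^*,$$ where in the first formula $m\colon\mathcal B\otimes\mathcal B\to\mathcal B$ is the original product map. Furthermore, the map $\theta$, considered as a map $\mathcal B_\Omega\to\mathbb C[G_\Omega]\otimes\mathcal B_\Omega$, defines a left algebraic action of $G_\Omega$ on $\mathcal B_\Omega$.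
   Context: **Compact quantum groups.** $G$ is a compact quantum group in the sense of Woronowicz, $h$ its Haar state, $(\mathbb C[G],\Delta)$ the Hopf $*$-algebra of matrix coefficients of its finite dimensional representations, with antipode $S$. The reduced form of $G$ is the one for which $h$ is faithful on $C(G)$. **Dual algebra.** $\mathcal U(G)=\mathbb C[G]^*$ is a $*$-algebra with product $\omega\eta=(\omega\otimes\eta)\Delta$ and involution $\omega^*(a)=\overline{\omega(S(a)^* )}$; similarly $(\mathbb C[G]\otimes\mathbb C[G])^*$ is a $*$-algebra. The coproduct is $\hat\Delta\colon\mathcal U(G)\to(\mathbb C[G]\otimes\mathbb C[G])^*$, $\hat\Delta(\omega)(a\otimes b)=\omega(ab)$, and the antipode is $\hat S(\omega)=\omega\circ S$. $W^*(G)\subset\mathcal U(G)$ is the von Neumann algebra $\ell^\infty$-$\bigoplus_\alpha B(H_\alpha)$, where $U_\alpha\in B(H_\alpha)\otimes\mathbb C[G]$ are representatives of the isomorphism classes of irreducible unitary representations and $\omega\in\mathcal U(G)$ is identified with the family $((\iota\otimes\omega)(U_\alpha))_\alpha$. In the formula for $u$, $m\colon(\mathbb C[G]\otimes\mathbb C[G])^*\to\mathbb C[G]^*$ is the product map of $\mathcal U(G)$, i.e. the map dual to $\Delta$. **Cocycles.** A unitary $2$-cocycle on $\hat G$ is a unitary $\Omega\in W^*(G)\bar\otimes W^*(G)\subset(\mathbb C[G]\otimes\mathbb C[G])^*$ with $(\Omega\otimes1)(\hat\Delta\otimes\iota)(\Omega)=(1\otimes\Omega)(\iota\otimes\hat\Delta)(\Omega)$.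 The element $u=m(\iota\otimes\hat S)(\Omega)$ is invertible, with inverse $u^{-1}=m(\hat S\otimes\iota)(\Omega^* )=\hat S(u^* )$. **Deformed quantum group.** $G_\Omega$ is the compact quantum group with $\mathbb C[G_\Omega]=\mathbb C[G]$ as coalgebras, with product dual to the coproduct $\hat\Delta_\Omega(\omega)=\Omega\hat\Delta(\omega)\Omega^*$ on $\mathcal U(G)$ (i.e. $\omega(a\cdot_\Omega b)=\hat\Delta_\Omega(\omega)(a\otimes b)$), and involution $a^\dagger=(u^*\otimes\iota\otimes(u^{-1})^* )\Delta^{(2)}(a^* )$, where $\Delta^{(2)}=(\Delta\otimes\iota)\Delta$. **Actions.** A continuous left action of $G$ on a C$^*$-algebra $B$ is an injective $*$-homomorphism $\theta\colon B\to C(G)\otimes B$ such that $(\Delta\otimes\iota)\theta=(\iota\otimes\theta)\theta$ and $(C(G)\otimes1)\theta(B)$ is dense in $C(G)\otimes B$. The algebra of regular elements $\mathcal B$ is the set of $x\in B$ such that $\theta(x)$ lies in the algebraic tensor product $\mathbb C[G]\otimes B$; it is a dense $*$-subalgebra of $B$ and $\theta$ restricts to a left coaction $\mathcal B\to\mathbb C[G]\otimes\mathcal B$. A right $\mathcal U(G)$-module structure on $\mathcal B$ is defined by $x\lhd\omega=(\omega\otimes\iota)\theta(x)$; likewise $(\mathbb C[G]\otimes\mathbb C[G])^*$ acts on $\mathcal B\otimes\mathcal B$ on the right: if $\theta(x)=\sum x_{(1)}\otimes x_{(2)}$ and $\theta(y)=\sum y_{(1)}\otimes y_{(2)}$, then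 $(x\otimes y)\lhd\Omega=\sum\Omega(x_{(1)}\otimes y_{(1)})\,x_{(2)}\otimes y_{(2)}$. **Algebraic actions.** A left algebraic action of a compact quantum group $H$ on a $*$-algebra $\mathcal D$ is a left coaction $\theta\colon\mathcal D\to\mathbb C[H]\otimes\mathcal D$ of the Hopf $*$-algebra $(\mathbb C[H],\Delta)$ on the $*$-algebra $\mathcal D$ (in particular a $*$-homomorphism) such that, with $h$ the Haar state of $H$: (i) the fixed point algebra $A=\{x\in\mathcal D:\theta(x)=1\otimes x\}$ is a C$^*$-algebra; (ii) $E=(h\otimes\iota)\theta\colon\mathcal D\to A$ is positive and faithful, i.e. $E(x^*x)\ge0$ for all $x$ and $E(x^*x)\ne0$ for $x\neq0$; (iii) $E(x^*a^*ax)\le\|a\|^2E(x^*x)$ for all $a\in A$, $x\in\mathcal D$.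
   Formalization: The unitary 2-cocycle Ω is additionally assumed normalized (counital), (ε⊗ε)(Ω)=1; without this the claim fails, e.g. for trivial G and Ω=z with |z|=1, z≠1, where † is not antimultiplicative for ⋆. *)

theory Defs
  imports "HOL-Analysis.Analysis" "HOL-Library.Nonpos_Ints"
begin

section \<open>Complex vector spaces and C*-algebras\<close>

class scaleC =
  fixes scaleC :: "complex \<Rightarrow> 'a \<Rightarrow> 'a"  (infixr \<open>*\<^sub>C\<close> 75)

class complex_vector = scaleC + ab_group_add +
  assumes scaleC_add_right: "c *\<^sub>C (x + y) = c *\<^sub>C x + c *\<^sub>C y"
    and scaleC_add_left: "(c + d) *\<^sub>C x = c *\<^sub>C x + d *\<^sub>C x"
    and scaleC_scaleC: "c *\<^sub>C (d *\<^sub>C x) = (c * d) *\<^sub>C x"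
    and scaleC_one: "1 *\<^sub>C x = x"

global_interpretation complex_vector: vector_space "scaleC :: complex \<Rightarrow> 'a \<Rightarrow> 'a::complex_vector"
  by unfold_locales (simp_all add: scaleC_add_right scaleC_add_left scaleC_scaleC scaleC_one)

instantiation complex :: complex_vector
begin
definition scaleC_complex :: "complex \<Rightarrow> complex \<Rightarrow> complex" where "scaleC_complex = (*)"
instance by standard (simp_all add: scaleC_complex_def algebra_simps)
end

abbreviation clinear :: "('a::complex_vector \<Rightarrow> 'b::complex_vector) \<Rightarrow> bool" where
  "clinear \<equiv> Vector_Spaces.linear scaleC scaleC"

definition cbilinear :: "('a::complex_vector \<Rightarrow> 'b::complex_vector \<Rightarrow> 'c::complex_vector) \<Rightarrow> bool" where
  "cbilinear F \<longleftrightarrow> (\<forall>a. clinear (F a)) \<and> (\<forall>b. clinear (\<lambda>a. F a b))"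

text \<open>C*-algebras are not assumed to be unital; the unital ones are those of sort
  \<open>{cstar_algebra, real_normed_algebra_1}\<close>.\<close>

class cstar_algebra = complex_vector + real_normed_algebra + banach +
  fixes star :: "'a \<Rightarrow> 'a"
  assumes scaleR_scaleC: "r *\<^sub>R x = complex_of_real r *\<^sub>C x"
    and scaleC_mult_left: "(c *\<^sub>C x) * y = c *\<^sub>C (x * y)"
    and scaleC_mult_right: "x * (c *\<^sub>C y) = c *\<^sub>C (x * y)"
    and norm_scaleC: "norm (c *\<^sub>C x) = cmod c * norm x"
    and star_add: "star (x + y) = star x + star y"
    and star_scaleC: "star (c *\<^sub>C x) = cnj c *\<^sub>C star x"
    and star_mult: "star (x * y) = star y * star x"
    and star_star: "star (star x) = x"
    and norm_star_mult_self: "norm (star x * x) = (norm x)\<^sup>2"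

definition star_hom :: "('a::cstar_algebra \<Rightarrow> 'b::cstar_algebra) \<Rightarrow> bool" where
  "star_hom f \<longleftrightarrow> clinear f \<and> (\<forall>x y. f (x * y) = f x * f y) \<and> (\<forall>x. f (star x) = star (f x))"

definition positive_functional :: "('a::cstar_algebra \<Rightarrow> complex) \<Rightarrow> bool" where
  "positive_functional \<phi> \<longleftrightarrow> clinear \<phi> \<and> (\<forall>x. \<phi> (star x * x) \<in> \<real>\<^sub>\<ge>\<^sub>0)"


section \<open>Algebraic tensor products\<close>

text \<open>Finite sums of elementary tensors are represented by lists of pairs. Since bilinear forms
  separate the points of the algebraic tensor product, two lists represent the same tensor iff
  every bilinear form takes the same value on them.\<close>

definition pair_sum :: "('a \<Rightarrow> 'b \<Rightarrow> 'c::comm_monoid_add) \<Rightarrow> ('a \<times> 'b) list \<Rightarrow> 'c" where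
  "pair_sum F xs = (\<Sum>(a, b) \<leftarrow> xs. F a b)"

lemma pair_sum_simps [simp]:
  "pair_sum F [] = 0"
  "pair_sum F ((a, b) # xs) = F a b + pair_sum F xs"
  "pair_sum F (xs @ ys) = pair_sum F xs + pair_sum F ys"
  by (simp_all add: pair_sum_def)

definition tensor_eq ::
    "('a::complex_vector \<times> 'b::complex_vector) list \<Rightarrow> ('a \<times> 'b) list \<Rightarrow> bool" where
  "tensor_eq xs ys \<longleftrightarrow>
     (\<forall>F::'a \<Rightarrow> 'b \<Rightarrow> complex. cbilinear F \<longrightarrow> pair_sum F xs = pair_sum F ys)"

quotient_type (overloaded) ('a, 'b) tensor =
    "('a::complex_vector \<times> 'b::complex_vector) list" / tensor_eq
  morphisms rep_tensor abs_tensor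
  by (rule equivpI) (auto simp: reflp_def symp_def transp_def tensor_eq_def)

lemma cbilinearD:
  assumes "cbilinear F"
  shows "F (a + a') b = F a b + F a' b" "F a (b + b') = F a b + F a b'"
    and "F (c *\<^sub>C a) b = c *\<^sub>C F a b" "F a (c *\<^sub>C b) = c *\<^sub>C F a b"
  using assms
  by (auto simp: cbilinear_def Vector_Spaces.linear_iff)

lemma pair_sum_scaleC:
  fixes F :: "'a::complex_vector \<Rightarrow> 'b::complex_vector \<Rightarrow> 'c::complex_vector"
  shows "cbilinear F \<Longrightarrow> pair_sum F (map (\<lambda>(a, b). (c *\<^sub>C a, b)) xs) = c *\<^sub>C pair_sum F xs"
  by (induction xs) (auto simp: cbilinearD complex_vector.scale_right_distrib)

instantiation tensor :: (complex_vector, complex_vector) complex_vector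
begin

lift_definition zero_tensor :: "('a, 'b) tensor" is "[]" .

lift_definition plus_tensor :: "('a, 'b) tensor \<Rightarrow> ('a, 'b) tensor \<Rightarrow> ('a, 'b) tensor" is "(@)"
  by (simp add: tensor_eq_def)

lift_definition scaleC_tensor :: "complex \<Rightarrow> ('a, 'b) tensor \<Rightarrow> ('a, 'b) tensor"
  is "\<lambda>c. map (\<lambda>(a, b). (c *\<^sub>C a, b))"
  by (simp add: tensor_eq_def pair_sum_scaleC)

definition uminus_tensor :: "('a, 'b) tensor \<Rightarrow> ('a, 'b) tensor" where
  "uminus_tensor t = (-1) *\<^sub>C t"

definition minus_tensor :: "('a, 'b) tensor \<Rightarrow> ('a, 'b) tensor \<Rightarrow> ('a, 'b) tensor" where
  "minus_tensor s t = s + - (t :: ('a, 'b) tensor)"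

instance
proof
  fix a b c :: "('a, 'b) tensor" and x y :: complex
  show "a + b + c = a + (b + c)" by transfer (simp add: tensor_eq_def)
  show "a + b = b + a" by transfer (simp add: tensor_eq_def add.commute)
  show "0 + a = a" by transfer (simp add: tensor_eq_def)
  show "- a + a = 0" unfolding uminus_tensor_def
    by transfer (simp add: tensor_eq_def pair_sum_scaleC scaleC_complex_def
        del: complex_vector.scale_minus_left)
  show "a - b = a + - b" by (simp add: minus_tensor_def)
  show "x *\<^sub>C (a + b) = x *\<^sub>C a + x *\<^sub>C b"
    by transfer (simp add: tensor_eq_def)
  show "(x + y) *\<^sub>C a = x *\<^sub>C a + y *\<^sub>C a"
    by transfer (simp add: tensor_eq_def pair_sum_scaleC scaleC_complex_def distrib_right)
  show "x *\<^sub>C (y *\<^sub>C a) = (x * y) *\<^sub>C a"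
    by transfer (simp add: tensor_eq_def pair_sum_scaleC scaleC_complex_def mult.assoc del: map_map)
  show "1 *\<^sub>C a = a"
    by transfer (simp add: tensor_eq_def pair_sum_scaleC scaleC_complex_def)
qed

end

lift_definition tensor :: "'a::complex_vector \<Rightarrow> 'b::complex_vector \<Rightarrow> ('a, 'b) tensor"
    (infixr \<open>\<otimes>\<close> 72)
  is "\<lambda>a b. [(a, b)]" .

text \<open>\<open>tensor_on S T\<close> is the tensor product of the subspaces \<open>S\<close> and \<open>T\<close>, as a subspace of the
  tensor product of the ambient spaces, and \<open>tensor_lift_on S T F\<close> is the map on it induced by
  \<open>F\<close>. The choice of a decomposition does not matter when \<open>F\<close> is bilinear on
  \<open>S \<times> T\<close>, and neither when it is conjugate linear in both variables there.\<close>

definition tensor_on :: "'a::complex_vector set \<Rightarrow> 'b::complex_vector set \<Rightarrow> ('a, 'b) tensor set" where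
  "tensor_on S T = {abs_tensor xs | xs. set xs \<subseteq> S \<times> T}"

definition tensor_lift_on ::
    "'a::complex_vector set \<Rightarrow> 'b::complex_vector set \<Rightarrow> ('a \<Rightarrow> 'b \<Rightarrow> 'c::comm_monoid_add)
      \<Rightarrow> ('a, 'b) tensor \<Rightarrow> 'c" where
  "tensor_lift_on S T F t = pair_sum F (SOME xs. set xs \<subseteq> S \<times> T \<and> abs_tensor xs = t)"

definition tensor_lift ::
    "('a::complex_vector \<Rightarrow> 'b::complex_vector \<Rightarrow> 'c::comm_monoid_add) \<Rightarrow> ('a, 'b) tensor \<Rightarrow> 'c" where
  "tensor_lift = tensor_lift_on UNIV UNIV"

lemma clinear_separates:
  fixes v w :: "'a::complex_vector"
  assumes "\<And>f :: 'a \<Rightarrow> complex. clinear f \<Longrightarrow> f v = f w"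
  shows "v = w"
proof (rule ccontr)
  assume "v \<noteq> w"
  interpret vector_space_pair "scaleC :: complex \<Rightarrow> 'a \<Rightarrow> 'a" "scaleC :: complex \<Rightarrow> complex \<Rightarrow> complex" ..
  have "\<not> complex_vector.dependent {v - w}"
    using \<open>v \<noteq> w\<close> by simp
  from linear_independent_extend[OF this, of "\<lambda>_. 1"]
  obtain f :: "'a \<Rightarrow> complex" where f: "clinear f" "f (v - w) = 1" by auto
  from assms[OF f(1)] f(2) linear_diff[OF f(1), of v w] show False by simp
qed

lemma abs_tensor_eq_iff: "abs_tensor xs = abs_tensor ys \<longleftrightarrow> tensor_eq xs ys"
  by (simp add: tensor.abs_eq_iff)

lemma pair_sum_tensor_eq:
  fixes F :: "'a::complex_vector \<Rightarrow> 'b::complex_vector \<Rightarrow> 'c::complex_vector"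
  assumes F: "cbilinear F" and "tensor_eq xs ys"
  shows "pair_sum F xs = pair_sum F ys"
proof (rule clinear_separates)
  fix f :: "'c \<Rightarrow> complex" assume f: "clinear f"
  have "f 0 = 0"
    using f by (metis Vector_Spaces.linear_iff complex_vector.scale_zero_left)
  then have eq: "f (pair_sum F zs) = pair_sum (\<lambda>a b. f (F a b)) zs" for zs
    using f by (induction zs) (auto simp: Vector_Spaces.linear_iff)
  have "cbilinear (\<lambda>a b. f (F a b))"
    using F f by (auto simp: cbilinear_def Vector_Spaces.linear_iff)
  with assms(2) show "f (pair_sum F xs) = f (pair_sum F ys)"
    by (simp add: eq tensor_eq_def)
qed

lemma tensor_lift_abs:
  fixes F :: "'a::complex_vector \<Rightarrow> 'b::complex_vector \<Rightarrow> 'c::complex_vector"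
  assumes "cbilinear F"
  shows "tensor_lift F (abs_tensor xs) = pair_sum F xs"
proof -
  have "abs_tensor (SOME ys. set ys \<subseteq> UNIV \<times> UNIV \<and> abs_tensor ys = abs_tensor xs) = abs_tensor xs"
    by (rule someI2[of _ xs]) auto
  then show ?thesis unfolding tensor_lift_def tensor_lift_on_def
    by (intro pair_sum_tensor_eq[OF assms]) (simp add: abs_tensor_eq_iff)
qed

lemma tensor_lift_tensor:
  fixes F :: "'a::complex_vector \<Rightarrow> 'b::complex_vector \<Rightarrow> 'c::complex_vector"
  assumes "cbilinear F"
  shows "tensor_lift F (a \<otimes> b) = F a b"
  by (simp add: tensor.abs_eq tensor_lift_abs[OF assms])

lemma clinear_tensor_lift:
  fixes F :: "'a::complex_vector \<Rightarrow> 'b::complex_vector \<Rightarrow> 'c::complex_vector"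
  assumes "cbilinear F"
  shows "clinear (tensor_lift F)"
proof -
  have "tensor_lift F (s + t) = tensor_lift F s + tensor_lift F t" for s t
    by (induction s, induction t) (simp add: plus_tensor.abs_eq tensor_lift_abs[OF assms])
  moreover have "tensor_lift F (c *\<^sub>C t) = c *\<^sub>C tensor_lift F t" for c t
    by (induction t) (simp add: scaleC_tensor.abs_eq tensor_lift_abs[OF assms] pair_sum_scaleC[OF assms])
  ultimately show ?thesis
    by (simp add: Vector_Spaces.linear_iff complex_vector.vector_space_axioms)
qed

definition tensor_mult ::
    "('a::complex_vector \<Rightarrow> 'a \<Rightarrow> 'a) \<Rightarrow> ('b::complex_vector \<Rightarrow> 'b \<Rightarrow> 'b)
      \<Rightarrow> ('a, 'b) tensor \<Rightarrow> ('a, 'b) tensor \<Rightarrow> ('a, 'b) tensor" where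
  "tensor_mult m m' s t = tensor_lift (\<lambda>a b. tensor_lift (\<lambda>c d. m a c \<otimes> m' b d) t) s"

definition tensor_star ::
    "('a::complex_vector \<Rightarrow> 'a) \<Rightarrow> ('b::complex_vector \<Rightarrow> 'b) \<Rightarrow> ('a, 'b) tensor \<Rightarrow> ('a, 'b) tensor" where
  "tensor_star j j' = tensor_lift (\<lambda>a b. j a \<otimes> j' b)"

definition tensor_comult ::
    "('a::complex_vector \<Rightarrow> ('a, 'a) tensor) \<Rightarrow> ('b::complex_vector \<Rightarrow> ('b, 'b) tensor)
      \<Rightarrow> ('a, 'b) tensor \<Rightarrow> (('a, 'b) tensor, ('a, 'b) tensor) tensor" where
  "tensor_comult \<Delta> \<Delta>' = tensor_lift (\<lambda>a b.
     tensor_lift (\<lambda>a1 a2. tensor_lift (\<lambda>b1 b2. (a1 \<otimes> b1) \<otimes> (a2 \<otimes> b2)) (\<Delta>' b)) (\<Delta> a))"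


section \<open>Minimal tensor products of C*-algebras\<close>

text \<open>The spatial norm of \<open>t\<close> is the supremum of the operator norms of
  \<open>(\<pi>\<^sub>\<phi> \<otimes> \<pi>\<^sub>\<psi>)(t)\<close> over the GNS representations of all pairs of positive functionals;
  the vectors \<open>y\<close> below run through a dense subspace of \<open>H\<^sub>\<phi> \<otimes> H\<^sub>\<psi>\<close>.\<close>

definition spatial_norm :: "('a::cstar_algebra, 'b::cstar_algebra) tensor \<Rightarrow> real" where
  "spatial_norm t = Inf {M. 0 \<le> M \<and>
     (\<forall>\<phi> \<psi> y. positive_functional \<phi> \<longrightarrow> positive_functional \<psi> \<longrightarrow>
        (let mult = tensor_mult (*) (*); st = tensor_star star star;
             \<phi>\<psi> = tensor_lift (\<lambda>a b. \<phi> a * \<psi> b); z = mult t y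
         in Re (\<phi>\<psi> (mult (st z) z)) \<le> M\<^sup>2 * Re (\<phi>\<psi> (mult (st y) y))))}"

text \<open>The completed tensor product is unique up to a canonical isomorphism; a type \<open>'t\<close>
  together with a map \<open>tens\<close> is a realization of it.\<close>

definition spatial_tensor_product ::
    "('a::cstar_algebra \<Rightarrow> 'b::cstar_algebra \<Rightarrow> 't::cstar_algebra) \<Rightarrow> bool" where
  "spatial_tensor_product tens \<longleftrightarrow>
     cbilinear tens \<and>
     (\<forall>a b c d. tens a b * tens c d = tens (a * c) (b * d)) \<and>
     (\<forall>a b. star (tens a b) = tens (star a) (star b)) \<and>
     inj (tensor_lift tens) \<and>
     closure (range (tensor_lift tens)) = UNIV \<and>
     (\<forall>t. norm (tensor_lift tens t) = spatial_norm t)"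

definition spatial_triple_product ::
    "('a::cstar_algebra \<Rightarrow> 'b::cstar_algebra \<Rightarrow> 'ab::cstar_algebra)
      \<Rightarrow> ('b \<Rightarrow> 'c::cstar_algebra \<Rightarrow> 'bc::cstar_algebra)
      \<Rightarrow> ('ab \<Rightarrow> 'c \<Rightarrow> 'abc::cstar_algebra) \<Rightarrow> ('a \<Rightarrow> 'bc \<Rightarrow> 'abc) \<Rightarrow> bool" where
  "spatial_triple_product tab tbc p q \<longleftrightarrow>
     spatial_tensor_product tab \<and> spatial_tensor_product tbc \<and>
     spatial_tensor_product p \<and> spatial_tensor_product q \<and>
     (\<forall>a b c. p (tab a b) c = q a (tbc b c))"

text \<open>The identity \<open>(\<Delta> \<otimes> \<iota>)\<theta> = (\<iota> \<otimes> \<theta>)\<theta>\<close>; the extensions \<open>\<Delta> \<otimes> \<iota>\<close> and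
  \<open>\<iota> \<otimes> \<theta>\<close> to the completed tensor products are determined by their values on
  elementary tensors.\<close>

definition cstar_coassociative ::
    "('g::cstar_algebra \<Rightarrow> 'b::cstar_algebra \<Rightarrow> 'gb::cstar_algebra)
      \<Rightarrow> ('gg::cstar_algebra \<Rightarrow> 'b \<Rightarrow> 'ggb::cstar_algebra) \<Rightarrow> ('g \<Rightarrow> 'gb \<Rightarrow> 'ggb)
      \<Rightarrow> ('g \<Rightarrow> 'gg) \<Rightarrow> ('b \<Rightarrow> 'gb) \<Rightarrow> bool" where
  "cstar_coassociative tgb p q \<Delta> \<theta> \<longleftrightarrow>
     (\<exists>\<Delta>\<iota> \<iota>\<theta>. star_hom \<Delta>\<iota> \<and> star_hom \<iota>\<theta> \<and>
        (\<forall>a x. \<Delta>\<iota> (tgb a x) = p (\<Delta> a) x) \<and>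
        (\<forall>a x. \<iota>\<theta> (tgb a x) = q a (\<theta> x)) \<and>
        (\<forall>x. \<Delta>\<iota> (\<theta> x) = \<iota>\<theta> (\<theta> x)))"


section \<open>Hopf *-algebras\<close>

text \<open>The antipode of a Hopf *-algebra is determined by the remaining structure and is
  therefore not part of the record.\<close>

record (overloaded) ('h::complex_vector) star_bialgebra =
  hmult :: "'h \<Rightarrow> 'h \<Rightarrow> 'h"
  hone :: 'h
  hstar :: "'h \<Rightarrow> 'h"
  comult :: "'h \<Rightarrow> ('h, 'h) tensor"
  counit :: "'h \<Rightarrow> complex"

definition is_antipode :: "'h::complex_vector star_bialgebra \<Rightarrow> ('h \<Rightarrow> 'h) \<Rightarrow> bool" where
  "is_antipode H S \<longleftrightarrow> clinear S \<and>
     (\<forall>a. tensor_lift (\<lambda>b c. hmult H (S b) c) (comult H a) = counit H a *\<^sub>C hone H) \<and>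
     (\<forall>a. tensor_lift (\<lambda>b c. hmult H b (S c)) (comult H a) = counit H a *\<^sub>C hone H)"

definition antipode :: "'h::complex_vector star_bialgebra \<Rightarrow> 'h \<Rightarrow> 'h" where
  "antipode H = (THE S. is_antipode H S)"

definition hopf_star_algebra :: "'h::complex_vector star_bialgebra \<Rightarrow> bool" where
  "hopf_star_algebra H \<longleftrightarrow>
     cbilinear (hmult H) \<and>
     (\<forall>a b c. hmult H (hmult H a b) c = hmult H a (hmult H b c)) \<and>
     (\<forall>a. hmult H (hone H) a = a \<and> hmult H a (hone H) = a) \<and>
     (\<forall>a b. hstar H (a + b) = hstar H a + hstar H b) \<and>
     (\<forall>c a. hstar H (c *\<^sub>C a) = cnj c *\<^sub>C hstar H a) \<and>
     (\<forall>a b. hstar H (hmult H a b) = hmult H (hstar H b) (hstar H a)) \<and>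
     (\<forall>a. hstar H (hstar H a) = a) \<and>
     clinear (comult H) \<and> clinear (counit H) \<and>
     (\<forall>a. tensor_lift (\<lambda>b c. tensor_lift (\<lambda>b1 b2. b1 \<otimes> (b2 \<otimes> c)) (comult H b)) (comult H a) =
          tensor_lift (\<lambda>b c. b \<otimes> comult H c) (comult H a)) \<and>
     (\<forall>a. tensor_lift (\<lambda>b c. counit H b *\<^sub>C c) (comult H a) = a) \<and>
     (\<forall>a. tensor_lift (\<lambda>b c. counit H c *\<^sub>C b) (comult H a) = a) \<and>
     (\<forall>a b. comult H (hmult H a b) = tensor_mult (hmult H) (hmult H) (comult H a) (comult H b)) \<and>
     comult H (hone H) = hone H \<otimes> hone H \<and>
     (\<forall>a. comult H (hstar H a) = tensor_star (hstar H) (hstar H) (comult H a)) \<and>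
     (\<forall>a b. counit H (hmult H a b) = counit H a * counit H b) \<and>
     counit H (hone H) = 1 \<and>
     (\<exists>S. is_antipode H S)"

definition unitary_rep ::
    "'h::complex_vector star_bialgebra \<Rightarrow> nat \<Rightarrow> (nat \<Rightarrow> nat \<Rightarrow> 'h) \<Rightarrow> bool" where
  "unitary_rep H n U \<longleftrightarrow>
     (\<forall>i<n. \<forall>j<n. comult H (U i j) = (\<Sum>k<n. U i k \<otimes> U k j)) \<and>
     (\<forall>i<n. \<forall>j<n. (\<Sum>k<n. hmult H (hstar H (U k i)) (U k j)) = (if i = j then hone H else 0)) \<and>
     (\<forall>i<n. \<forall>j<n. (\<Sum>k<n. hmult H (U i k) (hstar H (U j k))) = (if i = j then hone H else 0))"

definition irreducible_unitary_rep ::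
    "'h::complex_vector star_bialgebra \<Rightarrow> nat \<Rightarrow> (nat \<Rightarrow> nat \<Rightarrow> 'h) \<Rightarrow> bool" where
  "irreducible_unitary_rep H n U \<longleftrightarrow> 0 < n \<and> unitary_rep H n U \<and>
     (\<forall>T :: nat \<Rightarrow> nat \<Rightarrow> complex.
        (\<forall>i<n. \<forall>j<n. (\<Sum>k<n. T i k *\<^sub>C U k j) = (\<Sum>k<n. T k j *\<^sub>C U i k)) \<longrightarrow>
        (\<exists>c. \<forall>i<n. \<forall>j<n. T i j = (if i = j then c else 0)))"

text \<open>These are exactly the Hopf *-algebras of the form \<open>\<complex>[H]\<close> for a compact quantum group \<open>H\<close>.\<close>

definition cqg_algebra :: "'h::complex_vector star_bialgebra \<Rightarrow> bool" where
  "cqg_algebra H \<longleftrightarrow> hopf_star_algebra H \<and>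
     complex_vector.span {U i j | U n i j. unitary_rep H n U \<and> i < n \<and> j < n} = UNIV"

definition haar_state :: "'h::complex_vector star_bialgebra \<Rightarrow> ('h \<Rightarrow> complex) \<Rightarrow> bool" where
  "haar_state H h \<longleftrightarrow> clinear h \<and> h (hone H) = 1 \<and>
     (\<forall>a. h (hmult H (hstar H a) a) \<in> \<real>\<^sub>\<ge>\<^sub>0) \<and>
     (\<forall>a. tensor_lift (\<lambda>b c. h b *\<^sub>C c) (comult H a) = h a *\<^sub>C hone H) \<and>
     (\<forall>a. tensor_lift (\<lambda>b c. h c *\<^sub>C b) (comult H a) = h a *\<^sub>C hone H)"

definition haar :: "'h::complex_vector star_bialgebra \<Rightarrow> 'h \<Rightarrow> complex" where
  "haar H = (THE h. haar_state H h)"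


section \<open>Compact quantum groups in the reduced form\<close>

definition compact_quantum_group ::
    "('g::{cstar_algebra, real_normed_algebra_1} \<Rightarrow> 'g \<Rightarrow> 'gg::cstar_algebra)
      \<Rightarrow> ('gg \<Rightarrow> 'g \<Rightarrow> 'ggg::cstar_algebra) \<Rightarrow> ('g \<Rightarrow> 'gg \<Rightarrow> 'ggg) \<Rightarrow> ('g \<Rightarrow> 'gg) \<Rightarrow> bool" where
  "compact_quantum_group tgg p q \<Delta> \<longleftrightarrow>
     spatial_triple_product tgg tgg p q \<and>
     star_hom \<Delta> \<and> \<Delta> 1 = tgg 1 1 \<and>
     cstar_coassociative tgg p q \<Delta> \<Delta> \<and>
     closure (complex_vector.span {tgg a 1 * \<Delta> b | a b. True}) = UNIV \<and>
     closure (complex_vector.span {tgg 1 a * \<Delta> b | a b. True}) = UNIV"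

definition finite_dim_rep ::
    "('g::{cstar_algebra, real_normed_algebra_1} \<Rightarrow> 'g \<Rightarrow> 'gg::cstar_algebra) \<Rightarrow> ('g \<Rightarrow> 'gg)
      \<Rightarrow> nat \<Rightarrow> (nat \<Rightarrow> nat \<Rightarrow> 'g) \<Rightarrow> bool" where
  "finite_dim_rep tgg \<Delta> n U \<longleftrightarrow>
     (\<forall>i<n. \<forall>j<n. \<Delta> (U i j) = (\<Sum>k<n. tgg (U i k) (U k j))) \<and>
     (\<exists>V. \<forall>i<n. \<forall>j<n. (\<Sum>k<n. U i k * V k j) = (if i = j then 1 else 0) \<and>
                     (\<Sum>k<n. V i k * U k j) = (if i = j then 1 else 0))"

text \<open>\<open>\<complex>[G] \<subseteq> C(G)\<close> is given as a type \<open>'h\<close> embedded by \<open>\<iota>\<close>, so that \<open>\<complex>[G] \<otimes> \<complex>[G]\<close>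
  and the dual spaces are again types. Its structure maps are uniquely determined.\<close>

definition matrix_coefficient_algebra ::
    "('g::{cstar_algebra, real_normed_algebra_1} \<Rightarrow> 'g \<Rightarrow> 'gg::cstar_algebra) \<Rightarrow> ('g \<Rightarrow> 'gg)
      \<Rightarrow> 'h::complex_vector star_bialgebra \<Rightarrow> ('h \<Rightarrow> 'g) \<Rightarrow> bool" where
  "matrix_coefficient_algebra tgg \<Delta> G \<iota> \<longleftrightarrow>
     clinear \<iota> \<and> inj \<iota> \<and>
     range \<iota> = complex_vector.span {U i j | U n i j. finite_dim_rep tgg \<Delta> n U \<and> i < n \<and> j < n} \<and>
     (\<forall>a b. \<iota> (hmult G a b) = \<iota> a * \<iota> b) \<and> \<iota> (hone G) = 1 \<and>
     (\<forall>a. \<iota> (hstar G a) = star (\<iota> a)) \<and>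
     (\<forall>a. \<Delta> (\<iota> a) = tensor_lift (\<lambda>b c. tgg (\<iota> b) (\<iota> c)) (comult G a)) \<and>
     cqg_algebra G"

text \<open>A positive functional is bounded and \<open>\<complex>[G]\<close> is dense, so a positive functional on
  \<open>C(G)\<close> that extends the Haar state of \<open>\<complex>[G]\<close> is the Haar state of \<open>C(G)\<close>.\<close>

definition faithful_haar_state ::
    "'h::complex_vector star_bialgebra \<Rightarrow> ('h \<Rightarrow> 'g::cstar_algebra) \<Rightarrow> bool" where
  "faithful_haar_state G \<iota> \<longleftrightarrow>
     (\<exists>\<phi>. positive_functional \<phi> \<and> haar_state G (\<lambda>a. \<phi> (\<iota> a)) \<and>
          (\<forall>x. \<phi> (star x * x) = 0 \<longrightarrow> x = 0))"

definition reduced_quantum_group ::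
    "('g::{cstar_algebra, real_normed_algebra_1} \<Rightarrow> 'g \<Rightarrow> 'gg::cstar_algebra)
      \<Rightarrow> ('gg \<Rightarrow> 'g \<Rightarrow> 'ggg::cstar_algebra) \<Rightarrow> ('g \<Rightarrow> 'gg \<Rightarrow> 'ggg) \<Rightarrow> ('g \<Rightarrow> 'gg)
      \<Rightarrow> 'h::complex_vector star_bialgebra \<Rightarrow> ('h \<Rightarrow> 'g) \<Rightarrow> bool" where
  "reduced_quantum_group tgg p q \<Delta> G \<iota> \<longleftrightarrow>
     compact_quantum_group tgg p q \<Delta> \<and>
     matrix_coefficient_algebra tgg \<Delta> G \<iota> \<and>
     faithful_haar_state G \<iota>"


section \<open>The dual algebra and cocycles\<close>

text \<open>The product on the dual of a coalgebra; elements of the dual are the functions satisfying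
  \<^const>\<open>clinear\<close>.\<close>

definition conv ::
    "('c::complex_vector \<Rightarrow> ('c, 'c) tensor) \<Rightarrow> ('c \<Rightarrow> complex) \<Rightarrow> ('c \<Rightarrow> complex) \<Rightarrow> 'c \<Rightarrow> complex" where
  "conv \<Delta> \<omega> \<eta> a = tensor_lift (\<lambda>b c. \<omega> b * \<eta> c) (\<Delta> a)"

definition dual_star :: "'h::complex_vector star_bialgebra \<Rightarrow> ('h \<Rightarrow> complex) \<Rightarrow> 'h \<Rightarrow> complex" where
  "dual_star G \<omega> a = cnj (\<omega> (hstar G (antipode G a)))"

definition dual_inverse :: "'h::complex_vector star_bialgebra \<Rightarrow> ('h \<Rightarrow> complex) \<Rightarrow> 'h \<Rightarrow> complex" where
  "dual_inverse G \<omega> = (THE \<eta>. clinear \<eta> \<and>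
     conv (comult G) \<omega> \<eta> = counit G \<and> conv (comult G) \<eta> \<omega> = counit G)"

definition dual_comult ::
    "'h::complex_vector star_bialgebra \<Rightarrow> ('h \<Rightarrow> complex) \<Rightarrow> ('h, 'h) tensor \<Rightarrow> complex" where
  "dual_comult G \<omega> = tensor_lift (\<lambda>a b. \<omega> (hmult G a b))"

definition comult2 ::
    "'h::complex_vector star_bialgebra \<Rightarrow> ('h, 'h) tensor \<Rightarrow> (('h, 'h) tensor, ('h, 'h) tensor) tensor" where
  "comult2 G = tensor_comult (comult G) (comult G)"

definition counit2 :: "'h::complex_vector star_bialgebra \<Rightarrow> ('h, 'h) tensor \<Rightarrow> complex" where
  "counit2 G = tensor_lift (\<lambda>a b. counit G a * counit G b)"

definition dual_star2 ::
    "'h::complex_vector star_bialgebra \<Rightarrow> (('h, 'h) tensor \<Rightarrow> complex) \<Rightarrow> ('h, 'h) tensor \<Rightarrow> complex" where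
  "dual_star2 G \<Omega> =
     tensor_lift (\<lambda>a b. cnj (\<Omega> (hstar G (antipode G a) \<otimes> hstar G (antipode G b))))"

text \<open>Membership of \<open>\<Omega>\<close> in \<open>W\<^sup>*(G) \<otimes> W\<^sup>*(G)\<close>, the \<open>\<ell>\<^sup>\<infinity>\<close>-sum of the algebras
  \<open>B(H\<^sub>\<alpha> \<otimes> H\<^sub>\<beta>)\<close>: the matrices of the components of \<open>\<Omega>\<close> are
  \<open>(\<Omega>(u\<^sub>i\<^sub>j \<otimes> v\<^sub>k\<^sub>l))\<close>, and their operator norms are uniformly bounded.\<close>

definition bounded_dual2 ::
    "'h::complex_vector star_bialgebra \<Rightarrow> (('h, 'h) tensor \<Rightarrow> complex) \<Rightarrow> bool" where
  "bounded_dual2 G \<Omega> \<longleftrightarrow> (\<exists>M\<ge>0. \<forall>m U n V.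
     irreducible_unitary_rep G m U \<longrightarrow> irreducible_unitary_rep G n V \<longrightarrow>
     (\<forall>\<xi> :: nat \<Rightarrow> nat \<Rightarrow> complex.
        (\<Sum>i<m. \<Sum>k<n. (cmod (\<Sum>j<m. \<Sum>l<n. \<Omega> (U i j \<otimes> V k l) * \<xi> j l))\<^sup>2)
          \<le> M\<^sup>2 * (\<Sum>j<m. \<Sum>l<n. (cmod (\<xi> j l))\<^sup>2)))"

text \<open>Functionals on \<open>\<complex>[G] \<otimes> (\<complex>[G] \<otimes> \<complex>[G])\<close> are multiplied by means of \<open>comult3\<close>.\<close>

definition comult3 ::
    "'h::complex_vector star_bialgebra \<Rightarrow> ('h, ('h, 'h) tensor) tensor
      \<Rightarrow> (('h, ('h, 'h) tensor) tensor, ('h, ('h, 'h) tensor) tensor) tensor" where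
  "comult3 G = tensor_comult (comult G) (comult2 G)"

definition trilift ::
    "('a::complex_vector \<Rightarrow> 'b::complex_vector \<Rightarrow> 'c::complex_vector \<Rightarrow> complex)
      \<Rightarrow> ('a, ('b, 'c) tensor) tensor \<Rightarrow> complex" where
  "trilift F = tensor_lift (\<lambda>a. tensor_lift (\<lambda>b c. F a b c))"

definition unitary_cocycle ::
    "'h::complex_vector star_bialgebra \<Rightarrow> (('h, 'h) tensor \<Rightarrow> complex) \<Rightarrow> bool" where
  "unitary_cocycle G \<Omega> \<longleftrightarrow>
     clinear \<Omega> \<and> bounded_dual2 G \<Omega> \<and>
     conv (comult2 G) \<Omega> (dual_star2 G \<Omega>) = counit2 G \<and>
     conv (comult2 G) (dual_star2 G \<Omega>) \<Omega> = counit2 G \<and>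
     conv (comult3 G) (trilift (\<lambda>a b c. \<Omega> (a \<otimes> b) * counit G c))
                      (trilift (\<lambda>a b c. \<Omega> (hmult G a b \<otimes> c))) =
     conv (comult3 G) (trilift (\<lambda>a b c. counit G a * \<Omega> (b \<otimes> c)))
                      (trilift (\<lambda>a b c. \<Omega> (a \<otimes> hmult G b c)))"

text \<open>\<open>\<Omega>\<close> is normalized if \<open>(\<epsilon> \<otimes> \<epsilon>)(\<Omega>) = 1\<close>, where the counit \<open>\<epsilon>\<close> of \<open>\<U>(G)\<close> is
  evaluation at the unit. By the cocycle identity \<open>(\<epsilon> \<otimes> \<iota>)(\<Omega>)\<close> and \<open>(\<iota> \<otimes> \<epsilon>)(\<Omega>)\<close> are the
  scalar \<open>(\<epsilon> \<otimes> \<epsilon>)(\<Omega>)\<close>, so this is the usual counitality. It is not implied by the cocycle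
  identity: a scalar \<open>z\<close> of modulus one is a unitary cocycle, and with it the deformed product
  \<open>z xy\<close> and involution \<open>z\<^sup>-\<^sup>1 x\<^sup>*\<close> are not compatible unless \<open>z = 1\<close>.\<close>

definition normalized_cocycle ::
    "'h::complex_vector star_bialgebra \<Rightarrow> (('h, 'h) tensor \<Rightarrow> complex) \<Rightarrow> bool" where
  "normalized_cocycle G \<Omega> \<longleftrightarrow> \<Omega> (hone G \<otimes> hone G) = 1"

definition cocycle_u ::
    "'h::complex_vector star_bialgebra \<Rightarrow> (('h, 'h) tensor \<Rightarrow> complex) \<Rightarrow> 'h \<Rightarrow> complex" where
  "cocycle_u G \<Omega> a = tensor_lift (\<lambda>b c. \<Omega> (b \<otimes> antipode G c)) (comult G a)"

definition deformed_quantum_group ::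
    "'h::complex_vector star_bialgebra \<Rightarrow> (('h, 'h) tensor \<Rightarrow> complex) \<Rightarrow> 'h star_bialgebra" where
  "deformed_quantum_group G \<Omega> = \<lparr>
     hmult = (\<lambda>a b. THE c. \<forall>\<omega>. clinear \<omega> \<longrightarrow> \<omega> c =
        conv (comult2 G) \<Omega> (conv (comult2 G) (dual_comult G \<omega>) (dual_star2 G \<Omega>)) (a \<otimes> b)),
     hone = hone G,
     hstar = (\<lambda>a. tensor_lift (\<lambda>b c. tensor_lift (\<lambda>b1 b2.
        (dual_star G (cocycle_u G \<Omega>) b1 * dual_star G (dual_inverse G (cocycle_u G \<Omega>)) c) *\<^sub>C b2)
        (comult G b)) (comult G (hstar G a))),
     comult = comult G,
     counit = counit G \<rparr>"


section \<open>Continuous actions\<close>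

text \<open>For non-unital \<open>B\<close> the elements \<open>a \<otimes> 1\<close> are multipliers of \<open>C(G) \<otimes> B\<close>; \<open>L a\<close> below is
  the multiplication by \<open>a \<otimes> 1\<close> from the left.\<close>

definition continuous_action ::
    "('g::{cstar_algebra, real_normed_algebra_1} \<Rightarrow> 'g \<Rightarrow> 'gg::cstar_algebra) \<Rightarrow> ('g \<Rightarrow> 'gg)
      \<Rightarrow> ('g \<Rightarrow> 'b::cstar_algebra \<Rightarrow> 'gb::cstar_algebra)
      \<Rightarrow> ('gg \<Rightarrow> 'b \<Rightarrow> 'ggb::cstar_algebra) \<Rightarrow> ('g \<Rightarrow> 'gb \<Rightarrow> 'ggb) \<Rightarrow> ('b \<Rightarrow> 'gb) \<Rightarrow> bool" where
  "continuous_action tgg \<Delta> tgb p q \<theta> \<longleftrightarrow>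
     spatial_triple_product tgg tgb p q \<and>
     star_hom \<theta> \<and> inj \<theta> \<and>
     cstar_coassociative tgb p q \<Delta> \<theta> \<and>
     (\<exists>L. (\<forall>a. bounded_linear (L a) \<and> (\<forall>b x. L a (tgb b x) = tgb (a * b) x)) \<and>
          closure (complex_vector.span {L a (\<theta> x) | a x. True}) = UNIV)"

definition regular_elements ::
    "('h::complex_vector \<Rightarrow> 'g::cstar_algebra) \<Rightarrow> ('g \<Rightarrow> 'b::cstar_algebra \<Rightarrow> 'gb::cstar_algebra)
      \<Rightarrow> ('b \<Rightarrow> 'gb) \<Rightarrow> 'b set" where
  "regular_elements \<iota> tgb \<theta> = {x. \<exists>t. \<theta> x = tensor_lift (\<lambda>a y. tgb (\<iota> a) y) t}"

definition regular_coaction ::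
    "('h::complex_vector \<Rightarrow> 'g::cstar_algebra) \<Rightarrow> ('g \<Rightarrow> 'b::cstar_algebra \<Rightarrow> 'gb::cstar_algebra)
      \<Rightarrow> ('b \<Rightarrow> 'gb) \<Rightarrow> 'b \<Rightarrow> ('h, 'b) tensor" where
  "regular_coaction \<iota> tgb \<theta> x = (THE t. \<theta> x = tensor_lift (\<lambda>a y. tgb (\<iota> a) y) t)"

text \<open>\<open>ract \<theta> x \<omega> = x \<lhd> \<omega>\<close> and \<open>ract2 \<theta> x y \<Omega> = (x \<otimes> y) \<lhd> \<Omega>\<close>.\<close>

definition ract ::
    "('b \<Rightarrow> ('h::complex_vector, 'b::complex_vector) tensor) \<Rightarrow> 'b \<Rightarrow> ('h \<Rightarrow> complex) \<Rightarrow> 'b" where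
  "ract \<theta> x \<omega> = tensor_lift (\<lambda>a y. \<omega> a *\<^sub>C y) (\<theta> x)"

definition ract2 ::
    "('b \<Rightarrow> ('h::complex_vector, 'b::complex_vector) tensor) \<Rightarrow> 'b \<Rightarrow> 'b
      \<Rightarrow> (('h, 'h) tensor \<Rightarrow> complex) \<Rightarrow> ('b, 'b) tensor" where
  "ract2 \<theta> x y \<Omega> =
     tensor_lift (\<lambda>a x'. tensor_lift (\<lambda>b y'. \<Omega> (a \<otimes> b) *\<^sub>C (x' \<otimes> y')) (\<theta> y)) (\<theta> x)"


section \<open>Algebraic actions\<close>

text \<open>*-algebras whose underlying vector space is a subspace of a type. They need not be unital.\<close>

record 'd star_alg =
  carr :: "'d set"
  amult :: "'d \<Rightarrow> 'd \<Rightarrow> 'd"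
  astar :: "'d \<Rightarrow> 'd"

definition star_algebra :: "'d::complex_vector star_alg \<Rightarrow> bool" where
  "star_algebra D \<longleftrightarrow>
     complex_vector.subspace (carr D) \<and>
     (\<forall>x\<in>carr D. \<forall>y\<in>carr D. amult D x y \<in> carr D) \<and>
     (\<forall>x\<in>carr D. astar D x \<in> carr D) \<and>
     (\<forall>x\<in>carr D. \<forall>y\<in>carr D. \<forall>z\<in>carr D. amult D (x + y) z = amult D x z + amult D y z) \<and>
     (\<forall>x\<in>carr D. \<forall>y\<in>carr D. \<forall>z\<in>carr D. amult D x (y + z) = amult D x y + amult D x z) \<and>
     (\<forall>c. \<forall>x\<in>carr D. \<forall>y\<in>carr D. amult D (c *\<^sub>C x) y = c *\<^sub>C amult D x y) \<and>
     (\<forall>c. \<forall>x\<in>carr D. \<forall>y\<in>carr D. amult D x (c *\<^sub>C y) = c *\<^sub>C amult D x y) \<and>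
     (\<forall>x\<in>carr D. \<forall>y\<in>carr D. \<forall>z\<in>carr D. amult D (amult D x y) z = amult D x (amult D y z)) \<and>
     (\<forall>x\<in>carr D. \<forall>y\<in>carr D. astar D (x + y) = astar D x + astar D y) \<and>
     (\<forall>c. \<forall>x\<in>carr D. astar D (c *\<^sub>C x) = cnj c *\<^sub>C astar D x) \<and>
     (\<forall>x\<in>carr D. \<forall>y\<in>carr D. astar D (amult D x y) = amult D (astar D y) (astar D x)) \<and>
     (\<forall>x\<in>carr D. astar D (astar D x) = x)"

definition complete_cstar_norm :: "'d::complex_vector star_alg \<Rightarrow> ('d \<Rightarrow> real) \<Rightarrow> bool" where
  "complete_cstar_norm A N \<longleftrightarrow> star_algebra A \<and>
     (\<forall>x\<in>carr A. 0 \<le> N x \<and> (N x = 0 \<longleftrightarrow> x = 0)) \<and>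
     (\<forall>c. \<forall>x\<in>carr A. N (c *\<^sub>C x) = cmod c * N x) \<and>
     (\<forall>x\<in>carr A. \<forall>y\<in>carr A. N (x + y) \<le> N x + N y) \<and>
     (\<forall>x\<in>carr A. \<forall>y\<in>carr A. N (amult A x y) \<le> N x * N y) \<and>
     (\<forall>x\<in>carr A. N (amult A (astar A x) x) = (N x)\<^sup>2) \<and>
     (\<forall>X :: nat \<Rightarrow> 'd. range X \<subseteq> carr A \<longrightarrow>
        (\<forall>e>0. \<exists>K. \<forall>m\<ge>K. \<forall>n\<ge>K. N (X m - X n) < e) \<longrightarrow>
        (\<exists>x\<in>carr A. (\<lambda>n. N (X n - x)) \<longlonglongrightarrow> 0))"

definition positive_in :: "'d::complex_vector star_alg \<Rightarrow> 'd \<Rightarrow> bool" where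
  "positive_in A a \<longleftrightarrow> (\<exists>b\<in>carr A. a = amult A (astar A b) b)"

definition coaction ::
    "'h::complex_vector star_bialgebra \<Rightarrow> 'd::complex_vector star_alg \<Rightarrow> ('d \<Rightarrow> ('h, 'd) tensor) \<Rightarrow> bool" where
  "coaction H D \<theta> \<longleftrightarrow>
     (\<forall>x\<in>carr D. \<theta> x \<in> tensor_on UNIV (carr D)) \<and>
     (\<forall>x\<in>carr D. \<forall>y\<in>carr D. \<theta> (x + y) = \<theta> x + \<theta> y) \<and>
     (\<forall>c. \<forall>x\<in>carr D. \<theta> (c *\<^sub>C x) = c *\<^sub>C \<theta> x) \<and>
     (\<forall>x\<in>carr D.
        tensor_lift_on UNIV (carr D) (\<lambda>a y. tensor_lift (\<lambda>a1 a2. a1 \<otimes> (a2 \<otimes> y)) (comult H a)) (\<theta> x) =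
        tensor_lift_on UNIV (carr D) (\<lambda>a y. a \<otimes> \<theta> y) (\<theta> x)) \<and>
     (\<forall>x\<in>carr D. tensor_lift_on UNIV (carr D) (\<lambda>a y. counit H a *\<^sub>C y) (\<theta> x) = x) \<and>
     (\<forall>x\<in>carr D. \<forall>y\<in>carr D. \<theta> (amult D x y) =
        tensor_lift_on UNIV (carr D) (\<lambda>a x'. tensor_lift_on UNIV (carr D)
          (\<lambda>b y'. hmult H a b \<otimes> amult D x' y') (\<theta> y)) (\<theta> x)) \<and>
     (\<forall>x\<in>carr D. \<theta> (astar D x) =
        tensor_lift_on UNIV (carr D) (\<lambda>a y. hstar H a \<otimes> astar D y) (\<theta> x))"

definition fixed_points ::
    "'h::complex_vector star_bialgebra \<Rightarrow> 'd::complex_vector star_alg \<Rightarrow> ('d \<Rightarrow> ('h, 'd) tensor)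
      \<Rightarrow> 'd star_alg" where
  "fixed_points H D \<theta> = D \<lparr> carr := {x \<in> carr D. \<theta> x = hone H \<otimes> x} \<rparr>"

definition cond_exp ::
    "'h::complex_vector star_bialgebra \<Rightarrow> 'd::complex_vector star_alg \<Rightarrow> ('d \<Rightarrow> ('h, 'd) tensor)
      \<Rightarrow> 'd \<Rightarrow> 'd" where
  "cond_exp H D \<theta> x = tensor_lift_on UNIV (carr D) (\<lambda>a y. haar H a *\<^sub>C y) (\<theta> x)"

text \<open>The norm \<open>N\<close> below is the unique C*-norm of the fixed point algebra.\<close>

definition algebraic_action ::
    "'h::complex_vector star_bialgebra \<Rightarrow> 'd::complex_vector star_alg \<Rightarrow> ('d \<Rightarrow> ('h, 'd) tensor) \<Rightarrow> bool" where
  "algebraic_action H D \<theta> \<longleftrightarrow>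
     cqg_algebra H \<and> star_algebra D \<and> coaction H D \<theta> \<and>
     (let A = fixed_points H D \<theta>; E = cond_exp H D \<theta>; m = amult D; st = astar D in
      \<exists>N. complete_cstar_norm A N \<and>
          (\<forall>x\<in>carr D. positive_in A (E (m (st x) x))) \<and>
          (\<forall>x\<in>carr D. x \<noteq> 0 \<longrightarrow> E (m (st x) x) \<noteq> 0) \<and>
          (\<forall>a\<in>carr A. \<forall>x\<in>carr D.
             positive_in A (complex_of_real ((N a)\<^sup>2) *\<^sub>C E (m (st x) x)
                            - E (m (st x) (m (st a) (m a x))))))"


section \<open>The deformed algebra\<close>

definition deformed_algebra ::
    "'h::complex_vector star_bialgebra \<Rightarrow> (('h, 'h) tensor \<Rightarrow> complex)
      \<Rightarrow> 'b::cstar_algebra set \<Rightarrow> ('b \<Rightarrow> ('h, 'b) tensor) \<Rightarrow> 'b star_alg" where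
  "deformed_algebra G \<Omega> \<B> \<theta> = \<lparr>
     carr = \<B>,
     amult = (\<lambda>x y. tensor_lift (*) (ract2 \<theta> x y \<Omega>)),
     astar = (\<lambda>x. ract \<theta> (star x) (dual_star G (cocycle_u G \<Omega>))) \<rparr>"

end

theory Submission
  imports Defs
begin

text \<open>Write \<open>W = (u\<^sup>-\<^sup>1)\<^sup>*\<close>. Associativity of \<open>\<star>\<close> is the cocycle identity. That the deformed
  involution is antimultiplicative follows from the formula for \<open>\<Delta>(u)\<close> in terms of \<open>u \<otimes> u\<close>,
  \<open>\<Omega>\<close> and the flip of \<open>(S \<otimes> S)(\<Omega>)\<close>, and unitary representations of \<open>G\<close> remain unitary for
  \<open>G\<^sub>\<Omega>\<close>. As coalgebras \<open>\<complex>[G]\<close> and \<open>\<complex>[G\<^sub>\<Omega>]\<close> agree, hence so do their Haar states and the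
  conditional expectations \<open>E\<close>. Invariance of \<open>h\<close> gives \<open>E(x \<star> y) = E(x (y \<lhd> W))\<close>,
  and since the deformed adjoint of \<open>x\<close> equals \<open>(x \<lhd> W)\<^sup>*\<close>, we get
  \<open>E(x\<^sup>\<dagger> \<star> x) = E((x \<lhd> W)\<^sup>* (x \<lhd> W))\<close>. This reduces everything to the undeformed action: after
  orthogonalizing the first factors of \<open>\<theta>(w) = \<Sum> a\<^sub>i \<otimes> y\<^sub>i\<close> with respect to \<open>h\<close>, one has
  \<open>E(w\<^sup>*w) = \<Sum> h(a\<^sub>i\<^sup>*a\<^sub>i) y\<^sub>i\<^sup>*y\<^sub>i\<close>, so positivity, faithfulness and the bound by \<open>\<parallel>a\<parallel>\<^sup>2\<close> follow from the
  corresponding properties of sums of squares in a C*-algebra. On the fixed points of the action,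
  which form a closed subalgebra, both products and both involutions coincide.\<close>

section \<open>Linear maps\<close>

text \<open>Three obstacles shape the proof. Identities between iterated coproducts are checked on
  coefficients of unitary representations: there \<open>S (U i j) = st (U j i)\<close>, convolutions
  become matrix products, and the deformed product becomes conjugation of a tensor product
  representation by the matrix of Omega. By linearity they then hold as Sweedler sums, the form in
  which the coaction on \<open>B\<close> uses them. Next, \<open>B\<close> may lack a unit, and
  positivity in the fixed point algebra asks for roots inside it. Square roots are therefore limits
  of an iteration controlled by norms of left multiplications, kept inside a prescribed closed set.
  Finally, the action takes values in a completed tensor product and is algebraic only on regular
  elements. A linear left inverse of the embedding of C[G] \<otimes> B extends the regular coaction
  to a linear map on the whole type, so that Sweedler sums are linear in their argument without side
  conditions. Normalization enters as Omega(1 \<otimes> a) = \<epsilon>(a) = Omega(a \<otimes> 1);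
  it keeps the unit of C[G] a unit and leaves products with fixed points unchanged.\<close>

text \<open>\<open>intro lin\<close> proves linearity of an abstraction by descending to the occurrence of its variable.\<close>

named_theorems lin

lemma clinearI:
  fixes f :: "'a::complex_vector \<Rightarrow> 'b::complex_vector"
  assumes "\<And>x y. f (x + y) = f x + f y" and "\<And>c x. f (c *\<^sub>C x) = c *\<^sub>C f x"
  shows "clinear f"
  using assms by (simp add: Vector_Spaces.linear_iff complex_vector.vector_space_axioms)

lemma cbilinearI [lin]:
  assumes "\<And>a. clinear (\<lambda>b. F a b)" and "\<And>b. clinear (\<lambda>a. F a b)"
  shows "cbilinear F"
  using assms by (simp add: cbilinear_def)

lemma
  fixes f :: "'a::complex_vector \<Rightarrow> 'b::complex_vector"
  assumes "clinear f"
  shows clinear_add: "f (x + y) = f x + f y"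
    and clinear_scaleC: "f (c *\<^sub>C x) = c *\<^sub>C f x"
    and clinear_zero: "f 0 = 0"
    and clinear_diff: "f (x - y) = f x - f y"
    and clinear_sum: "f (\<Sum>i\<in>A. t i) = (\<Sum>i\<in>A. f (t i))"
proof -
  interpret f: Vector_Spaces.linear scaleC scaleC f by (fact assms)
  show "f (x + y) = f x + f y" "f (c *\<^sub>C x) = c *\<^sub>C f x" "f 0 = 0" "f (x - y) = f x - f y"
    "f (\<Sum>i\<in>A. t i) = (\<Sum>i\<in>A. f (t i))"
    by (simp_all add: f.add f.scale f.zero f.diff f.sum)
qed

lemma scaleC_complex [simp]: "(c::complex) *\<^sub>C d = c * d"
  by (simp add: scaleC_complex_def)

lemma clinear_of_cbilinear:
  assumes "cbilinear F"
  shows "clinear (F a)" "clinear (\<lambda>a. F a b)"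
  using assms by (auto simp: cbilinear_def)

lemma clinear_ident [lin]: "clinear (\<lambda>x. x)"
  and clinear_const_zero [lin]: "clinear (\<lambda>x. 0)"
  by (rule clinearI; simp)+

lemma clinear_compose_add [lin]:
  "clinear f \<Longrightarrow> clinear g \<Longrightarrow> clinear (\<lambda>x. f x + g x)"
  by (rule clinearI) (auto simp: clinear_add clinear_scaleC scaleC_add_right)

lemma clinear_compose_sum [lin]:
  "(\<And>i. clinear (f i)) \<Longrightarrow> clinear (\<lambda>x. \<Sum>i\<in>A. f i x)"
  by (rule clinearI)
    (auto simp: clinear_add clinear_scaleC sum.distrib complex_vector.scale_sum_right)

lemma clinear_compose_scaleC_right [lin]: "clinear f \<Longrightarrow> clinear (\<lambda>x. c *\<^sub>C f x)"
  by (rule clinearI) (auto simp: clinear_add clinear_scaleC scaleC_add_right scaleC_scaleC mult.commute)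

lemma clinear_compose_scaleC_left [lin]:
  "clinear f \<Longrightarrow> clinear (\<lambda>x. f x *\<^sub>C v)" for f :: "_ \<Rightarrow> complex"
  by (rule clinearI) (auto simp: clinear_add clinear_scaleC scaleC_add_left scaleC_scaleC)

lemma clinear_compose_times [lin]:
  "clinear f \<Longrightarrow> clinear (\<lambda>x. c * f x)" "clinear f \<Longrightarrow> clinear (\<lambda>x. f x * c)"
  for f :: "_ \<Rightarrow> complex"
  by (rule clinearI; auto simp: clinear_add clinear_scaleC algebra_simps)+

lemma clinear_compose_cstar_mult [lin]:
  "clinear f \<Longrightarrow> clinear (\<lambda>x. c * f x)" "clinear f \<Longrightarrow> clinear (\<lambda>x. f x * c)"
  for f :: "_ \<Rightarrow> 'a::cstar_algebra"
  by (rule clinearI; auto simp: clinear_add clinear_scaleC algebra_simps scaleC_mult_left scaleC_mult_right)+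

lemma cbilinear_tensor: "cbilinear (\<otimes>)"
proof -
  have "tensor_eq [(a, b + b')] [(a, b), (a, b')]" "tensor_eq [(a + a', b)] [(a, b), (a', b)]"
    "tensor_eq [(a, c *\<^sub>C b)] [(c *\<^sub>C a, b)]"
    for a a' :: 'a and b b' :: 'b and c
    by (auto simp: tensor_eq_def cbilinearD)
  then show ?thesis
    by (intro lin clinearI)
      (simp_all add: tensor.abs_eq plus_tensor.abs_eq scaleC_tensor.abs_eq abs_tensor_eq_iff)
qed

lemma tensor_add_left: "(a + a') \<otimes> b = a \<otimes> b + a' \<otimes> b"
  and tensor_add_right: "a \<otimes> (b + b') = a \<otimes> b + a \<otimes> b'"
  and tensor_scaleC_left: "(c *\<^sub>C a) \<otimes> b = c *\<^sub>C (a \<otimes> b)"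
  and tensor_scaleC_right: "a \<otimes> (c *\<^sub>C b) = c *\<^sub>C (a \<otimes> b)"
  by (simp_all add: cbilinearD[OF cbilinear_tensor])

lemma clinear_compose_tensor [lin]:
  "clinear f \<Longrightarrow> clinear (\<lambda>x. c \<otimes> f x)" "clinear f \<Longrightarrow> clinear (\<lambda>x. f x \<otimes> c)"
  by (rule clinearI; auto simp: clinear_add clinear_scaleC tensor_add_left tensor_add_right
      tensor_scaleC_left tensor_scaleC_right)+

lemma tensor_zero [simp]: "0 \<otimes> b = 0" "a \<otimes> 0 = 0"
  using tensor_scaleC_left[of 0 0 b] tensor_scaleC_right[of a 0 0] by simp_all

lemma abs_tensor_Cons: "abs_tensor ((a, b) # xs) = a \<otimes> b + abs_tensor xs"
  by (simp add: tensor.abs_eq plus_tensor.abs_eq)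

lemma abs_tensor_Nil: "abs_tensor [] = 0"
  by (simp add: zero_tensor.abs_eq)

lemma abs_tensor_eq_pair_sum: "abs_tensor xs = pair_sum (\<otimes>) xs"
  by (induction xs) (auto simp: abs_tensor_Nil abs_tensor_Cons)

lemma tensor_induct [case_names zero tensor add]:
  assumes "P 0" and "\<And>a b. P (a \<otimes> b)" and "\<And>s t. P s \<Longrightarrow> P t \<Longrightarrow> P (s + t)"
  shows "P t"
proof (induction t rule: tensor.abs_induct)
  case (1 xs)
  show ?case
    by (induction xs) (auto simp: abs_tensor_Nil abs_tensor_Cons assms)
qed

lemma tensor_lift_add:
  "cbilinear F \<Longrightarrow> tensor_lift F (s + t) = tensor_lift F s + tensor_lift F t"
  and tensor_lift_scaleC: "cbilinear F \<Longrightarrow> tensor_lift F (c *\<^sub>C t) = c *\<^sub>C tensor_lift F t"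
  and tensor_lift_zero: "cbilinear F \<Longrightarrow> tensor_lift F 0 = 0"
  and tensor_lift_sum: "cbilinear F \<Longrightarrow> tensor_lift F (\<Sum>i\<in>A. g i) = (\<Sum>i\<in>A. tensor_lift F (g i))"
  by (simp_all add: clinear_add clinear_scaleC clinear_zero clinear_sum clinear_tensor_lift)

lemma tensor_lift_ident: "tensor_lift (\<otimes>) t = t"
  by (induction t rule: tensor_induct)
    (simp_all add: tensor_lift_zero tensor_lift_tensor tensor_lift_add cbilinear_tensor)

lemma clinear_compose_tensor_lift [lin]:
  "cbilinear F \<Longrightarrow> clinear f \<Longrightarrow> clinear (\<lambda>x. tensor_lift F (f x))"
  by (rule clinearI) (auto simp: clinear_add clinear_scaleC tensor_lift_add tensor_lift_scaleC)

lemma clinear_param_tensor_lift [lin]: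
  assumes "\<And>x. cbilinear (F x)" and "\<And>p q. clinear (\<lambda>x. F x p q)"
  shows "clinear (\<lambda>x. tensor_lift (F x) t)"
proof (induction t rule: tensor_induct)
  case zero
  then show ?case by (simp add: tensor_lift_zero assms lin)
next
  case (tensor a b)
  then show ?case by (simp add: tensor_lift_tensor assms)
next
  case (add s t)
  then show ?case by (simp add: tensor_lift_add assms lin)
qed

lemma clinear_tensor_lift_eq:
  assumes "clinear f" and "cbilinear F"
  shows "f (tensor_lift F t) = tensor_lift (\<lambda>a b. f (F a b)) t"
proof -
  have F: "cbilinear (\<lambda>a b. f (F a b))"
    using assms by (auto simp: cbilinear_def Vector_Spaces.linear_iff)
  show ?thesis
    by (induction t rule: tensor_induct)
      (simp_all add: tensor_lift_zero tensor_lift_tensor tensor_lift_add F assms clinear_zero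
        clinear_add)
qed

lemma clinear_eq_on_tensors:
  assumes "clinear f" "clinear g" and "\<And>a b. f (a \<otimes> b) = g (a \<otimes> b)"
  shows "f t = g t"
  by (induction t rule: tensor_induct) (simp_all add: assms clinear_zero clinear_add)

text \<open>Fubini for two independent Sweedler sums. Together with coassociativity it regroups the
  iterated sums over \<open>\<theta> x\<close> and \<open>\<theta> y\<close> below.\<close>

lemma tensor_lift_swap:
  assumes "\<And>a b. cbilinear (F a b)" and "\<And>c d. cbilinear (\<lambda>a b. F a b c d)"
  shows "tensor_lift (\<lambda>a b. tensor_lift (F a b) t) s = tensor_lift (\<lambda>c d. tensor_lift (\<lambda>a b. F a b c d) s) t"
proof (rule clinear_eq_on_tensors[where t = s])
  have F [lin]: "clinear (\<lambda>d. F a b c d)" "clinear (\<lambda>c. F a b c d)" "clinear (\<lambda>b. F a b c d)"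
    "clinear (\<lambda>a. F a b c d)" for a b c d
    using assms by (auto simp: cbilinear_def)
  show "clinear (tensor_lift (\<lambda>a b. tensor_lift (F a b) t))"
    by (intro lin clinear_tensor_lift)
  show "clinear (\<lambda>s. tensor_lift (\<lambda>c d. tensor_lift (\<lambda>a b. F a b c d) s) t)"
    by (intro lin)
  fix a b
  have "cbilinear (\<lambda>a b. tensor_lift (F a b) t)"
    by (intro lin)
  then show "tensor_lift (\<lambda>a b. tensor_lift (F a b) t) (a \<otimes> b) =
      tensor_lift (\<lambda>c d. tensor_lift (\<lambda>a b. F a b c d) (a \<otimes> b)) t"
    using assms by (simp add: tensor_lift_tensor)
qed

section \<open>Positive elements of C*-algebras\<close>

lemma star_zero [simp]: "star (0::'a::cstar_algebra) = 0"
  using star_scaleC[of 0 "0::'a"] by simp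

lemma star_uminus: "star (- x) = - star (x::'a::cstar_algebra)"
  using star_scaleC[of "-1" x] by simp

lemma star_diff: "star (x - y) = star x - star (y::'a::cstar_algebra)"
  using star_add[of x "- y"] by (simp add: star_uminus)

lemma star_scaleR: "star (r *\<^sub>R x) = r *\<^sub>R star (x::'a::cstar_algebra)"
  by (simp add: scaleR_scaleC star_scaleC)

lemma norm_star [simp]: "norm (star x) = norm (x::'a::cstar_algebra)"
proof -
  have "norm x \<le> norm (star x)" for x :: 'a
  proof (cases "x = 0")
    case False
    have "norm x * norm x \<le> norm (star x) * norm x"
      using norm_mult_ineq[of "star x" x] by (simp add: norm_star_mult_self power2_eq_square)
    then show ?thesis using False by simp
  qed simp
  from this[of x] this[of "star x"] show ?thesis by (simp add: star_star)
qed

lemma norm_mult_star_self: "norm (x * star x) = (norm (x::'a::cstar_algebra))\<^sup>2"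
  using norm_star_mult_self[of "star x"] by (simp add: star_star)

lemma tendsto_star: "(f \<longlongrightarrow> l) F \<Longrightarrow> ((\<lambda>n. star (f n)) \<longlongrightarrow> star (l::'a::cstar_algebra)) F"
proof -
  have "bounded_linear (star :: 'a \<Rightarrow> 'a)"
    by (rule bounded_linear_intro[where K = 1]) (simp_all add: star_add star_scaleR)
  then show "(f \<longlongrightarrow> l) F \<Longrightarrow> ((\<lambda>n. star (f n)) \<longlongrightarrow> star l) F"
    by (rule bounded_linear.tendsto)
qed

lemma closed_fixed_by_star: "closed {x::'a::cstar_algebra. star x = x}"
  unfolding closed_sequential_limits
  by (auto dest: tendsto_star intro: LIMSEQ_unique)

lemma closed_commutant: "closed {x::'a::cstar_algebra. x * c = c * x}"
  by (intro closed_Collect_eq continuous_intros)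

text \<open>The test vector \<open>star w\<close> attains the norm of left multiplication. Bounds
  for operators of the form scalar plus left multiplication thereby come back to norms in the
  algebra.\<close>

lemma norm_le_of_left_mult:
  fixes w :: "'a::cstar_algebra"
  assumes "0 \<le> c" and "\<And>v. norm (w * v) \<le> c * norm v"
  shows "norm w \<le> c"
proof (cases "w = 0")
  case True
  then show ?thesis using assms(1) by simp
next
  case False
  from assms(2)[of "star w"] have "norm w * norm w \<le> c * norm w"
    by (simp add: norm_mult_star_self power2_eq_square)
  then show ?thesis using False by simp
qed

text \<open>With \<open>\<tau> + x\<close> a contraction of the unitization, the iteration \<open>d \<mapsto> (\<tau> + x + d\<^sup>2) / 2\<close>
  started at \<open>0\<close> converges to a solution of \<open>(1 - d)\<^sup>2 = 1 - \<tau> - x\<close>: it is dominated by the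
  scalar iteration \<open>r \<mapsto> (1 + r\<^sup>2) / 2\<close>. The unitization is present only through left
  multiplications.\<close>

lemma sqrt_iteration:
  fixes x :: "'a::cstar_algebra" and \<tau> :: real
  assumes x: "\<And>v. norm (\<tau> *\<^sub>R v + x * v) \<le> norm v" and \<tau>: "\<bar>\<tau>\<bar> \<le> 1"
    and S: "closed S" "0 \<in> S" "\<And>y \<alpha>. y \<in> S \<Longrightarrow> (1/2) *\<^sub>R (x + (2 * \<alpha>) *\<^sub>R y + y * y) \<in> S"
  obtains \<alpha> y where "\<alpha> = (\<tau> + \<alpha>\<^sup>2) / 2" "\<bar>\<alpha>\<bar> \<le> 1"
    "y = (1/2) *\<^sub>R (x + (2 * \<alpha>) *\<^sub>R y + y * y)" "y \<in> S" "\<And>v. norm (\<alpha> *\<^sub>R v + y * v) \<le> norm v"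
proof -
  \<comment> \<open>The iterate is d = \<open>a n\<close> + \<open>y n\<close>, with a scalar part
    and an algebra part; expanding d^2 gives one recursion for each.\<close>
  define p where "p n = ((\<lambda>(\<alpha>, y). ((\<tau> + \<alpha>\<^sup>2) / 2, (1/2) *\<^sub>R (x + (2 * \<alpha>) *\<^sub>R y + y * y))) ^^ n) (0, 0)"
    for n :: nat
  define a y where "a n = fst (p n)" and "y n = snd (p n)" for n
  define r where "r n = ((\<lambda>r::real. (1 + r\<^sup>2) / 2) ^^ n) 0" for n :: nat
  have a0 [simp]: "a 0 = 0" "y 0 = 0" "r 0 = 0" by (simp_all add: a_def y_def r_def p_def)
  have aS: "a (Suc n) = (\<tau> + (a n)\<^sup>2) / 2"
    and yS: "y (Suc n) = (1/2) *\<^sub>R (x + (2 * a n) *\<^sub>R y n + y n * y n)"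
    and rS: "r (Suc n) = (1 + (r n)\<^sup>2) / 2" for n
    by (simp_all add: a_def y_def r_def p_def case_prod_unfold)
  have r: "0 \<le> r n" "r n \<le> 1" for n
    by (induction n) (auto simp: rS power_le_one)
  have rinc: "r n \<le> r (Suc n)" for n
    using zero_le_power2[of "1 - r n"] by (simp add: rS power2_eq_square algebra_simps)
  \<comment> \<open>\<open>L n\<close> is left multiplication by \<open>a n\<close> +
    \<open>y n\<close>, and \<open>LS\<close> is the recursion d -> (\<tau> + x + d^2)/2 for these
    operators.\<close>
  define L where "L n v = a n *\<^sub>R v + y n * v" for n v
  have LS: "L (Suc n) v = (1/2) *\<^sub>R ((\<tau> *\<^sub>R v + x * v) + L n (L n v))" for n v
    by (simp add: L_def aS yS algebra_simps power2_eq_square scaleR_left_distrib add_divide_distrib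
        flip: scaleR_2)
  have Ldiff: "L n (v - w) = L n v - L n w" for n v w
    by (simp add: L_def algebra_simps)
  have ab: "\<bar>a n\<bar> \<le> r n" for n
  proof (induction n)
    case (Suc n)
    have "(a n)\<^sup>2 \<le> (r n)\<^sup>2" using Suc r by (simp add: abs_le_square_iff[symmetric])
    then have "\<bar>\<tau> + (a n)\<^sup>2\<bar> \<le> 1 + (r n)\<^sup>2"
      using \<tau> zero_le_power2[of "a n"] by linarith
    then show ?case unfolding aS rS by simp
  qed simp
  have Lb: "norm (L n v) \<le> r n * norm v" for n v
  proof (induction n arbitrary: v)
    case 0
    then show ?case by (simp add: L_def)
  next
    case (Suc n)
    have "norm (L n (L n v)) \<le> r n * (r n * norm v)"
      using Suc[of "L n v"] Suc[of v] r[of n] by (meson mult_left_mono order_trans)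
    then have "norm ((\<tau> *\<^sub>R v + x * v) + L n (L n v)) \<le> norm v + (r n)\<^sup>2 * norm v"
      using x[of v] by (intro order_trans[OF norm_triangle_ineq]) (simp add: power2_eq_square mult.assoc)
    then show ?case unfolding LS rS norm_scaleR by (simp add: distrib_right)
  qed
  \<comment> \<open>Successive differences are dominated by those of \<open>r\<close>: a difference
    of squares factors, and the sums occurring in it are bounded by the corresponding sums for
    \<open>r\<close>.\<close>
  have ad: "\<bar>a (Suc n) - a n\<bar> \<le> r (Suc n) - r n" for n
  proof (induction n)
    case 0
    then show ?case using \<tau> by (simp add: aS rS)
  next
    case (Suc n)
    have "\<bar>a (Suc (Suc n)) - a (Suc n)\<bar> = \<bar>a (Suc n) - a n\<bar> * \<bar>a (Suc n) + a n\<bar> / 2"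
    proof -
      have "a (Suc (Suc n)) - a (Suc n) = ((a (Suc n))\<^sup>2 - (a n)\<^sup>2) / 2"
        using aS[of "Suc n"] aS[of n] by argo
      also have "\<dots> = (a (Suc n) - a n) * (a (Suc n) + a n) / 2"
        by (simp add: power2_eq_square algebra_simps)
      finally show ?thesis by (simp only: abs_mult abs_divide abs_numeral)
    qed
    also have "\<dots> \<le> (r (Suc n) - r n) * (r (Suc n) + r n) / 2"
      using Suc ab[of n] ab[of "Suc n"] rinc[of n]
      by (intro divide_right_mono mult_mono) (auto intro: order_trans[OF abs_triangle_ineq])
    also have "\<dots> = r (Suc (Suc n)) - r (Suc n)"
    proof -
      have "r (Suc (Suc n)) - r (Suc n) = ((r (Suc n))\<^sup>2 - (r n)\<^sup>2) / 2"
        using rS[of "Suc n"] rS[of n] by argo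
      also have "\<dots> = (r (Suc n) - r n) * (r (Suc n) + r n) / 2"
        by (simp add: power2_eq_square algebra_simps)
      finally show ?thesis by (rule sym)
    qed
    finally show ?case .
  qed
  have Ld: "norm (L (Suc n) v - L n v) \<le> (r (Suc n) - r n) * norm v" for n v
  proof (induction n arbitrary: v)
    case 0
    then show ?case using x[of v] by (simp add: LS rS) (simp add: L_def)
  next
    case (Suc n)
    define \<delta> where "\<delta> v = L (Suc n) v - L n v" for v
    have eq: "L (Suc (Suc n)) v - L (Suc n) v = (1/2) *\<^sub>R (L (Suc n) (\<delta> v) + \<delta> (L n v))"
    proof -
      have "L (Suc (Suc n)) v - L (Suc n) v
          = (1/2) *\<^sub>R (L (Suc n) (L (Suc n) v) - L n (L n v))"
        unfolding LS[of "Suc n" v] LS[of n v] by (simp add: scaleR_diff_right[symmetric])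
      then show ?thesis by (simp add: \<delta>_def Ldiff)
    qed
    have "norm (L (Suc n) (\<delta> v)) \<le> r (Suc n) * ((r (Suc n) - r n) * norm v)"
      using Lb[of "Suc n" "\<delta> v"] Suc[of v] r[of "Suc n"] unfolding \<delta>_def
      by (meson mult_left_mono order_trans)
    moreover have "norm (\<delta> (L n v)) \<le> (r (Suc n) - r n) * (r n * norm v)"
      using Lb[of n v] Suc[of "L n v"] rinc[of n] unfolding \<delta>_def
      by (meson diff_ge_0_iff_ge mult_left_mono order_trans)
    ultimately have "norm (L (Suc n) (\<delta> v) + \<delta> (L n v))
        \<le> r (Suc n) * ((r (Suc n) - r n) * norm v) + (r (Suc n) - r n) * (r n * norm v)"
      by (intro order_trans[OF norm_triangle_ineq]) simp
    also have "\<dots> = 2 * ((r (Suc (Suc n)) - r (Suc n)) * norm v)"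
    proof -
      have "r (Suc (Suc n)) - r (Suc n) = ((r (Suc n))\<^sup>2 - (r n)\<^sup>2) / 2"
        using rS[of "Suc n"] rS[of n] by argo
      moreover have "2 * (((r (Suc n))\<^sup>2 - (r n)\<^sup>2) / 2 * norm v)
          = r (Suc n) * ((r (Suc n) - r n) * norm v) + (r (Suc n) - r n) * (r n * norm v)"
        by (simp add: power2_eq_square algebra_simps diff_divide_distrib)
      ultimately show ?thesis by (simp only:)
    qed
    finally show ?case unfolding eq by simp
  qed
  \<comment> \<open>The increment of the algebra part is the increment of \<open>L\<close> minus
    that of the scalar part. Each is dominated by the increment of \<open>r\<close>, whence the
    factor 2.\<close>
  have yd: "norm (y (Suc n) - y n) \<le> 2 * (r (Suc n) - r n)" for n
  proof (rule norm_le_of_left_mult)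
    show "0 \<le> 2 * (r (Suc n) - r n)" using rinc[of n] by simp
    fix v
    have "(y (Suc n) - y n) * v = (L (Suc n) v - L n v) - (a (Suc n) - a n) *\<^sub>R v"
      by (simp add: L_def algebra_simps)
    then have "norm ((y (Suc n) - y n) * v) \<le> norm (L (Suc n) v - L n v) + \<bar>a (Suc n) - a n\<bar> * norm v"
      by (metis norm_scaleR norm_triangle_ineq4)
    also have "\<dots> \<le> (r (Suc n) - r n) * norm v + (r (Suc n) - r n) * norm v"
      by (intro add_mono Ld mult_right_mono ad) simp
    finally show "norm ((y (Suc n) - y n) * v) \<le> 2 * (r (Suc n) - r n) * norm v"
      by (simp only: mult_2 distrib_right)
  qed
  have "convergent r"
    using r by (intro Bseq_monoseq_convergent BseqI'[of _ 1] incseq_imp_monoseq incseq_SucI rinc) auto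
  then obtain r' where "r \<longlonglongrightarrow> r'" by (auto simp: convergent_def)
  then have sr: "summable (\<lambda>n. r (Suc n) - r n)" by (rule telescope_summable)
  have conv: "convergent f" if "\<And>n. norm (f (Suc n) - f n) \<le> c * (r (Suc n) - r n)"
    for f :: "nat \<Rightarrow> 'b::banach" and c
  proof -
    have "summable (\<lambda>n. f (Suc n) - f n)"
      by (rule summable_comparison_test'[OF summable_mult[OF sr, of c], of 0]) (use that in auto)
    then have "convergent (\<lambda>n. \<Sum>i<n. f (Suc i) - f i)"
      by (auto simp: summable_iff_convergent)
    then have "convergent (\<lambda>n. f n - f 0)" by (simp add: sum_lessThan_telescope)
    then show ?thesis by (simp add: convergent_diff_const_right_iff)
  qed
  from conv[of a 1] ad obtain \<alpha> where \<alpha>: "a \<longlonglongrightarrow> \<alpha>" by (auto simp: convergent_def)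
  from conv[of y 2] yd obtain z where z: "y \<longlonglongrightarrow> z" by (auto simp: convergent_def)
  have "y n \<in> S" for n by (induction n) (auto simp: yS S)
  then have "z \<in> S" using S(1) z closed_sequentially by blast
  moreover have "\<bar>\<alpha>\<bar> \<le> 1"
    using ab r by (intro LIMSEQ_le_const2[OF tendsto_rabs[OF \<alpha>]]) (meson order_trans)
  moreover have "norm (\<alpha> *\<^sub>R v + z * v) \<le> norm v" for v
  proof (rule LIMSEQ_le_const2)
    show "(\<lambda>n. norm (L n v)) \<longlonglongrightarrow> norm (\<alpha> *\<^sub>R v + z * v)"
      unfolding L_def by (intro tendsto_intros \<alpha> z)
    show "\<exists>N. \<forall>n\<ge>N. norm (L n v) \<le> norm v"
      using Lb r by (metis mult_right_mono mult_1 norm_ge_zero order_trans)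
  qed
  moreover have "\<alpha> = (\<tau> + \<alpha>\<^sup>2) / 2"
    by (rule LIMSEQ_unique[OF LIMSEQ_Suc[OF \<alpha>]]) (unfold aS, intro tendsto_intros \<alpha>, simp)
  moreover have "z = (1/2) *\<^sub>R (x + (2 * \<alpha>) *\<^sub>R z + z * z)"
    by (rule LIMSEQ_unique[OF LIMSEQ_Suc[OF z]]) (unfold yS, intro tendsto_intros \<alpha> z)
  ultimately show ?thesis using that by blast
qed

text \<open>The equation says (1 - d)^2 = 1 - t. For \<tau> = 0 the scalar part of the limit
  satisfies \<alpha> = \<alpha>^2/2 and |\<alpha>| <= 1, so it vanishes and d lies in the algebra.
  Selfadjointness and commutation pass to the limit because they cut out a closed set stable under
  the iteration.\<close>

lemma sqrt_one_minus:
  fixes t :: "'a::cstar_algebra"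
  assumes "norm t \<le> 1" "star t = t"
  obtains d where "2 *\<^sub>R d - d * d = t" "star d = d" "\<And>c. t * c = c * t \<Longrightarrow> d * c = c * d"
proof -
  define S where "S = {d. star d = d} \<inter> (\<Inter>c\<in>{c. t * c = c * t}. {d. d * c = c * d})"
  have "norm (0 *\<^sub>R v + t * v) \<le> norm v" for v
    using norm_mult_ineq[of t v] mult_right_mono[OF assms(1), of "norm v"] by simp
  moreover have "closed S" unfolding S_def
    by (intro closed_Int closed_INT ballI closed_fixed_by_star closed_commutant)
  moreover have "(1/2) *\<^sub>R (t + (2 * \<alpha>) *\<^sub>R y + y * y) \<in> S" if "y \<in> S" for y \<alpha>
  proof -
    have y: "y * c = c * y" if "t * c = c * t" for c
      using \<open>y \<in> S\<close> that by (auto simp: S_def)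
    have "(1/2) *\<^sub>R (t + (2 * \<alpha>) *\<^sub>R y + y * y) * c = c * (1/2) *\<^sub>R (t + (2 * \<alpha>) *\<^sub>R y + y * y)"
      if "t * c = c * t" for c
    proof -
      have "y * y * c = c * (y * y)" using y[OF that] by (metis mult.assoc)
      then show ?thesis using that y[OF that] by (simp add: distrib_left distrib_right)
    qed
    moreover have "star y = y" using \<open>y \<in> S\<close> by (simp add: S_def)
    then have "star ((1/2) *\<^sub>R (t + (2 * \<alpha>) *\<^sub>R y + y * y)) = (1/2) *\<^sub>R (t + (2 * \<alpha>) *\<^sub>R y + y * y)"
      using assms(2) by (simp add: star_scaleR star_add star_mult)
    ultimately show ?thesis unfolding S_def by blast
  qed
  moreover have "0 \<in> S" by (simp add: S_def)
  ultimately obtain \<alpha> y where *: "\<alpha> = (0 + \<alpha>\<^sup>2) / 2" "\<bar>\<alpha>\<bar> \<le> 1"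
    "y = (1/2) *\<^sub>R (t + (2 * \<alpha>) *\<^sub>R y + y * y)" "y \<in> S"
    using sqrt_iteration[of 0 t S] by (metis abs_zero zero_le_one)
  from *(1) have "\<alpha> * (2 - \<alpha>) = 0" by (simp add: power2_eq_square algebra_simps)
  then have "\<alpha> = 0" using *(2) by auto
  with *(3) have "y = (1/2) *\<^sub>R (t + y * y)" by simp
  then have "2 *\<^sub>R y = 2 *\<^sub>R ((1/2) *\<^sub>R (t + y * y))" by (rule arg_cong)
  then have "2 *\<^sub>R y - y * y = t" by simp
  then show ?thesis by (rule that) (use *(4) in \<open>auto simp only: S_def\<close>)
qed

text \<open>The hypothesis reads k^2 + (1 - e)^2 = 1, so (1 - e) + i k and (1 - e) - i k multiply
  isometrically from the left. Half their sum is 1 - e, and half their difference is i k.\<close>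

lemma norm_mult_le_of_isometry:
  fixes k e v :: "'a::cstar_algebra"
  assumes "star k = k" "star e = e" "k * e = e * k" "k * k = 2 *\<^sub>R e - e * e"
  shows "norm (k * v) \<le> norm v" "norm (v - e * v) \<le> norm v"
proof -
  have iso: "norm (c *\<^sub>C (k * v) + (v - e * v)) = norm v" if "cnj c = - c" "c * c = -1" for c
  proof -
    let ?z = "c *\<^sub>C (k * v) + (v - e * v)"
    have st: "star ?z = - c *\<^sub>C (star v * k) + (star v - star v * e)"
      using that by (simp add: star_add star_diff star_scaleC star_mult assms)
    have "star ?z * ?z = star v * (k * k * v) + (star v - star v * e) * (v - e * v)
        + c *\<^sub>C (star v * ((k * e - e * k) * v))"
      unfolding st using that
      by (simp add: distrib_left distrib_right left_diff_distrib right_diff_distrib scaleC_mult_left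
          scaleC_mult_right scaleC_scaleC mult.assoc scaleC_one complex_vector.scale_right_diff_distrib)
    also have "\<dots> = star v * v"
    proof -
      have "(star v - star v * e) * (v - e * v) = star v * (v - (2 *\<^sub>R e - e * e) * v)"
        by (simp add: algebra_simps scaleR_2)
      then show ?thesis using assms(3) by (simp add: assms(4)[symmetric] algebra_simps)
    qed
    finally have "norm (star ?z * ?z) = norm (star v * v)" by simp
    then show ?thesis by (simp add: norm_star_mult_self)
  qed
  note i = iso[of \<i>] iso[of "- \<i>"]
  have "2 * norm (k * v) = norm ((\<i> *\<^sub>C (k * v) + (v - e * v)) - (- \<i> *\<^sub>C (k * v) + (v - e * v)))"
    by (simp add: norm_scaleC flip: scaleC_add_left) 
  also have "\<dots> \<le> norm v + norm v"
    using i by (intro order_trans[OF norm_triangle_ineq4]) simp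
  finally show "norm (k * v) \<le> norm v" by simp
  have "2 * norm (v - e * v) = norm ((\<i> *\<^sub>C (k * v) + (v - e * v)) + (- \<i> *\<^sub>C (k * v) + (v - e * v)))"
    by (simp flip: scaleR_2)
  also have "\<dots> \<le> norm v + norm v"
    using i by (intro order_trans[OF norm_triangle_ineq]) simp
  finally show "norm (v - e * v) \<le> norm v" by simp
qed

section \<open>Star homomorphisms are contractive\<close>

lemma star_homD:
  assumes "star_hom f"
  shows "clinear f" "f (x * y) = f x * f y" "f (star x) = star (f x)"
  using assms by (auto simp: star_hom_def)

text \<open>Scale to h = x^* x / |x|^2, of norm 1. The relation h^2 = 2 d - d^2 survives under
  \<open>f\<close>, so left multiplication by \<open>f h\<close> is a contraction; on the vector
  \<open>f h\<close> itself this yields |f h|^2 <= |f h|.\<close>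

lemma norm_star_hom_le:
  fixes f :: "'a::cstar_algebra \<Rightarrow> 'b::cstar_algebra"
  assumes f: "star_hom f"
  shows "norm (f x) \<le> norm x"
proof (cases "x = 0")
  case True
  then show ?thesis using clinear_zero[OF star_homD(1)[OF f]] by simp
next
  case False
  have fR: "f (r *\<^sub>R y) = r *\<^sub>R f y" for r y
    by (simp add: scaleR_scaleC clinear_scaleC[OF star_homD(1)[OF f]])
  define h where "h = (1 / (norm x)\<^sup>2) *\<^sub>R (star x * x)"
  have h: "star h = h" "norm h = 1"
    using False by (simp_all add: h_def star_scaleR star_mult star_star norm_star_mult_self)
  have "norm (h * h) \<le> 1" "star (h * h) = h * h"
    using norm_mult_ineq[of h h] h by (simp_all add: star_mult)
  then obtain d where d: "2 *\<^sub>R d - d * d = h * h" "star d = d" "d * h = h * d"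
    using sqrt_one_minus[of "h * h"] by (metis mult.assoc)
  have "f h * f h = 2 *\<^sub>R f d - f d * f d"
    unfolding star_homD(2)[OF f, symmetric] fR[symmetric] clinear_diff[OF star_homD(1)[OF f], symmetric] d(1) ..
  then have "norm (f h * f h) \<le> norm (f h)"
    using d h by (intro norm_mult_le_of_isometry(1)[of _ "f d"]) (simp_all add: star_homD[OF f] flip: star_homD(2,3)[OF f])
  then have "norm (f h) * norm (f h) \<le> norm (f h)"
    using norm_star_mult_self[of "f h"] h(1) by (simp add: power2_eq_square flip: star_homD(3)[OF f])
  then have "norm (f h) \<le> 1" by (cases "norm (f h) = 0") auto
  then have "(norm (f x))\<^sup>2 \<le> (norm x)\<^sup>2"
    using False by (simp add: h_def fR star_homD[OF f] norm_star_mult_self divide_le_eq)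
  then show ?thesis by (simp add: abs_le_square_iff[symmetric])
qed

lemma star_hom_bounded_linear: "star_hom f \<Longrightarrow> bounded_linear f"
  using norm_star_hom_le[of f]
  by (intro bounded_linear_intro[where K = 1])
    (auto dest!: star_homD(1) simp: clinear_add clinear_scaleC scaleR_scaleC)

text \<open>For z = p + i q and for z = p - i q, commutation gives z^* z = p^2 + q^2. Both elements
  thus have the same norm, and \<open>p\<close> is their mean.\<close>

lemma norm_square_le_commuting:
  fixes p q :: "'a::cstar_algebra"
  assumes "star p = p" "star q = q" "p * q = q * p"
  shows "(norm p)\<^sup>2 \<le> norm (p * p + q * q)"
proof -
  have eq: "(norm (p + c *\<^sub>C q))\<^sup>2 = norm (p * p + q * q)" if "cnj c = - c" "c * c = -1" for c
  proof -
    have st: "star (p + c *\<^sub>C q) = p + (- c) *\<^sub>C q"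
      using that by (simp add: star_add star_scaleC assms)
    have "star (p + c *\<^sub>C q) * (p + c *\<^sub>C q) = p * p + q * q"
      unfolding st using that
      by (simp add: distrib_left distrib_right left_diff_distrib scaleC_mult_left scaleC_mult_right scaleC_scaleC
          scaleC_one assms(3) complex_vector.scale_right_diff_distrib)
    then show ?thesis by (metis norm_star_mult_self)
  qed
  have "2 * norm p = norm ((p + \<i> *\<^sub>C q) + (p + (- \<i>) *\<^sub>C q))"
    by (simp flip: scaleR_2)
  also have "\<dots> \<le> norm (p + \<i> *\<^sub>C q) + norm (p + (- \<i>) *\<^sub>C q)" by (rule norm_triangle_ineq)
  also have "\<dots> = 2 * sqrt (norm (p * p + q * q))"
    using eq[of \<i>] eq[of "- \<i>"] real_sqrt_unique[OF _ norm_ge_zero]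
    by (metis complex_cnj_i complex_cnj_minus i_squared minus_mult_minus mult_2)
  finally have "norm p \<le> sqrt (norm (p * p + q * q))" by simp
  then show ?thesis by (rule sqrt_ge_absD[OF order_trans[rotated]]) simp
qed

text \<open>With c = |k|, the identity (2 c k^2)^2 + (c^2 k - k^3)^2 = (c^2 k + k^3)^2 bounds |2 c
  k^2| = 2 c^3 by |c^2 k + k^3|, which is at most c^3 by assumption. Spectrally: c^2 t + t^3 has
  modulus 2 c^3 at t = c and t = -c.\<close>

lemma selfadjoint_eq_zero:
  fixes k :: "'a::cstar_algebra"
  assumes k: "star k = k" and le: "norm ((norm k)\<^sup>2 *\<^sub>R k + k * k * k) \<le> (norm k)\<^sup>2 * norm k"
  shows "k = 0"
proof -
  define c where "c = norm k"
  define p q r where "p = (2 * c) *\<^sub>R (k * k)"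
    and "q = c\<^sup>2 *\<^sub>R k + k * k * k" and "r = c\<^sup>2 *\<^sub>R k - k * k * k"
  have "norm (k * k) = c\<^sup>2" using norm_star_mult_self[of k] k by (simp add: c_def)
  then have "4 * c ^ 6 = (norm p)\<^sup>2"
    by (simp add: p_def power_mult_distrib)
  also have "\<dots> \<le> norm (p * p + r * r)"
    by (rule norm_square_le_commuting)
      (simp_all add: p_def r_def star_scaleR star_diff star_mult k algebra_simps)
  also have "p * p + r * r = star q * q"
    by (simp add: p_def r_def q_def star_scaleR star_add star_mult k algebra_simps power2_eq_square)
      (simp flip: scaleR_add_left)
  also have "norm \<dots> = (norm q)\<^sup>2" by (rule norm_star_mult_self)
  also have "\<dots> \<le> (c\<^sup>2 * c)\<^sup>2" using le unfolding q_def c_def by (intro power_mono) simp_all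
  also have "\<dots> = c ^ 6" by (simp add: power_mult_distrib flip: power_mult power_Suc power_add power_Suc2)
  finally have "c ^ 6 \<le> 0" by simp
  then show ?thesis by (simp add: c_def)
qed

text \<open>The working notion of a positive element, phrased without reference to a
  spectrum.\<close>

definition square_elt :: "'a::cstar_algebra \<Rightarrow> bool" where
  "square_elt s \<longleftrightarrow> (\<exists>k. star k = k \<and> s = k * k)"

text \<open>Rescale to h = k / sqrt \<kappa> with |h| <= 1 and write h^2 = 2 d - d^2. Then 1 - h^2 =
  (1 - d)^2, and 1 - d is a contraction.\<close>

lemma norm_diff_square_le:
  fixes k v :: "'a::cstar_algebra"
  assumes "star k = k" "(norm k)\<^sup>2 \<le> \<kappa>"
  shows "norm (\<kappa> *\<^sub>R v - k * k * v) \<le> \<kappa> * norm v"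
proof (cases "\<kappa> = 0")
  case True
  then show ?thesis using assms by simp
next
  case False
  then have "0 < \<kappa>" using assms(2) zero_le_power2[of "norm k"] by linarith
  define h where "h = (1 / sqrt \<kappa>) *\<^sub>R k"
  have h: "star h = h" "k * k = \<kappa> *\<^sub>R (h * h)"
    using \<open>0 < \<kappa>\<close> by (simp_all add: h_def star_scaleR assms power2_eq_square[symmetric] power_divide)
  have "\<kappa> * norm (h * h) \<le> \<kappa>"
    using norm_star_mult_self[of k] assms \<open>0 < \<kappa>\<close> h(2) by (metis abs_of_pos norm_scaleR)
  then have "norm (h * h) \<le> 1" using \<open>0 < \<kappa>\<close> by simp
  moreover have "star (h * h) = h * h" by (simp add: star_mult h)
  ultimately obtain d where d: "2 *\<^sub>R d - d * d = h * h" "star d = d" "d * h = h * d"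
    using sqrt_one_minus[of "h * h"] by (metis mult.assoc)
  have "v - h * h * v = (v - d * v) - d * (v - d * v)"
    unfolding d(1)[symmetric] by (simp add: algebra_simps scaleR_2)
  also have "norm \<dots> \<le> norm (v - d * v)"
    using d h(1) by (intro norm_mult_le_of_isometry(2)[of h]) simp_all
  also have "\<dots> \<le> norm v"
    using d h(1) by (intro norm_mult_le_of_isometry(2)[of h]) simp_all
  finally have "norm (v - h * h * v) \<le> norm v" .
  then have "\<kappa> * norm (v - h * h * v) \<le> \<kappa> * norm v" using \<open>0 < \<kappa>\<close> by simp
  moreover have "\<kappa> *\<^sub>R v - k * k * v = \<kappa> *\<^sub>R (v - h * h * v)"
    by (simp add: h(2) scaleR_diff_right)
  ultimately show ?thesis using \<open>0 < \<kappa>\<close> by simp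
qed

text \<open>The iteration with \<tau> = 1 and x = - s/\<kappa> has scalar limit 1, the solution of
  \<alpha> = (1 + \<alpha>^2)/2, which leaves y^2 = s/\<kappa>. The sign in k = - sqrt \<kappa> y
  makes sqrt \<kappa> - k = sqrt \<kappa> (1 + y) bounded by sqrt \<kappa>. So the root satisfies
  the same kind of bound as \<open>s\<close>, and a further root can be extracted from it.\<close>

lemma square_root_exists:
  fixes s :: "'a::cstar_algebra"
  assumes \<kappa>: "0 < \<kappa>" and s: "\<And>v. norm (\<kappa> *\<^sub>R v - s * v) \<le> \<kappa> * norm v" "star s = s"
    and S: "closed S" "0 \<in> S" "s \<in> S" "\<And>x y. x \<in> S \<Longrightarrow> y \<in> S \<Longrightarrow> x + y \<in> S \<and> x * y \<in> S"
      "\<And>c x. x \<in> S \<Longrightarrow> c *\<^sub>R x \<in> S"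
  obtains k \<mu> where "s = k * k" "star k = k" "k \<in> S" "0 < \<mu>" "\<And>v. norm (\<mu> *\<^sub>R v - k * v) \<le> \<mu> * norm v"
proof -
  define x where "x = (- 1 / \<kappa>) *\<^sub>R s"
  have it1: "norm (1 *\<^sub>R v + x * v) \<le> norm v" for v
  proof -
    have "1 *\<^sub>R v + x * v = (1 / \<kappa>) *\<^sub>R (\<kappa> *\<^sub>R v - s * v)"
      using \<kappa> by (simp add: x_def scaleR_diff_right)
    then show ?thesis using s(1)[of v] \<kappa> by (simp add: divide_le_eq mult.commute)
  qed
  have it2: "closed (S \<inter> {x. star x = x} \<inter> {x. x * s = s * x})"
    by (intro closed_Int S closed_fixed_by_star closed_commutant)
  have it3: "(1/2) *\<^sub>R (x + (2 * \<alpha>) *\<^sub>R y + y * y) \<in> S \<inter> {x. star x = x} \<inter> {x. x * s = s * x}"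
    if "y \<in> S \<inter> {x. star x = x} \<inter> {x. x * s = s * x}" for y \<alpha>
  proof -
    have y: "y \<in> S" "star y = y" "y * s = s * y" using that by auto
    have "y * y * s = s * (y * y)" using y(3) by (metis mult.assoc)
    then have "(1/2) *\<^sub>R (x + (2 * \<alpha>) *\<^sub>R y + y * y) * s = s * (1/2) *\<^sub>R (x + (2 * \<alpha>) *\<^sub>R y + y * y)"
      using y(3) by (simp add: x_def distrib_left distrib_right left_diff_distrib right_diff_distrib)
    moreover have "star ((1/2) *\<^sub>R (x + (2 * \<alpha>) *\<^sub>R y + y * y)) = (1/2) *\<^sub>R (x + (2 * \<alpha>) *\<^sub>R y + y * y)"
      using s(2) y(2) by (simp only: x_def star_scaleR star_add star_mult)
    moreover have "(1/2) *\<^sub>R (x + (2 * \<alpha>) *\<^sub>R y + y * y) \<in> S"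
      unfolding x_def by (intro S(5) S(4)[THEN conjunct1] S(4)[THEN conjunct2] S(3) y(1))
    ultimately show ?thesis by blast
  qed
  have it4: "0 \<in> S \<inter> {x. star x = x} \<inter> {x. x * s = s * x}" using S(2) by simp
  obtain \<alpha> y where *: "\<alpha> = (1 + \<alpha>\<^sup>2) / 2"
    "y = (1/2) *\<^sub>R (x + (2 * \<alpha>) *\<^sub>R y + y * y)" "y \<in> S \<inter> {x. star x = x}"
    "\<And>v. norm (\<alpha> *\<^sub>R v + y * v) \<le> norm v"
    by (rule sqrt_iteration[OF it1 _ it2 it4 it3]) auto
  have "(\<alpha> - 1)\<^sup>2 = 0" using *(1) by (simp add: power2_eq_square algebra_simps)
  then have \<alpha>: "\<alpha> = 1" by simp
  from *(2) have "2 *\<^sub>R y = 2 *\<^sub>R ((1/2) *\<^sub>R (x + 2 *\<^sub>R y + y * y))" unfolding \<alpha> by simp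
  then have y: "y * y = - x" by (simp add: algebra_simps eq_neg_iff_add_eq_0)
  define k where "k = (- sqrt \<kappa>) *\<^sub>R y"
  have "k * k = s" using \<kappa> y by (simp add: k_def x_def)
  moreover have "star k = k" "k \<in> S"
    using *(3) S(5)[of y "- sqrt \<kappa>"] unfolding k_def by (simp_all only: star_scaleR Int_iff mem_Collect_eq)
  moreover have "norm (sqrt \<kappa> *\<^sub>R v - k * v) \<le> sqrt \<kappa> * norm v" for v
  proof -
    have "sqrt \<kappa> *\<^sub>R v - k * v = sqrt \<kappa> *\<^sub>R (1 *\<^sub>R v + y * v)"
      by (simp add: k_def scaleR_add_right)
    then show ?thesis using *(4)[of v] \<kappa> unfolding \<alpha> by simp
  qed
  ultimately show ?thesis using that[of k "sqrt \<kappa>"] \<kappa> by auto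
qed

lemma square_elt_add:
  fixes s t :: "'a::cstar_algebra"
  assumes "square_elt s" "square_elt t"
  shows "square_elt (s + t)"
proof -
  from assms obtain k l where kl: "star k = k" "s = k * k" "star l = l" "t = l * l"
    by (auto simp: square_elt_def)
  \<comment> \<open>The bound for the sum splits into one bound per summand; the extra 1 keeps
    \<open>\<kappa>\<close> positive.\<close>
  define \<kappa> where "\<kappa> = (norm k)\<^sup>2 + (norm l)\<^sup>2 + 1"
  have "0 < \<kappa>" by (simp add: \<kappa>_def add_nonneg_pos)
  moreover have "norm (\<kappa> *\<^sub>R v - (s + t) * v) \<le> \<kappa> * norm v" for v
  proof -
    have "\<kappa> *\<^sub>R v - (s + t) * v = (((norm k)\<^sup>2 + 1) *\<^sub>R v - k * k * v) + ((norm l)\<^sup>2 *\<^sub>R v - l * l * v)"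
      by (simp add: \<kappa>_def kl algebra_simps)
    also have "norm \<dots> \<le> ((norm k)\<^sup>2 + 1) * norm v + (norm l)\<^sup>2 * norm v"
      by (intro order_trans[OF norm_triangle_ineq] add_mono norm_diff_square_le) (simp_all add: kl)
    finally show ?thesis by (simp add: \<kappa>_def algebra_simps)
  qed
  moreover have "star (s + t) = s + t" by (simp add: star_add star_mult kl)
  ultimately show ?thesis
    by (rule square_root_exists[where S = UNIV]) (auto simp: square_elt_def)
qed

text \<open>Kelley and Vaught: with \<open>h = x\<^sup>*x\<close> and \<open>m = |h|\<close>, the element \<open>y = x (m - h)\<close> satisfies
  \<open>y\<^sup>*y = - k\<^sup>2\<close> and \<open>y y\<^sup>* = l\<^sup>2\<close>, whence \<open>(\<kappa> - l\<^sup>2) y = y (\<kappa> + k\<^sup>2)\<close> and \<open>k = 0\<close> by the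
  previous norm estimates.\<close>

lemma square_elt_star_mult_self: "square_elt (star x * x)" for x :: "'a::cstar_algebra"
proof -
  define h where "h = star x * x"
  have h: "star h = h" by (simp add: h_def star_mult star_star)
  define S where "S = {y. y * h = h * y}"
  have S: "closed S" "0 \<in> S" "\<And>x y. x \<in> S \<Longrightarrow> y \<in> S \<Longrightarrow> x + y \<in> S \<and> x * y \<in> S"
      "\<And>c x. x \<in> S \<Longrightarrow> c *\<^sub>R x \<in> S"
  proof -
    show "closed S" unfolding S_def by (rule closed_commutant)
    show "x + y \<in> S \<and> x * y \<in> S" if "x \<in> S" "y \<in> S" for x y
      using that by (simp add: S_def distrib_left distrib_right) (metis mult.assoc)
  qed (simp_all add: S_def)
  have "h * h \<in> S" by (simp add: S_def mult.assoc)
  moreover have "norm (((norm h)\<^sup>2 + 1) *\<^sub>R v - h * h * v) \<le> ((norm h)\<^sup>2 + 1) * norm v" for v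
    by (rule norm_diff_square_le) (simp_all add: h)
  moreover have "star (h * h) = h * h" by (simp add: star_mult h)
  moreover have "0 < (norm h)\<^sup>2 + 1" by (simp add: add_nonneg_pos)
  ultimately obtain m \<mu> where m: "h * h = m * m" "star m = m" "m \<in> S" "0 < \<mu>"
    "\<And>v. norm (\<mu> *\<^sub>R v - m * v) \<le> \<mu> * norm v"
    using square_root_exists[of "(norm h)\<^sup>2 + 1" "h * h" S] S by metis
  \<comment> \<open>A root of m = |h| within the commutant of \<open>h\<close>; it makes k = r n
    selfadjoint with k^2 = m n^2.\<close>
  from square_root_exists[OF m(4,5,2) S(1,2) m(3) S(3,4)]
  obtain r \<nu> where r: "m = r * r" "star r = r" "r \<in> S" by metis
  have rh: "r * h = h * r" and mh: "m * h = h * m" using r(3) m(3) by (simp_all add: S_def)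
  \<comment> \<open>\<open>n\<close> is twice the negative part of \<open>h\<close>; the aim is n =
    0.\<close>
  define n where "n = m - h"
  have n: "star n = n" "r * n = n * r"
    using rh by (simp_all add: n_def star_diff star_mult h r(1,2) algebra_simps)
  have hn: "h * n = - (n * m)"
    using m(1) mh by (simp add: n_def algebra_simps)
  define y k where "y = x * n" and "k = r * n"
  have k: "star k = k" using n r(2) by (simp add: k_def star_mult)
  have yy: "star y * y = - (k * k)"
  proof -
    have "star y * y = n * (h * n)" by (simp add: y_def star_mult n h_def mult.assoc)
    also have "\<dots> = - (n * n * r * r)" by (simp add: hn r(1) mult.assoc)
    also have "n * n * r * r = k * k"
      unfolding k_def by (metis mult.assoc n(2))
    finally show ?thesis .
  qed
  \<comment> \<open>Up to scaling, the real and imaginary parts of \<open>y\<close>: a^2 + b^2 = 2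
    y^* y + 2 y y^*. Since y^* y = - k^2, the element y y^* is a sum of squares.\<close>
  define a b where "a = star y + y" and "b = \<i> *\<^sub>C (star y - y)"
  have ab: "star a = a" "star b = b"
    by (simp_all add: a_def b_def star_add star_diff star_scaleC star_star add.commute
        complex_vector.scale_right_diff_distrib)
  have sq: "square_elt (c * c)" if "star c = c" for c :: 'a
    using that by (auto simp: square_elt_def)
  have "y * star y = (sqrt (1/2) *\<^sub>R a) * (sqrt (1/2) *\<^sub>R a) + (sqrt (1/2) *\<^sub>R b) * (sqrt (1/2) *\<^sub>R b) + k * k"
  proof -
    have "a * a + b * b = 2 *\<^sub>R (star y * y) + 2 *\<^sub>R (y * star y)"
      by (simp add: a_def b_def scaleC_mult_left scaleC_mult_right scaleC_scaleC algebra_simps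
          complex_vector.scale_right_diff_distrib scaleR_2)
    then have "(1/2) *\<^sub>R (a * a + b * b) = star y * y + y * star y"
      by (simp add: scaleR_add_right)
    then show ?thesis by (simp add: yy scaleR_add_right real_sqrt_divide flip: real_sqrt_mult)
  qed
  then have "square_elt (y * star y)"
    by (simp only:) (intro square_elt_add sq; simp add: star_scaleR ab k)
  then obtain l where l: "star l = l" "y * star y = l * l" by (auto simp: square_elt_def)
  have ny: "(norm y)\<^sup>2 = (norm k)\<^sup>2"
    using norm_star_mult_self[of y] norm_star_mult_self[of k] k by (simp add: yy)
  have "(norm l)\<^sup>2 = (norm k)\<^sup>2"
    using norm_mult_star_self[of y] norm_star_mult_self[of l] l ny by simp
  \<comment> \<open>The estimate for l^2 = y y^* acts on \<open>y\<close> itself; as l^2 y = y (y^*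
    y) = - y k^2, the minus sign becomes a plus.\<close>
  then have "norm ((norm k)\<^sup>2 *\<^sub>R y - l * l * y) \<le> (norm k)\<^sup>2 * norm y"
    by (intro norm_diff_square_le l) simp
  moreover have "l * l * y = - (y * (k * k))"
    using yy by (simp flip: l(2) add: mult.assoc)
  ultimately have *: "norm ((norm k)\<^sup>2 *\<^sub>R y + y * (k * k)) \<le> (norm k)\<^sup>2 * norm k"
    using ny by simp
  define w where "w = (norm k)\<^sup>2 *\<^sub>R y + y * (k * k)"
  define k' where "k' = (norm k)\<^sup>2 *\<^sub>R k + k * k * k"
  \<comment> \<open>Here w = y f(k) with f(k) = |k|^2 + k^2, and k' = k f(k). Thus y^* y = - k^2
    turns w^* w into - (k f(k))^2, and the bound on \<open>w\<close> becomes one on k'.\<close>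
  have "star w * w = - (star k' * k')"
  proof -
    have "star w * w = (norm k)\<^sup>2 *\<^sub>R (norm k)\<^sup>2 *\<^sub>R (star y * y) + (norm k)\<^sup>2 *\<^sub>R (star y * y * (k * k))
        + (norm k)\<^sup>2 *\<^sub>R (k * k * (star y * y)) + k * k * (star y * y) * (k * k)"
      by (simp add: w_def star_add star_scaleR star_mult k algebra_simps)
    then show ?thesis
      by (simp add: yy k'_def star_add star_scaleR star_mult k algebra_simps)
  qed
  then have "(norm k')\<^sup>2 = (norm w)\<^sup>2" by (metis norm_minus_cancel norm_star_mult_self)
  then have "norm k' = norm w" by simp
  with * have "k = 0" by (intro selfadjoint_eq_zero k) (simp add: w_def k'_def)
  with yy have "y = 0" by (metis norm_eq_zero norm_star_mult_self mult_zero_left neg_equal_0_iff_equal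
    norm_zero power_eq_0_iff)
  then have "h * n = 0" by (simp add: h_def y_def mult.assoc)
  with hn have "n * m = 0" by simp
  moreover have "n * h = 0" using \<open>h * n = 0\<close> h n(1) by (metis star_mult star_zero)
  moreover have "n * n = n * m - n * h"
    unfolding n_def by (rule right_diff_distrib)
  ultimately have "star n * n = 0" by (simp add: n(1))
  then have "n = 0" by (metis norm_eq_zero norm_star_mult_self norm_zero power_eq_0_iff)
  then have "h = r * r" using r(1) by (simp add: n_def)
  then show ?thesis using r(2) by (auto simp: square_elt_def h_def)
qed

lemma square_elt_sum_list:
  "square_elt (\<Sum>z\<leftarrow>zs. star z * z)" for zs :: "'a::cstar_algebra list"
proof (induction zs)
  case Nil
  show ?case by (auto simp: square_elt_def intro!: exI[of _ 0])
next
  case (Cons z zs)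
  then show ?case by (simp add: square_elt_add square_elt_star_mult_self)
qed

text \<open>If l^2 = - k^2 then |l| = |k|, and the estimate for |k|^2 - l^2 acting on
  \<open>k\<close> is the hypothesis of \<open>selfadjoint_eq_zero\<close>.\<close>

lemma square_elt_add_eq_zero:
  fixes s t :: "'a::cstar_algebra"
  assumes "square_elt s" "square_elt t" "s + t = 0"
  shows "s = 0"
proof -
  from assms obtain k l where kl: "star k = k" "s = k * k" "star l = l" "t = l * l"
    by (auto simp: square_elt_def)
  have l: "l * l = - (k * k)" using assms(3) kl by (simp add: eq_neg_iff_add_eq_0 add.commute)
  then have "norm l = norm k"
    using norm_star_mult_self[of k] norm_star_mult_self[of l] kl
    by (metis norm_ge_zero norm_minus_cancel power2_eq_imp_eq)
  then have "norm ((norm k)\<^sup>2 *\<^sub>R k - l * l * k) \<le> (norm k)\<^sup>2 * norm k"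
    by (intro norm_diff_square_le kl) simp
  then have "k = 0" using kl by (intro selfadjoint_eq_zero) (simp_all add: l)
  then show ?thesis by (simp add: kl)
qed

lemma sum_squares_eq_zero:
  fixes zs :: "'a::cstar_algebra list"
  assumes "(\<Sum>z\<leftarrow>zs. star z * z) = 0" "z \<in> set zs"
  shows "z = 0"
  using assms
proof (induction zs)
  case (Cons w zs)
  have w: "star w * w = 0"
    using Cons.prems(1) square_elt_add_eq_zero[OF square_elt_star_mult_self[of w] square_elt_sum_list[of zs]]
    by simp
  then have "w = 0" by (metis norm_eq_zero norm_star_mult_self norm_zero power_eq_0_iff)
  then show ?case using Cons by auto
qed simp

text \<open>Positivity in the fixed point algebra asks for a root inside that algebra;
  \<open>S\<close> will be the set of fixed points.\<close>

lemma sum_squares_root: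
  fixes zs :: "'a::cstar_algebra list"
  assumes S: "closed S" "0 \<in> S" "\<And>x y. x \<in> S \<Longrightarrow> y \<in> S \<Longrightarrow> x + y \<in> S \<and> x * y \<in> S"
      "\<And>c x. x \<in> S \<Longrightarrow> c *\<^sub>R x \<in> S" and s: "(\<Sum>z\<leftarrow>zs. star z * z) \<in> S"
  obtains k where "k \<in> S" "star k = k" "(\<Sum>z\<leftarrow>zs. star z * z) = star k * k"
proof -
  let ?s = "\<Sum>z\<leftarrow>zs. star z * z"
  obtain l where l: "star l = l" "?s = l * l"
    using square_elt_sum_list[of zs] by (auto simp: square_elt_def)
  have "0 < (norm l)\<^sup>2 + 1" by (simp add: add_nonneg_pos)
  moreover have "norm (((norm l)\<^sup>2 + 1) *\<^sub>R v - ?s * v) \<le> ((norm l)\<^sup>2 + 1) * norm v" for v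
    unfolding l(2) by (rule norm_diff_square_le) (simp_all add: l)
  moreover have "star ?s = ?s" by (simp add: l star_mult)
  ultimately show ?thesis
    by (rule square_root_exists[OF _ _ _ S(1,2) s S(3,4)]) (auto intro: that)
qed

text \<open>The witness is |a| (1 - d) y, where (1 - d)^2 = 1 - a^* a / |a|^2 in the unitization.
  This exhibits the difference in y^* a^* a y <= |a|^2 y^* y as a square.\<close>

lemma norm_le_sum_squares:
  fixes a y :: "'a::cstar_algebra"
  obtains z where "star z * z = (norm a)\<^sup>2 *\<^sub>R (star y * y) - star (a * y) * (a * y)"
proof (cases "a = 0")
  case True
  then show ?thesis using that[of 0] by simp
next
  case False
  define t where "t = (1 / (norm a)\<^sup>2) *\<^sub>R (star a * a)"
  have "norm t \<le> 1" "star t = t"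
    using False by (simp_all add: t_def star_scaleR star_mult star_star norm_star_mult_self)
  then obtain d where d: "2 *\<^sub>R d - d * d = t" "star d = d"
    using sqrt_one_minus by metis
  define z where "z = norm a *\<^sub>R (y - d * y)"
  have "star z * z = (norm a)\<^sup>2 *\<^sub>R (star y * y - star y * ((2 *\<^sub>R d - d * d) * y))"
    by (simp add: z_def star_scaleR star_diff star_mult d(2) algebra_simps power2_eq_square scaleR_2)
  also have "\<dots> = (norm a)\<^sup>2 *\<^sub>R (star y * y) - star (a * y) * (a * y)"
    unfolding d(1) using False by (simp add: t_def star_mult scaleR_diff_right mult.assoc)
  finally show ?thesis by (rule that)
qed

section \<open>Conjugate bilinear maps\<close>

text \<open>Involutions are antilinear in both legs, and \<open>tensor_lift\<close> is applied to
  them too. Conjugating functionals reduces the independence of the decomposition to the bilinear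
  case.\<close>

definition conj_bilinear :: "('a::complex_vector \<Rightarrow> 'b::complex_vector \<Rightarrow> 'c::complex_vector) \<Rightarrow> bool" where
  "conj_bilinear F \<longleftrightarrow>
     (\<forall>a a' b. F (a + a') b = F a b + F a' b) \<and> (\<forall>a b b'. F a (b + b') = F a b + F a b') \<and>
     (\<forall>c a b. F (c *\<^sub>C a) b = cnj c *\<^sub>C F a b) \<and> (\<forall>c a b. F a (c *\<^sub>C b) = cnj c *\<^sub>C F a b)"

lemma pair_sum_tensor_eq_conj:
  fixes F :: "'a::complex_vector \<Rightarrow> 'b::complex_vector \<Rightarrow> 'c::complex_vector"
  assumes F: "conj_bilinear F" and "tensor_eq xs ys"
  shows "pair_sum F xs = pair_sum F ys"
proof (rule clinear_separates)
  fix f :: "'c \<Rightarrow> complex" assume f: "clinear f"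
  have eq: "f (pair_sum F zs) = cnj (pair_sum (\<lambda>a b. cnj (f (F a b))) zs)" for zs
    using f by (induction zs) (auto simp: clinear_add clinear_zero)
  have "cbilinear (\<lambda>a b. cnj (f (F a b)))"
    using F f by (intro cbilinearI clinearI)
      (simp_all add: conj_bilinear_def clinear_add clinear_scaleC)
  with assms(2) show "f (pair_sum F xs) = f (pair_sum F ys)"
    by (simp add: eq tensor_eq_def)
qed

lemma tensor_lift_conj_abs:
  assumes "conj_bilinear F"
  shows "tensor_lift F (abs_tensor xs) = pair_sum F xs"
proof -
  have "abs_tensor (SOME ys. set ys \<subseteq> UNIV \<times> UNIV \<and> abs_tensor ys = abs_tensor xs) = abs_tensor xs"
    by (rule someI2[of _ xs]) auto
  then show ?thesis unfolding tensor_lift_def tensor_lift_on_def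
    by (intro pair_sum_tensor_eq_conj[OF assms]) (simp add: abs_tensor_eq_iff)
qed

lemma tensor_lift_conj_tensor: "conj_bilinear F \<Longrightarrow> tensor_lift F (a \<otimes> b) = F a b"
  and tensor_lift_conj_zero: "conj_bilinear F \<Longrightarrow> tensor_lift F 0 = 0"
  by (simp_all add: tensor.abs_eq zero_tensor.abs_eq tensor_lift_conj_abs)

lemma tensor_lift_conj_add:
  assumes "conj_bilinear F"
  shows "tensor_lift F (s + t) = tensor_lift F s + tensor_lift F t"
  by (induction s, induction t) (simp add: plus_tensor.abs_eq tensor_lift_conj_abs[OF assms])

lemma tensor_lift_conj_sum:
  assumes "conj_bilinear F"
  shows "tensor_lift F (\<Sum>i\<in>A. g i) = (\<Sum>i\<in>A. tensor_lift F (g i))"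
  by (induction A rule: infinite_finite_induct)
    (simp_all add: assms tensor_lift_conj_zero tensor_lift_conj_add)

lemma conj_bilinear_compose_linear:
  "conj_bilinear F \<Longrightarrow> clinear f \<Longrightarrow> conj_bilinear (\<lambda>a b. f (F a b))"
  by (simp add: conj_bilinear_def clinear_add clinear_scaleC)

lemma clinear_tensor_lift_conj_eq:
  assumes "clinear f" and "conj_bilinear F"
  shows "f (tensor_lift F t) = tensor_lift (\<lambda>a b. f (F a b)) t"
  using conj_bilinear_compose_linear[OF assms(2,1)] assms
  by (induction t rule: tensor_induct)
    (simp_all add: tensor_lift_conj_zero tensor_lift_conj_tensor tensor_lift_conj_add clinear_zero
      clinear_add)


section \<open>Comatrices\<close>

text \<open>The identity matrix of \<open>I\<close>, vanishing outside \<open>I\<close> to match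
  coefficient matrices extended by zero.\<close>

definition delta :: "'i set \<Rightarrow> 'i \<Rightarrow> 'i \<Rightarrow> complex" where
  "delta I i j = (if i = j \<and> i \<in> I then 1 else 0)"

lemma sum_delta_scaleC:
  fixes f :: "_ \<Rightarrow> 'a::complex_vector"
  assumes "finite I" "i \<notin> I \<Longrightarrow> f i = 0"
  shows "(\<Sum>k\<in>I. delta I i k *\<^sub>C f k) = f i" "(\<Sum>k\<in>I. delta I k i *\<^sub>C f k) = f i"
proof -
  have "(\<Sum>k\<in>I. delta I i k *\<^sub>C f k) = (\<Sum>k\<in>I. if k = i then f i else 0)"
    "(\<Sum>k\<in>I. delta I k i *\<^sub>C f k) = (\<Sum>k\<in>I. if k = i then f i else 0)"
    by (rule sum.cong; auto simp: delta_def scaleC_one)+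
  then show "(\<Sum>k\<in>I. delta I i k *\<^sub>C f k) = f i" "(\<Sum>k\<in>I. delta I k i *\<^sub>C f k) = f i"
    using assms by auto
qed

lemma sum_delta_times:
  fixes f :: "_ \<Rightarrow> complex"
  assumes "finite I" "i \<notin> I \<Longrightarrow> f i = 0"
  shows "(\<Sum>k\<in>I. delta I i k * f k) = f i" "(\<Sum>k\<in>I. delta I k i * f k) = f i"
    "(\<Sum>k\<in>I. f k * delta I i k) = f i" "(\<Sum>k\<in>I. f k * delta I k i) = f i"
  using sum_delta_scaleC[of I i f] assms by (simp_all add: mult.commute)

text \<open>Matrices of matrix coefficients are extended by zero outside their index set; the formulas
  for comultiplication and counit then hold for all indices.\<close>

definition comatrix :: "'h::complex_vector star_bialgebra \<Rightarrow> 'i set \<Rightarrow> ('i \<Rightarrow> 'i \<Rightarrow> 'h) \<Rightarrow> bool" where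
  "comatrix G I U \<longleftrightarrow> finite I \<and> (\<forall>i j. comult G (U i j) = (\<Sum>k\<in>I. U i k \<otimes> U k j)) \<and>
     (\<forall>i j. counit G (U i j) = delta I i j) \<and> (\<forall>i j. i \<notin> I \<or> j \<notin> I \<longrightarrow> U i j = 0)"

definition unitary_comatrix :: "'h::complex_vector star_bialgebra \<Rightarrow> 'i set \<Rightarrow> ('i \<Rightarrow> 'i \<Rightarrow> 'h) \<Rightarrow> bool" where
  "unitary_comatrix G I U \<longleftrightarrow> comatrix G I U \<and>
     (\<forall>i j. (\<Sum>k\<in>I. hmult G (hstar G (U k i)) (U k j)) = delta I i j *\<^sub>C hone G) \<and>
     (\<forall>i j. (\<Sum>k\<in>I. hmult G (U i k) (hstar G (U j k))) = delta I i j *\<^sub>C hone G)"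

lemma comatrixD:
  assumes "comatrix G I U"
  shows "finite I" "comult G (U i j) = (\<Sum>k\<in>I. U i k \<otimes> U k j)" "counit G (U i j) = delta I i j"
    "i \<notin> I \<Longrightarrow> U i j = 0" "j \<notin> I \<Longrightarrow> U i j = 0"
  using assms by (auto simp: comatrix_def)

lemma unitary_comatrixD:
  assumes "unitary_comatrix G I U"
  shows "comatrix G I U"
    "(\<Sum>k\<in>I. hmult G (hstar G (U k i)) (U k j)) = delta I i j *\<^sub>C hone G"
    "(\<Sum>k\<in>I. hmult G (U i k) (hstar G (U j k))) = delta I i j *\<^sub>C hone G"
  using assms by (auto simp: unitary_comatrix_def)

text \<open>The translation of Sweedler sums into matrix products, on which the Hopf algebra
  computations below rest.\<close>

lemma lift_comatrix:
  assumes "comatrix G I U" "cbilinear F"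
  shows "tensor_lift F (comult G (U i j)) = (\<Sum>k\<in>I. F (U i k) (U k j))"
  using assms by (simp add: comatrixD(2) tensor_lift_sum tensor_lift_tensor)

lemma sum_delta_comatrix:
  assumes "comatrix G I U"
  shows "(\<Sum>k\<in>I. delta I i k *\<^sub>C U k j) = U i j" "(\<Sum>k\<in>I. delta I k j *\<^sub>C U i k) = U i j"
  using assms by (simp_all add: sum_delta_scaleC comatrixD(1,4,5))


section \<open>Hopf *-algebras spanned by unitary representations\<close>

locale cqg =
  fixes G :: "'h::complex_vector star_bialgebra"
  assumes cqg: "cqg_algebra G"
begin

abbreviation mul (infixl \<open>\<cdot>\<close> 70) where "a \<cdot> b \<equiv> hmult G a b"
abbreviation unit (\<open>\<one>\<close>) where "\<one> \<equiv> hone G"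
abbreviation st where "st \<equiv> hstar G"
abbreviation \<epsilon> where "\<epsilon> \<equiv> counit G"
abbreviation S where "S \<equiv> antipode G"
abbreviation L :: "('h \<Rightarrow> 'h \<Rightarrow> 'c::comm_monoid_add) \<Rightarrow> 'h \<Rightarrow> 'c" where
  "L F a \<equiv> tensor_lift F (comult G a)"

lemma hopf: "hopf_star_algebra G"
  using cqg by (simp add: cqg_algebra_def)

lemma mul_cbilinear: "cbilinear (\<cdot>)"
  and mul_assoc: "(a \<cdot> b) \<cdot> c = a \<cdot> (b \<cdot> c)"
  and one_mul [simp]: "\<one> \<cdot> a = a" and mul_one [simp]: "a \<cdot> \<one> = a"
  and st_add: "st (a + b) = st a + st b"
  and st_scaleC: "st (z *\<^sub>C a) = cnj z *\<^sub>C st a"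
  and st_mul: "st (a \<cdot> b) = st b \<cdot> st a"
  and st_st [simp]: "st (st a) = a"
  and comult_clinear: "clinear (comult G)" and counit_clinear: "clinear \<epsilon>"
  and coassoc: "L (\<lambda>b c. L (\<lambda>b1 b2. b1 \<otimes> (b2 \<otimes> c)) b) a = L (\<lambda>b c. b \<otimes> comult G c) a"
  and counit_left: "L (\<lambda>b c. \<epsilon> b *\<^sub>C c) a = a"
  and counit_right: "L (\<lambda>b c. \<epsilon> c *\<^sub>C b) a = a"
  and comult_mul: "comult G (a \<cdot> b) = tensor_mult (\<cdot>) (\<cdot>) (comult G a) (comult G b)"
  and comult_one: "comult G \<one> = \<one> \<otimes> \<one>"
  and comult_st: "comult G (st a) = tensor_star st st (comult G a)"
  and counit_mul [simp]: "\<epsilon> (a \<cdot> b) = \<epsilon> a * \<epsilon> b"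
  and counit_one [simp]: "\<epsilon> \<one> = 1"
  and antipode_exists: "\<exists>S. is_antipode G S"
  using hopf by (simp_all add: hopf_star_algebra_def)

lemmas mul_simps = cbilinearD[OF mul_cbilinear]

lemma mul_zero [simp]: "0 \<cdot> a = 0" "a \<cdot> 0 = 0"
  using mul_simps(3)[of 0 0 a] mul_simps(4)[of a 0 0] by simp_all

lemma st_zero [simp]: "st 0 = 0"
  using st_scaleC[of 0 0] by simp

lemma st_sum: "st (\<Sum>i\<in>A. f i) = (\<Sum>i\<in>A. st (f i))"
  by (induction A rule: infinite_finite_induct) (simp_all add: st_add)

lemma st_one [simp]: "st \<one> = \<one>"
  by (metis mul_one one_mul st_mul st_st)

lemma clinear_compose_mul [lin]:
  "clinear f \<Longrightarrow> clinear (\<lambda>x. c \<cdot> f x)" "clinear f \<Longrightarrow> clinear (\<lambda>x. f x \<cdot> c)"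
  by (rule clinearI; simp add: clinear_add clinear_scaleC mul_simps)+

lemma clinear_compose_comult [lin]: "clinear f \<Longrightarrow> clinear (\<lambda>x. comult G (f x))"
  and clinear_compose_counit [lin]: "clinear f \<Longrightarrow> clinear (\<lambda>x. \<epsilon> (f x))"
  by (rule clinearI; simp add: clinear_add clinear_scaleC comult_clinear counit_clinear)+

lemma mul_sum:
  "(\<Sum>i\<in>A. f i) \<cdot> b = (\<Sum>i\<in>A. f i \<cdot> b)" "b \<cdot> (\<Sum>i\<in>A. f i) = (\<Sum>i\<in>A. b \<cdot> f i)"
  by (rule clinear_sum, intro lin)+

lemma comult_product:
  assumes "comatrix G I U" "comatrix G J V"
  shows "comult G (U i j \<cdot> V k l) = (\<Sum>p\<in>I. \<Sum>q\<in>J. (U i p \<cdot> V k q) \<otimes> (U p j \<cdot> V q l))"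
  unfolding comult_mul tensor_mult_def comatrixD(2)[OF assms(1)] comatrixD(2)[OF assms(2)]
  by (subst tensor_lift_sum tensor_lift_tensor, (intro lin)[1])+ simp

lemma unitary_rep_comatrix:
  assumes U: "unitary_rep G n U"
  shows "unitary_comatrix G {..<n} (\<lambda>i j. if i < n \<and> j < n then U i j else 0)"
proof -
  have comult: "comult G (U i j) = (\<Sum>k<n. U i k \<otimes> U k j)"
    and unit: "(\<Sum>k<n. st (U k i) \<cdot> U k j) = (if i = j then \<one> else 0)"
      "(\<Sum>k<n. U i k \<cdot> st (U j k)) = (if i = j then \<one> else 0)" if "i < n" "j < n" for i j
    using U that by (auto simp: unitary_rep_def)
  \<comment> \<open>The counit axiom gives U = \<epsilon>(U) U; multiplying by U^* from the right
    leaves \<epsilon>(U) = 1.\<close>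
  have counit: "\<epsilon> (U i l) = (if i = l then 1 else 0)" if "i < n" "l < n" for i l
  proof -
    have "U i j = (\<Sum>k<n. \<epsilon> (U i k) *\<^sub>C U k j)" if "j < n" for j
    proof -
      have "U i j = L (\<lambda>b c. \<epsilon> b *\<^sub>C c) (U i j)" by (rule counit_left[symmetric])
      also have "\<dots> = (\<Sum>k<n. \<epsilon> (U i k) *\<^sub>C U k j)"
        unfolding comult[OF \<open>i < n\<close> that]
        by (subst tensor_lift_sum tensor_lift_tensor, (intro lin)[1])+ simp
      finally show ?thesis .
    qed
    then have "(\<Sum>j<n. U i j \<cdot> st (U l j)) = (\<Sum>j<n. (\<Sum>k<n. \<epsilon> (U i k) *\<^sub>C U k j) \<cdot> st (U l j))"
      by simp
    also have "\<dots> = (\<Sum>k<n. \<epsilon> (U i k) *\<^sub>C (\<Sum>j<n. U k j \<cdot> st (U l j)))"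
      by (simp add: mul_sum mul_simps complex_vector.scale_sum_right) (rule sum.swap)
    also have "\<dots> = (\<Sum>k<n. if k = l then \<epsilon> (U i l) *\<^sub>C \<one> else 0)"
      using that by (intro sum.cong) (auto simp: unit)
    also have "\<dots> = \<epsilon> (U i l) *\<^sub>C \<one>" using that by simp
    finally have "\<epsilon> (if i = l then \<one> else 0) = \<epsilon> (\<epsilon> (U i l) *\<^sub>C \<one>)" using that unit by simp
    then show ?thesis by (simp add: clinear_scaleC[OF counit_clinear] clinear_zero[OF counit_clinear] split: if_splits)
  qed
  let ?V = "\<lambda>i j. if i < n \<and> j < n then U i j else 0"
  have "comatrix G {..<n} ?V"
    unfolding comatrix_def
    by (auto simp: comult counit delta_def clinear_zero[OF comult_clinear] clinear_zero[OF counit_clinear])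
  moreover have "(\<Sum>k<n. st (?V k i) \<cdot> ?V k j) = delta {..<n} i j *\<^sub>C \<one>"
    "(\<Sum>k<n. ?V i k \<cdot> st (?V j k)) = delta {..<n} i j *\<^sub>C \<one>" for i j
    by (cases "i < n"; cases "j < n"; simp add: unit delta_def scaleC_one)+
  ultimately show ?thesis by (simp add: unitary_comatrix_def)
qed

lemma cqg_induct [case_names coefficient add scaleC]:
  assumes "\<And>n U i j. unitary_comatrix G {..<n::nat} U \<Longrightarrow> P (U i j)"
    and "\<And>a b. P a \<Longrightarrow> P b \<Longrightarrow> P (a + b)" and "\<And>c a. P a \<Longrightarrow> P (c *\<^sub>C a)"
  shows "P a"
proof -
  have coeff: "P (U i j)" if "unitary_rep G n U" "i < n" "j < n" for n U i j
    using assms(1)[OF unitary_rep_comatrix[OF that(1)], of i j] that by simp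
  have "a \<in> complex_vector.span {U i j | U n i j. unitary_rep G n U \<and> i < n \<and> j < n}"
    using cqg by (simp add: cqg_algebra_def)
  then show ?thesis
  proof (induction rule: complex_vector.span_induct_alt)
    case base
    \<comment> \<open>The zero-dimensional representation supplies some element with
      \<open>P\<close>, and scaling it by 0 gives \<open>P 0\<close>.\<close>
    have "\<exists>b. P b"
      using assms(1)[of 0 "\<lambda>_ _. 0"]
      by (auto simp: unitary_comatrix_def comatrix_def delta_def clinear_zero comult_clinear counit_clinear)
    then obtain b where "P b" by blast
    from assms(3)[OF this, of 0] show ?case by simp
  next
    case (step c x y)
    then show ?case using assms(2,3) coeff by auto
  qed
qed

lemma clinear_eq_coefficients:
  assumes "clinear f" "clinear g"
    and "\<And>n U i j. unitary_comatrix G {..<n::nat} U \<Longrightarrow> f (U i j) = g (U i j)"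
  shows "f a = g a"
  using assms(3)
  by (induction a rule: cqg_induct) (simp_all add: assms(1,2) clinear_add clinear_scaleC)

text \<open>Adjoints of coefficients span as well. They are the convenient test elements for u^* and
  its inverse, whose values on them involve no complex conjugation.\<close>

lemma clinear_eq_star_coefficients:
  assumes "clinear f" "clinear g"
    and "\<And>n U i j. unitary_comatrix G {..<n::nat} U \<Longrightarrow> f (st (U i j)) = g (st (U i j))"
  shows "f a = g a"
proof -
  have "f (st b) = g (st b)" for b
    using assms(3)
    by (induction b rule: cqg_induct)
      (simp_all add: assms(1,2) clinear_add clinear_scaleC st_add st_scaleC)
  from this[of "st a"] show ?thesis by simp
qed

end

section \<open>Tensor products of representations and the antipode\<close>

definition kron ::
    "'h::complex_vector star_bialgebra \<Rightarrow> ('i \<Rightarrow> 'i \<Rightarrow> 'h) \<Rightarrow> ('j \<Rightarrow> 'j \<Rightarrow> 'h) \<Rightarrow> 'i \<times> 'j \<Rightarrow> 'i \<times> 'j \<Rightarrow> 'h" where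
  "kron G U V p q = hmult G (U (fst p) (fst q)) (V (snd p) (snd q))"

lemma delta_product: "delta (I \<times> J) p q = delta I (fst p) (fst q) * delta J (snd p) (snd q)"
  by (auto simp: delta_def prod_eq_iff mem_Times_iff)

lemma delta_commute: "delta I i j = delta I j i"
  by (auto simp: delta_def)

lemma sum_rotate3:
  "(\<Sum>p\<in>I. \<Sum>q\<in>J. \<Sum>r\<in>K. f p q r) = (\<Sum>q\<in>J. \<Sum>r\<in>K. \<Sum>p\<in>I. f p q r)"
  by (subst sum.swap) (intro sum.cong refl sum.swap)

lemma cnj_delta [simp]: "cnj (delta I i j) = delta I i j"
  by (simp add: delta_def)

context cqg
begin

text \<open>For any antipode \<open>T\<close>, the matrix T(U) is a left inverse of \<open>U\<close>
  and U^* is a right inverse, so they agree. As coefficients span, this also yields uniqueness of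
  the antipode.\<close>

lemma antipode_coefficient:
  assumes T: "is_antipode G T" and U: "unitary_comatrix G I U"
  shows "T (U i l) = st (U l i)"
proof -
  note U' = unitary_comatrixD[OF U] and cm = comatrixD[OF unitary_comatrixD(1)[OF U]]
  have T1: "clinear T" and T2: "L (\<lambda>b c. T b \<cdot> c) a = \<epsilon> a *\<^sub>C \<one>" for a
    using T by (simp_all add: is_antipode_def)
  have T3 [lin]: "clinear f \<Longrightarrow> clinear (\<lambda>x. T (f x))" for f :: "'h \<Rightarrow> 'h"
    by (rule clinearI) (simp_all add: clinear_add clinear_scaleC T1)
  have inv: "(\<Sum>k\<in>I. T (U i k) \<cdot> U k j) = delta I i j *\<^sub>C \<one>" for j
  proof -
    have "cbilinear (\<lambda>b c. T b \<cdot> c)" by (intro lin)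
    from lift_comatrix[OF U'(1) this, of i j] show ?thesis by (simp add: T2 cm(3))
  qed
  have "T (U i l) = (\<Sum>k\<in>I. delta I k l *\<^sub>C T (U i k))"
    using cm(1,5) clinear_zero[OF T1] by (subst sum_delta_scaleC) auto
  also have "\<dots> = (\<Sum>k\<in>I. T (U i k) \<cdot> (\<Sum>j\<in>I. U k j \<cdot> st (U l j)))"
    by (simp add: U'(3) mul_simps)
  also have "\<dots> = (\<Sum>j\<in>I. (\<Sum>k\<in>I. T (U i k) \<cdot> U k j) \<cdot> st (U l j))"
    by (simp add: mul_sum mul_assoc) (rule sum.swap)
  also have "\<dots> = (\<Sum>j\<in>I. delta I i j *\<^sub>C st (U l j))"
    by (simp add: inv mul_simps)
  also have "\<dots> = st (U l i)"
    using cm(1,5) by (subst sum_delta_scaleC) auto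
  finally show ?thesis .
qed

lemma is_antipode_antipode: "is_antipode G S"
proof -
  have uniq: "T = T'" if "is_antipode G T" "is_antipode G T'" for T T'
  proof
    fix a
    have "clinear T" "clinear T'" using that by (simp_all add: is_antipode_def)
    then show "T a = T' a"
      by (rule clinear_eq_coefficients) (simp add: antipode_coefficient that)
  qed
  obtain T where "is_antipode G T" using antipode_exists by blast
  with uniq have "\<exists>!T. is_antipode G T" by blast
  then show ?thesis unfolding antipode_def by (rule theI')
qed

lemma S_clinear: "clinear S"
  and antipode_left: "L (\<lambda>b c. S b \<cdot> c) a = \<epsilon> a *\<^sub>C \<one>"
  using is_antipode_antipode by (simp_all add: is_antipode_def)

lemmas S_coefficient = antipode_coefficient[OF is_antipode_antipode]

lemma clinear_compose_S [lin]: "clinear f \<Longrightarrow> clinear (\<lambda>x. S (f x))"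
  by (rule clinearI) (simp_all add: clinear_add clinear_scaleC S_clinear)

lemma S_zero [simp]: "S 0 = 0"
  by (rule clinear_zero[OF S_clinear])

lemma comatrix_kron:
  assumes "comatrix G I U" "comatrix G J V"
  shows "comatrix G (I \<times> J) (kron G U V)"
proof -
  have "kron G U V p q = 0" if "p \<notin> I \<times> J \<or> q \<notin> I \<times> J" for p q
    using that
    by (cases p; cases q) (auto simp: kron_def comatrixD(4,5)[OF assms(1)] comatrixD(4,5)[OF assms(2)])
  then show ?thesis
    unfolding comatrix_def
    using comatrixD(1)[OF assms(1)] comatrixD(1)[OF assms(2)]
    by (simp add: kron_def comult_product[OF assms] delta_product sum.cartesian_product
        case_prod_unfold comatrixD(3)[OF assms(1)] comatrixD(3)[OF assms(2)])
qed

lemma unitary_kron: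
  assumes U: "unitary_comatrix G I U" and V: "unitary_comatrix G J V"
  shows "unitary_comatrix G (I \<times> J) (kron G U V)"
proof -
  note U' = unitary_comatrixD[OF U] and V' = unitary_comatrixD[OF V]
  have 1: "(\<Sum>k\<in>I. \<Sum>l\<in>J. st (U k i \<cdot> V l m) \<cdot> (U k j \<cdot> V l n)) = delta (I \<times> J) (i, m) (j, n) *\<^sub>C \<one>" for i j m n
  proof -
    have "(\<Sum>k\<in>I. \<Sum>l\<in>J. st (U k i \<cdot> V l m) \<cdot> (U k j \<cdot> V l n))
        = (\<Sum>l\<in>J. st (V l m) \<cdot> ((\<Sum>k\<in>I. st (U k i) \<cdot> U k j) \<cdot> V l n))"
      by (subst sum.swap) (simp add: mul_sum st_mul mul_assoc)
    also have "\<dots> = delta I i j *\<^sub>C (\<Sum>l\<in>J. st (V l m) \<cdot> V l n)"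
      unfolding U'(2) by (simp add: mul_simps complex_vector.scale_sum_right)
    finally show ?thesis by (simp add: V'(2) delta_product scaleC_scaleC)
  qed
  have 2: "(\<Sum>k\<in>I. \<Sum>l\<in>J. (U i k \<cdot> V m l) \<cdot> st (U j k \<cdot> V n l)) = delta (I \<times> J) (i, m) (j, n) *\<^sub>C \<one>" for i j m n
  proof -
    have "(\<Sum>k\<in>I. \<Sum>l\<in>J. (U i k \<cdot> V m l) \<cdot> st (U j k \<cdot> V n l))
        = (\<Sum>k\<in>I. U i k \<cdot> ((\<Sum>l\<in>J. V m l \<cdot> st (V n l)) \<cdot> st (U j k)))"
      by (simp add: mul_sum st_mul mul_assoc)
    also have "\<dots> = delta J m n *\<^sub>C (\<Sum>k\<in>I. U i k \<cdot> st (U j k))"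
      unfolding V'(3) by (simp add: mul_simps complex_vector.scale_sum_right)
    finally show ?thesis by (simp add: U'(3) delta_product scaleC_scaleC mult.commute)
  qed
  show ?thesis
    unfolding unitary_comatrix_def
    using comatrix_kron[OF U'(1) V'(1)] 1[of "fst p" "snd p" "fst q" "snd q" for p q]
      2[of "fst p" "snd p" "fst q" "snd q" for p q]
    by (simp add: kron_def sum.cartesian_product case_prod_unfold del: split_paired_All)
qed

text \<open>The tensor product of unitary representations is unitary, so \<open>S\<close> acts on
  its coefficients as the transposed adjoint, and the adjoint reverses products.\<close>

lemma S_mul: "S (a \<cdot> b) = S b \<cdot> S a"
proof (rule clinear_eq_coefficients[where a = a])
  show "clinear (\<lambda>a. S (a \<cdot> b))" "clinear (\<lambda>a. S b \<cdot> S a)" by (intro lin)+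
  fix n U i j assume U: "unitary_comatrix G {..<n::nat} U"
  show "S (U i j \<cdot> b) = S b \<cdot> S (U i j)"
  proof (rule clinear_eq_coefficients[where a = b])
    show "clinear (\<lambda>b. S (U i j \<cdot> b))" "clinear (\<lambda>b. S b \<cdot> S (U i j))" by (intro lin)+
    fix m V k l assume V: "unitary_comatrix G {..<m::nat} V"
    show "S (U i j \<cdot> V k l) = S (V k l) \<cdot> S (U i j)"
      using S_coefficient[OF unitary_kron[OF U V], of "(i, k)" "(j, l)"]
      by (simp add: kron_def S_coefficient[OF U] S_coefficient[OF V] st_mul)
  qed
qed

lemma S_one [simp]: "S \<one> = \<one>"
  using antipode_left[of \<one>] unfolding comult_one
  by (subst (asm) tensor_lift_tensor, (intro lin)[1]) (simp add: scaleC_one)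

lemma conj_bilinear_st: "conj_bilinear (\<lambda>a b. st a \<otimes> st b)"
  by (simp add: conj_bilinear_def st_add st_scaleC tensor_add_left tensor_add_right
      tensor_scaleC_left tensor_scaleC_right)

lemma counit_st: "\<epsilon> (st a) = cnj (\<epsilon> a)"
proof (induction a rule: cqg_induct)
  case (coefficient n U i j)
  note U' = unitary_comatrixD[OF coefficient] and cm = comatrixD[OF unitary_comatrixD(1)[OF coefficient]]
  have "\<epsilon> (st (U i j)) = (\<Sum>k<n. \<epsilon> (st (U k j)) * delta {..<n} k i)"
    using cm by (subst sum_delta_times) (auto simp: clinear_zero[OF counit_clinear])
  also have "\<dots> = \<epsilon> (\<Sum>k<n. st (U k j) \<cdot> U k i)"
    by (simp add: clinear_sum[OF counit_clinear] cm(3))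
  also have "\<dots> = delta {..<n} i j"
    unfolding U'(2) by (simp add: clinear_scaleC[OF counit_clinear] delta_commute)
  finally show ?case by (simp add: cm(3))
qed (simp_all add: st_add st_scaleC clinear_add clinear_scaleC counit_clinear)

lemma comatrix_star:
  assumes U: "comatrix G I U"
  shows "comatrix G I (\<lambda>i j. st (U i j))"
  using assms
  by (simp add: comatrix_def comult_st tensor_star_def tensor_lift_conj_sum[OF conj_bilinear_st]
      tensor_lift_conj_tensor[OF conj_bilinear_st] counit_st)

lemma counit_S [simp]: "\<epsilon> (S a) = \<epsilon> a"
  by (rule clinear_eq_coefficients)
    (auto intro!: lin simp: counit_clinear S_coefficient counit_st delta_commute
      comatrixD(3)[OF unitary_comatrixD(1)])

lemma S_st_S [simp]: "S (st (S a)) = st a"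
  by (induction a rule: cqg_induct)
    (simp_all add: S_coefficient st_add st_scaleC clinear_add clinear_scaleC S_clinear)

lemma lift_S:
  assumes F: "cbilinear F"
  shows "L F (S a) = L (\<lambda>b c. F (S c) (S b)) a"
proof (rule clinear_eq_coefficients[where a = a])
  have [lin]: "clinear f \<Longrightarrow> clinear (\<lambda>x. F (f x) c)" "clinear f \<Longrightarrow> clinear (\<lambda>x. F c (f x))"
    for f :: "'h \<Rightarrow> 'h" and c
    by (rule clinearI; simp add: clinear_add clinear_scaleC cbilinearD[OF F])+
  show "clinear (\<lambda>a. L F (S a))" "clinear (L (\<lambda>b c. F (S c) (S b)))"
    by (intro lin F)+
  have G: "cbilinear (\<lambda>b c. F (S c) (S b))" by (intro lin)
  fix n U i j assume U: "unitary_comatrix G {..<n::nat} U"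
  show "L F (S (U i j)) = L (\<lambda>b c. F (S c) (S b)) (U i j)"
    by (simp add: S_coefficient[OF U] lift_comatrix[OF comatrix_star[OF unitary_comatrixD(1)[OF U]] F]
        lift_comatrix[OF unitary_comatrixD(1)[OF U] G])
qed

end


section \<open>Unitary cocycles\<close>

lemma tensor_comult_sum:
  assumes lin1: "clinear \<Delta>" "clinear \<Delta>'"
    and "\<Delta> a = (\<Sum>k\<in>I. x k \<otimes> y k)" "\<Delta>' b = (\<Sum>l\<in>J. z l \<otimes> w l)"
  shows "tensor_comult \<Delta> \<Delta>' (a \<otimes> b) = (\<Sum>k\<in>I. \<Sum>l\<in>J. (x k \<otimes> z l) \<otimes> (y k \<otimes> w l))"
proof -
  have [lin]: "clinear f \<Longrightarrow> clinear (\<lambda>x. \<Delta> (f x))" for f :: "'a \<Rightarrow> 'a"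
    by (rule clinearI; simp add: clinear_add clinear_scaleC lin1)+
  have [lin]: "clinear f \<Longrightarrow> clinear (\<lambda>x. \<Delta>' (f x))" for f :: "'b \<Rightarrow> 'b"
    by (rule clinearI; simp add: clinear_add clinear_scaleC lin1)+
  show ?thesis
    unfolding tensor_comult_def
    by (subst tensor_lift_tensor, (intro lin)[1], unfold assms(3,4))
      ((subst tensor_lift_sum tensor_lift_tensor, (intro lin)[1])+, simp?)
qed

lemma trilift_tensor:
  assumes "\<And>a b. clinear (F a b)" "\<And>a c. clinear (\<lambda>b. F a b c)" "\<And>b c. clinear (\<lambda>a. F a b c)"
  shows "trilift F (a \<otimes> (b \<otimes> c)) = F a b c" "clinear (trilift F)"
proof -
  have F: "cbilinear (F a)" "cbilinear (\<lambda>a. tensor_lift (F a))" for a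
    using assms by (auto intro!: lin clinear_tensor_lift)
  then show "trilift F (a \<otimes> (b \<otimes> c)) = F a b c"
    by (simp add: trilift_def tensor_lift_tensor)
  show "clinear (trilift F)"
    using clinear_tensor_lift[OF F(2)] by (simp add: trilift_def)
qed

locale cocycle_deformation = cqg G for G :: "'h::complex_vector star_bialgebra" +
  fixes \<Omega> :: "('h, 'h) tensor \<Rightarrow> complex"
  assumes cocycle: "unitary_cocycle G \<Omega>" and normalized: "normalized_cocycle G \<Omega>"
begin

lemma \<Omega>_clinear: "clinear \<Omega>"
  using cocycle by (simp add: unitary_cocycle_def)

lemma clinear_compose_\<Omega> [lin]: "clinear f \<Longrightarrow> clinear (\<lambda>x. \<Omega> (f x))"
  by (rule clinearI) (simp_all add: clinear_add clinear_scaleC \<Omega>_clinear)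

text \<open>\<open>sg\<close> and \<open>si\<close> are \<open>\<Omega>\<close> and \<open>\<Omega>\<^sup>* = \<Omega>\<^sup>-\<^sup>1\<close> as bilinear forms.\<close>

abbreviation sg :: "'h \<Rightarrow> 'h \<Rightarrow> complex" where "sg a b \<equiv> \<Omega> (a \<otimes> b)"

definition si :: "'h \<Rightarrow> 'h \<Rightarrow> complex" where "si a b = cnj (sg (st (S a)) (st (S b)))"

lemma clinear_compose_si [lin]:
  "clinear f \<Longrightarrow> clinear (\<lambda>x. si c (f x))" "clinear f \<Longrightarrow> clinear (\<lambda>x. si (f x) c)"
  by (rule clinearI; simp add: si_def clinear_add clinear_scaleC S_clinear st_add st_scaleC
      tensor_add_left tensor_add_right tensor_scaleC_left tensor_scaleC_right \<Omega>_clinear)+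

lemma si_cbilinear: "cbilinear si"
  by (intro lin)

lemma sg_zero [simp]: "\<Omega> 0 = 0"
  by (rule clinear_zero[OF \<Omega>_clinear])

lemma si_zero [simp]: "si 0 a = 0" "si a 0 = 0"
  by (simp_all add: si_def)

lemma dual_star2_eq: "dual_star2 G \<Omega> = tensor_lift si"
  by (simp add: dual_star2_def si_def[abs_def])

lemma sum_sg:
  "sg (\<Sum>i\<in>A. f i) b = (\<Sum>i\<in>A. sg (f i) b)" "sg b (\<Sum>i\<in>A. f i) = (\<Sum>i\<in>A. sg b (f i))"
  "si (\<Sum>i\<in>A. f i) b = (\<Sum>i\<in>A. si (f i) b)" "si b (\<Sum>i\<in>A. f i) = (\<Sum>i\<in>A. si b (f i))"
  "sg (c *\<^sub>C a) b = c * sg a b" "sg a (c *\<^sub>C b) = c * sg a b"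
  "si (c *\<^sub>C a) b = c * si a b" "si a (c *\<^sub>C b) = c * si a b"
proof -
  have 1: "clinear (\<lambda>a. sg a b)" "clinear (sg b)" "clinear (\<lambda>a. si a b)" "clinear (si b)" for b
    by (intro lin)+
  show "sg (\<Sum>i\<in>A. f i) b = (\<Sum>i\<in>A. sg (f i) b)" "sg b (\<Sum>i\<in>A. f i) = (\<Sum>i\<in>A. sg b (f i))"
  "si (\<Sum>i\<in>A. f i) b = (\<Sum>i\<in>A. si (f i) b)" "si b (\<Sum>i\<in>A. f i) = (\<Sum>i\<in>A. si b (f i))"
  "sg (c *\<^sub>C a) b = c * sg a b" "sg a (c *\<^sub>C b) = c * sg a b"
  "si (c *\<^sub>C a) b = c * si a b" "si a (c *\<^sub>C b) = c * si a b"
    by (rule 1[THEN clinear_sum] 1[THEN clinear_scaleC, unfolded scaleC_complex])+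
qed

lemma conv_comult2:
  assumes "comatrix G I U" "comatrix G J V" and f: "clinear f" "clinear g"
  shows "conv (comult2 G) f g (U i j \<otimes> V k l) =
    (\<Sum>p\<in>I. \<Sum>q\<in>J. f (U i p \<otimes> V k q) * g (U p j \<otimes> V q l))"
proof -
  have fg: "cbilinear (\<lambda>b c. f b * g c)" using f by (intro lin)
  show ?thesis
    unfolding conv_def comult2_def
    by (simp add: tensor_comult_sum[OF comult_clinear comult_clinear comatrixD(2)[OF assms(1)]
          comatrixD(2)[OF assms(2)]] tensor_lift_sum[OF fg] tensor_lift_tensor[OF fg])
qed

lemma clinear_tensor_comult:
  assumes "clinear \<Delta>" "clinear \<Delta>'"
  shows "clinear (tensor_comult \<Delta> \<Delta>')"
proof -
  have [lin]: "clinear f \<Longrightarrow> clinear (\<lambda>x. \<Delta> (f x))" for f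
    by (rule clinearI; simp add: clinear_add clinear_scaleC assms)+
  have [lin]: "clinear f \<Longrightarrow> clinear (\<lambda>x. \<Delta>' (f x))" for f
    by (rule clinearI; simp add: clinear_add clinear_scaleC assms)+
  show ?thesis unfolding tensor_comult_def by (intro lin clinear_tensor_lift)
qed

lemma conv_comult3:
  assumes U: "comatrix G I U" and V: "comatrix G J V" and X: "comatrix G K X" and f: "clinear f" "clinear g"
  shows "conv (comult3 G) f g (U i i' \<otimes> (V j j' \<otimes> X k k')) =
    (\<Sum>p\<in>I. \<Sum>q\<in>J. \<Sum>r\<in>K. f (U i p \<otimes> (V j q \<otimes> X k r)) * g (U p i' \<otimes> (V q j' \<otimes> X r k')))"
proof -
  have fg: "cbilinear (\<lambda>b c. f b * g c)" using f by (intro lin)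
  have 1: "comult2 G (V j j' \<otimes> X k k') =
      (\<Sum>z\<in>J \<times> K. (V j (fst z) \<otimes> X k (snd z)) \<otimes> (V (fst z) j' \<otimes> X (snd z) k'))"
    unfolding comult2_def
    by (simp add: tensor_comult_sum[OF comult_clinear comult_clinear comatrixD(2)[OF V]
          comatrixD(2)[OF X]] sum.cartesian_product case_prod_unfold)
  have 2: "clinear (comult2 G)" unfolding comult2_def
    by (rule clinear_tensor_comult[OF comult_clinear comult_clinear])
  show ?thesis
    unfolding conv_def comult3_def
    by (simp add: tensor_comult_sum[OF comult_clinear 2 comatrixD(2)[OF U] 1]
       tensor_lift_sum[OF fg] tensor_lift_tensor[OF fg] sum.cartesian_product' case_prod_unfold)
qed

lemma inverse_comatrix:
  assumes "comatrix G I U" "comatrix G J V"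
  shows "(\<Sum>p\<in>I. \<Sum>q\<in>J. sg (U i p) (V k q) * si (U p j) (V q l)) = delta I i j * delta J k l"
    "(\<Sum>p\<in>I. \<Sum>q\<in>J. si (U i p) (V k q) * sg (U p j) (V q l)) = delta I i j * delta J k l"
proof -
  have eps: "cbilinear (\<lambda>a b. \<epsilon> a * \<epsilon> b)" by (intro lin)
  have "conv (comult2 G) \<Omega> (tensor_lift si) = counit2 G" "conv (comult2 G) (tensor_lift si) \<Omega> = counit2 G"
    using cocycle by (simp_all add: unitary_cocycle_def dual_star2_eq)
  from fun_cong[OF this(1), of "U i j \<otimes> V k l"] fun_cong[OF this(2), of "U i j \<otimes> V k l"]
  show "(\<Sum>p\<in>I. \<Sum>q\<in>J. sg (U i p) (V k q) * si (U p j) (V q l)) = delta I i j * delta J k l"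
    "(\<Sum>p\<in>I. \<Sum>q\<in>J. si (U i p) (V k q) * sg (U p j) (V q l)) = delta I i j * delta J k l"
    by (simp_all add: conv_comult2[OF assms] \<Omega>_clinear clinear_tensor_lift si_cbilinear
        counit2_def tensor_lift_tensor eps comatrixD(3)[OF assms(1)] comatrixD(3)[OF assms(2)])
qed

lemma cocycle_comatrix:
  assumes U: "comatrix G I U" and V: "comatrix G J V" and X: "comatrix G K X"
  shows "(\<Sum>p\<in>I. \<Sum>q\<in>J. sg (U i p) (V j q) * sg (U p i' \<cdot> V q j') (X k k')) =
    (\<Sum>q\<in>J. \<Sum>r\<in>K. sg (V j q) (X k r) * sg (U i i') (V q j' \<cdot> X r k'))"
proof -
  note cm = comatrixD[OF U] comatrixD[OF V] comatrixD[OF X]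
  let ?F1 = "\<lambda>a b c. sg a b * \<epsilon> c" and ?G1 = "\<lambda>a b c. sg (a \<cdot> b) c"
  let ?F2 = "\<lambda>a b c. \<epsilon> a * sg b c" and ?G2 = "\<lambda>a b c. sg a (b \<cdot> c)"
  have "conv (comult3 G) (trilift ?F1) (trilift ?G1) = conv (comult3 G) (trilift ?F2) (trilift ?G2)"
    using cocycle by (simp add: unitary_cocycle_def)
  from fun_cong[OF this, of "U i i' \<otimes> (V j j' \<otimes> X k k')"]
  have "(\<Sum>p\<in>I. \<Sum>q\<in>J. \<Sum>r\<in>K. (sg (U i p) (V j q) * \<epsilon> (X k r)) * sg (U p i' \<cdot> V q j') (X r k')) =
    (\<Sum>p\<in>I. \<Sum>q\<in>J. \<Sum>r\<in>K. (\<epsilon> (U i p) * sg (V j q) (X k r)) * sg (U p i') (V q j' \<cdot> X r k'))"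
    by (subst (asm) (1 2) conv_comult3[OF U V X], (intro trilift_tensor lin)+)
      (subst (asm) trilift_tensor(1), (intro lin)+)+
  also have "(\<Sum>p\<in>I. \<Sum>q\<in>J. \<Sum>r\<in>K. (sg (U i p) (V j q) * \<epsilon> (X k r)) * sg (U p i' \<cdot> V q j') (X r k')) =
     (\<Sum>p\<in>I. \<Sum>q\<in>J. sg (U i p) (V j q) * sg (U p i' \<cdot> V q j') (X k k'))"
    by (intro sum.cong refl) (simp add: mult.assoc cm sum_delta_times flip: sum_distrib_left)
  also have "(\<Sum>p\<in>I. \<Sum>q\<in>J. \<Sum>r\<in>K. (\<epsilon> (U i p) * sg (V j q) (X k r)) * sg (U p i') (V q j' \<cdot> X r k')) =
     (\<Sum>q\<in>J. \<Sum>r\<in>K. \<Sum>p\<in>I. delta I i p * (sg (V j q) (X k r) * sg (U p i') (V q j' \<cdot> X r k')))"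
    unfolding cm(3) mult.assoc by (rule sum_rotate3)
  also have "\<dots> = (\<Sum>q\<in>J. \<Sum>r\<in>K. sg (V j q) (X k r) * sg (U i i') (V q j' \<cdot> X r k'))"
    by (intro sum.cong refl sum_delta_times) (simp_all add: cm)
  finally show ?thesis .
qed

end

lemma delta_notin: "i \<notin> I \<Longrightarrow> delta I i j = 0" "j \<notin> I \<Longrightarrow> delta I i j = 0"
  by (auto simp: delta_def)

lemma sum_pair: "(\<Sum>i\<in>I. \<Sum>j\<in>J. f i j) = (\<Sum>p\<in>I \<times> J. f (fst p) (snd p))"
  by (simp add: sum.cartesian_product case_prod_unfold)

text \<open>The computation f = f (f g) = (f f) g = f g = 1 for matrices over
  \<open>K\<close>.\<close>

lemma idempotent_right_inverse:
  fixes f g :: "'i \<Rightarrow> 'i \<Rightarrow> complex"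
  assumes "finite K" and f: "\<And>k l. (\<Sum>r\<in>K. f k r * f r l) = f k l" "\<And>k l. l \<notin> K \<Longrightarrow> f k l = 0"
    and g: "\<And>k l. (\<Sum>r\<in>K. f k r * g r l) = delta K k l"
  shows "f k l = delta K k l"
proof -
  have "f k l = (\<Sum>r\<in>K. f k r * delta K r l)"
    using assms(1) f(2) by (simp add: sum_delta_times)
  also have "\<dots> = (\<Sum>s\<in>K. (\<Sum>r\<in>K. f k r * f r s) * g s l)"
    unfolding g[symmetric] sum_distrib_left sum_distrib_right mult.assoc by (rule sum.swap)
  also have "\<dots> = delta K k l" by (simp add: f(1) g)
  finally show ?thesis .
qed

context cqg
begin

lemma comatrix_unit: "comatrix G (UNIV :: unit set) (\<lambda>_ _. \<one>)"
  by (simp add: comatrix_def comult_one delta_def UNIV_unit)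

lemma comatrix_S:
  assumes "comatrix G I U"
  shows "comatrix G I (\<lambda>i j. S (U j i))"
proof -
  have "comult G (S a) = L (\<lambda>b c. S c \<otimes> S b) a" for a
  proof -
    have "tensor_lift (\<otimes>) t = t" for t :: "('h, 'h) tensor"
      by (induction t rule: tensor_induct)
        (simp_all add: tensor_lift_zero tensor_lift_tensor tensor_lift_add cbilinear_tensor)
    then show ?thesis using lift_S[OF cbilinear_tensor, of a] by simp
  qed
  moreover have "cbilinear (\<lambda>b c. S c \<otimes> S b)" by (intro lin)
  ultimately have "comult G (S (U j i)) = (\<Sum>k\<in>I. S (U k i) \<otimes> S (U j k))" for i j
    by (simp only: lift_comatrix[OF assms])
  moreover have "S (U j i) = 0" if "i \<notin> I \<or> j \<notin> I" for i j
    using that comatrixD(4,5)[OF assms] by auto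
  ultimately show ?thesis
    unfolding comatrix_def
    by (simp add: comatrixD(1,3)[OF assms] delta_commute)
qed

lemma conv_comatrix:
  assumes "comatrix G I U" "clinear f" "clinear g"
  shows "conv (comult G) f g (U i j) = (\<Sum>k\<in>I. f (U i k) * g (U k j))"
proof -
  have "cbilinear (\<lambda>b c. f b * g c)" using assms by (intro lin)
  then show ?thesis by (simp add: conv_def lift_comatrix[OF assms(1)])
qed

lemma clinear_conv: "clinear f \<Longrightarrow> clinear g \<Longrightarrow> clinear (conv (comult G) f g)"
  unfolding conv_def by (intro lin)

lemma dual_star_clinear:
  assumes "clinear f"
  shows "clinear (dual_star G f)"
  by (rule clinearI) (simp_all add: dual_star_def clinear_add clinear_scaleC assms S_clinear st_add st_scaleC)

end

section \<open>Normalization, and the cocycle identity solved for its factors\<close>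

context cocycle_deformation
begin

lemma sg_one_one: "sg \<one> \<one> = 1"
  using normalized by (simp add: normalized_cocycle_def)

text \<open>On coefficients, the cocycle identity at 1 \<otimes> 1 \<otimes> a together with Omega(1
  \<otimes> 1) = 1 makes the matrix of sg(1, .) idempotent, and unitarity of Omega gives it a right
  inverse. The other side uses a \<otimes> 1 \<otimes> 1.\<close>

lemma sg_one [simp]: "sg \<one> a = \<epsilon> a" "sg a \<one> = \<epsilon> a"
proof -
  show "sg \<one> a = \<epsilon> a"
  proof (rule clinear_eq_coefficients[where a = a])
    show "clinear (sg \<one>)" "clinear \<epsilon>" by (intro lin)+
    fix n U i j assume "unitary_comatrix G {..<n::nat} U"
    note U = unitary_comatrixD(1)[OF this] note cm = comatrixD[OF U]
    have "sg \<one> (U i j) = delta {..<n} i j"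
    proof (rule idempotent_right_inverse)
      show "(\<Sum>r<n. sg \<one> (U k r) * sg \<one> (U r l)) = sg \<one> (U k l)" for k l
        using cocycle_comatrix[OF comatrix_unit comatrix_unit U, where k = k and k' = l]
        by (simp add: sg_one_one UNIV_unit)
      show "(\<Sum>r<n. sg \<one> (U k r) * si \<one> (U r l)) = delta {..<n} k l" for k l
        using inverse_comatrix(1)[OF comatrix_unit U, where k = k and l = l]
        by (simp add: UNIV_unit) (simp add: delta_def)
    qed (simp_all add: cm)
    then show "sg \<one> (U i j) = \<epsilon> (U i j)" by (simp add: cm)
  qed
  show "sg a \<one> = \<epsilon> a"
  proof (rule clinear_eq_coefficients[where a = a])
    show "clinear (\<lambda>a. sg a \<one>)" "clinear \<epsilon>" by (intro lin)+
    fix n U i j assume "unitary_comatrix G {..<n::nat} U"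
    note U = unitary_comatrixD(1)[OF this] note cm = comatrixD[OF U]
    have "sg (U i j) \<one> = delta {..<n} i j"
    proof (rule idempotent_right_inverse)
      show "(\<Sum>r<n. sg (U k r) \<one> * sg (U r l) \<one>) = sg (U k l) \<one>" for k l
        using cocycle_comatrix[OF U comatrix_unit comatrix_unit, where i = k and i' = l]
        by (simp add: sg_one_one UNIV_unit)
      show "(\<Sum>r<n. sg (U k r) \<one> * si (U r l) \<one>) = delta {..<n} k l" for k l
        using inverse_comatrix(1)[OF U comatrix_unit, where i = k and j = l]
        by (simp add: UNIV_unit) (simp add: delta_def)
    qed (simp_all add: cm)
    then show "sg (U i j) \<one> = \<epsilon> (U i j)" by (simp add: cm)
  qed
qed

lemma si_one [simp]: "si \<one> a = \<epsilon> a" "si a \<one> = \<epsilon> a"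
  by (simp_all add: si_def counit_st)

lemma si_sg_cancel:
  assumes V: "comatrix G J V" and X: "comatrix G K X" and h: "\<And>s t. s \<notin> J \<or> t \<notin> K \<Longrightarrow> h s t = 0"
  shows "(\<Sum>q\<in>J. \<Sum>r\<in>K. si (V j q) (X k r) * (\<Sum>s\<in>J. \<Sum>t\<in>K. sg (V q s) (X r t) * h s t)) = h j k"
    "(\<Sum>q\<in>J. \<Sum>r\<in>K. sg (V j q) (X k r) * (\<Sum>s\<in>J. \<Sum>t\<in>K. si (V q s) (X r t) * h s t)) = h j k"
proof -
  have fin: "finite J" "finite K" using comatrixD(1) V X by auto
  have *: "(\<Sum>q\<in>J. \<Sum>r\<in>K. f q r * (\<Sum>s\<in>J. \<Sum>t\<in>K. g q r s t * h s t)) = h j k"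
    if fg: "\<And>s t. (\<Sum>q\<in>J. \<Sum>r\<in>K. f q r * g q r s t) = delta J j s * delta K k t"
    for f :: "_ \<Rightarrow> _ \<Rightarrow> complex" and g
  proof -
    have "(\<Sum>q\<in>J. \<Sum>r\<in>K. f q r * (\<Sum>s\<in>J. \<Sum>t\<in>K. g q r s t * h s t))
        = (\<Sum>z\<in>J\<times>K. \<Sum>w\<in>J\<times>K. f (fst z) (snd z) * (g (fst z) (snd z) (fst w) (snd w) * h (fst w) (snd w)))"
    proof -
      have "(\<Sum>s\<in>J. \<Sum>t\<in>K. g q r s t * h s t) = (\<Sum>w\<in>J\<times>K. g q r (fst w) (snd w) * h (fst w) (snd w))" for q r
        by (rule sum_pair)
      then have "(\<Sum>q\<in>J. \<Sum>r\<in>K. f q r * (\<Sum>s\<in>J. \<Sum>t\<in>K. g q r s t * h s t))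
          = (\<Sum>q\<in>J. \<Sum>r\<in>K. f q r * (\<Sum>w\<in>J\<times>K. g q r (fst w) (snd w) * h (fst w) (snd w)))"
        by simp
      also have "\<dots> = (\<Sum>z\<in>J\<times>K. f (fst z) (snd z) * (\<Sum>w\<in>J\<times>K. g (fst z) (snd z) (fst w) (snd w) * h (fst w) (snd w)))"
        by (rule sum_pair)
      finally show ?thesis by (simp only: sum_distrib_left)
    qed
    also have "\<dots> = (\<Sum>w\<in>J\<times>K. (\<Sum>z\<in>J\<times>K. f (fst z) (snd z) * g (fst z) (snd z) (fst w) (snd w)) * h (fst w) (snd w))"
      by (subst sum.swap) (simp add: sum_distrib_right mult.assoc)
    also have "\<dots> = (\<Sum>s\<in>J. \<Sum>t\<in>K. (\<Sum>q\<in>J. \<Sum>r\<in>K. f q r * g q r s t) * h s t)"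
      unfolding sum_pair ..
    also have "\<dots> = (\<Sum>s\<in>J. delta J j s * (\<Sum>t\<in>K. delta K k t * h s t))"
      by (simp add: fg sum_distrib_left mult.assoc)
    also have "\<dots> = h j k"
      using h fin by (simp add: sum_delta_times)
    finally show ?thesis .
  qed
  show "(\<Sum>q\<in>J. \<Sum>r\<in>K. si (V j q) (X k r) * (\<Sum>s\<in>J. \<Sum>t\<in>K. sg (V q s) (X r t) * h s t)) = h j k"
    "(\<Sum>q\<in>J. \<Sum>r\<in>K. sg (V j q) (X k r) * (\<Sum>s\<in>J. \<Sum>t\<in>K. si (V q s) (X r t) * h s t)) = h j k"
    by (rule *; rule inverse_comatrix[OF V X])+
qed

text \<open>Convolution with Omega^* cancels one Omega in the cocycle identity and isolates the
  factor with a product in its second leg; \<open>cocycle_right\<close> does the same for the first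
  leg.\<close>

lemma cocycle_left:
  assumes U: "comatrix G I U" and V: "comatrix G J V" and X: "comatrix G K X"
  shows "sg (U i i') (V j j' \<cdot> X k k') = (\<Sum>q\<in>J. \<Sum>r\<in>K. si (V j q) (X k r) *
    (\<Sum>p\<in>I. \<Sum>s\<in>J. sg (U i p) (V q s) * sg (U p i' \<cdot> V s j') (X r k')))"
  unfolding cocycle_comatrix[OF assms]
  by (subst si_sg_cancel(1)[OF V X]) (auto simp: comatrixD(4)[OF V] comatrixD(4)[OF X])

lemma cocycle_right:
  assumes U: "comatrix G I U" and V: "comatrix G J V" and X: "comatrix G K X"
  shows "sg (U i i' \<cdot> V j j') (X k k') = (\<Sum>p\<in>I. \<Sum>q\<in>J. si (U i p) (V j q) *
    (\<Sum>s\<in>J. \<Sum>t\<in>K. sg (V q s) (X k t) * sg (U p i') (V s j' \<cdot> X t k')))"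
  unfolding cocycle_comatrix[OF assms, symmetric]
  by (subst si_sg_cancel(1)[OF U V]) (auto simp: comatrixD(4)[OF U] comatrixD(4)[OF V])

text \<open>The adjoint of the cocycle identity: conjugation combined with \<open>S\<close>
  transposes all coefficient matrices, which reverses the order of the convolutions.\<close>

lemma inverse_cocycle:
  "L (\<lambda>a1 a2. L (\<lambda>b1 b2. si (a1 \<cdot> b1) c * si a2 b2) b) a =
   L (\<lambda>b1 b2. L (\<lambda>c1 c2. si a (b1 \<cdot> c1) * si b2 c2) c) b"
proof (rule clinear_eq_coefficients[where a = a])
  show "clinear (\<lambda>a. L (\<lambda>a1 a2. L (\<lambda>b1 b2. si (a1 \<cdot> b1) c * si a2 b2) b) a)"
    "clinear (\<lambda>a. L (\<lambda>b1 b2. L (\<lambda>c1 c2. si a (b1 \<cdot> c1) * si b2 c2) c) b)" by (intro lin)+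
  fix n U i' i assume U: "unitary_comatrix G {..<n::nat} U"
  show "L (\<lambda>a1 a2. L (\<lambda>b1 b2. si (a1 \<cdot> b1) c * si a2 b2) b) (U i' i) =
    L (\<lambda>b1 b2. L (\<lambda>c1 c2. si (U i' i) (b1 \<cdot> c1) * si b2 c2) c) b"
  proof (rule clinear_eq_coefficients[where a = b])
    show "clinear (\<lambda>b. L (\<lambda>a1 a2. L (\<lambda>b1 b2. si (a1 \<cdot> b1) c * si a2 b2) b) (U i' i))"
      "clinear (\<lambda>b. L (\<lambda>b1 b2. L (\<lambda>c1 c2. si (U i' i) (b1 \<cdot> c1) * si b2 c2) c) b)" by (intro lin)+
    fix m V j' j assume V: "unitary_comatrix G {..<m::nat} V"
    show "L (\<lambda>a1 a2. L (\<lambda>b1 b2. si (a1 \<cdot> b1) c * si a2 b2) (V j' j)) (U i' i) =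
      L (\<lambda>b1 b2. L (\<lambda>c1 c2. si (U i' i) (b1 \<cdot> c1) * si b2 c2) c) (V j' j)"
    proof (rule clinear_eq_coefficients[where a = c])
      show "clinear (\<lambda>c. L (\<lambda>a1 a2. L (\<lambda>b1 b2. si (a1 \<cdot> b1) c * si a2 b2) (V j' j)) (U i' i))"
        "clinear (\<lambda>c. L (\<lambda>b1 b2. L (\<lambda>c1 c2. si (U i' i) (b1 \<cdot> c1) * si b2 c2) c) (V j' j))" by (intro lin)+
      fix l X k' k assume X: "unitary_comatrix G {..<l::nat} X"
      note cm = unitary_comatrixD(1)[OF U] unitary_comatrixD(1)[OF V] unitary_comatrixD(1)[OF X]
      have "L (\<lambda>a1 a2. L (\<lambda>b1 b2. si (a1 \<cdot> b1) (X k' k) * si a2 b2) (V j' j)) (U i' i)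
          = (\<Sum>p<n. \<Sum>q<m. si (U i' p \<cdot> V j' q) (X k' k) * si (U p i) (V q j))"
        by (subst lift_comatrix[OF cm(1)] lift_comatrix[OF cm(2)], (intro lin)[1])+ simp
      also have "\<dots> = cnj (\<Sum>p<n. \<Sum>q<m. sg (U i p) (V j q) * sg (U p i' \<cdot> V q j') (X k k'))"
        by (simp add: si_def S_mul st_mul S_coefficient[OF U] S_coefficient[OF V] S_coefficient[OF X] mult.commute)
      also have "\<dots> = cnj (\<Sum>q<m. \<Sum>r<l. sg (V j q) (X k r) * sg (U i i') (V q j' \<cdot> X r k'))"
        by (simp only: cocycle_comatrix[OF cm])
      also have "\<dots> = (\<Sum>q<m. \<Sum>r<l. si (U i' i) (V j' q \<cdot> X k' r) * si (V q j) (X r k))"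
        by (simp add: si_def S_mul st_mul S_coefficient[OF U] S_coefficient[OF V] S_coefficient[OF X] mult.commute)
      also have "\<dots> = L (\<lambda>b1 b2. L (\<lambda>c1 c2. si (U i' i) (b1 \<cdot> c1) * si b2 c2) (X k' k)) (V j' j)"
        by (subst lift_comatrix[OF cm(2)] lift_comatrix[OF cm(3)], (intro lin)[1])+ simp
      finally show "L (\<lambda>a1 a2. L (\<lambda>b1 b2. si (a1 \<cdot> b1) (X k' k) * si a2 b2) (V j' j)) (U i' i) =
        L (\<lambda>b1 b2. L (\<lambda>c1 c2. si (U i' i) (b1 \<cdot> c1) * si b2 c2) (X k' k)) (V j' j)" .
    qed
  qed
qed

text \<open>Passing through the Sweedler form frees the identity from unitarity, so that it applies
  to matrices of adjoints of coefficients.\<close>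

lemma inverse_cocycle_comatrix:
  assumes U: "comatrix G I U" and V: "comatrix G J V" and X: "comatrix G K X"
  shows "(\<Sum>p\<in>I. \<Sum>q\<in>J. si (U i p \<cdot> V j q) (X k k') * si (U p i') (V q j')) =
    (\<Sum>q\<in>J. \<Sum>r\<in>K. si (U i i') (V j q \<cdot> X k r) * si (V q j') (X r k'))"
proof -
  have "(\<Sum>p\<in>I. \<Sum>q\<in>J. si (U i p \<cdot> V j q) (X k k') * si (U p i') (V q j')) =
      L (\<lambda>a1 a2. L (\<lambda>b1 b2. si (a1 \<cdot> b1) (X k k') * si a2 b2) (V j j')) (U i i')"
    by (subst lift_comatrix[OF U] lift_comatrix[OF V], (intro lin)[1])+ simp
  also have "\<dots> = L (\<lambda>b1 b2. L (\<lambda>c1 c2. si (U i i') (b1 \<cdot> c1) * si b2 c2) (X k k')) (V j j')"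
    by (rule inverse_cocycle)
  also have "\<dots> = (\<Sum>q\<in>J. \<Sum>r\<in>K. si (U i i') (V j q \<cdot> X k r) * si (V q j') (X r k'))"
    by (subst lift_comatrix[OF V] lift_comatrix[OF X], (intro lin)[1])+ simp
  finally show ?thesis .
qed

section \<open>The element u, its inverse and their adjoints\<close>

text \<open>\<open>v\<close> is \<open>u\<^sup>-\<^sup>1\<close>.\<close>

abbreviation u :: "'h \<Rightarrow> complex" where "u \<equiv> cocycle_u G \<Omega>"

definition v :: "'h \<Rightarrow> complex" where "v a = L (\<lambda>b c. si (S b) c) a"

lemma u_clinear: "clinear u" and v_clinear: "clinear v"
  unfolding cocycle_u_def[abs_def] v_def[abs_def] by (intro lin)+

lemma u_zero [simp]: "u 0 = 0" "v 0 = 0"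
  by (rule clinear_zero u_clinear v_clinear)+

lemma u_comatrix:
  assumes "comatrix G I U"
  shows "u (U i j) = (\<Sum>p\<in>I. sg (U i p) (S (U p j)))" "v (U i j) = (\<Sum>p\<in>I. si (S (U i p)) (U p j))"
  unfolding cocycle_u_def v_def by (subst lift_comatrix[OF assms], (intro lin)[1], simp)+

lemma u_coefficient:
  assumes "unitary_comatrix G I U"
  shows "u (U i j) = (\<Sum>p\<in>I. sg (U i p) (st (U j p)))" "v (U i j) = (\<Sum>p\<in>I. si (st (U p i)) (U p j))"
  by (simp_all add: u_comatrix[OF unitary_comatrixD(1)[OF assms]] S_coefficient[OF assms])

text \<open>The cocycle identity at \<open>a\<^sub>(\<^sub>1\<^sub>) \<otimes> S(a\<^sub>(\<^sub>2\<^sub>)) \<otimes> a\<^sub>(\<^sub>3\<^sub>)\<close>.\<close>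

lemma u_v_inverse:
  assumes "unitary_comatrix G I U"
  shows "(\<Sum>k\<in>I. u (U i k) * v (U k j)) = delta I i j" "(\<Sum>k\<in>I. v (U i k) * u (U k j)) = delta I i j"
proof -
  note U = unitary_comatrixD[OF assms] note cm = comatrixD[OF U(1)] note C = comatrix_star[OF U(1)]
  \<comment> \<open>Start from Omega(a \<otimes> 1) = \<epsilon>(a), with S(b1) b2 in place of the
    unit. Expanding by the cocycle identity produces U U^*, whose sum over the shared index
    collapses and leaves u and u^-1.\<close>
  have "delta I i j = (\<Sum>a\<in>I. sg (U i a) (\<Sum>b\<in>I. st (U b a) \<cdot> U b j))"
    unfolding U(2) sum_sg by (simp add: sum_delta_times cm delta_notin)
  also have "\<dots> = (\<Sum>a\<in>I. \<Sum>b\<in>I. \<Sum>q\<in>I. \<Sum>r\<in>I. si (st (U b q)) (U b r) *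
    (\<Sum>p\<in>I. \<Sum>s\<in>I. sg (U i p) (st (U q s)) * sg (U p a \<cdot> st (U s a)) (U r j)))"
    unfolding sum_sg cocycle_left[OF U(1) C U(1)] ..
  also have "\<dots> = (\<Sum>b\<in>I. \<Sum>q\<in>I. \<Sum>r\<in>I. \<Sum>a\<in>I. si (st (U b q)) (U b r) *
    (\<Sum>p\<in>I. \<Sum>s\<in>I. sg (U i p) (st (U q s)) * sg (U p a \<cdot> st (U s a)) (U r j)))"
    by (subst sum_rotate3) (intro sum.cong refl sum.swap)
  also have "\<dots> = (\<Sum>b\<in>I. \<Sum>q\<in>I. \<Sum>r\<in>I. si (st (U b q)) (U b r) *
    (\<Sum>p\<in>I. \<Sum>s\<in>I. sg (U i p) (st (U q s)) * (\<Sum>a\<in>I. sg (U p a \<cdot> st (U s a)) (U r j))))"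
    by (intro sum.cong refl) (simp add: sum_distrib_left, subst sum_rotate3, simp)
  also have "\<dots> = (\<Sum>b\<in>I. \<Sum>q\<in>I. \<Sum>r\<in>I. si (st (U b q)) (U b r) *
    (\<Sum>p\<in>I. \<Sum>s\<in>I. sg (U i p) (st (U q s)) * (delta I p s * delta I r j)))"
    unfolding sum_sg(1)[symmetric] U(3) sum_sg by (simp add: cm)
  also have "\<dots> = (\<Sum>b\<in>I. \<Sum>q\<in>I. si (st (U b q)) (U b j) * u (U i q))"
  proof -
    have *: "(\<Sum>s\<in>I. sg (U i p) (st (U q s)) * (delta I p s * delta I r j)) = sg (U i p) (st (U q p)) * delta I r j" for p q r
      by (subst mult.assoc[symmetric], subst sum_distrib_right[symmetric], subst sum_delta_times(3)) (simp_all add: cm)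
    show ?thesis
      unfolding * u_coefficient[OF assms]
      by (simp add: cm sum_delta_times mult.assoc[symmetric] flip: sum_distrib_right)
  qed
  also have "\<dots> = (\<Sum>k\<in>I. u (U i k) * v (U k j))"
    unfolding u_coefficient(2)[OF assms] by (subst sum.swap) (simp add: sum_distrib_left mult.commute)
  finally show "(\<Sum>k\<in>I. u (U i k) * v (U k j)) = delta I i j" by simp
  \<comment> \<open>For the other order the triple is S(a1) \<otimes> a2 \<otimes> S(a3), and the
    identity is solved for the product in the first leg.\<close>
  have "delta I i j = (\<Sum>a\<in>I. sg (\<Sum>b\<in>I. st (U b i) \<cdot> U b a) (st (U j a)))"
    unfolding U(2) sum_sg by (simp add: cm sum_delta_times counit_st delta_notin) (simp add: delta_commute)
  also have "\<dots> = (\<Sum>a\<in>I. \<Sum>b\<in>I. \<Sum>p\<in>I. \<Sum>q\<in>I. si (st (U b p)) (U b q) *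
    (\<Sum>s\<in>I. \<Sum>t\<in>I. sg (U q s) (st (U j t)) * sg (st (U p i)) (U s a \<cdot> st (U t a))))"
    unfolding sum_sg cocycle_right[OF C U(1) C] ..
  also have "\<dots> = (\<Sum>b\<in>I. \<Sum>p\<in>I. \<Sum>q\<in>I. \<Sum>a\<in>I. si (st (U b p)) (U b q) *
    (\<Sum>s\<in>I. \<Sum>t\<in>I. sg (U q s) (st (U j t)) * sg (st (U p i)) (U s a \<cdot> st (U t a))))"
    by (subst sum_rotate3) (intro sum.cong refl sum.swap)
  also have "\<dots> = (\<Sum>b\<in>I. \<Sum>p\<in>I. \<Sum>q\<in>I. si (st (U b p)) (U b q) *
    (\<Sum>s\<in>I. \<Sum>t\<in>I. sg (U q s) (st (U j t)) * (\<Sum>a\<in>I. sg (st (U p i)) (U s a \<cdot> st (U t a)))))"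
    by (intro sum.cong refl) (simp add: sum_distrib_left, subst sum_rotate3, simp)
  also have "\<dots> = (\<Sum>b\<in>I. \<Sum>p\<in>I. \<Sum>q\<in>I. si (st (U b p)) (U b q) *
    (\<Sum>s\<in>I. \<Sum>t\<in>I. sg (U q s) (st (U j t)) * (delta I s t * delta I p i)))"
    unfolding sum_sg(2)[symmetric] U(3) sum_sg by (simp add: cm counit_st)
  also have "\<dots> = (\<Sum>b\<in>I. \<Sum>q\<in>I. \<Sum>p\<in>I. si (st (U b p)) (U b q) * u (U q j) * delta I p i)"
  proof -
    have *: "(\<Sum>t\<in>I. sg (U q s) (st (U j t)) * (delta I s t * delta I p i)) = sg (U q s) (st (U j s)) * delta I p i" for p q s
      by (subst mult.assoc[symmetric], subst sum_distrib_right[symmetric], subst sum_delta_times(3)) (simp_all add: cm)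
    show ?thesis
      unfolding * u_coefficient[OF assms]
      by (subst (2) sum.swap) (simp add: mult.assoc[symmetric] flip: sum_distrib_right)
  qed
  also have "\<dots> = (\<Sum>k\<in>I. v (U i k) * u (U k j))"
    unfolding u_coefficient(2)[OF assms] using cm
    by (subst sum.swap) (simp add: sum_distrib_right sum_delta_times)
  finally show "(\<Sum>k\<in>I. v (U i k) * u (U k j)) = delta I i j" by simp
qed

lemma dual_inverse_u: "dual_inverse G u = v"
proof -
  have inv: "conv (comult G) u v = \<epsilon>" "conv (comult G) v u = \<epsilon>"
  proof -
    show "conv (comult G) u v = \<epsilon>"
    proof
      fix a show "conv (comult G) u v a = \<epsilon> a"
        by (rule clinear_eq_coefficients) (auto intro: clinear_conv u_clinear v_clinear counit_clinear
          simp: conv_comatrix[OF unitary_comatrixD(1) u_clinear v_clinear] u_v_inverse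
            comatrixD(3)[OF unitary_comatrixD(1)])
    qed
    show "conv (comult G) v u = \<epsilon>"
    proof
      fix a show "conv (comult G) v u a = \<epsilon> a"
        by (rule clinear_eq_coefficients) (auto intro: clinear_conv u_clinear v_clinear counit_clinear
          simp: conv_comatrix[OF unitary_comatrixD(1) v_clinear u_clinear] u_v_inverse
            comatrixD(3)[OF unitary_comatrixD(1)])
    qed
  qed
  have "\<eta> = v" if \<eta>: "clinear \<eta>" "conv (comult G) \<eta> u = \<epsilon>" for \<eta>
  proof
    fix a show "\<eta> a = v a"
    proof (rule clinear_eq_coefficients[OF \<eta>(1) v_clinear])
      fix n U i j assume U: "unitary_comatrix G {..<n::nat} U"
      note cm = comatrixD[OF unitary_comatrixD(1)[OF U]]
      have \<eta>u: "(\<Sum>k<n. \<eta> (U i k) * u (U k j)) = delta {..<n} i j" for j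
        using fun_cong[OF \<eta>(2), of "U i j"] by (simp add: conv_comatrix[OF unitary_comatrixD(1)[OF U] \<eta>(1) u_clinear] cm)
      have "\<eta> (U i j) = (\<Sum>k<n. \<eta> (U i k) * delta {..<n} k j)"
        by (simp add: sum_delta_times cm clinear_zero[OF \<eta>(1)] del: lessThan_iff)
      also have "\<dots> = (\<Sum>l<n. (\<Sum>k<n. \<eta> (U i k) * u (U k l)) * v (U l j))"
        unfolding u_v_inverse(1)[OF U, symmetric] sum_distrib_left sum_distrib_right mult.assoc
        by (rule sum.swap)
      also have "\<dots> = v (U i j)" by (simp add: \<eta>u sum_delta_times cm del: lessThan_iff)
      finally show "\<eta> (U i j) = v (U i j)" .
    qed
  qed
  then show ?thesis unfolding dual_inverse_def using inv
    by (intro the_equality) (auto intro: u_clinear v_clinear)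
qed

abbreviation ustar where "ustar \<equiv> dual_star G u"
abbreviation vstar where "vstar \<equiv> dual_star G v"

text \<open>Conjugating the contraction of Omega that defines u gives the contraction of Omega^*
  that defines u^-1; this is u^-1 = u^* S, and likewise for u^-1 in place of u.\<close>

lemma ustar_S: "ustar (S a) = v a" and vstar_S: "vstar (S a) = u a"
proof -
  have "ustar (S (U i j)) = v (U i j) \<and> vstar (S (U i j)) = u (U i j)"
    if U: "unitary_comatrix G {..<n::nat} U" for n U i j
  proof -
    \<comment> \<open>\<open>?b i j\<close> is the inverse antipode of \<open>U j i\<close>.\<close>
    let ?b = "\<lambda>i j. st (S (st (U j i)))"
    have b: "comatrix G {..<n} ?b"
      by (rule comatrix_star[OF comatrix_S[OF comatrix_star[OF unitary_comatrixD(1)[OF U]]]])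
    have Sb: "S (?b i j) = U j i" for i j by simp
    show ?thesis
      unfolding dual_star_def S_coefficient[OF U] u_comatrix[OF b] Sb
      by (simp add: u_coefficient[OF U] si_def S_coefficient[OF U])
  qed
  then show "ustar (S a) = v a" "vstar (S a) = u a"
    by - (rule clinear_eq_coefficients[of "\<lambda>a. ustar (S a)" v a] clinear_eq_coefficients[of "\<lambda>a. vstar (S a)" u a];
      auto intro!: u_clinear v_clinear clinearI simp: clinear_add clinear_scaleC S_clinear dual_star_clinear
        u_clinear v_clinear)+
qed

lemma ustar_clinear: "clinear ustar" and vstar_clinear: "clinear vstar"
  by (rule dual_star_clinear u_clinear v_clinear)+

lemma ustar_coefficient:
  assumes "unitary_comatrix G I U"
  shows "ustar (st (U i j)) = v (U j i)" "vstar (st (U i j)) = u (U j i)"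
    "ustar (U i j) = cnj (u (U j i))" "vstar (U i j) = cnj (v (U j i))"
  using ustar_S[of "U j i"] vstar_S[of "U j i"]
  by (simp_all add: S_coefficient[OF assms] dual_star_def)

end

text \<open>The matrix product A W B with scalar outer factors and an algebra-valued middle one. The
  outer index types are free, so that single rows and columns are included with outer index
  \<open>()\<close>.\<close>

definition conjm ::
    "'i set \<Rightarrow> ('j \<Rightarrow> 'i \<Rightarrow> complex) \<Rightarrow> ('i \<Rightarrow> 'i \<Rightarrow> 'a::complex_vector) \<Rightarrow> ('i \<Rightarrow> 'k \<Rightarrow> complex) \<Rightarrow> 'j \<Rightarrow> 'k \<Rightarrow> 'a" where
  "conjm I A W B i j = (\<Sum>z\<in>I. \<Sum>w\<in>I. (A i z * B w j) *\<^sub>C W z w)"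

lemma sum_conjm_right:
  "(\<Sum>y\<in>J. a y *\<^sub>C conjm I A W B i y) = conjm I A W (\<lambda>w _. \<Sum>y\<in>J. B w y * a y) i ()"
proof -
  have "(\<Sum>y\<in>J. a y *\<^sub>C conjm I A W B i y) = (\<Sum>y\<in>J. \<Sum>z\<in>I. \<Sum>w\<in>I. (A i z * (B w y * a y)) *\<^sub>C W z w)"
    by (simp add: conjm_def complex_vector.scale_sum_right scaleC_scaleC mult.commute mult.left_commute)
  also have "\<dots> = conjm I A W (\<lambda>w _. \<Sum>y\<in>J. B w y * a y) i ()"
    by (subst sum_rotate3) (simp add: conjm_def sum_distrib_left complex_vector.scale_sum_left)
  finally show ?thesis .
qed

lemma sum_conjm_left:
  "(\<Sum>y\<in>J. a y *\<^sub>C conjm I A W B y j) = conjm I (\<lambda>_ z. \<Sum>y\<in>J. a y * A y z) W B () j"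
proof -
  have "(\<Sum>y\<in>J. a y *\<^sub>C conjm I A W B y j) = (\<Sum>y\<in>J. \<Sum>z\<in>I. \<Sum>w\<in>I. (a y * A y z * B w j) *\<^sub>C W z w)"
    by (simp add: conjm_def complex_vector.scale_sum_right scaleC_scaleC mult.assoc)
  also have "\<dots> = conjm I (\<lambda>_ z. \<Sum>y\<in>J. a y * A y z) W B () j"
    by (subst sum_rotate3) (simp add: conjm_def sum_distrib_right complex_vector.scale_sum_left)
  finally show ?thesis .
qed

lemma conjm_conjm:
  "conjm J A (conjm I C W D) B i j =
    conjm I (\<lambda>i z'. \<Sum>z\<in>J. A i z * C z z') W (\<lambda>w' j. \<Sum>w\<in>J. D w' w * B w j) i j"
proof -
  have "conjm J A (conjm I C W D) B i j = (\<Sum>z\<in>J. A i z *\<^sub>C (\<Sum>w\<in>J. B w j *\<^sub>C conjm I C W D z w))"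
    unfolding conjm_def[of J] by (simp add: complex_vector.scale_sum_right scaleC_scaleC)
  also have "\<dots> = (\<Sum>z\<in>J. A i z *\<^sub>C conjm I C W (\<lambda>w' _. \<Sum>w\<in>J. D w' w * B w j) z ())"
    by (simp only: sum_conjm_right)
  also have "\<dots> = conjm I (\<lambda>_ z'. \<Sum>z\<in>J. A i z * C z z') W (\<lambda>w' _. \<Sum>w\<in>J. D w' w * B w j) () ()"
    by (rule sum_conjm_left)
  also have "\<dots> = conjm I (\<lambda>i z'. \<Sum>z\<in>J. A i z * C z z') W (\<lambda>w' j. \<Sum>w\<in>J. D w' w * B w j) i j"
    by (simp add: conjm_def)
  finally show ?thesis .
qed

lemma conjm_cong:
  "(\<And>z. z \<in> I \<Longrightarrow> A i z = A' i' z) \<Longrightarrow> (\<And>z w. z \<in> I \<Longrightarrow> w \<in> I \<Longrightarrow> W z w = W' z w) \<Longrightarrow>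
    (\<And>w. w \<in> I \<Longrightarrow> B w j = B' w j') \<Longrightarrow> conjm I A W B i j = conjm I A' W' B' i' j'"
  by (simp add: conjm_def)

lemma conjm_reindex:
  fixes W :: "'j \<Rightarrow> 'j \<Rightarrow> 'a::complex_vector"
  assumes f: "bij_betw f I J"
  shows "conjm J A W B i j = conjm I (\<lambda>i z. A i (f z)) (\<lambda>z w. W (f z) (f w)) (\<lambda>w j. B (f w) j) i j"
proof -
  have "(\<Sum>z\<in>J. g z) = (\<Sum>z\<in>I. g (f z))" for g :: "'j \<Rightarrow> 'a"
    by (rule sum.reindex_bij_betw[OF f, symmetric])
  then show ?thesis by (simp add: conjm_def)
qed

lemma conjm_delta:
  assumes "finite I" "i \<in> I" "j \<in> I"
  shows "conjm I (delta I) W (delta I) i j = W i j"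
proof -
  have "conjm I (delta I) W (delta I) i j = (\<Sum>z\<in>I. delta I i z *\<^sub>C (\<Sum>w\<in>I. delta I w j *\<^sub>C W z w))"
    by (simp add: conjm_def complex_vector.scale_sum_right scaleC_scaleC)
  also have "\<dots> = W i j"
  proof -
    have "(\<Sum>w\<in>I. delta I w j *\<^sub>C W z w) = W z j" for z
      by (rule sum_delta_scaleC(2)) (simp_all add: assms)
    moreover have "(\<Sum>z\<in>I. delta I i z *\<^sub>C W z j) = W i j"
      by (rule sum_delta_scaleC(1)) (simp_all add: assms)
    ultimately show ?thesis by simp
  qed
  finally show ?thesis .
qed

lemma clinear_conjm:
  "clinear f \<Longrightarrow> f (conjm I A W B i j) = conjm I A (\<lambda>z w. f (W z w)) B i j"
  by (simp add: conjm_def clinear_sum clinear_scaleC)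

lemma sum_pair_swap: "(\<Sum>z\<in>I \<times> J. f (fst z) (snd z)) = (\<Sum>n\<in>J. \<Sum>m\<in>I. f m n)"
  unfolding sum_pair[symmetric] by (rule sum.swap)

lemma sum_product_inverse_right:
  fixes h :: "'a \<Rightarrow> 'b \<Rightarrow> complex"
  assumes fin: "finite J" "finite K" and h: "\<And>s t. s \<notin> J \<or> t \<notin> K \<Longrightarrow> h s t = 0"
    and gf: "\<And>s t. (\<Sum>q\<in>J. \<Sum>r\<in>K. g s t q r * f q r) = delta J s j * delta K t k"
  shows "(\<Sum>q\<in>J. \<Sum>r\<in>K. (\<Sum>s\<in>J. \<Sum>t\<in>K. h s t * g s t q r) * f q r) = h j k"
proof -
  have "(\<Sum>q\<in>J. \<Sum>r\<in>K. (\<Sum>s\<in>J. \<Sum>t\<in>K. h s t * g s t q r) * f q r)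
      = (\<Sum>q\<in>J. \<Sum>r\<in>K. \<Sum>w\<in>J\<times>K. h (fst w) (snd w) * (g (fst w) (snd w) q r * f q r))"
    unfolding sum_pair[where f = "\<lambda>s t. h s t * g s t q r" for q r] by (simp add: sum_distrib_right mult.assoc)
  also have "\<dots> = (\<Sum>w\<in>J\<times>K. h (fst w) (snd w) * (\<Sum>q\<in>J. \<Sum>r\<in>K. g (fst w) (snd w) q r * f q r))"
    by (subst sum_rotate3[symmetric]) (simp add: sum_distrib_left)
  also have "\<dots> = (\<Sum>s\<in>J. \<Sum>t\<in>K. h s t * (delta J s j * delta K t k))"
    unfolding gf by (rule sum_pair[symmetric])
  also have "\<dots> = (\<Sum>s\<in>J. delta J s j * (\<Sum>t\<in>K. delta K t k * h s t))"
    by (simp add: sum_distrib_left mult.commute mult.left_commute)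
  also have "\<dots> = h j k"
    using h fin by (simp add: sum_delta_times)
  finally show ?thesis .
qed

context cqg
begin

text \<open>Equivalence of corepresentations: the inner factors B A cancel in the coproduct, and A B
  = 1 gives the counit.\<close>

lemma comatrix_conjm:
  assumes W: "comatrix G I W"
    and AB: "\<And>i j. (\<Sum>z\<in>I. A i z * B z j) = delta I i j"
    and BA: "\<And>i j. (\<Sum>z\<in>I. B i z * A z j) = delta I i j"
    and zero: "\<And>i z. i \<notin> I \<Longrightarrow> A i z = 0" "\<And>w j. j \<notin> I \<Longrightarrow> B w j = 0"
  shows "comatrix G I (conjm I A W B)"
proof -
  note cm = comatrixD[OF W]
  have "comult G (conjm I A W B i j) = (\<Sum>k\<in>I. conjm I A W B i k \<otimes> conjm I A W B k j)" for i j
  proof -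
    have r: "(\<Sum>w\<in>I. W z w \<otimes> (\<Sum>k\<in>I. B w k *\<^sub>C conjm I A W B k j)) = (\<Sum>w\<in>I. B w j *\<^sub>C (\<Sum>k\<in>I. W z k \<otimes> W k w))" for z
    proof -
      have "(\<Sum>k\<in>I. B w k *\<^sub>C conjm I A W B k j) = (\<Sum>w'\<in>I. B w' j *\<^sub>C W w w')" for w
      proof -
        have "(\<Sum>k\<in>I. B w k *\<^sub>C conjm I A W B k j) = (\<Sum>z'\<in>I. delta I w z' *\<^sub>C (\<Sum>w'\<in>I. B w' j *\<^sub>C W z' w'))"
          unfolding sum_conjm_left BA by (simp add: conjm_def complex_vector.scale_sum_right scaleC_scaleC)
        also have "\<dots> = (\<Sum>w'\<in>I. B w' j *\<^sub>C W w w')"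
          by (subst sum_delta_scaleC) (simp_all add: cm)
        finally show ?thesis .
      qed
      then have "(\<Sum>w\<in>I. W z w \<otimes> (\<Sum>k\<in>I. B w k *\<^sub>C conjm I A W B k j)) =
          (\<Sum>w\<in>I. \<Sum>w'\<in>I. B w' j *\<^sub>C (W z w \<otimes> W w w'))"
        by (simp add: clinear_sum[OF clinear_of_cbilinear(1)[OF cbilinear_tensor]] tensor_scaleC_right)
      also have "\<dots> = (\<Sum>w\<in>I. B w j *\<^sub>C (\<Sum>k\<in>I. W z k \<otimes> W k w))"
        by (subst sum.swap) (simp add: complex_vector.scale_sum_right)
      finally show ?thesis .
    qed
    have "(\<Sum>k\<in>I. conjm I A W B i k \<otimes> conjm I A W B k j) =
        (\<Sum>k\<in>I. \<Sum>z\<in>I. \<Sum>w\<in>I. A i z *\<^sub>C (W z w \<otimes> (B w k *\<^sub>C conjm I A W B k j)))"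
      unfolding conjm_def[of I A W B i]
      by (simp add: clinear_sum[OF clinear_of_cbilinear(2)[OF cbilinear_tensor]] tensor_scaleC_left
          tensor_scaleC_right scaleC_scaleC)
    also have "\<dots> = (\<Sum>z\<in>I. A i z *\<^sub>C (\<Sum>w\<in>I. W z w \<otimes> (\<Sum>k\<in>I. B w k *\<^sub>C conjm I A W B k j)))"
      by (subst sum_rotate3) (simp add: complex_vector.scale_sum_right clinear_sum[OF clinear_of_cbilinear(1)[OF cbilinear_tensor]])
    also have "\<dots> = comult G (conjm I A W B i j)"
      unfolding r clinear_conjm[OF comult_clinear]
      by (simp add: conjm_def cm(2) complex_vector.scale_sum_right scaleC_scaleC)
    finally show ?thesis by (rule sym)
  qed
  moreover have "\<epsilon> (conjm I A W B i j) = delta I i j" for i j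
  proof -
    have "\<epsilon> (conjm I A W B i j) = (\<Sum>z\<in>I. A i z * (\<Sum>w\<in>I. delta I z w * B w j))"
      unfolding clinear_conjm[OF counit_clinear] by (simp add: conjm_def cm(3) sum_distrib_left mult.assoc mult.left_commute mult.commute)
    also have "\<dots> = (\<Sum>z\<in>I. A i z * B z j)"
    proof (rule sum.cong[OF refl])
      fix z assume "z \<in> I"
      then have "(\<Sum>w\<in>I. delta I z w * B w j) = B z j"
        by (intro sum_delta_times(1) cm(1)) simp
      then show "A i z * (\<Sum>w\<in>I. delta I z w * B w j) = A i z * B z j" by simp
    qed
    finally show ?thesis by (simp add: AB)
  qed
  moreover have "conjm I A W B i j = 0" if "i \<notin> I \<or> j \<notin> I" for i j
    using that zero by (auto simp: conjm_def)
  ultimately show ?thesis unfolding comatrix_def using cm(1) by blast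
qed

end

section \<open>The coproduct of the inverse of u\<close>

context cocycle_deformation
begin

text \<open>Convolving the left side with Omega^* brings in the inverse cocycle identity at x
  \<otimes> S(a) \<otimes> b. There S(a) meets its neighbour, their product collapses to a counit,
  and \<open>v\<close> remains; convolving with Omega undoes the first step.\<close>

lemma sg_v_contract:
  assumes X: "comatrix G K X" and U: "unitary_comatrix G I U"
  shows "(\<Sum>r\<in>I. si (X s l \<cdot> st (U r j)) (U r i)) = (\<Sum>r\<in>I. v (U r i) * sg (X s l) (st (U r j)))"
proof -
  note U' = unitary_comatrixD[OF U] note cm = comatrixD[OF U'(1)] comatrixD[OF X] note C = comatrix_star[OF U'(1)]
  define A where "A p q = (\<Sum>r\<in>I. si (X s p \<cdot> st (U r q)) (U r i))" for p q
  have A: "(\<Sum>p\<in>K. \<Sum>q\<in>I. A p q * si (X p l') (st (U q j'))) = delta K s l' * v (U j' i)" for l' j'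
  proof -
    have "(\<Sum>p\<in>K. \<Sum>q\<in>I. A p q * si (X p l') (st (U q j'))) =
        (\<Sum>r\<in>I. \<Sum>p\<in>K. \<Sum>q\<in>I. si (X s p \<cdot> st (U r q)) (U r i) * si (X p l') (st (U q j')))"
      by (subst sum_rotate3) (simp add: A_def sum_distrib_right)
    also have "\<dots> = (\<Sum>r\<in>I. \<Sum>q\<in>I. \<Sum>t\<in>I. si (X s l') (st (U r q) \<cdot> U r t) * si (st (U q j')) (U t i))"
      unfolding inverse_cocycle_comatrix[OF X C U'(1)] ..
    also have "\<dots> = (\<Sum>q\<in>I. \<Sum>t\<in>I. si (X s l') (\<Sum>r\<in>I. st (U r q) \<cdot> U r t) * si (st (U q j')) (U t i))"
      by (subst sum_rotate3) (simp add: sum_sg sum_distrib_right)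
    also have "\<dots> = (\<Sum>q\<in>I. delta K s l' * (\<Sum>t\<in>I. delta I q t * si (st (U q j')) (U t i)))"
      unfolding U'(2) by (simp add: sum_sg cm sum_distrib_left ac_simps)
    also have "\<dots> = delta K s l' * v (U j' i)"
      unfolding u_coefficient[OF U] sum_distrib_left[symmetric]
      by (intro arg_cong2[where f = "(*)"] refl sum.cong sum_delta_times) (simp_all add: cm)
    finally show ?thesis .
  qed
  have "A l j = (\<Sum>l'\<in>K. \<Sum>j'\<in>I. (\<Sum>p\<in>K. \<Sum>q\<in>I. A p q * si (X p l') (st (U q j'))) * sg (X l' l) (st (U j' j)))"
    using inverse_comatrix(2)[OF X C]
    by (intro sum_product_inverse_right[symmetric]) (auto simp: cm A_def)
  also have "\<dots> = (\<Sum>l'\<in>K. delta K s l' * (\<Sum>j'\<in>I. v (U j' i) * sg (X l' l) (st (U j' j))))"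
    unfolding A by (simp add: sum_distrib_left mult.assoc)
  also have "\<dots> = (\<Sum>j'\<in>I. v (U j' i) * sg (X s l) (st (U j' j)))"
    by (rule sum_delta_times) (simp_all add: cm)
  finally show ?thesis by (simp add: A_def)
qed

text \<open>In terms of the dual coproduct this is \<Delta>(u^-1) Omega^* = (S \<otimes>
  S)(Omega)_21 (u^-1 \<otimes> u^-1). Write u^-1(a b) as Omega^* at S(b1) S(a1) \<otimes> a2 b2. The
  inverse cocycle identity separates a2 from b2, the product S(a1) a2 collapses, and what remains
  has the form treated in \<open>sg_v_contract\<close>.\<close>

lemma v_product:
  assumes U: "unitary_comatrix G I U" and V: "unitary_comatrix G J V"
  shows "(\<Sum>p\<in>I. \<Sum>q\<in>J. v (U j p \<cdot> V l q) * si (U p i) (V q k)) =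
    (\<Sum>p\<in>I. \<Sum>q\<in>J. sg (st (V q l)) (st (U p j)) * (v (U p i) * v (V q k)))"
proof -
  note U' = unitary_comatrixD[OF U] and V' = unitary_comatrixD[OF V]
  note cm = comatrixD[OF U'(1)] comatrixD[OF V'(1)]
  note C = comatrix_star[OF U'(1)] comatrix_star[OF V'(1)]
  let ?W = "kron G (\<lambda>i j. st (V i j)) (\<lambda>i j. st (U i j))"
  have W: "comatrix G (J \<times> I) ?W" by (rule comatrix_kron[OF C(2,1)])
  have v: "v (U j p \<cdot> V l q) = (\<Sum>m\<in>I. \<Sum>n\<in>J. si (?W (n, m) (l, j)) (U m p \<cdot> V n q))" for p q
    using u_coefficient(2)[OF unitary_kron[OF U V], of "(j, l)" "(p, q)"]
    by (simp add: kron_def st_mul sum_pair)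
  have "(\<Sum>p\<in>I. \<Sum>q\<in>J. v (U j p \<cdot> V l q) * si (U p i) (V q k)) =
      (\<Sum>z\<in>I \<times> J. \<Sum>p\<in>I. \<Sum>q\<in>J. si (?W (snd z, fst z) (l, j)) (U (fst z) p \<cdot> V (snd z) q) * si (U p i) (V q k))"
    unfolding v sum_pair[where f = "\<lambda>m n. si (?W (n, m) (l, j)) (U m p \<cdot> V n q)" for p q] sum_distrib_right
    by (subst sum_rotate3) (rule refl)
  also have "\<dots> = (\<Sum>z\<in>I \<times> J. \<Sum>y\<in>J \<times> I. \<Sum>p\<in>I. si (?W (snd z, fst z) y \<cdot> U (fst z) p) (V (snd z) k) * si (?W y (l, j)) (U p i))"
    unfolding inverse_cocycle_comatrix[OF W U'(1) V'(1), symmetric] ..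
  also have "\<dots> = (\<Sum>y\<in>J \<times> I. \<Sum>p\<in>I. (\<Sum>n\<in>J. \<Sum>m\<in>I. si (?W (n, m) y \<cdot> U m p) (V n k)) * si (?W y (l, j)) (U p i))"
    by (subst sum_rotate3) (simp only: sum_distrib_right[symmetric]
      sum_pair_swap[where f = "\<lambda>m n. si (?W (n, m) y \<cdot> U m p) (V n k)" for y p])
  also have "\<dots> = (\<Sum>y\<in>J \<times> I. \<Sum>p\<in>I. (v (V (fst y) k) * delta I (snd y) p) * si (?W y (l, j)) (U p i))"
  proof -
    have "(\<Sum>n\<in>J. \<Sum>m\<in>I. si (?W (n, m) y \<cdot> U m p) (V n k)) = v (V (fst y) k) * delta I (snd y) p" for y p
    proof -
      have "(\<Sum>n\<in>J. \<Sum>m\<in>I. si (?W (n, m) y \<cdot> U m p) (V n k)) =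
          (\<Sum>n\<in>J. si (st (V n (fst y)) \<cdot> (\<Sum>m\<in>I. st (U m (snd y)) \<cdot> U m p)) (V n k))"
        by (simp add: kron_def mul_sum sum_sg mul_assoc)
      also have "\<dots> = (\<Sum>n\<in>J. delta I (snd y) p * si (st (V n (fst y))) (V n k))"
        unfolding U'(2) by (simp add: mul_simps sum_sg)
      also have "\<dots> = v (V (fst y) k) * delta I (snd y) p"
        unfolding u_coefficient(2)[OF V] sum_distrib_right by (simp only: mult.commute)
      finally show ?thesis .
    qed
    then show ?thesis by simp
  qed
  also have "\<dots> = (\<Sum>y\<in>J \<times> I. v (V (fst y) k) * si (?W y (l, j)) (U (snd y) i))"
  proof (rule sum.cong[OF refl])
    fix y
    have "(\<Sum>p\<in>I. delta I (snd y) p * si (?W y (l, j)) (U p i)) = si (?W y (l, j)) (U (snd y) i)"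
      by (rule sum_delta_times) (simp_all add: cm)
    then show "(\<Sum>p\<in>I. (v (V (fst y) k) * delta I (snd y) p) * si (?W y (l, j)) (U p i)) = v (V (fst y) k) * si (?W y (l, j)) (U (snd y) i)"
      by (simp add: mult.assoc flip: sum_distrib_left)
  qed
  also have "\<dots> = (\<Sum>s\<in>J. v (V s k) * (\<Sum>r\<in>I. si (st (V s l) \<cdot> st (U r j)) (U r i)))"
    unfolding sum_distrib_left sum_pair by (simp add: kron_def)
  also have "\<dots> = (\<Sum>s\<in>J. v (V s k) * (\<Sum>r\<in>I. v (U r i) * sg (st (V s l)) (st (U r j))))"
    unfolding sg_v_contract[OF C(2) U] ..
  also have "\<dots> = (\<Sum>p\<in>I. \<Sum>q\<in>J. sg (st (V q l)) (st (U p j)) * (v (U p i) * v (V q k)))"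
    by (subst sum.swap) (simp add: sum_distrib_left mult.commute mult.left_commute)
  finally show ?thesis .
qed

text \<open>The coefficient that appears when \<open>star\<close> is applied to a product twisted by
  Omega; composed with \<open>S\<close> in both legs it is \<open>si\<close>.\<close>

definition sgs :: "'h \<Rightarrow> 'h \<Rightarrow> complex" where "sgs a b = cnj (sg (st a) (st b))"

lemma clinear_compose_sgs [lin]:
  "clinear f \<Longrightarrow> clinear (\<lambda>x. sgs c (f x))" "clinear f \<Longrightarrow> clinear (\<lambda>x. sgs (f x) c)"
  by (rule clinearI; simp add: sgs_def clinear_add clinear_scaleC st_add st_scaleC
      tensor_add_left tensor_add_right tensor_scaleC_left tensor_scaleC_right \<Omega>_clinear)+

lemma clinear_compose_ustar [lin]:
  "clinear f \<Longrightarrow> clinear (\<lambda>x. ustar (f x))" "clinear f \<Longrightarrow> clinear (\<lambda>x. vstar (f x))"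
  "clinear f \<Longrightarrow> clinear (\<lambda>x. u (f x))" "clinear f \<Longrightarrow> clinear (\<lambda>x. v (f x))"
  by (rule clinearI; simp add: clinear_add clinear_scaleC ustar_clinear vstar_clinear u_clinear v_clinear)+

text \<open>This is \<open>v_product\<close> read through ustar(S a) = v(a), since adjoints of
  coefficients are values of \<open>S\<close>. It is the kernel identity behind antimultiplicativity
  of the deformed involution on \<open>B\<close>.\<close>

lemma ustar_product:
  "L (\<lambda>c1 c2. L (\<lambda>d1 d2. sgs c1 d1 * ustar (d2 \<cdot> c2)) d) c =
   L (\<lambda>c1 c2. L (\<lambda>d1 d2. ustar d1 * ustar c1 * sg d2 c2) d) c"
proof (rule clinear_eq_star_coefficients[where a = c])
  show "clinear (\<lambda>c. L (\<lambda>c1 c2. L (\<lambda>d1 d2. sgs c1 d1 * ustar (d2 \<cdot> c2)) d) c)"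
    "clinear (\<lambda>c. L (\<lambda>c1 c2. L (\<lambda>d1 d2. ustar d1 * ustar c1 * sg d2 c2) d) c)" by (intro lin)+
  fix n U i j assume U: "unitary_comatrix G {..<n::nat} U"
  show "L (\<lambda>c1 c2. L (\<lambda>d1 d2. sgs c1 d1 * ustar (d2 \<cdot> c2)) d) (st (U i j)) =
    L (\<lambda>c1 c2. L (\<lambda>d1 d2. ustar d1 * ustar c1 * sg d2 c2) d) (st (U i j))"
  proof (rule clinear_eq_star_coefficients[where a = d])
    show "clinear (\<lambda>d. L (\<lambda>c1 c2. L (\<lambda>d1 d2. sgs c1 d1 * ustar (d2 \<cdot> c2)) d) (st (U i j)))"
      "clinear (\<lambda>d. L (\<lambda>c1 c2. L (\<lambda>d1 d2. ustar d1 * ustar c1 * sg d2 c2) d) (st (U i j)))" by (intro lin)+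
    fix m V k l assume V: "unitary_comatrix G {..<m::nat} V"
    note C = comatrix_star[OF unitary_comatrixD(1)[OF U]] comatrix_star[OF unitary_comatrixD(1)[OF V]]
    have w: "ustar (st (V q l) \<cdot> st (U p j)) = v (U j p \<cdot> V l q)" for p q
      using ustar_coefficient(1)[OF unitary_kron[OF U V], of "(p, q)" "(j, l)"] by (simp add: kron_def st_mul)
    have "L (\<lambda>c1 c2. L (\<lambda>d1 d2. sgs c1 d1 * ustar (d2 \<cdot> c2)) (st (V k l))) (st (U i j)) =
        (\<Sum>p<n. \<Sum>q<m. sgs (st (U i p)) (st (V k q)) * ustar (st (V q l) \<cdot> st (U p j)))"
      by (subst lift_comatrix[OF C(1)] lift_comatrix[OF C(2)], (intro lin)[1])+ simp
    also have "\<dots> = (\<Sum>p<n. \<Sum>q<m. v (U j p \<cdot> V l q) * si (U p i) (V q k))"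
      by (simp add: sgs_def si_def S_coefficient[OF U] S_coefficient[OF V] w mult.commute)
    also have "\<dots> = (\<Sum>p<n. \<Sum>q<m. sg (st (V q l)) (st (U p j)) * (v (U p i) * v (V q k)))"
      by (rule v_product[OF U V])
    also have "\<dots> = (\<Sum>p<n. \<Sum>q<m. ustar (st (V k q)) * ustar (st (U i p)) * sg (st (V q l)) (st (U p j)))"
      by (simp add: ustar_coefficient[OF U] ustar_coefficient[OF V] mult.commute mult.left_commute)
    also have "\<dots> = L (\<lambda>c1 c2. L (\<lambda>d1 d2. ustar d1 * ustar c1 * sg d2 c2) (st (V k l))) (st (U i j))"
      by (subst lift_comatrix[OF C(1)] lift_comatrix[OF C(2)], (intro lin)[1])+ simp
    finally show "L (\<lambda>c1 c2. L (\<lambda>d1 d2. sgs c1 d1 * ustar (d2 \<cdot> c2)) (st (V k l))) (st (U i j)) =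
        L (\<lambda>c1 c2. L (\<lambda>d1 d2. ustar d1 * ustar c1 * sg d2 c2) (st (V k l))) (st (U i j))" .
  qed
qed

end

lemma tensor_lift_conj_scaleC:
  assumes F: "conj_bilinear F"
  shows "tensor_lift F (c *\<^sub>C t) = cnj c *\<^sub>C tensor_lift F t"
  by (induction t rule: tensor_induct)
    (use F in \<open>simp_all add: tensor_lift_conj_zero tensor_lift_conj_tensor tensor_lift_conj_add
      scaleC_add_right conj_bilinear_def flip: tensor_scaleC_left\<close>)

lemma conjm_transpose:
  "conjm I A W B i j = conjm I (\<lambda>j w. B w j) (\<lambda>w z. W z w) (\<lambda>z i. A i z) j i"
  unfolding conjm_def by (subst sum.swap) (simp only: mult.commute)

lemma kron_conjm:
  "(\<Sum>p\<in>I. \<Sum>q\<in>J. a p q *\<^sub>C (\<Sum>r\<in>I. \<Sum>s\<in>J. b r s *\<^sub>C f p q r s)) =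
   conjm (I \<times> J) (\<lambda>_ z. a (fst z) (snd z)) (\<lambda>z w. f (fst z) (snd z) (fst w) (snd w)) (\<lambda>w _. b (fst w) (snd w)) i j"
proof -
  have "(\<Sum>p\<in>I. \<Sum>q\<in>J. a p q *\<^sub>C (\<Sum>r\<in>I. \<Sum>s\<in>J. b r s *\<^sub>C f p q r s)) =
      (\<Sum>p\<in>I. \<Sum>q\<in>J. a p q *\<^sub>C (\<Sum>w\<in>I \<times> J. b (fst w) (snd w) *\<^sub>C f p q (fst w) (snd w)))"
    by (intro sum.cong refl arg_cong2[where f = scaleC] sum_pair)
  also have "\<dots> = (\<Sum>z\<in>I \<times> J. a (fst z) (snd z) *\<^sub>C
      (\<Sum>w\<in>I \<times> J. b (fst w) (snd w) *\<^sub>C f (fst z) (snd z) (fst w) (snd w)))"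
    by (rule sum_pair)
  finally show ?thesis
    by (simp add: conjm_def complex_vector.scale_sum_right scaleC_scaleC)
qed

context cocycle_deformation
begin

section \<open>The deformed Hopf *-algebra\<close>

definition sgm where "sgm U V p q = sg (U (fst p) (fst q)) (V (snd p) (snd q))"
definition sim where "sim U V p q = si (U (fst p) (fst q)) (V (snd p) (snd q))"

text \<open>\<open>dmul\<close>, \<open>dst\<close> and \<open>dS\<close> are the product, the involution and the antipode of \<open>G\<^sub>\<Omega>\<close>.\<close>

definition dmul :: "'h \<Rightarrow> 'h \<Rightarrow> 'h" where
  "dmul a b = L (\<lambda>a1 a'. L (\<lambda>b1 b'. sg a1 b1 *\<^sub>C
     L (\<lambda>a2 a3. L (\<lambda>b2 b3. si a3 b3 *\<^sub>C (a2 \<cdot> b2)) b') a') b) a"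

lemma dmul_cbilinear: "cbilinear dmul"
  unfolding dmul_def[abs_def] by (intro lin)

lemmas dmul_simps = cbilinearD[OF dmul_cbilinear]

lemma clinear_compose_dmul [lin]:
  "clinear f \<Longrightarrow> clinear (\<lambda>x. dmul c (f x))" "clinear f \<Longrightarrow> clinear (\<lambda>x. dmul (f x) c)"
  by (rule clinearI; simp add: clinear_add clinear_scaleC dmul_simps)+

lemma dmul_sum:
  "dmul (\<Sum>i\<in>A. f i) b = (\<Sum>i\<in>A. dmul (f i) b)" "dmul b (\<Sum>i\<in>A. f i) = (\<Sum>i\<in>A. dmul b (f i))"
  by (rule clinear_sum, intro lin)+

lemma dmul_zero [simp]: "dmul 0 a = 0" "dmul a 0 = 0"
  using dmul_simps(3)[of 0 0 a] dmul_simps(4)[of a 0 0] by simp_all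

text \<open>The tensor product of representations for \<open>H\<close> is the one for
  \<open>G\<close> conjugated by the matrix of Omega. Coproduct and counit of deformed products then
  follow from \<open>comatrix_conjm\<close>.\<close>

lemma dmul_comatrix:
  assumes U: "comatrix G I U" and V: "comatrix G J V"
  shows "dmul (U i j) (V k l) = conjm (I \<times> J) (sgm U V) (kron G U V) (sim U V) (i, k) (j, l)"
proof -
  have "dmul (U i j) (V k l) = (\<Sum>p\<in>I. \<Sum>q\<in>J. sg (U i p) (V k q) *\<^sub>C
      (\<Sum>r\<in>I. \<Sum>s\<in>J. si (U r j) (V s l) *\<^sub>C (U p r \<cdot> V q s)))"
    unfolding dmul_def by (subst lift_comatrix[OF U] lift_comatrix[OF V], (intro lin)[1])+ simp
  also have "\<dots> = conjm (I \<times> J) (sgm U V) (kron G U V) (sim U V) (i, k) (j, l)"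
    by (subst kron_conjm) (rule conjm_cong; simp add: sgm_def sim_def kron_def)
  finally show ?thesis .
qed

lemma sgm_sim:
  assumes "comatrix G I U" "comatrix G J V"
  shows "(\<Sum>z\<in>I \<times> J. sgm U V p z * sim U V z q) = delta (I \<times> J) p q"
    "(\<Sum>z\<in>I \<times> J. sim U V p z * sgm U V z q) = delta (I \<times> J) p q"
    "p \<notin> I \<times> J \<Longrightarrow> sgm U V p z = 0" "q \<notin> I \<times> J \<Longrightarrow> sim U V w q = 0"
proof -
  show "(\<Sum>z\<in>I \<times> J. sgm U V p z * sim U V z q) = delta (I \<times> J) p q"
    using inverse_comatrix(1)[OF assms, of "fst p" "snd p" "fst q" "snd q"]
    by (simp add: sgm_def sim_def delta_product sum_pair)
  show "(\<Sum>z\<in>I \<times> J. sim U V p z * sgm U V z q) = delta (I \<times> J) p q"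
    using inverse_comatrix(2)[OF assms, of "fst p" "snd p" "fst q" "snd q"]
    by (simp add: sgm_def sim_def delta_product sum_pair)
  show "sgm U V p z = 0" if "p \<notin> I \<times> J"
    using that comatrixD(4)[OF assms(1)] comatrixD(4)[OF assms(2)] by (cases p) (auto simp: sgm_def)
  show "sim U V w q = 0" if "q \<notin> I \<times> J"
    using that comatrixD(5)[OF assms(1)] comatrixD(5)[OF assms(2)] by (cases q) (auto simp: sim_def)
qed

lemma comatrix_dmul:
  assumes "comatrix G I U" "comatrix G J V"
  shows "comatrix G (I \<times> J) (\<lambda>p q. dmul (U (fst p) (fst q)) (V (snd p) (snd q)))"
proof -
  have "(\<lambda>p q. dmul (U (fst p) (fst q)) (V (snd p) (snd q))) =
      conjm (I \<times> J) (sgm U V) (kron G U V) (sim U V)"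
    by (intro ext) (simp add: dmul_comatrix[OF assms])
  then show ?thesis
    using comatrix_conjm[OF comatrix_kron[OF assms] sgm_sim[OF assms]] by simp
qed

lemma cbilinear_eq_coefficients:
  assumes "cbilinear F" "cbilinear F'"
    and "\<And>m n U V i j k l. unitary_comatrix G {..<m::nat} U \<Longrightarrow> unitary_comatrix G {..<n::nat} V \<Longrightarrow>
      F (U i j) (V k l) = F' (U i j) (V k l)"
  shows "F a b = F' a b"
proof (rule clinear_eq_coefficients[where a = a])
  show "clinear (\<lambda>a. F a b)" "clinear (\<lambda>a. F' a b)" using assms(1,2) by (simp_all add: cbilinear_def)
  fix m U i j assume U: "unitary_comatrix G {..<m::nat} U"
  show "F (U i j) b = F' (U i j) b"
  proof (rule clinear_eq_coefficients[where a = b])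
    show "clinear (F (U i j))" "clinear (F' (U i j))" by (rule clinear_of_cbilinear assms)+
  qed (rule assms(3)[OF U])
qed

text \<open>Both bracketings conjugate U \<otimes> V \<otimes> X. The left scalar matrices agree by
  the cocycle identity and the right ones by its adjoint; what remains is reindexing between the two
  nestings of pairs.\<close>

lemma dmul_assoc: "dmul (dmul a b) c = dmul a (dmul b c)"
proof (rule cbilinear_eq_coefficients[where a = a and b = b])
  show "cbilinear (\<lambda>a b. dmul (dmul a b) c)" "cbilinear (\<lambda>a b. dmul a (dmul b c))" by (intro lin)+
  fix n' n'' U V i j k l
  assume U: "unitary_comatrix G {..<n'::nat} U" and V: "unitary_comatrix G {..<n''::nat} V"
  show "dmul (dmul (U i j) (V k l)) c = dmul (U i j) (dmul (V k l) c)"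
  proof (rule clinear_eq_coefficients[where a = c])
    show "clinear (dmul (dmul (U i j) (V k l)))" "clinear (\<lambda>c. dmul (U i j) (dmul (V k l) c))" by (intro lin)+
    fix n''' X m n assume X: "unitary_comatrix G {..<n'''::nat} X"
    define I J K where "I = {..<n'}" and "J = {..<n''}" and "K = {..<n'''}"
    have cm: "comatrix G I U" "comatrix G J V" "comatrix G K X"
      using U V X by (simp_all add: I_def J_def K_def unitary_comatrix_def)
    let ?W = "kron G U V" and ?Y = "kron G V X"
    note W = comatrix_kron[OF cm(1,2)] and Y = comatrix_kron[OF cm(2,3)]
    have "dmul (dmul (U i j) (V k l)) (X m n) =
        conjm (I \<times> J) (sgm U V) (\<lambda>z w. dmul (?W z w) (X m n)) (sim U V) (i, k) (j, l)"
      unfolding dmul_comatrix[OF cm(1,2)] by (rule clinear_conjm) (intro lin)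
    also have "(\<lambda>z w. dmul (?W z w) (X m n)) =
        conjm ((I \<times> J) \<times> K) (\<lambda>z. sgm ?W X (z, m)) (kron G ?W X) (\<lambda>w' w. sim ?W X w' (w, n))"
      by (intro ext) (simp add: dmul_comatrix[OF W cm(3)] conjm_def)
    also have "conjm (I \<times> J) (sgm U V) \<dots> (sim U V) (i, k) (j, l) =
      conjm ((I \<times> J) \<times> K) (\<lambda>i z'. \<Sum>z\<in>I \<times> J. sgm U V i z * sgm ?W X (z, m) z') (kron G ?W X)
       (\<lambda>w' j. \<Sum>w\<in>I \<times> J. sim ?W X w' (w, n) * sim U V w j) (i, k) (j, l)"
      by (rule conjm_conjm)
    finally have left: "dmul (dmul (U i j) (V k l)) (X m n) = \<dots>" .
    have "dmul (U i j) (dmul (V k l) (X m n)) =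
        conjm (J \<times> K) (sgm V X) (\<lambda>z w. dmul (U i j) (?Y z w)) (sim V X) (k, m) (l, n)"
      unfolding dmul_comatrix[OF cm(2,3)] by (rule clinear_conjm) (intro lin)
    also have "(\<lambda>z w. dmul (U i j) (?Y z w)) =
        conjm (I \<times> (J \<times> K)) (\<lambda>z. sgm U ?Y (i, z)) (kron G U ?Y) (\<lambda>w' w. sim U ?Y w' (j, w))"
      by (intro ext) (simp add: dmul_comatrix[OF cm(1) Y] conjm_def)
    also have "conjm (J \<times> K) (sgm V X) \<dots> (sim V X) (k, m) (l, n) =
      conjm (I \<times> (J \<times> K)) (\<lambda>k z'. \<Sum>z\<in>J \<times> K. sgm V X k z * sgm U ?Y (i, z) z') (kron G U ?Y)
       (\<lambda>w' l. \<Sum>w\<in>J \<times> K. sim U ?Y w' (j, w) * sim V X w l) (k, m) (l, n)"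
      by (rule conjm_conjm)
    also have "\<dots> = conjm ((I \<times> J) \<times> K) (\<lambda>k y. \<Sum>z\<in>J \<times> K. sgm V X k z * sgm U ?Y (i, z) (fst (fst y), snd (fst y), snd y))
       (\<lambda>y y'. kron G U ?Y (fst (fst y), snd (fst y), snd y) (fst (fst y'), snd (fst y'), snd y'))
       (\<lambda>y' l. \<Sum>w\<in>J \<times> K. sim U ?Y (fst (fst y'), snd (fst y'), snd y') (j, w) * sim V X w l) (k, m) (l, n)"
      by (rule conjm_reindex) (rule bij_betwI[where g = "\<lambda>y. ((fst y, fst (snd y)), snd (snd y))"]; auto)
    also have "\<dots> = dmul (dmul (U i j) (V k l)) (X m n)"
      unfolding left
    proof (rule conjm_cong)
      fix z
      show "(\<Sum>y\<in>J \<times> K. sgm V X (k, m) y * sgm U ?Y (i, y) (fst (fst z), snd (fst z), snd z)) =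
          (\<Sum>y\<in>I \<times> J. sgm U V (i, k) y * sgm ?W X (y, m) z)"
        using cocycle_comatrix[OF cm, of i k "fst (fst z)" "snd (fst z)" m "snd z"]
        by (simp add: sgm_def kron_def sum_pair)
      show "(\<Sum>w\<in>J \<times> K. sim U ?Y (fst (fst z), snd (fst z), snd z) (j, w) * sim V X w (l, n)) =
          (\<Sum>w\<in>I \<times> J. sim ?W X z (w, n) * sim U V w (j, l))"
        using inverse_cocycle_comatrix[OF cm, of "fst (fst z)" "snd (fst z)" "snd z" n j l]
        by (simp add: sim_def kron_def sum_pair)
    qed (simp add: kron_def mul_assoc)
    finally show "dmul (dmul (U i j) (V k l)) (X m n) = dmul (U i j) (dmul (V k l) (X m n))" by simp
  qed
qed

lemma lift_one: "cbilinear F \<Longrightarrow> L F \<one> = F \<one> \<one>"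
  by (simp add: comult_one tensor_lift_tensor)

lemma dmul_one [simp]: "dmul \<one> a = a" "dmul a \<one> = a"
proof -
  show "dmul \<one> a = a"
    unfolding dmul_def by (subst lift_one, (intro lin)[1])+ (simp add: counit_left counit_right)
  show "dmul a \<one> = a"
    unfolding dmul_def by (subst lift_one, (intro lin)[1])+ (simp add: counit_left counit_right)
qed

lemma counit_dmul: "\<epsilon> (dmul a b) = \<epsilon> a * \<epsilon> b"
proof (rule cbilinear_eq_coefficients[where a = a and b = b])
  show "cbilinear (\<lambda>a b. \<epsilon> (dmul a b))" "cbilinear (\<lambda>a b. \<epsilon> a * \<epsilon> b)" by (intro lin)+
  fix m n U V i j k l
  assume "unitary_comatrix G {..<m::nat} U" "unitary_comatrix G {..<n::nat} V"
  note cm = this[THEN unitary_comatrixD(1)]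
  show "\<epsilon> (dmul (U i j) (V k l)) = \<epsilon> (U i j) * \<epsilon> (V k l)"
    using comatrixD(3)[OF comatrix_dmul[OF cm], of "(i, k)" "(j, l)"]
    by (simp add: delta_product comatrixD(3)[OF cm(1)] comatrixD(3)[OF cm(2)])
qed

lemma comult_dmul: "comult G (dmul a b) = tensor_mult dmul dmul (comult G a) (comult G b)"
proof (rule cbilinear_eq_coefficients[where a = a and b = b])
  show "cbilinear (\<lambda>a b. comult G (dmul a b))" "cbilinear (\<lambda>a b. tensor_mult dmul dmul (comult G a) (comult G b))"
    unfolding tensor_mult_def by (intro lin)+
  fix m n U V i j k l
  assume "unitary_comatrix G {..<m::nat} U" "unitary_comatrix G {..<n::nat} V"
  note cm = this[THEN unitary_comatrixD(1)]
  have "tensor_mult dmul dmul (comult G (U i j)) (comult G (V k l)) =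
      (\<Sum>p<m. \<Sum>q<n. dmul (U i p) (V k q) \<otimes> dmul (U p j) (V q l))"
    unfolding tensor_mult_def comatrixD(2)[OF cm(1)] comatrixD(2)[OF cm(2)]
    by (subst tensor_lift_sum tensor_lift_tensor, (intro lin)[1])+ simp
  then show "comult G (dmul (U i j) (V k l)) = tensor_mult dmul dmul (comult G (U i j)) (comult G (V k l))"
    using comatrixD(2)[OF comatrix_dmul[OF cm], of "(i, k)" "(j, l)"] by (simp add: sum_pair)
qed

text \<open>The linear part of the antilinear involution \<open>dst\<close>, split off so that
  linearity arguments apply to it.\<close>

definition tau :: "'h \<Rightarrow> 'h" where
  "tau a = L (\<lambda>b c. L (\<lambda>b1 b2. (ustar b1 * vstar c) *\<^sub>C b2) b) a"

definition dst :: "'h \<Rightarrow> 'h" where "dst a = tau (st a)"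

text \<open>Dual to the map \<omega> -> u S(\<omega>) u^-1.\<close>

definition dS :: "'h \<Rightarrow> 'h" where
  "dS a = L (\<lambda>b c. L (\<lambda>b1 b2. (u b1 * v c) *\<^sub>C S b2) b) a"

lemma tau_clinear: "clinear tau" and dS_clinear: "clinear dS"
  unfolding tau_def[abs_def] dS_def[abs_def] by (intro lin)+

lemma clinear_compose_tau [lin]: "clinear f \<Longrightarrow> clinear (\<lambda>x. tau (f x))"
  and clinear_compose_dS [lin]: "clinear f \<Longrightarrow> clinear (\<lambda>x. dS (f x))"
  by (rule clinearI; simp add: clinear_add clinear_scaleC tau_clinear dS_clinear)+

lemma dst_add: "dst (a + b) = dst a + dst b"
  and dst_scaleC: "dst (c *\<^sub>C a) = cnj c *\<^sub>C dst a"
  by (simp_all add: dst_def st_add st_scaleC clinear_add clinear_scaleC tau_clinear)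

lemma dst_zero [simp]: "dst 0 = 0" "dS 0 = 0"
  by (simp_all add: dst_def clinear_zero tau_clinear dS_clinear)

lemma dst_conjm: "dst (conjm I A W B i j) = conjm I (\<lambda>i z. cnj (A i z)) (\<lambda>z w. dst (W z w)) (\<lambda>w j. cnj (B w j)) i j"
proof -
  have "st (conjm I A W B i j) = conjm I (\<lambda>i z. cnj (A i z)) (\<lambda>z w. st (W z w)) (\<lambda>w j. cnj (B w j)) i j"
    by (simp add: conjm_def st_sum st_scaleC)
  then show ?thesis by (simp add: dst_def clinear_conjm[OF tau_clinear])
qed

lemma tau_comatrix:
  assumes "comatrix G I U"
  shows "tau (U i j) = conjm I (\<lambda>i z. ustar (U i z)) U (\<lambda>w j. vstar (U w j)) i j"
proof -
  have "tau (U i j) = (\<Sum>l\<in>I. \<Sum>k\<in>I. (ustar (U i k) * vstar (U l j)) *\<^sub>C U k l)"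
    unfolding tau_def by (subst lift_comatrix[OF assms], (intro lin)[1])+ simp
  then show ?thesis by (subst (asm) sum.swap) (simp add: conjm_def)
qed

lemma dst_coefficient:
  assumes "unitary_comatrix G I U"
  shows "dst (U i j) = conjm I (\<lambda>i z. v (U z i)) (\<lambda>i j. st (U i j)) (\<lambda>w j. u (U j w)) i j"
  unfolding dst_def tau_comatrix[OF comatrix_star[OF unitary_comatrixD(1)[OF assms]]]
  by (simp add: ustar_coefficient[OF assms])

text \<open>Combined with the convolution identities for \<open>dS\<close> below, this says that
  \<open>U\<close> stays unitary for \<open>H\<close>.\<close>

lemma dS_coefficient:
  assumes "unitary_comatrix G I U"
  shows "dS (U i j) = dst (U j i)"
proof -
  have "dS (U i j) = (\<Sum>l\<in>I. \<Sum>k\<in>I. (u (U i k) * v (U l j)) *\<^sub>C st (U l k))"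
    unfolding dS_def by (subst lift_comatrix[OF unitary_comatrixD(1)[OF assms]], (intro lin)[1])+ (simp add: S_coefficient[OF assms])
  then show ?thesis by (simp add: dst_coefficient[OF assms] conjm_def mult.commute)
qed

lemma comatrix_dst:
  assumes "unitary_comatrix G I U"
  shows "comatrix G I (\<lambda>i j. dst (U i j))"
  unfolding dst_coefficient[OF assms]
proof (rule comatrix_conjm[OF comatrix_star[OF unitary_comatrixD(1)[OF assms]]])
  note cm = comatrixD[OF unitary_comatrixD(1)[OF assms]]
  show "(\<Sum>z\<in>I. v (U z i) * u (U j z)) = delta I i j" for i j
    using u_v_inverse(1)[OF assms, of j i] by (simp add: mult.commute delta_commute)
  show "(\<Sum>z\<in>I. u (U z i) * v (U j z)) = delta I i j" for i j
    using u_v_inverse(2)[OF assms, of j i] by (simp add: mult.commute delta_commute)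
  show "v (U z i) = 0" if "i \<notin> I" for i z using that by (simp add: cm)
  show "u (U j w) = 0" if "j \<notin> I" for j w using that by (simp add: cm)
qed

lemma conj_bilinear_dst: "conj_bilinear (\<lambda>a b. dst a \<otimes> dst b)"
  by (simp add: conj_bilinear_def dst_add dst_scaleC tensor_add_left tensor_add_right
      tensor_scaleC_left tensor_scaleC_right)

lemma comult_dst: "comult G (dst a) = tensor_star dst dst (comult G a)"
proof (induction a rule: cqg_induct)
  case (coefficient n U i j)
  show ?case
    by (simp add: comatrixD(2)[OF comatrix_dst[OF coefficient]] tensor_star_def
        comatrixD(2)[OF unitary_comatrixD(1)[OF coefficient]] tensor_lift_conj_sum[OF conj_bilinear_dst]
        tensor_lift_conj_tensor[OF conj_bilinear_dst])
qed (simp_all add: dst_add dst_scaleC clinear_add clinear_scaleC comult_clinear tensor_star_def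
      tensor_lift_conj_add[OF conj_bilinear_dst] tensor_lift_conj_scaleC[OF conj_bilinear_dst])

text \<open>The two applications contribute conjugated matrices of u and u^-1 on either side, which
  cancel in pairs.\<close>

lemma dst_dst [simp]: "dst (dst a) = a"
proof (induction a rule: cqg_induct)
  case (coefficient n U i j)
  define I where "I = {..<n}"
  have U: "unitary_comatrix G I U" using coefficient by (simp add: I_def)
  note cm = comatrixD[OF unitary_comatrixD(1)[OF U]]
  have "dst (dst (U i j)) = conjm I (\<lambda>i z. cnj (v (U z i))) (\<lambda>z w. tau (U z w)) (\<lambda>w j. cnj (u (U j w))) i j"
    by (simp add: dst_coefficient[OF U] dst_conjm dst_def[of "st _"])
  also have "(\<lambda>z w. tau (U z w)) = conjm I (\<lambda>z p. cnj (u (U p z))) U (\<lambda>q w. cnj (v (U w q)))"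
    by (intro ext) (simp add: tau_comatrix[OF unitary_comatrixD(1)[OF U]] ustar_coefficient[OF U])
  also have "conjm I (\<lambda>i z. cnj (v (U z i))) \<dots> (\<lambda>w j. cnj (u (U j w))) i j = conjm I (delta I) U (delta I) i j"
    unfolding conjm_conjm
  proof (rule conjm_cong)
    fix z
    have "cnj (\<Sum>k\<in>I. u (U z k) * v (U k i)) = delta I i z" "cnj (\<Sum>k\<in>I. u (U j k) * v (U k z)) = delta I z j"
      by (simp_all only: u_v_inverse[OF U] cnj_delta delta_commute)
    then show "(\<Sum>k\<in>I. cnj (v (U k i)) * cnj (u (U z k))) = delta I i z"
      "(\<Sum>k\<in>I. cnj (v (U k z)) * cnj (u (U j k))) = delta I z j"
      by (simp_all add: mult.commute)
  qed simp
  also have "\<dots> = U i j"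
  proof (cases "i \<in> I \<and> j \<in> I")
    case True
    then show ?thesis by (simp add: conjm_delta cm)
  next
    case False
    then show ?thesis by (auto simp: conjm_def delta_notin cm)
  qed
  finally show ?case .
qed (simp_all add: dst_add dst_scaleC)

text \<open>Since u is a contraction of Omega over U and U^*, summing the deformed product against
  it cancels Omega^* and leaves U U^* = 1. The surviving Omega rebuilds u, which the factor u^-1 of
  \<open>dS\<close> cancels. In the second identity u and u^-1 exchange roles, as do Omega and
  Omega^*.\<close>

lemma dS_convolution:
  assumes U: "unitary_comatrix G I U"
  shows "(\<Sum>j\<in>I. dmul (U i j) (dS (U j m))) = delta I i m *\<^sub>C \<one>"
    "(\<Sum>j\<in>I. dmul (dS (U i j)) (U j m)) = delta I i m *\<^sub>C \<one>"
proof -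
  note U' = unitary_comatrixD[OF U] note cm = comatrixD[OF U'(1)] note C = comatrix_star[OF U'(1)]
  let ?V = "\<lambda>i j. st (U i j)"
  have dS: "dS (U j m) = (\<Sum>l\<in>I. v (U l m) *\<^sub>C (\<Sum>k\<in>I. u (U j k) *\<^sub>C st (U l k)))" for j m
    by (simp add: dS_coefficient[OF U] dst_coefficient[OF U] conjm_def complex_vector.scale_sum_right scaleC_scaleC)
  have dS': "dS (U j m) = (\<Sum>k\<in>I. u (U j k) *\<^sub>C (\<Sum>l\<in>I. v (U l m) *\<^sub>C st (U l k)))" for j m
    unfolding dS by (simp add: complex_vector.scale_sum_right scaleC_scaleC mult.commute) (rule sum.swap)
  have pairs: "(\<Sum>z\<in>I \<times> I. f z *\<^sub>C (delta I (fst z) (snd z) *\<^sub>C \<one>)) = (\<Sum>r\<in>I. f (r, r)) *\<^sub>C \<one>" for f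
  proof -
    have "(\<Sum>z\<in>I \<times> I. f z *\<^sub>C (delta I (fst z) (snd z) *\<^sub>C \<one>)) =
        (\<Sum>r\<in>I. \<Sum>s\<in>I. f (r, s) *\<^sub>C (delta I r s *\<^sub>C \<one>))"
      unfolding sum_pair by simp
    also have "\<dots> = (\<Sum>r\<in>I. f (r, r) *\<^sub>C \<one>)"
    proof (rule sum.cong[OF refl])
      fix r assume "r \<in> I"
      then have "(\<Sum>s\<in>I. delta I r s *\<^sub>C (f (r, s) *\<^sub>C \<one>)) = f (r, r) *\<^sub>C \<one>"
        by (intro sum_delta_scaleC cm(1)) simp
      then show "(\<Sum>s\<in>I. f (r, s) *\<^sub>C (delta I r s *\<^sub>C \<one>)) = f (r, r) *\<^sub>C \<one>"
        by (simp add: scaleC_scaleC mult.commute)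
    qed
    finally show ?thesis by (simp add: complex_vector.scale_sum_left)
  qed
  have rr: "(\<Sum>w\<in>I \<times> I. delta I (fst w) (snd w) *\<^sub>C f w) = (\<Sum>r\<in>I. f (r, r))" for f :: "_ \<Rightarrow> 'h"
  proof -
    have "(\<Sum>w\<in>I \<times> I. delta I (fst w) (snd w) *\<^sub>C f w) = (\<Sum>r\<in>I. \<Sum>s\<in>I. delta I r s *\<^sub>C f (r, s))"
      unfolding sum_pair by simp
    also have "\<dots> = (\<Sum>r\<in>I. f (r, r))"
      by (intro sum.cong refl sum_delta_scaleC cm(1)) simp
    finally show ?thesis .
  qed
  have "(\<Sum>y\<in>I \<times> I. u (U (fst y) (snd y)) *\<^sub>C dmul (U i (fst y)) (st (U l (snd y)))) = u (U i l) *\<^sub>C \<one>" for l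
  proof -
    have d: "(\<Sum>y\<in>I \<times> I. sim U ?V w y * u (U (fst y) (snd y))) = delta I (fst w) (snd w)" for w
    proof -
      have "(\<Sum>y\<in>I \<times> I. sim U ?V w y * u (U (fst y) (snd y))) = (\<Sum>t\<in>I. \<Sum>y\<in>I \<times> I. sim U ?V w y * sgm U ?V y (t, t))"
        by (subst sum.swap) (simp add: u_coefficient[OF U] sgm_def sum_distrib_left)
      also have "\<dots> = (\<Sum>t\<in>I. delta I (fst w) t * delta I (snd w) t)"
        unfolding sgm_sim[OF U'(1) C] by (simp add: delta_product)
      also have "\<dots> = delta I (snd w) (fst w)"
        by (rule sum_delta_times) (simp_all add: cm delta_notin)
      finally show ?thesis by (simp add: delta_commute)
    qed
    have "(\<Sum>y\<in>I \<times> I. u (U (fst y) (snd y)) *\<^sub>C dmul (U i (fst y)) (st (U l (snd y)))) =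
        conjm (I \<times> I) (sgm U ?V) (kron G U ?V) (\<lambda>w _. delta I (fst w) (snd w)) (i, l) ()"
      unfolding d[symmetric] sum_conjm_right[symmetric] by (simp add: dmul_comatrix[OF U'(1) C])
    also have "\<dots> = (\<Sum>z\<in>I \<times> I. sgm U ?V (i, l) z *\<^sub>C (\<Sum>w\<in>I \<times> I. delta I (fst w) (snd w) *\<^sub>C kron G U ?V z w))"
      by (simp add: conjm_def complex_vector.scale_sum_right scaleC_scaleC)
    also have "\<dots> = (\<Sum>z\<in>I \<times> I. sgm U ?V (i, l) z *\<^sub>C (delta I (fst z) (snd z) *\<^sub>C \<one>))"
      unfolding rr by (simp add: kron_def U'(3))
    also have "\<dots> = u (U i l) *\<^sub>C \<one>"
      unfolding pairs by (simp add: sgm_def u_coefficient[OF U])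
    finally show ?thesis .
  qed
  then have 1: "(\<Sum>j\<in>I. \<Sum>k\<in>I. u (U j k) *\<^sub>C dmul (U i j) (st (U l k))) = u (U i l) *\<^sub>C \<one>" for l
    by (simp add: sum_pair)
  have "(\<Sum>j\<in>I. dmul (U i j) (dS (U j m))) = (\<Sum>l\<in>I. v (U l m) *\<^sub>C (\<Sum>j\<in>I. \<Sum>k\<in>I. u (U j k) *\<^sub>C dmul (U i j) (st (U l k))))"
    unfolding dS by (simp add: dmul_sum dmul_simps complex_vector.scale_sum_right) (rule sum.swap)
  also have "\<dots> = (\<Sum>l\<in>I. u (U i l) * v (U l m)) *\<^sub>C \<one>"
    unfolding 1 by (simp add: scaleC_scaleC complex_vector.scale_sum_left mult.commute)
  finally show "(\<Sum>j\<in>I. dmul (U i j) (dS (U j m))) = delta I i m *\<^sub>C \<one>"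
    by (simp add: u_v_inverse[OF U])
  have "(\<Sum>y\<in>I \<times> I. v (U (fst y) (snd y)) *\<^sub>C dmul (st (U (fst y) k)) (U (snd y) m)) = v (U k m) *\<^sub>C \<one>" for k
  proof -
    have d: "(\<Sum>y\<in>I \<times> I. v (U (fst y) (snd y)) * sgm ?V U y z) = delta I (fst z) (snd z)" for z
    proof -
      have "(\<Sum>y\<in>I \<times> I. v (U (fst y) (snd y)) * sgm ?V U y z) = (\<Sum>t\<in>I. \<Sum>y\<in>I \<times> I. sim ?V U (t, t) y * sgm ?V U y z)"
        by (subst sum.swap) (simp add: u_coefficient[OF U] sim_def sum_distrib_right)
      also have "\<dots> = (\<Sum>t\<in>I. delta I t (fst z) * delta I t (snd z))"
        unfolding sgm_sim[OF C U'(1)] by (simp add: delta_product)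
      also have "\<dots> = delta I (fst z) (snd z)"
        by (rule sum_delta_times) (simp_all add: cm delta_notin)
      finally show ?thesis .
    qed
    have "(\<Sum>y\<in>I \<times> I. v (U (fst y) (snd y)) *\<^sub>C dmul (st (U (fst y) k)) (U (snd y) m)) =
        conjm (I \<times> I) (\<lambda>_ z. delta I (fst z) (snd z)) (kron G ?V U) (sim ?V U) () (k, m)"
      unfolding d[symmetric] sum_conjm_left[symmetric] by (simp add: dmul_comatrix[OF C U'(1)])
    also have "\<dots> = (\<Sum>w\<in>I \<times> I. sim ?V U w (k, m) *\<^sub>C (\<Sum>z\<in>I \<times> I. delta I (fst z) (snd z) *\<^sub>C kron G ?V U z w))"
      unfolding conjm_def by (subst sum.swap) (simp add: complex_vector.scale_sum_right scaleC_scaleC mult.commute)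
    also have "\<dots> = (\<Sum>w\<in>I \<times> I. sim ?V U w (k, m) *\<^sub>C (delta I (fst w) (snd w) *\<^sub>C \<one>))"
      unfolding rr by (simp add: kron_def U'(2))
    also have "\<dots> = v (U k m) *\<^sub>C \<one>"
      unfolding pairs by (simp add: sim_def u_coefficient[OF U])
    finally show ?thesis .
  qed
  then have 2: "(\<Sum>l\<in>I. \<Sum>j\<in>I. v (U l j) *\<^sub>C dmul (st (U l k)) (U j m)) = v (U k m) *\<^sub>C \<one>" for k
    by (simp add: sum_pair)
  have "(\<Sum>j\<in>I. dmul (dS (U i j)) (U j m)) = (\<Sum>k\<in>I. u (U i k) *\<^sub>C (\<Sum>l\<in>I. \<Sum>j\<in>I. v (U l j) *\<^sub>C dmul (st (U l k)) (U j m)))"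
    unfolding dS' by (simp add: dmul_sum dmul_simps complex_vector.scale_sum_right) (subst sum_rotate3, intro sum.cong refl sum.swap)
  also have "\<dots> = (\<Sum>k\<in>I. u (U i k) * v (U k m)) *\<^sub>C \<one>"
    unfolding 2 by (simp add: scaleC_scaleC complex_vector.scale_sum_left)
  finally show "(\<Sum>j\<in>I. dmul (dS (U i j)) (U j m)) = delta I i m *\<^sub>C \<one>"
    by (simp add: u_v_inverse[OF U])
qed

lemma dS_antipode:
  "L (\<lambda>b c. dmul (dS b) c) a = \<epsilon> a *\<^sub>C \<one>" "L (\<lambda>b c. dmul b (dS c)) a = \<epsilon> a *\<^sub>C \<one>"
proof -
  show "L (\<lambda>b c. dmul (dS b) c) a = \<epsilon> a *\<^sub>C \<one>"
  proof (rule clinear_eq_coefficients[where a = a])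
    fix n U i j assume U: "unitary_comatrix G {..<n::nat} U"
    show "L (\<lambda>b c. dmul (dS b) c) (U i j) = \<epsilon> (U i j) *\<^sub>C \<one>"
      by (subst lift_comatrix[OF unitary_comatrixD(1)[OF U]], (intro lin)[1])
        (simp add: dS_convolution[OF U] comatrixD(3)[OF unitary_comatrixD(1)[OF U]])
  qed (intro lin)+
  show "L (\<lambda>b c. dmul b (dS c)) a = \<epsilon> a *\<^sub>C \<one>"
  proof (rule clinear_eq_coefficients[where a = a])
    fix n U i j assume U: "unitary_comatrix G {..<n::nat} U"
    show "L (\<lambda>b c. dmul b (dS c)) (U i j) = \<epsilon> (U i j) *\<^sub>C \<one>"
      by (subst lift_comatrix[OF unitary_comatrixD(1)[OF U]], (intro lin)[1])
        (simp add: dS_convolution[OF U] comatrixD(3)[OF unitary_comatrixD(1)[OF U]])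
  qed (intro lin)+
qed

text \<open>The matrix dS(M) is a left inverse and N a right inverse of the matrix M of deformed
  products, so they coincide.\<close>

lemma dS_dmul: "dS (dmul a b) = dmul (dS b) (dS a)"
proof (rule cbilinear_eq_coefficients[where a = a and b = b])
  show "cbilinear (\<lambda>a b. dS (dmul a b))" "cbilinear (\<lambda>a b. dmul (dS b) (dS a))" by (intro lin)+
  fix m n U V i j k l
  assume U: "unitary_comatrix G {..<m::nat} U" and V: "unitary_comatrix G {..<n::nat} V"
  define I J where "I = {..<m}" and "J = {..<n}"
  have U: "unitary_comatrix G I U" and V: "unitary_comatrix G J V" using U V by (simp_all add: I_def J_def)
  note cm = unitary_comatrixD(1)[OF U] unitary_comatrixD(1)[OF V]
  define M where "M p q = dmul (U (fst p) (fst q)) (V (snd p) (snd q))" for p q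
  define N where "N p q = dmul (dS (V (snd p) (snd q))) (dS (U (fst p) (fst q)))" for p q
  have M: "comatrix G (I \<times> J) M" using comatrix_dmul[OF cm] by (simp add: M_def[abs_def])
  have SM: "(\<Sum>q\<in>I \<times> J. dmul (dS (M p q)) (M q r)) = delta (I \<times> J) p r *\<^sub>C \<one>" for p r
    using dS_antipode(1)[of "M p r"]
    by (subst (asm) lift_comatrix[OF M], (intro lin)[1]) (simp add: comatrixD(3)[OF M])
  have MN: "(\<Sum>q\<in>I \<times> J. dmul (M p q) (N q r)) = delta (I \<times> J) p r *\<^sub>C \<one>" for p r
  proof -
    have "(\<Sum>q\<in>I \<times> J. dmul (M p q) (N q r)) = (\<Sum>x\<in>I. \<Sum>y\<in>J. dmul (U (fst p) x)
        (dmul (dmul (V (snd p) y) (dS (V y (snd r)))) (dS (U x (fst r)))))"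
      unfolding sum_pair by (simp add: M_def N_def dmul_assoc)
    also have "\<dots> = (\<Sum>x\<in>I. dmul (U (fst p) x) (dmul (delta J (snd p) (snd r) *\<^sub>C \<one>) (dS (U x (fst r)))))"
      unfolding dmul_sum[symmetric] dS_convolution[OF V] ..
    also have "\<dots> = delta J (snd p) (snd r) *\<^sub>C (\<Sum>x\<in>I. dmul (U (fst p) x) (dS (U x (fst r))))"
      by (simp add: dmul_simps complex_vector.scale_sum_right)
    finally show ?thesis
      by (simp add: dS_convolution[OF U] delta_product scaleC_scaleC mult.commute)
  qed
  have "dS (M p r) = N p r" for p r
  proof -
    have "dS (M p r) = (\<Sum>q\<in>I \<times> J. delta (I \<times> J) q r *\<^sub>C dS (M p q))"
      by (rule sum_delta_scaleC(2)[symmetric]) (simp_all add: comatrixD(1,5)[OF M])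
    also have "\<dots> = (\<Sum>q\<in>I \<times> J. dmul (dS (M p q)) (\<Sum>s\<in>I \<times> J. dmul (M q s) (N s r)))"
      unfolding MN by (simp add: dmul_simps)
    also have "\<dots> = (\<Sum>s\<in>I \<times> J. dmul (\<Sum>q\<in>I \<times> J. dmul (dS (M p q)) (M q s)) (N s r))"
      unfolding dmul_sum dmul_assoc by (rule sum.swap)
    also have "\<dots> = (\<Sum>s\<in>I \<times> J. delta (I \<times> J) p s *\<^sub>C N s r)"
      unfolding SM by (simp add: dmul_simps)
    also have "\<dots> = N p r"
    proof (rule sum_delta_scaleC)
      show "N p r = 0" if "p \<notin> I \<times> J"
        using that comatrixD(4)[OF cm(1)] comatrixD(4)[OF cm(2)] by (cases p) (auto simp: N_def)
    qed (rule comatrixD(1)[OF M])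
    finally show ?thesis .
  qed
  from this[of "(i, k)" "(j, l)"] show "dS (dmul (U i j) (V k l)) = dmul (dS (V k l)) (dS (U i j))"
    by (simp add: M_def N_def)
qed

text \<open>On coefficients \<open>dst\<close> is the transposed \<open>dS\<close>. Unitarity of
  Omega enters here: conjugation and transposition exchange \<open>sgm\<close> and
  \<open>sim\<close>, so the conjugated product is again a deformed product and
  \<open>dS_dmul\<close> applies.\<close>

lemma dst_dmul: "dst (dmul a b) = dmul (dst b) (dst a)"
proof (induction a rule: cqg_induct)
  case (coefficient m U i j)
  note U = coefficient
  show ?case
  proof (induction b rule: cqg_induct)
    case (coefficient n V k l)
    note V = coefficient
    note cm = unitary_comatrixD(1)[OF U] unitary_comatrixD(1)[OF V]
    let ?K = "{..<m} \<times> {..<n}"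
    have cnj: "cnj (sgm U V p q) = sim U V q p" "cnj (sim U V p q) = sgm U V q p" for p q
      by (simp_all add: sgm_def sim_def si_def S_coefficient[OF U] S_coefficient[OF V])
    have "dst (dmul (U i j) (V k l)) =
        conjm ?K (\<lambda>i z. sim U V z i) (\<lambda>z w. dS (kron G U V w z)) (\<lambda>w j. sgm U V j w) (i, k) (j, l)"
      unfolding dmul_comatrix[OF cm] dst_conjm by (simp add: cnj dS_coefficient[OF unitary_kron[OF U V]])
    also have "\<dots> = conjm ?K (sgm U V) (\<lambda>w z. dS (kron G U V w z)) (sim U V) (j, l) (i, k)"
      by (rule conjm_transpose)
    also have "\<dots> = dS (dmul (U j i) (V l k))"
      unfolding dmul_comatrix[OF cm] by (rule clinear_conjm[OF dS_clinear, symmetric])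
    also have "\<dots> = dmul (dst (V k l)) (dst (U i j))"
      by (simp add: dS_dmul dS_coefficient[OF U] dS_coefficient[OF V])
    finally show ?case .
  qed (simp_all add: dst_add dst_scaleC dmul_simps)
qed (simp_all add: dst_add dst_scaleC dmul_simps)

abbreviation H where "H \<equiv> deformed_quantum_group G \<Omega>"

lemma deformed_simps [simp]:
  "hone H = \<one>" "comult H = comult G" "counit H = \<epsilon>" "hstar H = dst"
  by (simp_all add: deformed_quantum_group_def dual_inverse_u dst_def[abs_def] tau_def)

text \<open>The record determines the product by its values under all linear functionals. These
  separate points, so it suffices to compute them for \<open>dmul\<close>.\<close>

lemma hmult_deformed [simp]: "hmult H = dmul"
proof (intro ext)
  fix a b
  have dc: "clinear (dual_comult G \<omega>)" "dual_comult G \<omega> (a \<otimes> b) = \<omega> (a \<cdot> b)" if "clinear \<omega>" for \<omega> a b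
  proof -
    have [lin]: "clinear f \<Longrightarrow> clinear (\<lambda>x. \<omega> (f x))" for f :: "'h \<Rightarrow> 'h"
      by (rule clinearI; simp add: clinear_add clinear_scaleC that)
    have "cbilinear (\<lambda>a b. \<omega> (a \<cdot> b))" by (intro lin)
    then show "clinear (dual_comult G \<omega>)" "dual_comult G \<omega> (a \<otimes> b) = \<omega> (a \<cdot> b)"
      unfolding dual_comult_def by (simp_all add: clinear_tensor_lift tensor_lift_tensor)
  qed
  have [lin]: "clinear (conv (comult2 G) f g)" if "clinear f" "clinear g" for f g
    unfolding conv_def
  proof -
    have "clinear (comult2 G)" unfolding comult2_def
      by (rule clinear_tensor_comult[OF comult_clinear comult_clinear])
    then show "clinear (\<lambda>a. tensor_lift (\<lambda>b c. f b * g c) (comult2 G a))"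
      using that by (intro lin)
  qed
  have key: "conv (comult2 G) \<Omega> (conv (comult2 G) (dual_comult G \<omega>) (tensor_lift si)) (a \<otimes> b) = \<omega> (dmul a b)"
    if \<omega>: "clinear \<omega>" for \<omega> a b
  proof (rule cbilinear_eq_coefficients[where a = a and b = b])
    let ?f = "conv (comult2 G) \<Omega> (conv (comult2 G) (dual_comult G \<omega>) (tensor_lift si))"
    have f: "clinear ?f" by (intro lin \<Omega>_clinear dc[OF \<omega>] clinear_tensor_lift)
    have [lin]: "clinear f \<Longrightarrow> clinear (\<lambda>x. ?f (f x))" for f :: "'h \<Rightarrow> ('h, 'h) tensor"
      by (rule clinearI; simp add: clinear_add clinear_scaleC f)
    have [lin]: "clinear f \<Longrightarrow> clinear (\<lambda>x. \<omega> (f x))" for f :: "'h \<Rightarrow> 'h"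
      by (rule clinearI; simp add: clinear_add clinear_scaleC \<omega>)
    show "cbilinear (\<lambda>a b. ?f (a \<otimes> b))" "cbilinear (\<lambda>a b. \<omega> (dmul a b))" by (intro lin)+
    fix m n U V i j k l
    assume "unitary_comatrix G {..<m::nat} U" "unitary_comatrix G {..<n::nat} V"
    note cm = this[THEN unitary_comatrixD(1)]
    have "?f (U i j \<otimes> V k l) = (\<Sum>p<m. \<Sum>q<n. sg (U i p) (V k q) *
        (\<Sum>r<m. \<Sum>s<n. \<omega> (U p r \<cdot> V q s) * si (U r j) (V s l)))"
    proof -
      have g: "clinear (conv (comult2 G) (dual_comult G \<omega>) (tensor_lift si))"
        by (intro lin dc[OF \<omega>] clinear_tensor_lift)
      show ?thesis
        unfolding conv_comult2[OF cm \<Omega>_clinear g]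
          conv_comult2[OF cm dc(1)[OF \<omega>] clinear_tensor_lift[OF si_cbilinear]]
        by (simp add: dc[OF \<omega>] tensor_lift_tensor[OF si_cbilinear])
    qed
    also have "\<dots> = (\<Sum>p<m. \<Sum>q<n. sg (U i p) (V k q) *\<^sub>C
        (\<Sum>r<m. \<Sum>s<n. si (U r j) (V s l) *\<^sub>C \<omega> (U p r \<cdot> V q s)))"
      by (simp add: mult.commute)
    also have "\<dots> = \<omega> (dmul (U i j) (V k l))"
      unfolding dmul_comatrix[OF cm] clinear_conjm[OF \<omega>]
      by (subst kron_conjm) (rule conjm_cong; simp add: sgm_def sim_def kron_def)
    finally show "?f (U i j \<otimes> V k l) = \<omega> (dmul (U i j) (V k l))" .
  qed
  have "hmult H a b = (THE c. \<forall>\<omega> :: 'h \<Rightarrow> complex. clinear \<omega> \<longrightarrow> \<omega> c = \<omega> (dmul a b))"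
    unfolding deformed_quantum_group_def dual_star2_eq using key
    by (simp cong: imp_cong)
  also have "\<dots> = dmul a b"
    by (rule the_equality) (auto intro: clinear_separates)
  finally show "hmult H a b = dmul a b" .
qed

lemma hopf_deformed: "hopf_star_algebra H"
proof -
  have "is_antipode H dS"
    by (simp add: is_antipode_def dS_clinear dS_antipode)
  then show ?thesis
    unfolding hopf_star_algebra_def
    by (auto simp: dmul_cbilinear dmul_assoc dst_add dst_scaleC dst_dmul comult_clinear counit_clinear coassoc
        counit_left counit_right comult_dmul comult_one comult_dst counit_dmul)
qed

lemma unitary_rep_deformed:
  assumes "unitary_rep G n U"
  shows "unitary_rep H n U"
proof -
  let ?V = "\<lambda>i j. if i < n \<and> j < n then U i j else 0"
  note V = unitary_rep_comatrix[OF assms]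
  have "(\<Sum>k<n. dmul (dst (U k i)) (U k j)) = (if i = j then \<one> else 0)"
    "(\<Sum>k<n. dmul (U i k) (dst (U j k))) = (if i = j then \<one> else 0)" if "i < n" "j < n" for i j
  proof -
    have "(\<Sum>k<n. dmul (dst (U k i)) (U k j)) = (\<Sum>k<n. dmul (dS (?V i k)) (?V k j))"
      "(\<Sum>k<n. dmul (U i k) (dst (U j k))) = (\<Sum>k<n. dmul (?V i k) (dS (?V k j)))"
      using that unfolding dS_coefficient[OF V] by simp_all
    then show "(\<Sum>k<n. dmul (dst (U k i)) (U k j)) = (if i = j then \<one> else 0)"
      "(\<Sum>k<n. dmul (U i k) (dst (U j k))) = (if i = j then \<one> else 0)"
      using that unfolding dS_convolution[OF V] by (simp_all add: delta_def scaleC_one)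
  qed
  with assms show ?thesis by (simp add: unitary_rep_def)
qed

lemma cqg_deformed: "cqg_algebra H"
proof -
  have "{U i j | U n i j. unitary_rep G n U \<and> i < n \<and> j < n} \<subseteq> {U i j | U n i j. unitary_rep H n U \<and> i < n \<and> j < n}"
    using unitary_rep_deformed by blast
  then have "complex_vector.span {U i j | U n i j. unitary_rep H n U \<and> i < n \<and> j < n} = UNIV"
    using complex_vector.span_mono cqg unfolding cqg_algebra_def by blast
  then show ?thesis using hopf_deformed by (simp add: cqg_algebra_def)
qed

end

section \<open>Haar states\<close>

lemma haar_stateD:
  assumes "haar_state K h"
  shows "clinear h" "h (hone K) = 1" "h (hmult K (hstar K a) a) \<in> \<real>\<^sub>\<ge>\<^sub>0"
    "tensor_lift (\<lambda>b c. h b *\<^sub>C c) (comult K a) = h a *\<^sub>C hone K"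
    "tensor_lift (\<lambda>b c. h c *\<^sub>C b) (comult K a) = h a *\<^sub>C hone K"
  using assms by (auto simp: haar_state_def)

text \<open>Invariance of both functionals evaluates (h \<otimes> h') \<Delta>(a) in two
  ways.\<close>

lemma haar_eqI:
  assumes h: "haar_state K h"
  shows "haar K = h"
proof -
  have *: "h' = h" if h': "haar_state K h'" for h'
  proof
    fix a
    have [lin]: "clinear f \<Longrightarrow> clinear (\<lambda>x. h (f x))" "clinear f \<Longrightarrow> clinear (\<lambda>x. h' (f x))" for f :: "'a \<Rightarrow> 'a"
      by (rule clinearI; simp add: clinear_add clinear_scaleC haar_stateD(1)[OF h] haar_stateD(1)[OF h'])+
    have bil: "cbilinear (\<lambda>b c. h b *\<^sub>C c)" "cbilinear (\<lambda>b c. h' c *\<^sub>C b)" by (intro lin)+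
    have "h a = h' (h a *\<^sub>C hone K)"
      by (simp add: clinear_scaleC haar_stateD[OF h'])
    also have "\<dots> = tensor_lift (\<lambda>b c. h b * h' c) (comult K a)"
      unfolding haar_stateD(4)[OF h, symmetric] clinear_tensor_lift_eq[OF haar_stateD(1)[OF h'] bil(1)]
      by (simp add: clinear_scaleC haar_stateD(1)[OF h'])
    also have "\<dots> = h (h' a *\<^sub>C hone K)"
      unfolding haar_stateD(5)[OF h', symmetric] clinear_tensor_lift_eq[OF haar_stateD(1)[OF h] bil(2)]
      by (simp add: clinear_scaleC haar_stateD(1)[OF h] mult.commute)
    also have "\<dots> = h' a"
      by (simp add: clinear_scaleC haar_stateD[OF h])
    finally show "h' a = h a" by simp
  qed
  show ?thesis unfolding haar_def using h * by (rule the_equality[of "haar_state K"])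
qed

locale cqg_haar = cqg G for G :: "'h::complex_vector star_bialgebra" +
  fixes h :: "'h \<Rightarrow> complex"
  assumes haar: "haar_state G h" and haar_faithful: "h (hmult G (hstar G a) a) = 0 \<Longrightarrow> a = 0"
begin

lemmas h_clinear = haar_stateD(1)[OF haar]

lemma clinear_compose_h [lin]: "clinear f \<Longrightarrow> clinear (\<lambda>x. h (f x))"
  by (rule clinearI) (simp_all add: clinear_add clinear_scaleC h_clinear)

lemmas h_simps = clinear_add[OF h_clinear] clinear_scaleC[OF h_clinear] clinear_zero[OF h_clinear]
  clinear_sum[OF h_clinear]

text \<open>Polarization: h(x^* x) is real for x = a + b and for x = a + i b.\<close>

lemma h_hermitian: "h (st a \<cdot> b) = cnj (h (st b \<cdot> a))"
proof -
  have im: "Im (h (st x \<cdot> x)) = 0" for x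
    using haar_stateD(3)[OF haar, of x] by (simp add: complex_nonneg_Reals_iff)
  have "Im (h (st a \<cdot> b) + h (st b \<cdot> a)) = 0"
    using im[of "a + b"] im[of a] im[of b] by (simp add: st_add mul_simps h_simps)
  moreover have "Re (h (st a \<cdot> b)) = Re (h (st b \<cdot> a))"
    using im[of "a + \<i> *\<^sub>C b"] im[of a] im[of b]
    by (simp add: st_add st_scaleC mul_simps h_simps del: complex_vector.scale_minus_left)
  ultimately show ?thesis by (simp add: complex_eq_iff)
qed

text \<open>\<open>sorted_wrt\<close> compares earlier with later entries only, hence both orders of
  the pairing.\<close>

definition orthogonal_list :: "('h \<times> 'b) list \<Rightarrow> bool" where
  "orthogonal_list = sorted_wrt (\<lambda>p q. h (st (fst p) \<cdot> fst q) = 0 \<and> h (st (fst q) \<cdot> fst p) = 0)"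

lemma orthogonal_complement:
  assumes "orthogonal_list xs"
  shows "\<exists>c. \<forall>p\<in>set xs. h (st (fst p) \<cdot> (a - (\<Sum>q\<leftarrow>xs. c (fst q) *\<^sub>C fst q))) = 0"
proof -
  \<comment> \<open>Gram-Schmidt coefficients. If h(e^* e) = 0 the quotient is 0 by convention, and
    faithfulness gives e = 0, so the projection formula still holds.\<close>
  define c where "c e = h (st e \<cdot> a) / h (st e \<cdot> e)" for e
  have "h (st (fst p) \<cdot> (\<Sum>q\<leftarrow>xs. c (fst q) *\<^sub>C fst q)) = h (st (fst p) \<cdot> a)" if "p \<in> set xs" for p
  proof -
    have dec: "h (st (fst p) \<cdot> (\<Sum>q\<leftarrow>ys. c (fst q) *\<^sub>C fst q)) = (\<Sum>q\<leftarrow>ys. c (fst q) * h (st (fst p) \<cdot> fst q))" for ys :: "('h \<times> 'b) list"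
      by (induction ys) (simp_all add: mul_simps h_simps)
    have zero: "(\<Sum>q\<leftarrow>ys. c (fst q) * h (st (fst p) \<cdot> fst q)) = 0"
      if "\<And>q. q \<in> set ys \<Longrightarrow> h (st (fst p) \<cdot> fst q) = 0" for ys :: "('h \<times> 'b) list"
      using that by (induction ys) auto
    have "c (fst p) * h (st (fst p) \<cdot> fst p) = h (st (fst p) \<cdot> a)"
      using haar_faithful[of "fst p"] by (cases "h (st (fst p) \<cdot> fst p) = 0") (auto simp: c_def h_simps)
    moreover obtain ys zs where xs: "xs = ys @ p # zs"
      using \<open>p \<in> set xs\<close> by (auto simp: in_set_conv_decomp)
    have "h (st (fst p) \<cdot> fst q) = 0" if "q \<in> set ys \<or> q \<in> set zs" for q
      using assms that unfolding xs orthogonal_list_def by (auto simp: sorted_wrt_append)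
    ultimately show ?thesis unfolding dec unfolding xs by (simp add: zero)
  qed
  moreover have "h (x \<cdot> (a - b)) = h (x \<cdot> a) - h (x \<cdot> b)" for x b
    by (rule clinear_diff) (intro lin)
  ultimately show ?thesis by (intro exI[of _ c]) simp
qed

lemma orthogonal_decomposition:
  fixes t :: "('h, 'b::complex_vector) tensor"
  shows "\<exists>xs. abs_tensor xs = t \<and> orthogonal_list xs"
proof (induction t rule: tensor.abs_induct)
  case (1 xs)
  show ?case
  proof (induction xs)
    case Nil
    show ?case by (intro exI[of _ "[]"]) (simp add: orthogonal_list_def)
  next
    case (Cons z xs)
    then obtain ys where ys: "abs_tensor ys = abs_tensor xs" "orthogonal_list ys" by blast
    obtain a y where z: "z = (a, y)" by (cases z) auto
    obtain c where c: "\<And>p. p \<in> set ys \<Longrightarrow> h (st (fst p) \<cdot> (a - (\<Sum>q\<leftarrow>ys. c (fst q) *\<^sub>C fst q))) = 0"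
      using orthogonal_complement[OF ys(2), of a] by blast
    define a' where "a' = a - (\<Sum>q\<leftarrow>ys. c (fst q) *\<^sub>C fst q)"
    \<comment> \<open>What is removed from the new first leg goes into the second legs of the old
      entries; their first legs, and so their orthogonality, are untouched.\<close>
    define ws where "ws = map (\<lambda>p. (fst p, snd p + c (fst p) *\<^sub>C y)) ys"
    have "abs_tensor (map (\<lambda>p. (fst p, snd p + c (fst p) *\<^sub>C y)) us) = abs_tensor us + (\<Sum>q\<leftarrow>us. c (fst q) *\<^sub>C fst q) \<otimes> y" for us
      by (induction us) (simp_all add: abs_tensor_Nil abs_tensor_Cons tensor_add_left tensor_add_right
        tensor_scaleC_left tensor_scaleC_right case_prod_unfold split_paired_all)
    then have "abs_tensor ((a', y) # ws) = abs_tensor (z # xs)"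
      by (simp add: ws_def abs_tensor_Cons z ys(1) a'_def flip: tensor_add_left add.assoc)
    moreover have "orthogonal_list ws"
      using ys(2) by (simp add: orthogonal_list_def ws_def sorted_wrt_map)
    moreover have "h (st (fst p) \<cdot> a') = 0 \<and> h (st a' \<cdot> fst p) = 0" if "p \<in> set ws" for p
      using that c h_hermitian[of a' "fst p"] by (auto simp: ws_def a'_def)
    ultimately show ?case
      by (intro exI[of _ "(a', y) # ws"]) (simp add: orthogonal_list_def)
  qed
qed

text \<open>The rule a1 h(a2 b) = S^-1(b1) h(a b2) for a = U i j and b = st (V q l), where the
  inverse antipode of st (V q r) is V r q.\<close>

lemma haar_left_invariance:
  assumes U: "comatrix G I U" and V: "unitary_comatrix G J V"
  shows "(\<Sum>p\<in>I. h (U p j \<cdot> st (V q l)) *\<^sub>C U i p) = (\<Sum>r\<in>J. h (U i j \<cdot> st (V r l)) *\<^sub>C V r q)"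
proof -
  note V' = unitary_comatrixD[OF V] note cm = comatrixD[OF V'(1)]
  note C = comatrix_star[OF V'(1)]
  have inv: "(\<Sum>p\<in>I. \<Sum>s\<in>J. h (U p j \<cdot> st (V s l)) *\<^sub>C (U i p \<cdot> st (V k s))) = h (U i j \<cdot> st (V k l)) *\<^sub>C \<one>" for k
    unfolding haar_stateD(5)[OF haar, symmetric] comult_product[OF U C]
    by (subst tensor_lift_sum tensor_lift_tensor, (intro lin)[1])+ simp
  have "(\<Sum>r\<in>J. h (U i j \<cdot> st (V r l)) *\<^sub>C V r q) = (\<Sum>k\<in>J. (h (U i j \<cdot> st (V k l)) *\<^sub>C \<one>) \<cdot> V k q)"
    by (simp add: mul_simps)
  also have "\<dots> = (\<Sum>k\<in>J. \<Sum>p\<in>I. \<Sum>s\<in>J. h (U p j \<cdot> st (V s l)) *\<^sub>C (U i p \<cdot> (st (V k s) \<cdot> V k q)))"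
    unfolding inv[symmetric] by (simp add: mul_sum mul_simps mul_assoc)
  also have "\<dots> = (\<Sum>p\<in>I. \<Sum>s\<in>J. h (U p j \<cdot> st (V s l)) *\<^sub>C (U i p \<cdot> (\<Sum>k\<in>J. st (V k s) \<cdot> V k q)))"
    by (subst sum_rotate3) (simp add: mul_sum complex_vector.scale_sum_right)
  also have "\<dots> = (\<Sum>p\<in>I. \<Sum>s\<in>J. delta J s q *\<^sub>C (h (U p j \<cdot> st (V s l)) *\<^sub>C U i p))"
    unfolding V'(2) by (simp add: mul_simps scaleC_scaleC mult.commute)
  also have "\<dots> = (\<Sum>p\<in>I. h (U p j \<cdot> st (V q l)) *\<^sub>C U i p)"
    by (intro sum.cong refl sum_delta_scaleC) (simp_all add: cm h_simps)
  finally show ?thesis by (rule sym)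
qed

text \<open>The mirror rule h(a1 b) a2 = h(a b1) S(b2).\<close>

lemma haar_right_invariance:
  assumes U: "comatrix G I U" and V: "unitary_comatrix G J V"
  shows "(\<Sum>p\<in>I. h (U i p \<cdot> V k l) *\<^sub>C U p j) = (\<Sum>q\<in>J. h (U i j \<cdot> V k q) *\<^sub>C st (V l q))"
proof -
  note V' = unitary_comatrixD[OF V] note cm = comatrixD[OF V'(1)]
  have inv: "(\<Sum>p\<in>I. \<Sum>s\<in>J. h (U i p \<cdot> V k s) *\<^sub>C (U p j \<cdot> V s q)) = h (U i j \<cdot> V k q) *\<^sub>C \<one>" for q
    unfolding haar_stateD(4)[OF haar, symmetric] comult_product[OF U V'(1)]
    by (subst tensor_lift_sum tensor_lift_tensor, (intro lin)[1])+ simp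
  have "(\<Sum>q\<in>J. h (U i j \<cdot> V k q) *\<^sub>C st (V l q)) = (\<Sum>q\<in>J. (h (U i j \<cdot> V k q) *\<^sub>C \<one>) \<cdot> st (V l q))"
    by (simp add: mul_simps)
  also have "\<dots> = (\<Sum>q\<in>J. \<Sum>p\<in>I. \<Sum>s\<in>J. h (U i p \<cdot> V k s) *\<^sub>C (U p j \<cdot> (V s q \<cdot> st (V l q))))"
    unfolding inv[symmetric] by (simp add: mul_sum mul_simps mul_assoc)
  also have "\<dots> = (\<Sum>p\<in>I. \<Sum>s\<in>J. h (U i p \<cdot> V k s) *\<^sub>C (U p j \<cdot> (\<Sum>q\<in>J. V s q \<cdot> st (V l q))))"
    by (subst sum_rotate3) (simp add: mul_sum complex_vector.scale_sum_right)
  also have "\<dots> = (\<Sum>p\<in>I. \<Sum>s\<in>J. delta J s l *\<^sub>C (h (U i p \<cdot> V k s) *\<^sub>C U p j))"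
    unfolding V'(3) by (simp add: mul_simps scaleC_scaleC mult.commute)
  also have "\<dots> = (\<Sum>p\<in>I. h (U i p \<cdot> V k l) *\<^sub>C U p j)"
    by (intro sum.cong refl sum_delta_scaleC) (simp_all add: cm h_simps)
  finally show ?thesis by (rule sym)
qed

end

section \<open>The Haar state under the deformation\<close>

locale cocycle_haar = cocycle_deformation G \<Omega> + cqg_haar G h
  for G :: "'h::complex_vector star_bialgebra" and \<Omega> h
begin

text \<open>For the left twisted product \<open>x \<star> y\<close> this says \<open>h(x \<star> y) = h(x (y \<lhd> W))\<close> with
  \<open>W = (u\<^sup>-\<^sup>1)\<^sup>*\<close>.\<close>

lemma haar_twisted_product:
  "L (\<lambda>a1 a2. L (\<lambda>b1 b2. sg a1 b1 * h (a2 \<cdot> b2)) b) a = L (\<lambda>b1 b2. vstar b1 * h (a \<cdot> b2)) b"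
proof (rule clinear_eq_coefficients[where a = a])
  show "clinear (\<lambda>a. L (\<lambda>a1 a2. L (\<lambda>b1 b2. sg a1 b1 * h (a2 \<cdot> b2)) b) a)"
    "clinear (\<lambda>a. L (\<lambda>b1 b2. vstar b1 * h (a \<cdot> b2)) b)" by (intro lin)+
  fix m U i j assume "unitary_comatrix G {..<m::nat} U"
  note U = unitary_comatrixD(1)[OF this]
  show "L (\<lambda>a1 a2. L (\<lambda>b1 b2. sg a1 b1 * h (a2 \<cdot> b2)) b) (U i j) = L (\<lambda>b1 b2. vstar b1 * h (U i j \<cdot> b2)) b"
  proof (rule clinear_eq_star_coefficients[where a = b])
    show "clinear (\<lambda>b. L (\<lambda>a1 a2. L (\<lambda>b1 b2. sg a1 b1 * h (a2 \<cdot> b2)) b) (U i j))"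
      "clinear (L (\<lambda>b1 b2. vstar b1 * h (U i j \<cdot> b2)))" by (intro lin clinear_tensor_lift)+
    fix n V k l assume V: "unitary_comatrix G {..<n::nat} V"
    note C = comatrix_star[OF unitary_comatrixD(1)[OF V]]
    have "L (\<lambda>a1 a2. L (\<lambda>b1 b2. sg a1 b1 * h (a2 \<cdot> b2)) (st (V k l))) (U i j) =
        (\<Sum>p<m. \<Sum>q<n. sg (U i p) (st (V k q)) * h (U p j \<cdot> st (V q l)))"
      by (subst lift_comatrix[OF U] lift_comatrix[OF C], (intro lin)[1])+ simp
    also have "\<dots> = (\<Sum>q<n. sg (\<Sum>p<m. h (U p j \<cdot> st (V q l)) *\<^sub>C U i p) (st (V k q)))"
      by (subst sum.swap) (simp add: sum_sg mult.commute)
    \<comment> \<open>Invariance moves the leg seen by Omega from \<open>U\<close> to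
      \<open>V\<close>, where Omega contracts to u.\<close>
    also have "\<dots> = (\<Sum>q<n. sg (\<Sum>r<n. h (U i j \<cdot> st (V r l)) *\<^sub>C V r q) (st (V k q)))"
      unfolding haar_left_invariance[OF U V] ..
    also have "\<dots> = (\<Sum>r<n. (\<Sum>q<n. sg (V r q) (st (V k q))) * h (U i j \<cdot> st (V r l)))"
      unfolding sum_sg sum_distrib_right by (subst sum.swap) (simp only: mult.commute)
    also have "\<dots> = (\<Sum>r<n. vstar (st (V k r)) * h (U i j \<cdot> st (V r l)))"
      by (simp add: ustar_coefficient[OF V] u_coefficient[OF V])
    also have "\<dots> = L (\<lambda>b1 b2. vstar b1 * h (U i j \<cdot> b2)) (st (V k l))"
      by (subst lift_comatrix[OF C], (intro lin)[1])+ simp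
    finally show "L (\<lambda>a1 a2. L (\<lambda>b1 b2. sg a1 b1 * h (a2 \<cdot> b2)) (st (V k l))) (U i j) =
        L (\<lambda>b1 b2. vstar b1 * h (U i j \<cdot> b2)) (st (V k l))" .
  qed
qed

text \<open>The Omega in front of the product is absorbed by \<open>haar_twisted_product\<close> and
  becomes \<open>vstar\<close>; right invariance turns the Omega^* behind it into
  \<open>v\<close>.\<close>

lemma haar_dmul:
  assumes U: "comatrix G I U" and V: "unitary_comatrix G J V"
  shows "h (dmul (U i j) (V k l)) = (\<Sum>q\<in>J. \<Sum>t\<in>J. vstar (V k q) * h (U i j \<cdot> V q t) * v (V t l))"
proof -
  note V' = unitary_comatrixD[OF V]
  have K: "(\<Sum>p\<in>I. \<Sum>q\<in>J. sg (U i p) (V k q) * h (U p r \<cdot> V q s)) = (\<Sum>q\<in>J. vstar (V k q) * h (U i r \<cdot> V q s))" for r s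
  proof -
    have "(\<Sum>p\<in>I. \<Sum>q\<in>J. sg (U i p) (V k q) * h (U p r \<cdot> V q s)) =
        L (\<lambda>a1 a2. L (\<lambda>b1 b2. sg a1 b1 * h (a2 \<cdot> b2)) (V k s)) (U i r)"
      by (subst lift_comatrix[OF U] lift_comatrix[OF V'(1)], (intro lin)[1])+ simp
    also have "\<dots> = (\<Sum>q\<in>J. vstar (V k q) * h (U i r \<cdot> V q s))"
      unfolding haar_twisted_product by (subst lift_comatrix[OF V'(1)], (intro lin)[1]) simp
    finally show ?thesis .
  qed
  have "dmul (U i j) (V k l) = (\<Sum>p\<in>I. \<Sum>q\<in>J. sg (U i p) (V k q) *\<^sub>C
      (\<Sum>r\<in>I. \<Sum>s\<in>J. si (U r j) (V s l) *\<^sub>C (U p r \<cdot> V q s)))"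
    unfolding dmul_def by (subst lift_comatrix[OF U] lift_comatrix[OF V'(1)], (intro lin)[1])+ simp
  then have "h (dmul (U i j) (V k l)) = (\<Sum>p\<in>I. \<Sum>q\<in>J. \<Sum>r\<in>I. \<Sum>s\<in>J.
      si (U r j) (V s l) * (sg (U i p) (V k q) * h (U p r \<cdot> V q s)))"
    by (simp add: h_simps sum_distrib_left mult.left_commute)
  also have "\<dots> = (\<Sum>p\<in>I. \<Sum>r\<in>I. \<Sum>s\<in>J. \<Sum>q\<in>J. si (U r j) (V s l) * (sg (U i p) (V k q) * h (U p r \<cdot> V q s)))"
    by (intro sum.cong refl sum_rotate3)
  also have "\<dots> = (\<Sum>r\<in>I. \<Sum>s\<in>J. \<Sum>p\<in>I. \<Sum>q\<in>J. si (U r j) (V s l) * (sg (U i p) (V k q) * h (U p r \<cdot> V q s)))"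
    by (rule sum_rotate3)
  also have "\<dots> = (\<Sum>r\<in>I. \<Sum>s\<in>J. si (U r j) (V s l) * (\<Sum>q\<in>J. vstar (V k q) * h (U i r \<cdot> V q s)))"
    unfolding K[symmetric] by (simp add: sum_distrib_left)
  also have "\<dots> = (\<Sum>s\<in>J. \<Sum>q\<in>J. vstar (V k q) * si (\<Sum>r\<in>I. h (U i r \<cdot> V q s) *\<^sub>C U r j) (V s l))"
    unfolding sum_sg sum_distrib_left by (subst sum_rotate3) (simp only: ac_simps)
  also have "\<dots> = (\<Sum>s\<in>J. \<Sum>q\<in>J. \<Sum>t\<in>J. vstar (V k q) * h (U i j \<cdot> V q t) * si (st (V s t)) (V s l))"
    unfolding haar_right_invariance[OF U V] by (simp add: sum_sg sum_distrib_left mult.assoc)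
  also have "\<dots> = (\<Sum>q\<in>J. \<Sum>t\<in>J. vstar (V k q) * h (U i j \<cdot> V q t) * v (V t l))"
    by (subst sum_rotate3) (simp add: u_coefficient[OF V] sum_distrib_left)
  finally show ?thesis .
qed

text \<open>The right action of \<open>W\<close> on \<open>\<complex>[G]\<close>, where \<open>G\<close> acts by translations.\<close>

definition rW :: "'h \<Rightarrow> 'h" where "rW a = L (\<lambda>b c. vstar b *\<^sub>C c) a"

lemma rW_clinear: "clinear rW"
  unfolding rW_def[abs_def] by (intro lin)

lemma clinear_compose_rW [lin]: "clinear f \<Longrightarrow> clinear (\<lambda>x. rW (f x))"
  by (rule clinearI) (simp_all add: clinear_add clinear_scaleC rW_clinear)

text \<open>This makes \<open>h\<close> positive for \<open>H\<close>. The trailing u^-1 of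
  \<open>haar_dmul\<close> cancels the u of the involution, once right invariance has moved that u
  from \<open>U\<close> to \<open>V\<close>.\<close>

lemma haar_dst_dmul: "h (dmul (dst a) b) = h (st (rW a) \<cdot> rW b)"
proof (induction a rule: cqg_induct)
  case (coefficient m U i j)
  note U = coefficient
  show ?case
  proof (rule clinear_eq_coefficients[where a = b])
    show "clinear (\<lambda>b. h (dmul (dst (U i j)) b))" "clinear (\<lambda>b. h (st (rW (U i j)) \<cdot> rW b))" by (intro lin)+
    fix n V k l assume V: "unitary_comatrix G {..<n::nat} V"
    note C = comatrix_star[OF unitary_comatrixD(1)[OF U]] note cmV = comatrixD[OF unitary_comatrixD(1)[OF V]]
    have rWU: "rW (U i j) = (\<Sum>p<m. cnj (v (U p i)) *\<^sub>C U p j)"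
      unfolding rW_def by (subst lift_comatrix[OF unitary_comatrixD(1)[OF U]], (intro lin)[1]) (simp add: ustar_coefficient[OF U])
    have rWV: "rW (V k l) = (\<Sum>q<n. vstar (V k q) *\<^sub>C V q l)"
      unfolding rW_def by (subst lift_comatrix[OF unitary_comatrixD(1)[OF V]], (intro lin)[1]) simp
    have dst: "dst (U i j) = (\<Sum>p<m. v (U p i) *\<^sub>C (\<Sum>r<m. u (U j r) *\<^sub>C st (U p r)))"
      by (simp add: dst_coefficient[OF U] conjm_def complex_vector.scale_sum_right scaleC_scaleC)
    have inner: "(\<Sum>r<m. u (U j r) * h (dmul (st (U p r)) (V k l))) = (\<Sum>q<n. vstar (V k q) * h (st (U p j) \<cdot> V q l))" for p
    proof -
      \<comment> \<open>\<open>vstar\<close> is applied to both sides of right invariance; on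
        adjoints of coefficients it takes the values of u.\<close>
      have R: "(\<Sum>r<m. u (U j r) * h (st (U p r) \<cdot> V q t)) = (\<Sum>s<n. h (st (U p j) \<cdot> V q s) * u (V s t))" for q t
      proof -
        have "vstar (\<Sum>r<m. h (st (U p r) \<cdot> V q t) *\<^sub>C st (U r j)) = vstar (\<Sum>s<n. h (st (U p j) \<cdot> V q s) *\<^sub>C st (V t s))"
          unfolding haar_right_invariance[OF C V] ..
        then show ?thesis
          by (simp add: clinear_sum[OF vstar_clinear] clinear_scaleC[OF vstar_clinear] ustar_coefficient[OF U]
            ustar_coefficient[OF V] mult.commute)
      qed
      have "(\<Sum>r<m. u (U j r) * h (dmul (st (U p r)) (V k l))) =
          (\<Sum>r<m. \<Sum>q<n. \<Sum>t<n. (vstar (V k q) * v (V t l)) * (u (U j r) * h (st (U p r) \<cdot> V q t)))"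
        unfolding haar_dmul[OF C V] by (simp add: sum_distrib_left ac_simps)
      also have "\<dots> = (\<Sum>q<n. \<Sum>t<n. (vstar (V k q) * v (V t l)) * (\<Sum>s<n. h (st (U p j) \<cdot> V q s) * u (V s t)))"
        unfolding R[symmetric] by (subst sum_rotate3) (simp add: sum_distrib_left)
      also have "\<dots> = (\<Sum>q<n. vstar (V k q) * (\<Sum>s<n. h (st (U p j) \<cdot> V q s) * (\<Sum>t<n. u (V s t) * v (V t l))))"
      proof (rule sum.cong[OF refl])
        fix q
        have "(\<Sum>t<n. (vstar (V k q) * v (V t l)) * (\<Sum>s<n. h (st (U p j) \<cdot> V q s) * u (V s t))) =
            (\<Sum>t<n. \<Sum>s<n. vstar (V k q) * (h (st (U p j) \<cdot> V q s) * (u (V s t) * v (V t l))))"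
          by (simp add: sum_distrib_left ac_simps)
        then show "(\<Sum>t<n. (vstar (V k q) * v (V t l)) * (\<Sum>s<n. h (st (U p j) \<cdot> V q s) * u (V s t))) =
            vstar (V k q) * (\<Sum>s<n. h (st (U p j) \<cdot> V q s) * (\<Sum>t<n. u (V s t) * v (V t l)))"
          by (subst (asm) sum.swap) (simp add: sum_distrib_left)
      qed
      also have "\<dots> = (\<Sum>q<n. vstar (V k q) * h (st (U p j) \<cdot> V q l))"
        unfolding u_v_inverse[OF V]
        by (intro sum.cong refl arg_cong2[where f = "(*)"] sum_delta_times) (simp_all add: cmV h_simps)
      finally show ?thesis .
    qed
    have "h (dmul (dst (U i j)) (V k l)) = (\<Sum>p<m. v (U p i) * (\<Sum>r<m. u (U j r) * h (dmul (st (U p r)) (V k l))))"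
      unfolding dst by (simp add: dmul_sum dmul_simps h_simps)
    also have "\<dots> = h (st (rW (U i j)) \<cdot> rW (V k l))"
      unfolding inner rWU rWV by (simp add: st_sum st_scaleC mul_sum mul_simps h_simps sum_distrib_left)
        (subst sum.swap, simp add: ac_simps)
    finally show "h (dmul (dst (U i j)) (V k l)) = h (st (rW (U i j)) \<cdot> rW (V k l))" .
  qed
qed (simp_all add: dst_add dst_scaleC dmul_simps h_simps st_add st_scaleC clinear_add clinear_scaleC rW_clinear mul_simps)

lemma haar_deformed: "haar H = h"
proof (rule haar_eqI)
  show "haar_state H h"
    unfolding haar_state_def
    using haar_stateD[OF haar] by (simp add: haar_dst_dmul)
qed

end

section \<open>Tensors over a subspace\<close>

lemma tensor_lift_abs_semilinear:
  "cbilinear F \<or> conj_bilinear F \<Longrightarrow> tensor_lift F (abs_tensor xs) = pair_sum F xs"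
  using tensor_lift_abs tensor_lift_conj_abs by blast

lemma pair_sum_cong: "(\<And>a b. (a, b) \<in> set xs \<Longrightarrow> F a b = F' a b) \<Longrightarrow> pair_sum F xs = pair_sum F' xs"
  unfolding pair_sum_def by (intro arg_cong[where f = sum_list] map_cong refl) auto

lemma tensor_lift_cong_on:
  assumes "t \<in> tensor_on UNIV T" "cbilinear F \<or> conj_bilinear F" "cbilinear F' \<or> conj_bilinear F'"
    and "\<And>a y. y \<in> T \<Longrightarrow> F a y = F' a y"
  shows "tensor_lift F t = tensor_lift F' t"
proof -
  obtain xs where xs: "set xs \<subseteq> UNIV \<times> T" "t = abs_tensor xs"
    using assms(1) by (auto simp: tensor_on_def)
  then have "pair_sum F xs = pair_sum F' xs"
    using assms(4) by (intro pair_sum_cong) auto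
  then show ?thesis by (simp add: xs(2) tensor_lift_abs_semilinear assms(2,3))
qed

text \<open>The chosen decomposition lies in \<open>T\<close>, so \<open>F\<close> may be anything
  off \<open>T\<close>; a semilinear F' agreeing with it on \<open>T\<close> makes the choice
  irrelevant.\<close>

lemma tensor_lift_on_eq:
  assumes "t \<in> tensor_on UNIV T" "cbilinear F' \<or> conj_bilinear F'"
    and "\<And>a y. y \<in> T \<Longrightarrow> F a y = F' a y"
  shows "tensor_lift_on UNIV T F t = tensor_lift F' t"
proof -
  let ?xs = "SOME xs. set xs \<subseteq> UNIV \<times> T \<and> abs_tensor xs = t"
  have xs: "set ?xs \<subseteq> UNIV \<times> T \<and> abs_tensor ?xs = t"
    using assms(1) by (intro someI_ex[where P = "\<lambda>xs. set xs \<subseteq> UNIV \<times> T \<and> abs_tensor xs = t"]) (auto simp: tensor_on_def)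
  then have "pair_sum F ?xs = pair_sum F' ?xs"
    using assms(3) by (intro pair_sum_cong) auto
  also have "\<dots> = tensor_lift F' (abs_tensor ?xs)"
    by (rule tensor_lift_abs_semilinear[OF assms(2), symmetric])
  finally show ?thesis using xs by (simp add: tensor_lift_on_def)
qed

lemma star_tensor_lift:
  fixes F :: "'a::complex_vector \<Rightarrow> 'b::complex_vector \<Rightarrow> 'c::cstar_algebra"
  assumes "cbilinear F \<or> conj_bilinear F"
  shows "star (tensor_lift F t) = tensor_lift (\<lambda>a b. star (F a b)) t"
proof (induction t rule: tensor.abs_induct)
  case (1 xs)
  have "cbilinear (\<lambda>a b. star (F a b)) \<or> conj_bilinear (\<lambda>a b. star (F a b))"
    using assms
  proof
    assume "cbilinear F"
    then show ?thesis by (simp add: conj_bilinear_def cbilinearD star_add star_scaleC)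
  next
    assume "conj_bilinear F"
    then have "cbilinear (\<lambda>a b. star (F a b))"
      by (intro cbilinearI clinearI) (simp_all add: conj_bilinear_def star_add star_scaleC)
    then show ?thesis ..
  qed
  then show ?case
    using assms by (simp add: tensor_lift_abs_semilinear) (induction xs; auto simp: star_add)
qed

lemma tensor_lift_scaleC_const:
  fixes K :: "'a::complex_vector \<Rightarrow> 'b::complex_vector \<Rightarrow> complex" and v :: "'c::complex_vector"
  assumes "cbilinear K"
  shows "tensor_lift (\<lambda>p q. K p q *\<^sub>C v) t = tensor_lift K t *\<^sub>C v"
proof -
  have "clinear (\<lambda>s::complex. s *\<^sub>C v)" by (intro lin)
  from clinear_tensor_lift_eq[OF this assms] show ?thesis by simp
qed

lemma tensor_lift_tensor_const:
  "cbilinear F \<Longrightarrow> tensor_lift (\<lambda>p q. F p q \<otimes> v) t = tensor_lift F t \<otimes> v"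
  using clinear_tensor_lift_eq[OF clinear_of_cbilinear(2)[OF cbilinear_tensor]] by metis

context cqg
begin

lemma conj_bilinear_compose_stars:
  fixes F :: "'h \<Rightarrow> 'b::cstar_algebra \<Rightarrow> 'c::complex_vector"
  shows "cbilinear F \<Longrightarrow> conj_bilinear (\<lambda>a y. F (st a) (star y))"
    "conj_bilinear F \<Longrightarrow> cbilinear (\<lambda>a y. F (st a) (star y))"
proof -
  show "cbilinear F \<Longrightarrow> conj_bilinear (\<lambda>a y. F (st a) (star y))"
    by (simp add: conj_bilinear_def cbilinearD st_add st_scaleC star_add star_scaleC)
  show "conj_bilinear F \<Longrightarrow> cbilinear (\<lambda>a y. F (st a) (star y))"
    by (intro cbilinearI clinearI) (simp_all add: conj_bilinear_def st_add st_scaleC star_add star_scaleC)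
qed

end

context cocycle_deformation
begin

text \<open>The cocycle identity freed from coefficients, as required for Sweedler sums over the
  coaction.\<close>

lemma cocycle_element:
  "L (\<lambda>a1 a2. L (\<lambda>b1 b2. sg a1 b1 * sg (a2 \<cdot> b2) c) b) a =
   L (\<lambda>b1 b2. L (\<lambda>c1 c2. sg b1 c1 * sg a (b2 \<cdot> c2)) c) b"
proof (rule cbilinear_eq_coefficients[where a = a and b = b])
  show "cbilinear (\<lambda>a b. L (\<lambda>a1 a2. L (\<lambda>b1 b2. sg a1 b1 * sg (a2 \<cdot> b2) c) b) a)"
    "cbilinear (\<lambda>a b. L (\<lambda>b1 b2. L (\<lambda>c1 c2. sg b1 c1 * sg a (b2 \<cdot> c2)) c) b)" by (intro lin)+
  fix m n U V i j k l
  assume "unitary_comatrix G {..<m::nat} U" "unitary_comatrix G {..<n::nat} V"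
  note cm = this[THEN unitary_comatrixD(1)]
  show "L (\<lambda>a1 a2. L (\<lambda>b1 b2. sg a1 b1 * sg (a2 \<cdot> b2) c) (V k l)) (U i j) =
    L (\<lambda>b1 b2. L (\<lambda>c1 c2. sg b1 c1 * sg (U i j) (b2 \<cdot> c2)) c) (V k l)"
  proof (rule clinear_eq_coefficients[where a = c])
    show "clinear (\<lambda>c. L (\<lambda>a1 a2. L (\<lambda>b1 b2. sg a1 b1 * sg (a2 \<cdot> b2) c) (V k l)) (U i j))"
      "clinear (\<lambda>c. L (\<lambda>b1 b2. L (\<lambda>c1 c2. sg b1 c1 * sg (U i j) (b2 \<cdot> c2)) c) (V k l))" by (intro lin)+
    fix r X s t assume "unitary_comatrix G {..<r::nat} X"
    note X = this[THEN unitary_comatrixD(1)]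
    have "L (\<lambda>a1 a2. L (\<lambda>b1 b2. sg a1 b1 * sg (a2 \<cdot> b2) (X s t)) (V k l)) (U i j) =
        (\<Sum>p<m. \<Sum>q<n. sg (U i p) (V k q) * sg (U p j \<cdot> V q l) (X s t))"
      by (subst lift_comatrix[OF cm(1)] lift_comatrix[OF cm(2)], (intro lin)[1])+ simp
    also have "\<dots> = (\<Sum>q<n. \<Sum>p<r. sg (V k q) (X s p) * sg (U i j) (V q l \<cdot> X p t))"
      by (rule cocycle_comatrix[OF cm X])
    also have "\<dots> = L (\<lambda>b1 b2. L (\<lambda>c1 c2. sg b1 c1 * sg (U i j) (b2 \<cdot> c2)) (X s t)) (V k l)"
      by (subst lift_comatrix[OF X] lift_comatrix[OF cm(2)], (intro lin)[1])+ simp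
    finally show "L (\<lambda>a1 a2. L (\<lambda>b1 b2. sg a1 b1 * sg (a2 \<cdot> b2) (X s t)) (V k l)) (U i j) =
        L (\<lambda>b1 b2. L (\<lambda>c1 c2. sg b1 c1 * sg (U i j) (b2 \<cdot> c2)) (X s t)) (V k l)" .
  qed
qed

text \<open>Omega cancels the trailing Omega^* of \<open>dmul\<close>. This is the algebraic core of
  the multiplicativity of \<theta> for the deformed products.\<close>

lemma sg_dmul:
  "L (\<lambda>a1 a2. L (\<lambda>b1 b2. sg a2 b2 *\<^sub>C dmul a1 b1) b) a = L (\<lambda>a1 a2. L (\<lambda>b1 b2. sg a1 b1 *\<^sub>C (a2 \<cdot> b2)) b) a"
proof (rule cbilinear_eq_coefficients[where a = a and b = b])
  show "cbilinear (\<lambda>a b. L (\<lambda>a1 a2. L (\<lambda>b1 b2. sg a2 b2 *\<^sub>C dmul a1 b1) b) a)"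
    "cbilinear (\<lambda>a b. L (\<lambda>a1 a2. L (\<lambda>b1 b2. sg a1 b1 *\<^sub>C (a2 \<cdot> b2)) b) a)" by (intro lin)+
  fix m n U V i j k l
  assume U: "unitary_comatrix G {..<m::nat} U" and V: "unitary_comatrix G {..<n::nat} V"
  note cm = unitary_comatrixD(1)[OF U] unitary_comatrixD(1)[OF V]
  let ?K = "{..<m} \<times> {..<n}"
  have "L (\<lambda>a1 a2. L (\<lambda>b1 b2. sg a2 b2 *\<^sub>C dmul a1 b1) (V k l)) (U i j) =
      (\<Sum>y\<in>?K. sgm U V y (j, l) *\<^sub>C dmul (U i (fst y)) (V k (snd y)))"
    by (subst lift_comatrix[OF cm(1)] lift_comatrix[OF cm(2)], (intro lin)[1])+ (simp add: sum_pair sgm_def)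
  also have "\<dots> = conjm ?K (sgm U V) (kron G U V) (\<lambda>w _. delta ?K w (j, l)) (i, k) ()"
    unfolding sgm_sim(2)[OF cm, symmetric] sum_conjm_right[symmetric] by (simp add: dmul_comatrix[OF cm])
  also have "\<dots> = (\<Sum>z\<in>?K. sgm U V (i, k) z *\<^sub>C (\<Sum>w\<in>?K. delta ?K w (j, l) *\<^sub>C kron G U V z w))"
    by (simp add: conjm_def complex_vector.scale_sum_right scaleC_scaleC)
  also have "\<dots> = (\<Sum>z\<in>?K. sgm U V (i, k) z *\<^sub>C kron G U V z (j, l))"
    by (simp only: sum_delta_comatrix[OF comatrix_kron[OF cm]])
  also have "\<dots> = L (\<lambda>a1 a2. L (\<lambda>b1 b2. sg a1 b1 *\<^sub>C (a2 \<cdot> b2)) (V k l)) (U i j)"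
    by (subst lift_comatrix[OF cm(1)] lift_comatrix[OF cm(2)], (intro lin)[1])+ (simp add: sum_pair sgm_def kron_def)
  finally show "L (\<lambda>a1 a2. L (\<lambda>b1 b2. sg a2 b2 *\<^sub>C dmul a1 b1) (V k l)) (U i j) =
      L (\<lambda>a1 a2. L (\<lambda>b1 b2. sg a1 b1 *\<^sub>C (a2 \<cdot> b2)) (V k l)) (U i j)" .
qed

lemma ustar_vstar:
  "L (\<lambda>b c. ustar b * vstar c) a = \<epsilon> a" "L (\<lambda>b c. vstar b * ustar c) a = \<epsilon> a"
proof -
  show "L (\<lambda>b c. ustar b * vstar c) a = \<epsilon> a"
  proof (rule clinear_eq_star_coefficients[where a = a])
    fix n U i j assume U: "unitary_comatrix G {..<n::nat} U"
    show "L (\<lambda>b c. ustar b * vstar c) (st (U i j)) = \<epsilon> (st (U i j))"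
      using u_v_inverse(1)[OF U, of j i]
      by (subst lift_comatrix[OF comatrix_star[OF unitary_comatrixD(1)[OF U]]], (intro lin)[1])
       (simp add: ustar_coefficient[OF U] counit_st comatrixD(3)[OF unitary_comatrixD(1)[OF U]] mult.commute delta_commute)
  qed (intro lin clinear_tensor_lift)+
  show "L (\<lambda>b c. vstar b * ustar c) a = \<epsilon> a"
  proof (rule clinear_eq_star_coefficients[where a = a])
    fix n U i j assume U: "unitary_comatrix G {..<n::nat} U"
    show "L (\<lambda>b c. vstar b * ustar c) (st (U i j)) = \<epsilon> (st (U i j))"
      using u_v_inverse(2)[OF U, of j i]
      by (subst lift_comatrix[OF comatrix_star[OF unitary_comatrixD(1)[OF U]]], (intro lin)[1])
       (simp add: ustar_coefficient[OF U] counit_st comatrixD(3)[OF unitary_comatrixD(1)[OF U]] mult.commute delta_commute)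
  qed (intro lin clinear_tensor_lift)+
qed

lemma ustar_st: "ustar (st a) = cnj (vstar a)" and vstar_st: "vstar (st a) = cnj (ustar a)"
proof -
  show *: "ustar (st a) = cnj (vstar a)" for a
    by (induction a rule: cqg_induct)
      (simp_all add: ustar_coefficient st_add st_scaleC clinear_add clinear_scaleC ustar_clinear vstar_clinear)
  show "vstar (st a) = cnj (ustar a)" using *[of "st a"] by simp
qed

lemma ustar_one: "ustar \<one> = 1"
  by (simp add: dual_star_def cocycle_u_def comult_one tensor_lift_tensor cbilinearI lin)

text \<open>The counterpart of \<open>sg_dmul\<close> for the involution: \<open>ustar\<close>
  cancels the trailing \<open>vstar\<close> of \<open>tau\<close>.\<close>

lemma ustar_tau: "L (\<lambda>b c. ustar c *\<^sub>C tau b) a = L (\<lambda>b c. ustar b *\<^sub>C c) a"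
proof (rule clinear_eq_coefficients[where a = a])
  fix n U i j assume U: "unitary_comatrix G {..<n::nat} U"
  note cm = unitary_comatrixD(1)[OF U]
  have "(\<Sum>k<n. vstar (U w k) * ustar (U k j)) = delta {..<n} w j" for w
    using ustar_vstar(2)[of "U w j"]
    by (subst (asm) lift_comatrix[OF cm], (intro lin)[1]) (simp add: comatrixD(3)[OF cm])
  then have "(\<Sum>k<n. ustar (U k j) *\<^sub>C tau (U i k)) =
      conjm {..<n} (\<lambda>i z. ustar (U i z)) U (\<lambda>w _. delta {..<n} w j) i ()"
    unfolding tau_comatrix[OF cm] sum_conjm_right by simp
  also have "\<dots> = (\<Sum>z<n. ustar (U i z) *\<^sub>C (\<Sum>w<n. delta {..<n} w j *\<^sub>C U z w))"
    by (simp add: conjm_def complex_vector.scale_sum_right scaleC_scaleC)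
  finally show "L (\<lambda>b c. ustar c *\<^sub>C tau b) (U i j) = L (\<lambda>b c. ustar b *\<^sub>C c) (U i j)"
    unfolding sum_delta_comatrix[OF cm]
    by (subst lift_comatrix[OF cm], (intro lin)[1])+ simp
qed (intro lin clinear_tensor_lift)+

end


section \<open>The deformed algebra\<close>

text \<open>The algebraic content of an action. \<open>\<theta>\<close> is linear on the whole type,
  whereas \<open>\<theta>\<^sub>0\<close>, later the regular coaction, agrees with it on
  \<open>B\<close>. The assumption \<open>closed_fixed\<close> is the only topological one.\<close>

locale deformed_action = cocycle_haar G \<Omega> h
  for G :: "'h::complex_vector star_bialgebra" and \<Omega> h +
  fixes B :: "'b::cstar_algebra set" and \<theta> \<theta>\<^sub>0 :: "'b \<Rightarrow> ('h, 'b) tensor"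
  assumes \<theta>_clinear: "clinear \<theta>"
    and \<theta>\<^sub>0_eq: "x \<in> B \<Longrightarrow> \<theta>\<^sub>0 x = \<theta> x"
    and B_subspace: "complex_vector.subspace B"
    and B_mult: "x \<in> B \<Longrightarrow> y \<in> B \<Longrightarrow> x * y \<in> B"
    and B_star: "x \<in> B \<Longrightarrow> star x \<in> B"
    and \<theta>_range: "x \<in> B \<Longrightarrow> \<theta> x \<in> tensor_on UNIV B"
    and \<theta>_coassoc: "x \<in> B \<Longrightarrow> tensor_lift (\<lambda>a y. a \<otimes> \<theta> y) (\<theta> x) =
      tensor_lift (\<lambda>a y. tensor_lift (\<lambda>p q. p \<otimes> (q \<otimes> y)) (comult G a)) (\<theta> x)"
    and \<theta>_counit: "x \<in> B \<Longrightarrow> tensor_lift (\<lambda>a y. counit G a *\<^sub>C y) (\<theta> x) = x"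
    and \<theta>_mult: "x \<in> B \<Longrightarrow> y \<in> B \<Longrightarrow> \<theta> (x * y) = tensor_mult (hmult G) (*) (\<theta> x) (\<theta> y)"
    and \<theta>_star: "x \<in> B \<Longrightarrow> \<theta> (star x) = tensor_star (hstar G) star (\<theta> x)"
    and closed_fixed: "closed {x \<in> B. \<theta> x = hone G \<otimes> x}"
begin

abbreviation M :: "('h \<Rightarrow> 'b \<Rightarrow> 'c::comm_monoid_add) \<Rightarrow> 'b \<Rightarrow> 'c" where "M F x \<equiv> tensor_lift F (\<theta> x)"

lemma clinear_compose_\<theta> [lin]: "clinear f \<Longrightarrow> clinear (\<lambda>x. \<theta> (f x))"
  by (rule clinearI) (simp_all add: clinear_add clinear_scaleC \<theta>_clinear)

lemma M_cong:
  assumes "x \<in> B" "cbilinear F" "cbilinear F'" "\<And>a y. y \<in> B \<Longrightarrow> F a y = F' a y"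
  shows "M F x = M F' x"
  using assms \<theta>_range by (intro tensor_lift_cong_on[where T = B]) auto

lemma M_mem:
  assumes "x \<in> B" "cbilinear F" "\<And>a y. y \<in> B \<Longrightarrow> F a y \<in> B"
  shows "M F x \<in> B"
proof -
  obtain xs where xs: "set xs \<subseteq> UNIV \<times> B" "\<theta> x = abs_tensor xs"
    using \<theta>_range[OF assms(1)] by (auto simp: tensor_on_def)
  from xs(1) have "pair_sum F xs \<in> B"
  proof (induction xs)
    case Nil
    then show ?case by (simp add: complex_vector.subspace_0[OF B_subspace])
  next
    case (Cons z xs)
    then show ?case
      using complex_vector.subspace_add[OF B_subspace, of "F (fst z) (snd z)" "pair_sum F xs"]
        assms(3)[of "snd z" "fst z"]
      by (cases z) auto
  qed
  then show ?thesis by (simp add: xs(2) tensor_lift_abs assms(2))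
qed

lemma B_scaleC: "x \<in> B \<Longrightarrow> c *\<^sub>C x \<in> B"
  by (rule complex_vector.subspace_scale[OF B_subspace])

text \<open>Coassociativity inside an arbitrary trilinear expression: a second coaction on the
  second leg is traded for a coproduct of the first leg.\<close>

lemma M_coassoc:
  assumes "x \<in> B" and \<Phi>: "\<And>a b. clinear (\<Phi> a b)" "\<And>a z. clinear (\<lambda>b. \<Phi> a b z)" "\<And>b z. clinear (\<lambda>a. \<Phi> a b z)"
  shows "M (\<lambda>a y. M (\<Phi> a) y) x = M (\<lambda>a y. L (\<lambda>p q. \<Phi> p q y) a) x"
proof -
  have bil: "cbilinear (\<Phi> a)" for a by (rule cbilinearI) (rule \<Phi>)+
  have bil2: "cbilinear (\<lambda>a. tensor_lift (\<Phi> a))"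
    by (intro cbilinearI clinear_tensor_lift bil clinear_param_tensor_lift \<Phi>)
  let ?f = "tensor_lift (\<lambda>a. tensor_lift (\<Phi> a))"
  have f: "clinear ?f" by (rule clinear_tensor_lift[OF bil2])
  have b: "cbilinear (\<lambda>a y. a \<otimes> \<theta> y)" "cbilinear (\<lambda>p q. p \<otimes> (q \<otimes> y))"
    "cbilinear (\<lambda>a y. L (\<lambda>p q. p \<otimes> (q \<otimes> y)) a)" for y :: 'b by (intro lin)+
  have "M (\<lambda>a y. M (\<Phi> a) y) x = ?f (M (\<lambda>a y. a \<otimes> \<theta> y) x)"
    by (simp add: clinear_tensor_lift_eq[OF f b(1)] tensor_lift_tensor[OF bil2])
  also have "\<dots> = M (\<lambda>a y. L (\<lambda>p q. \<Phi> p q y) a) x"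
    unfolding \<theta>_coassoc[OF assms(1)] clinear_tensor_lift_eq[OF f b(3)] clinear_tensor_lift_eq[OF f b(2)]
    by (simp add: tensor_lift_tensor[OF bil2] tensor_lift_tensor[OF bil])
  finally show ?thesis .
qed

lemma M_mult:
  assumes "x \<in> B" "y \<in> B" and F: "cbilinear F"
  shows "M F (x * y) = M (\<lambda>a x'. M (\<lambda>b y'. F (a \<cdot> b) (x' * y')) y) x"
proof -
  have b: "cbilinear (\<lambda>a b. tensor_lift (\<lambda>c d. (a \<cdot> c) \<otimes> (b * d)) (\<theta> y))"
    "cbilinear (\<lambda>c d. (a \<cdot> c) \<otimes> (b * d))" for a and b :: 'b by (intro lin)+
  show ?thesis
    unfolding \<theta>_mult[OF assms(1,2)] tensor_mult_def clinear_tensor_lift_eq[OF clinear_tensor_lift[OF F] b(1)]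
      clinear_tensor_lift_eq[OF clinear_tensor_lift[OF F] b(2)] by (simp add: tensor_lift_tensor[OF F])
qed

lemma M_star:
  assumes "x \<in> B" and F: "cbilinear F \<or> conj_bilinear F"
  shows "M F (star x) = M (\<lambda>a y. F (st a) (star y)) x"
proof -
  have cs: "conj_bilinear (\<lambda>a (y::'b). st a \<otimes> star y)"
    using conj_bilinear_compose_stars(1)[OF cbilinear_tensor] .
  have F': "cbilinear (\<lambda>a y. F (st a) (star y)) \<or> conj_bilinear (\<lambda>a y. F (st a) (star y))"
    using F conj_bilinear_compose_stars by blast
  \<comment> \<open>Computed on lists, because the inner map is antilinear while \<open>F\<close>
    may be linear or antilinear.\<close>
  have "tensor_lift F (tensor_lift (\<lambda>a y. st a \<otimes> star y) (abs_tensor xs)) = pair_sum (\<lambda>a y. F (st a) (star y)) xs" for xs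
  proof (induction xs)
    case Nil
    then show ?case using F
      by (auto simp: abs_tensor_Nil tensor_lift_conj_zero[OF cs] tensor_lift_conj_zero tensor_lift_zero)
  next
    case (Cons z xs)
    then show ?case using F
      by (cases z) (auto simp: abs_tensor_Cons tensor_lift_conj_add[OF cs] tensor_lift_conj_tensor[OF cs]
        tensor_lift_conj_add tensor_lift_conj_tensor tensor_lift_add tensor_lift_tensor)
  qed
  moreover obtain xs where "\<theta> x = abs_tensor xs" using \<theta>_range[OF assms(1)] by (auto simp: tensor_on_def)
  ultimately show ?thesis
    by (simp add: \<theta>_star[OF assms(1)] tensor_star_def tensor_lift_abs_semilinear[OF F'])
qed

text \<open>\<open>tw x y\<close> is \<open>x \<star> y\<close>, \<open>rU x\<close> is \<open>x \<lhd> u\<^sup>*\<close>, \<open>rV x\<close> is \<open>x \<lhd> (u\<^sup>-\<^sup>1)\<^sup>*\<close> and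
  \<open>bst x\<close> is the deformed involution of \<open>x\<close>.\<close>

definition tw :: "'b \<Rightarrow> 'b \<Rightarrow> 'b" where
  "tw x y = M (\<lambda>a x'. M (\<lambda>b y'. sg a b *\<^sub>C (x' * y')) y) x"

definition rU :: "'b \<Rightarrow> 'b" where "rU x = M (\<lambda>a y. ustar a *\<^sub>C y) x"
definition rV :: "'b \<Rightarrow> 'b" where "rV x = M (\<lambda>a y. vstar a *\<^sub>C y) x"

definition bst :: "'b \<Rightarrow> 'b" where "bst x = rU (star x)"

lemma tw_cbilinear: "cbilinear tw"
  unfolding tw_def[abs_def] by (intro lin)

lemma clinear_compose_tw [lin]:
  "clinear f \<Longrightarrow> clinear (\<lambda>x. tw c (f x))" "clinear f \<Longrightarrow> clinear (\<lambda>x. tw (f x) c)"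
  by (rule clinearI; simp add: clinear_add clinear_scaleC cbilinearD[OF tw_cbilinear])+

lemma rU_clinear: "clinear rU" and rV_clinear: "clinear rV"
  unfolding rU_def[abs_def] rV_def[abs_def] by (intro lin)+

lemma tw_mem: "x \<in> B \<Longrightarrow> y \<in> B \<Longrightarrow> tw x y \<in> B"
  unfolding tw_def by (intro M_mem lin B_scaleC B_mult)

lemma rU_mem: "x \<in> B \<Longrightarrow> rU x \<in> B" and rV_mem: "x \<in> B \<Longrightarrow> rV x \<in> B"
  unfolding rU_def rV_def by (intro M_mem lin B_scaleC; assumption)+

lemma bst_mem: "x \<in> B \<Longrightarrow> bst x \<in> B"
  unfolding bst_def by (intro rU_mem B_star)

lemma bst_add: "bst (x + y) = bst x + bst y" and bst_scaleC: "bst (c *\<^sub>C x) = cnj c *\<^sub>C bst x"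
  by (simp_all add: bst_def star_add star_scaleC clinear_add clinear_scaleC rU_clinear)

text \<open>As x \<star> y = Omega(x1 \<otimes> y1) x2 y2, coassociativity gives the first coproduct
  legs to Omega and passes the second ones to \<open>F\<close>.\<close>

lemma M_tw:
  assumes "x \<in> B" "y \<in> B" and F: "cbilinear F"
  shows "M F (tw x y) = M (\<lambda>a x'. M (\<lambda>b y'. L (\<lambda>a1 a2. L (\<lambda>b1 b2. sg a1 b1 *\<^sub>C F (a2 \<cdot> b2) (x' * y')) b) a) y) x"
proof -
  have [lin]: "clinear f \<Longrightarrow> clinear (\<lambda>x. F c (f x))" "clinear g \<Longrightarrow> clinear (\<lambda>x. F (g x) d)" for f g c d
    by (rule clinearI; simp add: clinear_add clinear_scaleC cbilinearD[OF F])+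
  have MF: "clinear (\<lambda>x. M F x)" by (intro lin F)
  have b: "cbilinear (\<lambda>a x'. M (\<lambda>b y'. sg a b *\<^sub>C (x' * y')) y)" "cbilinear (\<lambda>b y'. sg a b *\<^sub>C (x' * y'))" for a and x' :: 'b
    by (intro lin)+
  have "M F (tw x y) = M (\<lambda>a x'. M (\<lambda>b y'. sg a b *\<^sub>C M F (x' * y')) y) x"
    unfolding tw_def clinear_tensor_lift_eq[OF MF b(1)] clinear_tensor_lift_eq[OF MF b(2)] clinear_scaleC[OF MF] ..
  also have "\<dots> = M (\<lambda>a x'. M (\<lambda>b y'. sg a b *\<^sub>C M (\<lambda>c x''. M (\<lambda>d y''. F (c \<cdot> d) (x'' * y'')) y') x') y) x"
    by (intro M_cong assms lin F arg_cong2[where f = scaleC] refl M_mult)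
  also have "\<dots> = M (\<lambda>a x'. M (\<lambda>c x''. M (\<lambda>b y'. M (\<lambda>d y''. sg a b *\<^sub>C F (c \<cdot> d) (x'' * y'')) y') y) x') x"
  proof (intro M_cong assms)
    fix a x'
    have "M (\<lambda>b y'. sg a b *\<^sub>C M (\<lambda>c x''. M (\<lambda>d y''. F (c \<cdot> d) (x'' * y'')) y') x') y =
        M (\<lambda>b y'. M (\<lambda>c x''. M (\<lambda>d y''. sg a b *\<^sub>C F (c \<cdot> d) (x'' * y'')) y') x') y"
    proof -
      have c: "clinear (\<lambda>z. k *\<^sub>C z)" for k by (intro lin)
      have b: "cbilinear (\<lambda>c x''. M (\<lambda>d y''. F (c \<cdot> d) (x'' * y'')) y')" "cbilinear (\<lambda>d y''. F (c \<cdot> d) (x'' * y''))" for y' c x''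
        by (intro lin)+
      show ?thesis unfolding clinear_tensor_lift_eq[OF c b(1)] clinear_tensor_lift_eq[OF c b(2)] ..
    qed
    also have "\<dots> = M (\<lambda>c x''. M (\<lambda>b y'. M (\<lambda>d y''. sg a b *\<^sub>C F (c \<cdot> d) (x'' * y'')) y') y) x'"
      by (rule tensor_lift_swap; intro lin)
    finally show "M (\<lambda>b y'. sg a b *\<^sub>C M (\<lambda>c x''. M (\<lambda>d y''. F (c \<cdot> d) (x'' * y'')) y') x') y = \<dots>" .
  qed (intro lin)+
  also have "\<dots> = M (\<lambda>a x'. L (\<lambda>p q. M (\<lambda>b y'. M (\<lambda>d y''. sg p b *\<^sub>C F (q \<cdot> d) (x' * y'')) y') y) a) x"
    by (intro M_coassoc assms lin)
  also have "\<dots> = M (\<lambda>a x'. L (\<lambda>p q. M (\<lambda>b y'. L (\<lambda>r s. sg p r *\<^sub>C F (q \<cdot> s) (x' * y')) b) y) a) x"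
  proof -
    have "M (\<lambda>b y'. M (\<lambda>d y''. sg p b *\<^sub>C F (q \<cdot> d) (x' * y'')) y') y = M (\<lambda>b y'. L (\<lambda>r s. sg p r *\<^sub>C F (q \<cdot> s) (x' * y')) b) y" for p q x'
      by (intro M_coassoc assms lin)
    then show ?thesis by simp
  qed
  also have "\<dots> = M (\<lambda>a x'. M (\<lambda>b y'. L (\<lambda>a1 a2. L (\<lambda>b1 b2. sg a1 b1 *\<^sub>C F (a2 \<cdot> b2) (x' * y')) b) a) y) x"
  proof -
    have "L (\<lambda>p q. M (\<lambda>b y'. L (\<lambda>r s. sg p r *\<^sub>C F (q \<cdot> s) (x' * y')) b) y) a =
        M (\<lambda>b y'. L (\<lambda>a1 a2. L (\<lambda>b1 b2. sg a1 b1 *\<^sub>C F (a2 \<cdot> b2) (x' * y')) b) a) y" for a x'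
      by (rule tensor_lift_swap; intro lin)
    then show ?thesis by simp
  qed
  finally show ?thesis .
qed

lemma M_scaled:
  assumes "x \<in> B" and F: "cbilinear F" and \<omega>: "clinear \<omega>"
  shows "M F (M (\<lambda>a y. \<omega> a *\<^sub>C y) x) = M (\<lambda>a y. L (\<lambda>p q. \<omega> p *\<^sub>C F q y) a) x"
proof -
  have [lin]: "clinear f \<Longrightarrow> clinear (\<lambda>x. F c (f x))" "clinear g \<Longrightarrow> clinear (\<lambda>x. F (g x) d)" for f g c d
    by (rule clinearI; simp add: clinear_add clinear_scaleC cbilinearD[OF F])+
  have [lin]: "clinear f \<Longrightarrow> clinear (\<lambda>x. \<omega> (f x))" for f :: "_ \<Rightarrow> 'h"
    by (rule clinearI) (simp_all add: clinear_add clinear_scaleC \<omega>)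
  have MF: "clinear (\<lambda>x. M F x)" by (intro lin F)
  have b: "cbilinear (\<lambda>a (y::'b). \<omega> a *\<^sub>C y)" by (intro lin)
  have "M F (M (\<lambda>a y. \<omega> a *\<^sub>C y) x) = M (\<lambda>a y. \<omega> a *\<^sub>C M F y) x"
    unfolding clinear_tensor_lift_eq[OF MF b] clinear_scaleC[OF MF] ..
  also have "\<dots> = M (\<lambda>a y. M (\<lambda>b z. \<omega> a *\<^sub>C F b z) y) x"
  proof -
    have c: "clinear (\<lambda>z. k *\<^sub>C z)" for k by (intro lin)
    show ?thesis unfolding clinear_tensor_lift_eq[OF c F] ..
  qed
  also have "\<dots> = M (\<lambda>a y. L (\<lambda>p q. \<omega> p *\<^sub>C F q y) a) x"
    by (intro M_coassoc assms lin)
  finally show ?thesis .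
qed

lemma rU_rV: "x \<in> B \<Longrightarrow> rU (rV x) = x" "x \<in> B \<Longrightarrow> rV (rU x) = x"
proof -
  assume x: "x \<in> B"
  have b: "cbilinear (\<lambda>a (y::'b). ustar a *\<^sub>C y)" "cbilinear (\<lambda>a (y::'b). vstar a *\<^sub>C y)"
    "cbilinear (\<lambda>p q. vstar p * ustar q)" "cbilinear (\<lambda>p q. ustar p * vstar q)" by (intro lin)+
  have "rU (rV x) = M (\<lambda>a y. L (\<lambda>p q. (vstar p * ustar q) *\<^sub>C y) a) x"
    unfolding rU_def rV_def M_scaled[OF x b(1) vstar_clinear] by (simp add: scaleC_scaleC)
  also have "\<dots> = x"
    unfolding tensor_lift_scaleC_const[OF b(3)] ustar_vstar by (rule \<theta>_counit[OF x])
  finally show "rU (rV x) = x" .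
  have "rV (rU x) = M (\<lambda>a y. L (\<lambda>p q. (ustar p * vstar q) *\<^sub>C y) a) x"
    unfolding rU_def rV_def M_scaled[OF x b(2) ustar_clinear] by (simp add: scaleC_scaleC)
  also have "\<dots> = x"
    unfolding tensor_lift_scaleC_const[OF b(4)] ustar_vstar by (rule \<theta>_counit[OF x])
  finally show "rV (rU x) = x" .
qed

text \<open>By \<open>ustar_st\<close>, conjugation exchanges \<open>ustar\<close> and
  \<open>vstar\<close>, so the twist can precede \<open>star\<close>. In this form the deformed
  square becomes an ordinary one under \<open>E\<close>.\<close>

lemma bst_eq: "x \<in> B \<Longrightarrow> bst x = star (rV x)"
proof -
  assume x: "x \<in> B"
  have b: "cbilinear (\<lambda>a (y::'b). ustar a *\<^sub>C y)" "cbilinear (\<lambda>a (y::'b). vstar a *\<^sub>C y)" by (intro lin)+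
  have "bst x = M (\<lambda>a y. ustar (st a) *\<^sub>C star y) x"
    unfolding bst_def rU_def using b x by (intro M_star) auto
  also have "\<dots> = star (rV x)"
    unfolding rV_def using b by (subst star_tensor_lift) (auto simp: star_scaleC ustar_st)
  finally show ?thesis .
qed

lemma bst_bst: "x \<in> B \<Longrightarrow> bst (bst x) = x"
  by (simp add: bst_eq[of x] bst_def[of "star _"] star_star rU_rV)

lemma tw_assoc:
  assumes "x \<in> B" "y \<in> B" "z \<in> B"
  shows "tw (tw x y) z = tw x (tw y z)"
proof -
  \<comment> \<open>Both bracketings are this trilinear sum with a scalar kernel \<open>K\<close>,
    and the cocycle identity equates the two kernels.\<close>
  define T where "T K = M (\<lambda>a x'. M (\<lambda>b y'. M (\<lambda>c z'. K a b c *\<^sub>C (x' * y' * z')) z) y) x" for K :: "'h \<Rightarrow> 'h \<Rightarrow> 'h \<Rightarrow> complex"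
  have "tw (tw x y) z = M (\<lambda>a x'. M (\<lambda>b y'. L (\<lambda>a1 a2. L (\<lambda>b1 b2. sg a1 b1 *\<^sub>C
      M (\<lambda>d z'. sg (a2 \<cdot> b2) d *\<^sub>C (x' * y' * z')) z) b) a) y) x"
    unfolding tw_def[of "tw x y"] by (intro M_tw assms lin)
  also have "\<dots> = T (\<lambda>a b c. L (\<lambda>a1 a2. L (\<lambda>b1 b2. sg a1 b1 * sg (a2 \<cdot> b2) c) b) a)"
  proof -
    have "L (\<lambda>a1 a2. L (\<lambda>b1 b2. sg a1 b1 *\<^sub>C tensor_lift (\<lambda>d z'. sg (a2 \<cdot> b2) d *\<^sub>C (w * z')) t) b) a =
        tensor_lift (\<lambda>c z'. L (\<lambda>a1 a2. L (\<lambda>b1 b2. sg a1 b1 * sg (a2 \<cdot> b2) c) b) a *\<^sub>C (w * z')) t" for a b and w :: 'b and t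
    proof (rule clinear_eq_on_tensors[where t = t])
      show "clinear (\<lambda>t. L (\<lambda>a1 a2. L (\<lambda>b1 b2. sg a1 b1 *\<^sub>C tensor_lift (\<lambda>d z'. sg (a2 \<cdot> b2) d *\<^sub>C (w * z')) t) b) a)"
        "clinear (\<lambda>t. tensor_lift (\<lambda>c z'. L (\<lambda>a1 a2. L (\<lambda>b1 b2. sg a1 b1 * sg (a2 \<cdot> b2) c) b) a *\<^sub>C (w * z')) t)"
        by (intro lin)+
      fix c z'
      have k: "cbilinear (\<lambda>b1 b2. sg a1 b1 * sg (a2 \<cdot> b2) c)"
        "cbilinear (\<lambda>a1 a2. L (\<lambda>b1 b2. sg a1 b1 * sg (a2 \<cdot> b2) c) b)" for a1 a2 b by (intro lin)+
      have e: "tensor_lift (\<lambda>d z'. sg (a2 \<cdot> b2) d *\<^sub>C (w * z')) (c \<otimes> z') = sg (a2 \<cdot> b2) c *\<^sub>C (w * z')" for a2 b2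
        by (rule tensor_lift_tensor) (intro lin)
      have "tensor_lift (\<lambda>c z'. L (\<lambda>a1 a2. L (\<lambda>b1 b2. sg a1 b1 * sg (a2 \<cdot> b2) c) b) a *\<^sub>C (w * z')) (c \<otimes> z') =
          L (\<lambda>a1 a2. L (\<lambda>b1 b2. sg a1 b1 * sg (a2 \<cdot> b2) c) b) a *\<^sub>C (w * z')"
        by (rule tensor_lift_tensor) (intro lin)
      then show "L (\<lambda>a1 a2. L (\<lambda>b1 b2. sg a1 b1 *\<^sub>C tensor_lift (\<lambda>d z'. sg (a2 \<cdot> b2) d *\<^sub>C (w * z')) (c \<otimes> z')) b) a =
          tensor_lift (\<lambda>c z'. L (\<lambda>a1 a2. L (\<lambda>b1 b2. sg a1 b1 * sg (a2 \<cdot> b2) c) b) a *\<^sub>C (w * z')) (c \<otimes> z')"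
        by (simp only: e scaleC_scaleC tensor_lift_scaleC_const[OF k(1)] tensor_lift_scaleC_const[OF k(2)])
    qed
    then show ?thesis by (simp add: T_def)
  qed
  also have "\<dots> = T (\<lambda>a b c. L (\<lambda>b1 b2. L (\<lambda>c1 c2. sg b1 c1 * sg a (b2 \<cdot> c2)) c) b)"
    by (simp only: cocycle_element)
  also have "\<dots> = tw x (tw y z)"
  proof -
    have "M (\<lambda>c w. sg a c *\<^sub>C (x' * w)) (tw y z) = M (\<lambda>b y'. M (\<lambda>c z'.
        L (\<lambda>b1 b2. L (\<lambda>c1 c2. sg b1 c1 * sg a (b2 \<cdot> c2)) c) b *\<^sub>C (x' * y' * z')) z) y" for a x'
    proof -
      have k: "cbilinear (\<lambda>c1 c2. sg b1 c1 * sg a (b2 \<cdot> c2))"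
        "cbilinear (\<lambda>b1 b2. L (\<lambda>c1 c2. sg b1 c1 * sg a (b2 \<cdot> c2)) c)" for b1 b2 c by (intro lin)+
      have "M (\<lambda>c w. sg a c *\<^sub>C (x' * w)) (tw y z) = M (\<lambda>b y'. M (\<lambda>c z'. L (\<lambda>b1 b2. L (\<lambda>c1 c2.
          sg b1 c1 *\<^sub>C (sg a (b2 \<cdot> c2) *\<^sub>C (x' * (y' * z')))) c) b) z) y"
        by (intro M_tw assms lin)
      then show ?thesis
        by (simp add: scaleC_scaleC tensor_lift_scaleC_const[OF k(1)] tensor_lift_scaleC_const[OF k(2)] mult.assoc)
    qed
    then show ?thesis by (simp add: T_def tw_def[of x])
  qed
  finally show ?thesis .
qed

lemma bst_tw:
  assumes "x \<in> B" "y \<in> B"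
  shows "bst (tw x y) = tw (bst y) (bst x)"
proof -
  \<comment> \<open>The deformed involution begins with \<open>star\<close>, so both sides are
    expanded over \<theta>(X) and \<theta>(Y), which brings them to a common form.\<close>
  define X Y where "X = star x" and "Y = star y"
  have XY: "X \<in> B" "Y \<in> B" "x = star X" "y = star Y"
    using assms by (simp_all add: X_def Y_def B_star star_star)
  have "star (tw x y) = M (\<lambda>c x'. M (\<lambda>d y'. sgs c d *\<^sub>C (y' * x')) Y) X"
  proof -
    have b: "cbilinear (\<lambda>b y'. sg a b *\<^sub>C (x' * y'))" "cbilinear (\<lambda>a x'. M (\<lambda>b y'. sg a b *\<^sub>C (x' * y')) y)" for a and x' :: 'b
      by (intro lin)+
    have "star (tw x y) = M (\<lambda>a x'. M (\<lambda>b y'. cnj (sg a b) *\<^sub>C (star y' * star x')) y) x"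
    proof -
      have "star (M (\<lambda>b y'. sg a b *\<^sub>C (x' * y')) y) = M (\<lambda>b y'. cnj (sg a b) *\<^sub>C (star y' * star x')) y" for a x'
        using b by (subst star_tensor_lift) (auto simp: star_scaleC star_mult)
      then show ?thesis
        unfolding tw_def using b by (subst star_tensor_lift) auto
    qed
    also have "\<dots> = M (\<lambda>a x'. M (\<lambda>b y'. cnj (sg a (st b)) *\<^sub>C (y' * star x')) Y) x"
    proof -
      have "M (\<lambda>b y'. cnj (sg a b) *\<^sub>C (star y' * star x')) (star Y) = M (\<lambda>b y'. cnj (sg a (st b)) *\<^sub>C (star (star y') * star x')) Y" for a x'
        by (rule M_star[OF XY(2)]) (simp add: conj_bilinear_def tensor_add_left tensor_add_right
          tensor_scaleC_left tensor_scaleC_right clinear_add clinear_scaleC \<Omega>_clinear star_add star_scaleC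
          distrib_left distrib_right scaleC_add_left scaleC_add_right scaleC_scaleC scaleC_mult_left mult.commute)
      then show ?thesis by (simp add: XY(4) star_star)
    qed
    also have "\<dots> = M (\<lambda>a x'. M (\<lambda>b y'. cnj (sg (st a) (st b)) *\<^sub>C (y' * star (star x'))) Y) X"
    proof -
      have c: "conj_bilinear (\<lambda>a x'. M (\<lambda>b y'. cnj (sg a (st b)) *\<^sub>C (y' * star x')) Y)"
      proof -
        have bb: "cbilinear (\<lambda>b y'. cnj (sg a (st b)) *\<^sub>C (y' * star x'))" for a and x' :: 'b
          by (intro cbilinearI clinearI; simp add: tensor_add_right tensor_scaleC_right clinear_add clinear_scaleC
            \<Omega>_clinear st_add st_scaleC distrib_right scaleC_add_left scaleC_add_right scaleC_scaleC scaleC_mult_left mult.commute)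
        have dist: "tensor_lift (\<lambda>b y'. F b y' + F' b y') t = tensor_lift F t + tensor_lift F' t"
          if "cbilinear F" "cbilinear F'" for F F' :: "'h \<Rightarrow> 'b \<Rightarrow> 'b" and t
        proof -
          have "cbilinear (\<lambda>b y'. F b y' + F' b y')" using that by (auto intro!: lin simp: clinear_of_cbilinear)
          then show ?thesis using that
            by (induction t rule: tensor_induct) (simp_all add: tensor_lift_zero tensor_lift_tensor tensor_lift_add)
        qed
        have dists: "tensor_lift (\<lambda>b y'. k *\<^sub>C F b y') t = k *\<^sub>C tensor_lift F t"
          if "cbilinear F" for F :: "'h \<Rightarrow> 'b \<Rightarrow> 'b" and t k
        proof -
          have "clinear (\<lambda>z::'b. k *\<^sub>C z)" by (intro lin)
          from clinear_tensor_lift_eq[OF this that] show ?thesis by simp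
        qed
        show ?thesis
          unfolding conj_bilinear_def dist[OF bb bb, symmetric] dists[OF bb, symmetric]
          by (simp add: tensor_add_left tensor_scaleC_left clinear_add clinear_scaleC \<Omega>_clinear star_add star_scaleC
            distrib_left scaleC_add_left scaleC_add_right scaleC_scaleC scaleC_mult_right mult.commute)
      qed
      show ?thesis unfolding XY(3) by (rule M_star[OF XY(1)]) (use c in simp)
    qed
    finally show ?thesis by (simp add: sgs_def star_star)
  qed
  then have "bst (tw x y) = M (\<lambda>c x'. M (\<lambda>d y'. sgs c d *\<^sub>C rU (y' * x')) Y) X"
  proof -
    have b: "cbilinear (\<lambda>d y'. sgs c d *\<^sub>C (y' * x'))" "cbilinear (\<lambda>c x'. M (\<lambda>d y'. sgs c d *\<^sub>C (y' * x')) Y)" for c and x' :: 'b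
      by (intro lin)+
    assume "star (tw x y) = M (\<lambda>c x'. M (\<lambda>d y'. sgs c d *\<^sub>C (y' * x')) Y) X"
    then show ?thesis
      unfolding bst_def by (simp add: clinear_tensor_lift_eq[OF rU_clinear b(2)] clinear_tensor_lift_eq[OF rU_clinear b(1)]
        clinear_scaleC[OF rU_clinear])
  qed
  also have "\<dots> = M (\<lambda>c x'. M (\<lambda>d y'. sgs c d *\<^sub>C M (\<lambda>d2 y''. M (\<lambda>c2 x''. ustar (d2 \<cdot> c2) *\<^sub>C (y'' * x'')) x') y') Y) X"
    unfolding rU_def by (intro M_cong XY lin arg_cong2[where f = scaleC] refl M_mult)
  also have "\<dots> = M (\<lambda>c x'. M (\<lambda>d y'. M (\<lambda>d2 y''. M (\<lambda>c2 x''. (sgs c d * ustar (d2 \<cdot> c2)) *\<^sub>C (y'' * x'')) x') y') Y) X"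
  proof -
    have c: "clinear (\<lambda>z::'b. k *\<^sub>C z)" for k by (intro lin)
    have b: "cbilinear (\<lambda>d2 y''. M (\<lambda>c2 x''. ustar (d2 \<cdot> c2) *\<^sub>C (y'' * x'')) x')" "cbilinear (\<lambda>c2 x''. ustar (d2 \<cdot> c2) *\<^sub>C (y'' * x''))" for x' d2 and y'' :: 'b
      by (intro lin)+
    show ?thesis unfolding clinear_tensor_lift_eq[OF c b(1)] clinear_tensor_lift_eq[OF c b(2)] scaleC_scaleC ..
  qed
  also have "\<dots> = M (\<lambda>c x'. M (\<lambda>d y'. L (\<lambda>d1 d2. M (\<lambda>c2 x''. (sgs c d1 * ustar (d2 \<cdot> c2)) *\<^sub>C (y' * x'')) x') d) Y) X"
  proof -
    have "M (\<lambda>d y'. M (\<lambda>d2 y''. M (\<lambda>c2 x''. (sgs c d * ustar (d2 \<cdot> c2)) *\<^sub>C (y'' * x'')) x') y') Y =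
        M (\<lambda>d y'. L (\<lambda>d1 d2. M (\<lambda>c2 x''. (sgs c d1 * ustar (d2 \<cdot> c2)) *\<^sub>C (y' * x'')) x') d) Y" for c x'
      by (intro M_coassoc XY lin)
    then show ?thesis by simp
  qed
  also have "\<dots> = M (\<lambda>c x'. M (\<lambda>c2 x''. M (\<lambda>d y'. L (\<lambda>d1 d2. (sgs c d1 * ustar (d2 \<cdot> c2)) *\<^sub>C (y' * x'')) d) Y) x') X"
  proof -
    have "L (\<lambda>d1 d2. M (\<lambda>c2 x''. (sgs c d1 * ustar (d2 \<cdot> c2)) *\<^sub>C (y' * x'')) x') d =
        M (\<lambda>c2 x''. L (\<lambda>d1 d2. (sgs c d1 * ustar (d2 \<cdot> c2)) *\<^sub>C (y' * x'')) d) x'" for c d x' y'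
      by (rule tensor_lift_swap; intro lin)
    moreover have "M (\<lambda>d y'. M (\<lambda>c2 x''. L (\<lambda>d1 d2. (sgs c d1 * ustar (d2 \<cdot> c2)) *\<^sub>C (y' * x'')) d) x') Y =
        M (\<lambda>c2 x''. M (\<lambda>d y'. L (\<lambda>d1 d2. (sgs c d1 * ustar (d2 \<cdot> c2)) *\<^sub>C (y' * x'')) d) Y) x'" for c x'
      by (rule tensor_lift_swap; intro lin)
    ultimately show ?thesis by simp
  qed
  also have "\<dots> = M (\<lambda>c x'. L (\<lambda>c1 c2. M (\<lambda>d y'. L (\<lambda>d1 d2. (sgs c1 d1 * ustar (d2 \<cdot> c2)) *\<^sub>C (y' * x')) d) Y) c) X"
    by (intro M_coassoc XY lin)
  also have "\<dots> = M (\<lambda>c x'. M (\<lambda>d y'. L (\<lambda>c1 c2. L (\<lambda>d1 d2. sgs c1 d1 * ustar (d2 \<cdot> c2)) d) c *\<^sub>C (y' * x')) Y) X"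
  proof -
    have k: "cbilinear (\<lambda>d1 d2. sgs c1 d1 * ustar (d2 \<cdot> c2))"
        "cbilinear (\<lambda>c1 c2. L (\<lambda>d1 d2. sgs c1 d1 * ustar (d2 \<cdot> c2)) d)" for c1 c2 d by (intro lin)+
    have "L (\<lambda>c1 c2. M (\<lambda>d y'. L (\<lambda>d1 d2. (sgs c1 d1 * ustar (d2 \<cdot> c2)) *\<^sub>C (y' * x')) d) Y) c =
        M (\<lambda>d y'. L (\<lambda>c1 c2. L (\<lambda>d1 d2. (sgs c1 d1 * ustar (d2 \<cdot> c2)) *\<^sub>C (y' * x')) d) c) Y" for c x'
      by (rule tensor_lift_swap; intro lin)
    then show ?thesis by (simp add: tensor_lift_scaleC_const[OF k(1)] tensor_lift_scaleC_const[OF k(2)])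
  qed
  finally have left: "bst (tw x y) = \<dots>" .
  have "tw (bst y) (bst x) = M (\<lambda>d y'. M (\<lambda>c x'. sg d c *\<^sub>C (y' * x')) (rU X)) (rU Y)"
    by (simp add: tw_def bst_def X_def Y_def)
  also have "\<dots> = M (\<lambda>d y'. L (\<lambda>d1 d2. ustar d1 *\<^sub>C M (\<lambda>c x'. sg d2 c *\<^sub>C (y' * x')) (rU X)) d) Y"
    unfolding rU_def[of Y] by (intro M_scaled XY lin ustar_clinear)
  also have "\<dots> = M (\<lambda>d y'. L (\<lambda>d1 d2. M (\<lambda>c x'. L (\<lambda>c1 c2. (ustar d1 * ustar c1 * sg d2 c2) *\<^sub>C (y' * x')) c) X) d) Y"
  proof -
    have "ustar d1 *\<^sub>C M (\<lambda>c x'. sg d2 c *\<^sub>C (y' * x')) (rU X) =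
        M (\<lambda>c x'. L (\<lambda>c1 c2. (ustar d1 * ustar c1 * sg d2 c2) *\<^sub>C (y' * x')) c) X" for d1 d2 y'
    proof -
      have c: "clinear (\<lambda>z::'b. k *\<^sub>C z)" for k by (intro lin)
      have b: "cbilinear (\<lambda>c x'. L (\<lambda>c1 c2. ustar c1 *\<^sub>C (sg d2 c2 *\<^sub>C (y' * x'))) c)"
        "cbilinear (\<lambda>c1 c2. ustar c1 *\<^sub>C (sg d2 c2 *\<^sub>C (y' * x')))" for x' by (intro lin)+
      have "M (\<lambda>c x'. sg d2 c *\<^sub>C (y' * x')) (rU X) = M (\<lambda>c x'. L (\<lambda>c1 c2. ustar c1 *\<^sub>C (sg d2 c2 *\<^sub>C (y' * x'))) c) X"
        unfolding rU_def by (intro M_scaled XY lin ustar_clinear)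
      then have "ustar d1 *\<^sub>C M (\<lambda>c x'. sg d2 c *\<^sub>C (y' * x')) (rU X) =
          M (\<lambda>c x'. L (\<lambda>c1 c2. ustar d1 *\<^sub>C ustar c1 *\<^sub>C sg d2 c2 *\<^sub>C (y' * x')) c) X"
        by (simp only: clinear_tensor_lift_eq[OF c b(1)] clinear_tensor_lift_eq[OF c b(2)])
      then show ?thesis by (simp only: scaleC_scaleC mult.assoc)
    qed
    then show ?thesis by simp
  qed
  also have "\<dots> = M (\<lambda>d y'. M (\<lambda>c x'. L (\<lambda>d1 d2. L (\<lambda>c1 c2. (ustar d1 * ustar c1 * sg d2 c2) *\<^sub>C (y' * x')) c) d) X) Y"
  proof -
    have "L (\<lambda>d1 d2. M (\<lambda>c x'. L (\<lambda>c1 c2. (ustar d1 * ustar c1 * sg d2 c2) *\<^sub>C (y' * x')) c) X) d =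
        M (\<lambda>c x'. L (\<lambda>d1 d2. L (\<lambda>c1 c2. (ustar d1 * ustar c1 * sg d2 c2) *\<^sub>C (y' * x')) c) d) X" for d y'
      by (rule tensor_lift_swap; intro lin)
    then show ?thesis by simp
  qed
  also have "\<dots> = M (\<lambda>c x'. M (\<lambda>d y'. L (\<lambda>c1 c2. L (\<lambda>d1 d2. ustar d1 * ustar c1 * sg d2 c2) d) c *\<^sub>C (y' * x')) Y) X"
  proof -
    have k: "cbilinear (\<lambda>d1 d2. ustar d1 * ustar c1 * sg d2 c2)"
        "cbilinear (\<lambda>c1 c2. L (\<lambda>d1 d2. ustar d1 * ustar c1 * sg d2 c2) d)" for c1 c2 d by (intro lin)+
    have "L (\<lambda>d1 d2. L (\<lambda>c1 c2. (ustar d1 * ustar c1 * sg d2 c2) *\<^sub>C w) c) d =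
        L (\<lambda>c1 c2. L (\<lambda>d1 d2. (ustar d1 * ustar c1 * sg d2 c2) *\<^sub>C w) d) c" for c d and w :: 'b
      by (rule tensor_lift_swap; intro lin)
    then have "L (\<lambda>d1 d2. L (\<lambda>c1 c2. (ustar d1 * ustar c1 * sg d2 c2) *\<^sub>C w) c) d =
        L (\<lambda>c1 c2. L (\<lambda>d1 d2. ustar d1 * ustar c1 * sg d2 c2) d) c *\<^sub>C w" for c d and w :: 'b
      by (simp add: tensor_lift_scaleC_const[OF k(1)] tensor_lift_scaleC_const[OF k(2)])
    moreover have "M (\<lambda>d y'. M (\<lambda>c x'. L (\<lambda>c1 c2. L (\<lambda>d1 d2. ustar d1 * ustar c1 * sg d2 c2) d) c *\<^sub>C (y' * x')) X) Y =
        M (\<lambda>c x'. M (\<lambda>d y'. L (\<lambda>c1 c2. L (\<lambda>d1 d2. ustar d1 * ustar c1 * sg d2 c2) d) c *\<^sub>C (y' * x')) Y) X"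
      by (rule tensor_lift_swap; intro lin)
    ultimately show ?thesis by simp
  qed
  \<comment> \<open>The two scalar kernels agree by \<open>ustar_product\<close>.\<close>
  also have "\<dots> = bst (tw x y)" unfolding left ustar_product ..
  finally show ?thesis by (rule sym)
qed

end

lemma sum_list_orthogonal:
  fixes f :: "'a \<Rightarrow> 'a \<Rightarrow> 'b::comm_monoid_add"
  assumes "sorted_wrt R xs" "\<And>p q. R p q \<Longrightarrow> f p q = 0 \<and> f q p = 0"
  shows "(\<Sum>p\<leftarrow>xs. \<Sum>q\<leftarrow>xs. f p q) = (\<Sum>p\<leftarrow>xs. f p p)"
  using assms(1)
proof (induction xs)
  case (Cons a xs)
  have "(\<Sum>q\<leftarrow>xs. f a q) = 0" "(\<Sum>p\<leftarrow>xs. f p a) = 0"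
    using Cons.prems assms(2) by (induction xs) auto
  then show ?case using Cons by (simp add: sum_list_addf)
qed simp

lemma pair_sum_eq_sum_list: "pair_sum F xs = (\<Sum>p\<leftarrow>xs. F (fst p) (snd p))"
  by (simp add: pair_sum_def case_prod_unfold)

section \<open>The deformed *-algebra and its coaction\<close>

context deformed_action
begin

abbreviation D where "D \<equiv> deformed_algebra G \<Omega> B \<theta>\<^sub>0"

lemma carr_D [simp]: "carr D = B"
  by (simp add: deformed_algebra_def)

lemma amult_D: "x \<in> B \<Longrightarrow> y \<in> B \<Longrightarrow> amult D x y = tw x y"
proof -
  assume xy: "x \<in> B" "y \<in> B"
  have m: "cbilinear ((*) :: 'b \<Rightarrow> 'b \<Rightarrow> 'b)" by (intro lin)
  note f = clinear_tensor_lift[OF m]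
  have b: "cbilinear (\<lambda>a (x'::'b). M (\<lambda>b y'. sg a b *\<^sub>C (x' \<otimes> y')) y)" "cbilinear (\<lambda>b (y'::'b). sg a b *\<^sub>C (x' \<otimes> y'))" for a and x' :: 'b
    by (intro lin)+
  show ?thesis
    using xy by (simp add: deformed_algebra_def ract2_def \<theta>\<^sub>0_eq tw_def clinear_tensor_lift_eq[OF f b(1)]
      clinear_tensor_lift_eq[OF f b(2)] clinear_scaleC[OF f] tensor_lift_tensor[OF m])
qed

lemma astar_D: "x \<in> B \<Longrightarrow> astar D x = bst x"
  by (simp add: deformed_algebra_def ract_def \<theta>\<^sub>0_eq B_star bst_def rU_def)

lemmas tw_simps = cbilinearD[OF tw_cbilinear]
lemmas B_closed = complex_vector.subspace_add[OF B_subspace] complex_vector.subspace_diff[OF B_subspace] B_scaleC B_mult B_star tw_mem bst_mem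

lemma star_algebra_D: "star_algebra D"
  unfolding star_algebra_def
  by (simp add: amult_D astar_D B_subspace B_closed tw_simps tw_assoc bst_add bst_scaleC bst_tw bst_bst)

text \<open>Coassociativity brings the Omega of \<open>tw\<close> next to the Omega^* at the end of
  \<open>dmul\<close>, where \<open>sg_dmul\<close> cancels them.\<close>

lemma \<theta>_tw: 
  assumes "x \<in> B" "y \<in> B"
  shows "\<theta> (tw x y) = M (\<lambda>a x'. M (\<lambda>b y'. dmul a b \<otimes> tw x' y') y) x"
proof -
  have k: "cbilinear (\<lambda>r s. sg q s *\<^sub>C dmul p r)" "cbilinear (\<lambda>p q. L (\<lambda>r s. sg q s *\<^sub>C dmul p r) b)"
    "cbilinear (\<lambda>r s. sg p r *\<^sub>C (q \<cdot> s))" "cbilinear (\<lambda>p q. L (\<lambda>r s. sg p r *\<^sub>C (q \<cdot> s)) b)"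
    for p q b by (intro lin)+
  have "M (\<lambda>a x'. M (\<lambda>b y'. dmul a b \<otimes> tw x' y') y) x =
      M (\<lambda>a x'. M (\<lambda>b y'. M (\<lambda>c x''. M (\<lambda>d y''. sg c d *\<^sub>C (dmul a b \<otimes> (x'' * y''))) y') x') y) x"
  proof -
    have f: "clinear ((\<otimes>) a)" for a :: 'h by (rule clinear_of_cbilinear(1)[OF cbilinear_tensor])
    have b: "cbilinear (\<lambda>c x''. M (\<lambda>d y''. sg c d *\<^sub>C (x'' * y'')) y')" "cbilinear (\<lambda>d y''. sg c d *\<^sub>C (x'' * y''))" for c y' and x'' :: 'b
      by (intro lin)+
    show ?thesis
      unfolding tw_def clinear_tensor_lift_eq[OF f b(1)] clinear_tensor_lift_eq[OF f b(2)] tensor_scaleC_right ..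
  qed
  also have "\<dots> = M (\<lambda>a x'. M (\<lambda>c x''. M (\<lambda>b y'. M (\<lambda>d y''. sg c d *\<^sub>C (dmul a b \<otimes> (x'' * y''))) y') y) x') x"
  proof -
    have "M (\<lambda>b y'. M (\<lambda>c x''. M (\<lambda>d y''. sg c d *\<^sub>C (dmul a b \<otimes> (x'' * y''))) y') x') y =
        M (\<lambda>c x''. M (\<lambda>b y'. M (\<lambda>d y''. sg c d *\<^sub>C (dmul a b \<otimes> (x'' * y''))) y') y) x'" for a x'
      by (rule tensor_lift_swap; intro lin)
    then show ?thesis by simp
  qed
  also have "\<dots> = M (\<lambda>a x'. L (\<lambda>p q. M (\<lambda>b y'. M (\<lambda>d y''. sg q d *\<^sub>C (dmul p b \<otimes> (x' * y''))) y') y) a) x"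
    by (intro M_coassoc assms lin)
  also have "\<dots> = M (\<lambda>a x'. L (\<lambda>p q. M (\<lambda>b y'. L (\<lambda>r s. sg q s *\<^sub>C (dmul p r \<otimes> (x' * y'))) b) y) a) x"
  proof -
    have "M (\<lambda>b y'. M (\<lambda>d y''. sg q d *\<^sub>C (dmul p b \<otimes> (x' * y''))) y') y = M (\<lambda>b y'. L (\<lambda>r s. sg q s *\<^sub>C (dmul p r \<otimes> (x' * y'))) b) y" for p q x'
      by (intro M_coassoc assms lin)
    then show ?thesis by simp
  qed
  also have "\<dots> = M (\<lambda>a x'. M (\<lambda>b y'. L (\<lambda>p q. L (\<lambda>r s. sg q s *\<^sub>C dmul p r) b) a \<otimes> (x' * y')) y) x"
  proof -
    have "L (\<lambda>p q. M (\<lambda>b y'. L (\<lambda>r s. sg q s *\<^sub>C (dmul p r \<otimes> (x' * y'))) b) y) a =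
        M (\<lambda>b y'. L (\<lambda>p q. L (\<lambda>r s. sg q s *\<^sub>C (dmul p r \<otimes> (x' * y'))) b) a) y" for a x'
      by (rule tensor_lift_swap; intro lin)
    then show ?thesis
      by (simp add: tensor_lift_tensor_const[OF k(1)] tensor_lift_tensor_const[OF k(2)] flip: tensor_scaleC_left)
  qed
  also have "\<dots> = M (\<lambda>a x'. M (\<lambda>b y'. L (\<lambda>p q. L (\<lambda>r s. sg p r *\<^sub>C (q \<cdot> s)) b) a \<otimes> (x' * y')) y) x"
    unfolding sg_dmul ..
  also have "\<dots> = M (\<otimes>) (tw x y)"
    unfolding M_tw[OF assms cbilinear_tensor]
    by (simp add: tensor_lift_tensor_const[OF k(3)] tensor_lift_tensor_const[OF k(4)] flip: tensor_scaleC_left)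
  finally show ?thesis by (simp add: tensor_lift_ident)
qed

lemma \<theta>_bst:
  assumes "x \<in> B"
  shows "\<theta> (bst x) = M (\<lambda>a y. dst a \<otimes> bst y) x"
proof -
  define X where "X = star x"
  have X: "X \<in> B" "x = star X" using assms by (simp_all add: X_def B_star star_star)
  have k: "cbilinear (\<lambda>p q. ustar q *\<^sub>C tau p)" "cbilinear (\<lambda>p q. ustar p *\<^sub>C q)" by (intro lin)+
  have "conj_bilinear (\<lambda>a y. dst a \<otimes> bst y)"
    by (simp add: conj_bilinear_def dst_add dst_scaleC bst_add bst_scaleC tensor_add_left tensor_add_right
      tensor_scaleC_left tensor_scaleC_right)
  then have "M (\<lambda>a y. dst a \<otimes> bst y) x = M (\<lambda>a y. dst (st a) \<otimes> bst (star y)) X"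
    unfolding X(2) by (intro M_star[OF X(1)]) simp
  also have "\<dots> = M (\<lambda>a y. M (\<lambda>b z. ustar b *\<^sub>C (tau a \<otimes> z)) y) X"
  proof -
    have f: "clinear ((\<otimes>) a)" for a :: 'h by (rule clinear_of_cbilinear(1)[OF cbilinear_tensor])
    have b: "cbilinear (\<lambda>b (z::'b). ustar b *\<^sub>C z)" by (intro lin)
    show ?thesis
      unfolding bst_def dst_def star_star st_st rU_def clinear_tensor_lift_eq[OF f b] tensor_scaleC_right ..
  qed
  also have "\<dots> = M (\<lambda>a y. L (\<lambda>p q. ustar q *\<^sub>C (tau p \<otimes> y)) a) X"
    by (intro M_coassoc X lin)
  also have "\<dots> = M (\<lambda>a y. L (\<lambda>p q. ustar p *\<^sub>C q) a \<otimes> y) X"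
    by (simp add: tensor_lift_tensor_const[OF k(1)] ustar_tau flip: tensor_scaleC_left)
  also have "\<dots> = M (\<otimes>) (bst x)"
    unfolding bst_def rU_def M_scaled[OF B_star[OF assms] cbilinear_tensor ustar_clinear] X_def
    by (simp add: tensor_lift_tensor_const[OF k(2)] flip: tensor_scaleC_left)
  finally show ?thesis by (simp add: tensor_lift_ident)
qed

lemma coaction_D: "coaction H D \<theta>\<^sub>0"
proof -
  note R = \<theta>_range
  have "tensor_lift_on UNIV B (\<lambda>a y. L (\<lambda>a1 a2. a1 \<otimes> (a2 \<otimes> y)) a) (\<theta>\<^sub>0 x) = tensor_lift_on UNIV B (\<lambda>a y. a \<otimes> \<theta>\<^sub>0 y) (\<theta>\<^sub>0 x)"
    if x: "x \<in> B" for x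
  proof -
    have b: "cbilinear (\<lambda>a (y::'b). L (\<lambda>a1 a2. a1 \<otimes> (a2 \<otimes> y)) a)" "cbilinear (\<lambda>a y. a \<otimes> \<theta> y)" by (intro lin)+
    have "tensor_lift_on UNIV B (\<lambda>a y. L (\<lambda>a1 a2. a1 \<otimes> (a2 \<otimes> y)) a) (\<theta> x) = M (\<lambda>a y. L (\<lambda>a1 a2. a1 \<otimes> (a2 \<otimes> y)) a) x"
      using b by (intro tensor_lift_on_eq R x) auto
    moreover have "tensor_lift_on UNIV B (\<lambda>a y. a \<otimes> \<theta>\<^sub>0 y) (\<theta> x) = M (\<lambda>a y. a \<otimes> \<theta> y) x"
      using b by (intro tensor_lift_on_eq R x) (auto simp: \<theta>\<^sub>0_eq)
    ultimately show ?thesis using x by (simp add: \<theta>\<^sub>0_eq \<theta>_coassoc)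
  qed
  moreover have "tensor_lift_on UNIV B (\<lambda>a y. \<epsilon> a *\<^sub>C y) (\<theta>\<^sub>0 x) = x" if x: "x \<in> B" for x
  proof -
    have b: "cbilinear (\<lambda>a (y::'b). \<epsilon> a *\<^sub>C y)" by (intro lin)
    have "tensor_lift_on UNIV B (\<lambda>a y. \<epsilon> a *\<^sub>C y) (\<theta> x) = M (\<lambda>a y. \<epsilon> a *\<^sub>C y) x"
      using b by (intro tensor_lift_on_eq R x) auto
    then show ?thesis using x by (simp add: \<theta>\<^sub>0_eq \<theta>_counit)
  qed
  moreover have "\<theta>\<^sub>0 (amult D x y) = tensor_lift_on UNIV B (\<lambda>a x'. tensor_lift_on UNIV B
      (\<lambda>b y'. dmul a b \<otimes> amult D x' y') (\<theta>\<^sub>0 y)) (\<theta>\<^sub>0 x)" if x: "x \<in> B" and y: "y \<in> B" for x y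
  proof -
    have b: "cbilinear (\<lambda>b y'. dmul a b \<otimes> tw x' y')" "cbilinear (\<lambda>a x'. M (\<lambda>b y'. dmul a b \<otimes> tw x' y') y)" for a x' by (intro lin)+
    have "tensor_lift_on UNIV B (\<lambda>b y'. dmul a b \<otimes> amult D x' y') (\<theta> y) = M (\<lambda>b y'. dmul a b \<otimes> tw x' y') y" if "x' \<in> B" for a x'
      using b that by (intro tensor_lift_on_eq R y) (auto simp: amult_D)
    then have "tensor_lift_on UNIV B (\<lambda>a x'. tensor_lift_on UNIV B (\<lambda>b y'. dmul a b \<otimes> amult D x' y') (\<theta> y)) (\<theta> x) =
        M (\<lambda>a x'. M (\<lambda>b y'. dmul a b \<otimes> tw x' y') y) x"
      by (intro tensor_lift_on_eq[OF R[OF x] disjI1[OF b(2)]]) blast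
    then show ?thesis using x y by (simp add: \<theta>\<^sub>0_eq amult_D \<theta>_tw tw_mem)
  qed
  moreover have "\<theta>\<^sub>0 (astar D x) = tensor_lift_on UNIV B (\<lambda>a y. dst a \<otimes> astar D y) (\<theta>\<^sub>0 x)" if x: "x \<in> B" for x
  proof -
    have "conj_bilinear (\<lambda>a y. dst a \<otimes> bst y)"
      by (simp add: conj_bilinear_def dst_add dst_scaleC bst_add bst_scaleC tensor_add_left tensor_add_right
        tensor_scaleC_left tensor_scaleC_right)
    then have "tensor_lift_on UNIV B (\<lambda>a y. dst a \<otimes> astar D y) (\<theta> x) = M (\<lambda>a y. dst a \<otimes> bst y) x"
      by (intro tensor_lift_on_eq R x) (auto simp: astar_D)
    then show ?thesis using x by (simp add: \<theta>\<^sub>0_eq astar_D \<theta>_bst bst_mem)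
  qed
  ultimately show ?thesis
    unfolding coaction_def
    by (simp add: \<theta>\<^sub>0_eq R B_closed clinear_add[OF \<theta>_clinear] clinear_scaleC[OF \<theta>_clinear])
qed

section \<open>Fixed points and the conditional expectation\<close>

definition A :: "'b set" where "A = {x \<in> B. \<theta> x = \<one> \<otimes> x}"
definition E :: "'b \<Rightarrow> 'b" where "E x = M (\<lambda>a y. h a *\<^sub>C y) x"

lemma fixed_points_D: "fixed_points H D \<theta>\<^sub>0 = D\<lparr>carr := A\<rparr>"
  unfolding fixed_points_def A_def deformed_simps(1) carr_D
  by (intro arg_cong[where f = "\<lambda>X. D\<lparr>carr := X\<rparr>"] Collect_cong conj_cong refl) (simp add: \<theta>\<^sub>0_eq)

lemma cond_exp_D: "x \<in> B \<Longrightarrow> cond_exp H D \<theta>\<^sub>0 x = E x"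
proof -
  assume x: "x \<in> B"
  have b: "cbilinear (\<lambda>a (y::'b). h a *\<^sub>C y)" by (intro lin)
  show ?thesis
    unfolding cond_exp_def haar_deformed E_def carr_D \<theta>\<^sub>0_eq[OF x]
    using b by (intro tensor_lift_on_eq \<theta>_range x) auto
qed

lemma A_B: "a \<in> A \<Longrightarrow> a \<in> B" by (simp add: A_def)

lemma M_A: "a \<in> A \<Longrightarrow> cbilinear F \<or> conj_bilinear F \<Longrightarrow> M F a = F \<one> a"
  by (auto simp: A_def tensor_lift_tensor tensor_lift_conj_tensor)

lemma M_A_mult:
  assumes "a \<in> A" "x \<in> B" and F: "cbilinear F"
  shows "M F (a * x) = M (\<lambda>b y. F b (a * y)) x"
proof -
  have [lin]: "clinear f \<Longrightarrow> clinear (\<lambda>x. F c (f x))" "clinear g \<Longrightarrow> clinear (\<lambda>x. F (g x) d)" for f g c d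
    by (rule clinearI; simp add: clinear_add clinear_scaleC cbilinearD[OF F])+
  have b: "cbilinear (\<lambda>a' x'. M (\<lambda>b y'. F (a' \<cdot> b) (x' * y')) x)" by (intro lin)
  show ?thesis
    unfolding M_mult[OF A_B[OF assms(1)] assms(2) F] using b by (simp add: M_A[OF assms(1)])
qed

lemma A_mult: "a \<in> A \<Longrightarrow> b \<in> A \<Longrightarrow> a * b \<in> A"
proof -
  assume ab: "a \<in> A" "b \<in> A"
  have f: "cbilinear (\<lambda>(c::'h) y. c \<otimes> (a * y))" by (intro lin)
  have "\<theta> (a * b) = M (\<otimes>) (a * b)" by (simp add: tensor_lift_ident)
  also have "\<dots> = \<one> \<otimes> (a * b)"
    unfolding M_A_mult[OF ab(1) A_B[OF ab(2)] cbilinear_tensor] using f by (simp add: M_A[OF ab(2)])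
  finally show ?thesis using ab by (simp add: A_def B_mult)
qed

lemma A_star: "a \<in> A \<Longrightarrow> star a \<in> A"
proof -
  assume a: "a \<in> A"
  have "\<theta> (star a) = M (\<otimes>) (star a)" by (simp add: tensor_lift_ident)
  also have "\<dots> = M (\<lambda>b y. st b \<otimes> star y) a"
    by (rule M_star) (simp_all add: A_B a cbilinear_tensor)
  also have "\<dots> = \<one> \<otimes> star a"
  proof -
    have "conj_bilinear (\<lambda>b (y::'b). st b \<otimes> star y)"
      by (rule conj_bilinear_compose_stars(1)[OF cbilinear_tensor])
    then show ?thesis by (simp add: M_A[OF a])
  qed
  finally show ?thesis using a by (simp add: A_def B_star)
qed

lemma A_add: "a \<in> A \<Longrightarrow> b \<in> A \<Longrightarrow> a + b \<in> A"
  and A_scaleC: "a \<in> A \<Longrightarrow> c *\<^sub>C a \<in> A"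
  and A_diff: "a \<in> A \<Longrightarrow> b \<in> A \<Longrightarrow> a - b \<in> A"
  and A_zero: "0 \<in> A"
  by (simp_all add: A_def B_closed complex_vector.subspace_0[OF B_subspace] clinear_add[OF \<theta>_clinear]
      clinear_scaleC[OF \<theta>_clinear] clinear_diff[OF \<theta>_clinear] clinear_zero[OF \<theta>_clinear]
      tensor_add_right tensor_scaleC_right clinear_diff[OF clinear_of_cbilinear(1)[OF cbilinear_tensor]])

text \<open>A fixed point contributes the first leg 1, and Omega(1 \<otimes> b) =
  \<epsilon>(b).\<close>

lemma tw_A: "a \<in> A \<Longrightarrow> x \<in> B \<Longrightarrow> tw a x = a * x"
proof -
  assume a: "a \<in> A" "x \<in> B"
  have b: "cbilinear (\<lambda>a x'. M (\<lambda>b y'. sg a b *\<^sub>C (x' * y')) x)" "cbilinear (\<lambda>b (y'::'b). \<epsilon> b *\<^sub>C y')" by (intro lin)+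
  have c: "clinear ((*) a)" by (intro lin)
  have "tw a x = M (\<lambda>b y'. \<epsilon> b *\<^sub>C (a * y')) x"
    unfolding tw_def using b by (simp add: M_A[OF a(1)])
  also have "\<dots> = a * M (\<lambda>b y'. \<epsilon> b *\<^sub>C y') x"
    unfolding clinear_tensor_lift_eq[OF c b(2)] by (simp add: scaleC_mult_right)
  finally show ?thesis by (simp add: \<theta>_counit a)
qed

lemma bst_A: "a \<in> A \<Longrightarrow> bst a = star a"
proof -
  assume a: "a \<in> A"
  have b: "cbilinear (\<lambda>a (y::'b). ustar a *\<^sub>C y)" by (intro lin)
  show ?thesis
    unfolding bst_def rU_def using b by (simp add: M_A A_star[OF a] ustar_one scaleC_one)
qed

lemma rV_A_mult: "a \<in> A \<Longrightarrow> x \<in> B \<Longrightarrow> rV (a * x) = a * rV x"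
proof -
  assume a: "a \<in> A" "x \<in> B"
  have b: "cbilinear (\<lambda>b (y::'b). vstar b *\<^sub>C y)" by (intro lin)
  have c: "clinear ((*) a)" by (intro lin)
  show ?thesis
    unfolding rV_def M_A_mult[OF a b] clinear_tensor_lift_eq[OF c b] by (simp add: scaleC_mult_right)
qed

lemma E_A: "x \<in> B \<Longrightarrow> E x \<in> A"
proof -
  assume x: "x \<in> B"
  have b: "cbilinear (\<lambda>p q. h p *\<^sub>C q)" by (intro lin)
  have b2: "cbilinear (\<lambda>a (y::'b). h a *\<^sub>C y)" by (intro lin)
  have c: "clinear ((\<otimes>) \<one> :: 'b \<Rightarrow> ('h, 'b) tensor)" by (rule clinear_of_cbilinear(1)[OF cbilinear_tensor])
  have "\<theta> (E x) = M (\<otimes>) (E x)" by (simp add: tensor_lift_ident)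
  also have "\<dots> = M (\<lambda>a y. L (\<lambda>p q. h p *\<^sub>C q) a \<otimes> y) x"
    unfolding E_def M_scaled[OF x cbilinear_tensor h_clinear]
    by (simp add: tensor_lift_tensor_const[OF b] flip: tensor_scaleC_left)
  also have "\<dots> = M (\<lambda>a y. \<one> \<otimes> (h a *\<^sub>C y)) x"
    by (simp add: haar_stateD(4)[OF haar] tensor_scaleC_left tensor_scaleC_right)
  also have "\<dots> = \<one> \<otimes> E x"
    unfolding E_def clinear_tensor_lift_eq[OF c b2] ..
  finally have "\<theta> (E x) = \<one> \<otimes> E x" .
  moreover have "E x \<in> B" unfolding E_def by (intro M_mem x b2 B_scaleC)
  ultimately show ?thesis by (simp add: A_def)
qed

lemma E_tw:
  assumes "x \<in> B" "y \<in> B"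
  shows "E (tw x y) = E (x * rV y)"
proof -
  have b: "cbilinear (\<lambda>a (z::'b). h a *\<^sub>C z)" by (intro lin)
  have k: "cbilinear (\<lambda>b1 b2. sg a1 b1 * h (a2 \<cdot> b2))" "cbilinear (\<lambda>a1 a2. L (\<lambda>b1 b2. sg a1 b1 * h (a2 \<cdot> b2)) b)"
    "cbilinear (\<lambda>b1 b2. vstar b1 * h (a \<cdot> b2))" for a a1 a2 b by (intro lin)+
  have "E (tw x y) = M (\<lambda>a x'. M (\<lambda>b y'. L (\<lambda>a1 a2. L (\<lambda>b1 b2. sg a1 b1 * h (a2 \<cdot> b2)) b) a *\<^sub>C (x' * y')) y) x"
    unfolding E_def M_tw[OF assms b] scaleC_scaleC tensor_lift_scaleC_const[OF k(1)] tensor_lift_scaleC_const[OF k(2)] ..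
  also have "\<dots> = M (\<lambda>a x'. M (\<lambda>b y'. L (\<lambda>b1 b2. vstar b1 * h (a \<cdot> b2)) b *\<^sub>C (x' * y')) y) x"
    unfolding haar_twisted_product ..
  also have "\<dots> = M (\<lambda>a x'. M (\<lambda>b w. h (a \<cdot> b) *\<^sub>C (x' * w)) (rV y)) x"
  proof -
    have "cbilinear (\<lambda>b w. h (a \<cdot> b) *\<^sub>C (x' * w))" for a and x' :: 'b by (intro lin)
    then show ?thesis
      unfolding rV_def by (simp add: M_scaled[OF assms(2) _ vstar_clinear] scaleC_scaleC tensor_lift_scaleC_const[OF k(3)])
  qed
  also have "\<dots> = E (x * rV y)"
    unfolding E_def by (rule M_mult[OF assms(1) rV_mem[OF assms(2)] b, symmetric])
  finally show ?thesis .
qed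

lemma E_square:
  assumes w: "w \<in> B" and xs: "\<theta> w = abs_tensor xs" "orthogonal_list xs"
  shows "E (star w * w) = (\<Sum>p\<leftarrow>xs. h (st (fst p) \<cdot> fst p) *\<^sub>C (star (snd p) * snd p))"
proof -
  have b: "cbilinear (\<lambda>a (z::'b). h a *\<^sub>C z)" "cbilinear (\<lambda>b y. h (a \<cdot> b) *\<^sub>C (x * y))"
    "cbilinear (\<lambda>a x. M (\<lambda>b y. h (a \<cdot> b) *\<^sub>C (x * y)) w)" for a and x :: 'b by (intro lin)+
  have "E (star w * w) = M (\<lambda>a x. M (\<lambda>b y. h (a \<cdot> b) *\<^sub>C (x * y)) w) (star w)"
    unfolding E_def by (rule M_mult[OF B_star[OF w] w b(1)])
  also have "\<dots> = M (\<lambda>a x. M (\<lambda>b y. h (st a \<cdot> b) *\<^sub>C (star x * y)) w) w"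
    using b(3) by (intro M_star[OF w]) simp
  also have "\<dots> = pair_sum (\<lambda>a x. pair_sum (\<lambda>b y. h (st a \<cdot> b) *\<^sub>C (star x * y)) xs) xs"
    using conj_bilinear_compose_stars(1)[OF b(3)]
    unfolding xs(1) by (simp add: tensor_lift_conj_abs tensor_lift_abs[OF b(2)])
  also have "\<dots> = (\<Sum>p\<leftarrow>xs. \<Sum>q\<leftarrow>xs. h (st (fst p) \<cdot> fst q) *\<^sub>C (star (snd p) * snd q))"
    by (simp only: pair_sum_eq_sum_list)
  also have "\<dots> = (\<Sum>p\<leftarrow>xs. h (st (fst p) \<cdot> fst p) *\<^sub>C (star (snd p) * snd p))"
    using xs(2) unfolding orthogonal_list_def by (rule sum_list_orthogonal) simp
  finally show ?thesis .
qed

text \<open>For an orthogonal decomposition of \<open>\<theta> w\<close> only diagonal terms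
  survive, and the square roots of their nonnegative weights go into the entries of
  \<open>zs\<close>. One list serves all a w, since a fixed point multiplies only the second
  legs.\<close>

lemma E_square_decomposition:
  assumes w: "w \<in> B"
  obtains zs where "\<And>a. a \<in> A \<Longrightarrow> E (star (a * w) * (a * w)) = (\<Sum>z\<leftarrow>zs. star (a * z) * (a * z))"
    "E (star w * w) = (\<Sum>z\<leftarrow>zs. star z * z)" "(\<And>z. z \<in> set zs \<Longrightarrow> z = 0) \<Longrightarrow> w = 0"
proof -
  obtain xs where xs: "\<theta> w = abs_tensor xs" "orthogonal_list xs"
    using orthogonal_decomposition[of "\<theta> w"] by metis
  define c where "c p = Re (h (st (fst p) \<cdot> fst p))" for p :: "'h \<times> 'b"
  have c: "h (st (fst p) \<cdot> fst p) = complex_of_real (c p)" "0 \<le> c p" for p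
    using haar_stateD(3)[OF haar, of "fst p"] by (simp_all add: c_def complex_nonneg_Reals_iff complex_eq_iff)
  define zs where "zs = map (\<lambda>p. sqrt (c p) *\<^sub>R snd p) xs"
  have sq: "h (st (fst p) \<cdot> fst p) *\<^sub>C (star y * y) = star (sqrt (c p) *\<^sub>R y) * (sqrt (c p) *\<^sub>R y)" for p and y :: 'b
    using c(2)[of p] by (simp add: c(1) star_scaleR flip: scaleR_scaleC)
  show ?thesis
  proof (rule that)
    show "E (star w * w) = (\<Sum>z\<leftarrow>zs. star z * z)"
      unfolding E_square[OF w xs] by (simp add: sq zs_def o_def)
    show "E (star (a * w) * (a * w)) = (\<Sum>z\<leftarrow>zs. star (a * z) * (a * z))" if a: "a \<in> A" for a
    proof -
      define ys where "ys = map (\<lambda>p. (fst p, a * snd p)) xs"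
      have f: "cbilinear (\<lambda>(c::'h) y. c \<otimes> (a * y))" by (intro lin)
      have "\<theta> (a * w) = M (\<lambda>c y. c \<otimes> (a * y)) w"
        using M_A_mult[OF a w cbilinear_tensor] by (simp add: tensor_lift_ident)
      also have "\<dots> = abs_tensor ys"
        unfolding xs(1) tensor_lift_abs[OF f] abs_tensor_eq_pair_sum[of ys] by (simp add: ys_def pair_sum_eq_sum_list o_def)
      finally have "\<theta> (a * w) = abs_tensor ys" .
      moreover have "orthogonal_list ys"
        using xs(2) by (simp add: orthogonal_list_def ys_def sorted_wrt_map)
      ultimately have "E (star (a * w) * (a * w)) = (\<Sum>p\<leftarrow>ys. h (st (fst p) \<cdot> fst p) *\<^sub>C (star (snd p) * snd p))"
        by (rule E_square[OF B_mult[OF A_B[OF a] w]])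
      also have "\<dots> = (\<Sum>p\<leftarrow>xs. star (sqrt (c p) *\<^sub>R (a * snd p)) * (sqrt (c p) *\<^sub>R (a * snd p)))"
        unfolding sq[symmetric] by (simp add: ys_def o_def)
      finally show ?thesis by (simp add: zs_def o_def)
    qed
    show "w = 0" if zs0: "\<And>z. z \<in> set zs \<Longrightarrow> z = 0"
    proof -
      \<comment> \<open>If the weight is 0, faithfulness of \<open>h\<close> kills the first leg;
        otherwise the second leg vanishes.\<close>
      have "fst p \<otimes> snd p = 0" if p: "p \<in> set xs" for p
      proof -
        have "sqrt (c p) *\<^sub>R snd p = 0"
          by (rule zs0) (use p in \<open>simp add: zs_def\<close>)
        then show ?thesis using haar_faithful[of "fst p"] c(1)[of p] by auto
      qed
      then have "(\<Sum>p\<leftarrow>xs. fst p \<otimes> snd p) = 0" by (induction xs) auto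
      then have "\<theta> w = 0" unfolding xs(1) abs_tensor_eq_pair_sum pair_sum_eq_sum_list .
      moreover have "cbilinear (\<lambda>a (y::'b). \<epsilon> a *\<^sub>C y)" by (intro lin)
      ultimately show "w = 0" using \<theta>_counit[OF w] by (simp add: tensor_lift_zero)
    qed
  qed
qed

text \<open>The fixed points are closed, so the root found by the iteration stays among them, where
  deformed and original operations coincide.\<close>

lemma A_root:
  assumes "(\<Sum>z\<leftarrow>zs. star z * z) \<in> A"
  shows "positive_in (D\<lparr>carr := A\<rparr>) (\<Sum>z\<leftarrow>zs. star z * z)"
proof -
  have "closed A" using closed_fixed by (simp add: A_def)
  then obtain k where k: "k \<in> A" "star k = k" "(\<Sum>z\<leftarrow>zs. star z * z) = star k * k"
    by (rule sum_squares_root[OF _ A_zero _ _ assms]) (auto intro: A_add A_mult simp: scaleR_scaleC A_scaleC)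
  then have "(\<Sum>z\<leftarrow>zs. star z * z) = amult D (astar D k) k"
    by (simp add: astar_D A_B bst_A amult_D tw_A)
  then show ?thesis using k(1) unfolding positive_in_def by auto
qed

lemma complete_cstar_norm_A: "complete_cstar_norm (D\<lparr>carr := A\<rparr>) norm"
proof -
  have ops: "amult D x y = x * y" "astar D x = star x" if "x \<in> A" "y \<in> A" for x y
    using that by (simp_all add: amult_D astar_D A_B tw_A bst_A)
  have sub: "complex_vector.subspace A"
    by (rule complex_vector.subspaceI) (auto intro: A_zero A_add A_scaleC)
  have "star_algebra (D\<lparr>carr := A\<rparr>)"
    unfolding star_algebra_def
    by (simp add: ops A_mult A_star A_add A_scaleC sub distrib_left distrib_right scaleC_mult_left scaleC_mult_right
      mult.assoc star_add star_scaleC star_mult star_star)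
  moreover have "\<exists>x\<in>A. (\<lambda>n. norm (X n - x)) \<longlonglongrightarrow> 0"
    if X: "range X \<subseteq> A" "\<forall>e>0. \<exists>K. \<forall>m\<ge>K. \<forall>n\<ge>K. norm (X m - X n) < e" for X :: "nat \<Rightarrow> 'b"
  proof -
    have "Cauchy X" using X(2) by (simp add: Cauchy_def dist_norm)
    then obtain x where x: "X \<longlonglongrightarrow> x" using Cauchy_convergent by (auto simp: convergent_def)
    have "closed A" using closed_fixed by (simp add: A_def)
    then have "x \<in> A" using x X(1) closed_sequentially[of A X x] by auto
    moreover have "(\<lambda>n. norm (X n - x)) \<longlonglongrightarrow> 0" using x by (simp add: LIM_zero_iff tendsto_norm_zero)
    ultimately show ?thesis by blast
  qed
  ultimately show ?thesis
    unfolding complete_cstar_norm_def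
    by (simp add: ops A_star norm_scaleC norm_triangle_ineq norm_mult_ineq norm_star_mult_self)
qed

theorem algebraic_action_D: "algebraic_action H D \<theta>\<^sub>0"
proof -
  let ?A = "D\<lparr>carr := A\<rparr>"
  have E: "cond_exp H D \<theta>\<^sub>0 (amult D (astar D x) x) = E (star (rV x) * rV x)" if "x \<in> B" for x
    using that by (simp add: astar_D amult_D bst_mem cond_exp_D tw_mem E_tw) (simp add: bst_eq)
  have pos: "positive_in ?A (E (star w * w))" if w: "w \<in> B" for w
  proof -
    obtain zs where "E (star w * w) = (\<Sum>z\<leftarrow>zs. star z * z)" using E_square_decomposition[OF w] by metis
    then show ?thesis using A_root[of zs] E_A[of "star w * w"] w by (simp add: B_closed)
  qed
  have faithful: "w = 0" if w: "w \<in> B" "E (star w * w) = 0" for w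
  proof -
    obtain zs where "E (star w * w) = (\<Sum>z\<leftarrow>zs. star z * z)" "(\<And>z. z \<in> set zs \<Longrightarrow> z = 0) \<Longrightarrow> w = 0"
      using E_square_decomposition[OF w(1)] by metis
    then show ?thesis using sum_squares_eq_zero[of zs] w(2) by auto
  qed
  have bound: "positive_in ?A (complex_of_real ((norm a)\<^sup>2) *\<^sub>C E (star w * w) - E (star (a * w) * (a * w)))"
    if a: "a \<in> A" and w: "w \<in> B" for a w
  proof -
    obtain zs where zs: "E (star (a * w) * (a * w)) = (\<Sum>z\<leftarrow>zs. star (a * z) * (a * z))" "E (star w * w) = (\<Sum>z\<leftarrow>zs. star z * z)"
      by (rule E_square_decomposition[OF w]) (use a in blast)
    define f where "f z = (SOME t. star t * t = (norm a)\<^sup>2 *\<^sub>R (star z * z) - star (a * z) * (a * z))" for z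
    have f: "star (f z) * f z = (norm a)\<^sup>2 *\<^sub>R (star z * z) - star (a * z) * (a * z)" for z
    proof -
      obtain t where "star t * t = (norm a)\<^sup>2 *\<^sub>R (star z * z) - star (a * z) * (a * z)" by (rule norm_le_sum_squares[where a = a and y = z]) blast
      then show ?thesis unfolding f_def by (rule someI)
    qed
    have "(norm a)\<^sup>2 *\<^sub>R (\<Sum>z\<leftarrow>zs. star z * z) - (\<Sum>z\<leftarrow>zs. star (a * z) * (a * z)) = (\<Sum>t\<leftarrow>map f zs. star t * t)"
      by (induction zs) (simp_all add: f scaleR_add_right)
    then have eq: "complex_of_real ((norm a)\<^sup>2) *\<^sub>C E (star w * w) - E (star (a * w) * (a * w)) = (\<Sum>t\<leftarrow>map f zs. star t * t)"
      unfolding zs scaleR_scaleC .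
    have "complex_of_real ((norm a)\<^sup>2) *\<^sub>C E (star w * w) - E (star (a * w) * (a * w)) \<in> A"
      by (intro A_diff A_scaleC E_A B_star B_mult w A_B[OF a])
    then show ?thesis unfolding eq by (rule A_root)
  qed
  \<comment> \<open>\<open>rV\<close> is injective on \<open>B\<close>, being inverted there by
    \<open>rU\<close>.\<close>
  have nonzero: "E (star (rV x) * rV x) \<noteq> 0" if "x \<in> B" "x \<noteq> 0" for x
    using faithful[OF rV_mem[OF that(1)]] rU_rV(1)[OF that(1)] that(2) clinear_zero[OF rU_clinear] by auto
  \<comment> \<open>Associativity and antimultiplicativity rewrite the argument as the deformed
    square of a \<star> x = a x, and \<open>rV\<close> commutes with left multiplication by fixed
    points.\<close>
  have E2: "cond_exp H D \<theta>\<^sub>0 (amult D (astar D x) (amult D (astar D a) (amult D a x))) =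
      E (star (a * rV x) * (a * rV x))" if a: "a \<in> A" and x: "x \<in> B" for a x
  proof -
    have "amult D (astar D x) (amult D (astar D a) (amult D a x)) = tw (bst x) (tw (bst a) (tw a x))"
      using a x by (simp add: astar_D amult_D A_B bst_mem tw_mem)
    also have "\<dots> = tw (bst (tw a x)) (tw a x)"
      using a x by (simp add: bst_tw A_B bst_mem tw_mem tw_assoc)
    finally show ?thesis
      using a x E[of "tw a x"] by (simp add: astar_D amult_D A_B bst_mem tw_mem tw_A rV_A_mult B_mult)
  qed
  show ?thesis
    unfolding algebraic_action_def Let_def fixed_points_D
    using cqg_deformed star_algebra_D coaction_D complete_cstar_norm_A pos nonzero bound
    by (intro conjI exI[of _ norm]) (auto simp: E E2 rV_mem)
qed

end

section \<open>Regular elements of a continuous action\<close>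

lemma clinear_compose: "clinear g \<Longrightarrow> clinear f \<Longrightarrow> clinear (\<lambda>x. g (f x))"
  for f :: "'a::complex_vector \<Rightarrow> 'b::complex_vector" and g :: "'b \<Rightarrow> 'c::complex_vector"
  by (rule clinearI) (simp_all add: clinear_add clinear_scaleC)

lemma clinear_left_inverse:
  fixes f :: "'a::complex_vector \<Rightarrow> 'b::complex_vector"
  assumes "clinear f" "inj f"
  shows "\<exists>g. clinear g \<and> (\<forall>x. g (f x) = x)"
proof -
  have "vector_space_pair (scaleC :: complex \<Rightarrow> 'a \<Rightarrow> 'a) (scaleC :: complex \<Rightarrow> 'b \<Rightarrow> 'b)" ..
  from vector_space_pair.linear_injective_left_inverse[OF this assms]
  obtain g where g: "clinear g" "g \<circ> f = id" by (elim exE conjE)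
  from g(2) have "\<forall>x. g (f x) = x" by (simp add: fun_eq_iff)
  with g(1) show ?thesis by (intro exI conjI)
qed

lemma cbilinear_compose:
  assumes "cbilinear T" "clinear f" "clinear g"
  shows "cbilinear (\<lambda>a b. T (f a) (g b))"
  using assms by (intro cbilinearI clinearI) (simp_all add: cbilinearD clinear_add clinear_scaleC)

text \<open>Linear left inverses of \<open>f\<close> and \<open>g\<close> yield one of their tensor
  product, which is then composed with the injective map induced by \<open>T\<close>.\<close>

lemma inj_tensor_lift_compose:
  fixes f :: "'a::complex_vector \<Rightarrow> 'a'::complex_vector" and g :: "'b::complex_vector \<Rightarrow> 'b'::complex_vector"
    and T :: "'a' \<Rightarrow> 'b' \<Rightarrow> 'c::complex_vector"
  assumes T: "cbilinear T" "inj (tensor_lift T)" and f: "clinear f" "inj f" and g: "clinear g" "inj g"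
  shows "inj (tensor_lift (\<lambda>a b. T (f a) (g b)))"
proof (rule injI)
  fix s t assume eq: "tensor_lift (\<lambda>a b. T (f a) (g b)) s = tensor_lift (\<lambda>a b. T (f a) (g b)) t"
  obtain f' where f': "clinear f'" "\<And>x. f' (f x) = x" 
    using clinear_left_inverse[OF f] by blast
  obtain g' where g': "clinear g'" "\<And>x. g' (g x) = x" 
    using clinear_left_inverse[OF g] by blast
  let ?u = "\<lambda>s. tensor_lift (\<lambda>a b. f a \<otimes> g b) s"
  note b = cbilinear_compose[OF cbilinear_tensor f(1) g(1)] cbilinear_compose[OF cbilinear_tensor f'(1) g'(1)]
  have "tensor_lift T (?u s) = tensor_lift (\<lambda>a b. T (f a) (g b)) s" for s
    by (subst clinear_tensor_lift_eq[OF clinear_tensor_lift[OF T(1)] b(1)]) (simp add: tensor_lift_tensor[OF T(1)])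
  with eq have "tensor_lift T (?u s) = tensor_lift T (?u t)" by simp
  then have "?u s = ?u t" by (rule injD[OF T(2)])
  have left: "tensor_lift (\<lambda>a b. f' a \<otimes> g' b) (?u s) = s" for s
    by (subst clinear_tensor_lift_eq[OF clinear_tensor_lift[OF b(2)] b(1)])
      (simp only: tensor_lift_tensor[OF b(2)] f'(2) g'(2) tensor_lift_ident)
  have "s = tensor_lift (\<lambda>a b. f' a \<otimes> g' b) (?u s)" by (rule left[symmetric])
  also have "\<dots> = t" unfolding \<open>?u s = ?u t\<close> by (rule left)
  finally show "s = t" .
qed

lemma tensor_basis_expansion:
  fixes t :: "('a::complex_vector, 'b::complex_vector) tensor"
  obtains S and f :: "'a \<Rightarrow> 'a \<Rightarrow> complex"
  where "finite S" "\<And>b. clinear (f b)" "t = (\<Sum>b\<in>S. b \<otimes> tensor_lift (\<lambda>a y. f b a *\<^sub>C y) t)"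
proof -
  define X :: "'a set" where "X = complex_vector.extend_basis {}"
  have X: "complex_vector.independent X" "complex_vector.span X = UNIV"
    unfolding X_def by (simp_all add: complex_vector.independent_extend_basis complex_vector.span_extend_basis complex_vector.independent_empty)
  define f where "f b a = complex_vector.representation X a b" for a b
  have f: "clinear (f b)" for b
    by (rule clinearI) (simp_all add: f_def complex_vector.representation_add complex_vector.representation_scale X)
  note b = cbilinearI[OF clinear_compose_scaleC_right[OF clinear_ident] clinear_compose_scaleC_left[OF f]]
  \<comment> \<open>Claimed for all larger finite sets, so that the sets belonging to two summands
    can be merged.\<close>
  have "\<exists>S. finite S \<and> (\<forall>S'. finite S' \<longrightarrow> S \<subseteq> S' \<longrightarrow> t = (\<Sum>b\<in>S'. b \<otimes> tensor_lift (\<lambda>a y. f b a *\<^sub>C y) t))"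
  proof (induction t rule: tensor_induct)
    case zero
    then show ?case by (auto simp: tensor_lift_zero[OF b])
  next
    case (tensor a y)
    have "a \<otimes> y = (\<Sum>b\<in>S'. b \<otimes> (f b a *\<^sub>C y))" if S': "finite S'" "{b. f b a \<noteq> 0} \<subseteq> S'" for S'
    proof -
      have "(\<Sum>b\<in>S'. f b a *\<^sub>C b) = (\<Sum>b | f b a \<noteq> 0. f b a *\<^sub>C b)"
        using S' by (intro sum.mono_neutral_right) auto
      also have "\<dots> = a" unfolding f_def by (rule complex_vector.sum_nonzero_representation_eq) (simp_all add: X)
      finally have "a \<otimes> y = (\<Sum>b\<in>S'. f b a *\<^sub>C b) \<otimes> y" by simp
      also have "\<dots> = (\<Sum>b\<in>S'. b \<otimes> (f b a *\<^sub>C y))"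
        by (simp add: clinear_sum[OF clinear_of_cbilinear(2)[OF cbilinear_tensor]] tensor_scaleC_left tensor_scaleC_right)
      finally show ?thesis .
    qed
    moreover have "finite {b. f b a \<noteq> 0}" unfolding f_def by (rule complex_vector.finite_representation)
    ultimately show ?case unfolding tensor_lift_tensor[OF b] by blast
  next
    case (add s t)
    then obtain S1 S2 where S: "finite S1" "\<And>S'. finite S' \<Longrightarrow> S1 \<subseteq> S' \<Longrightarrow> s = (\<Sum>b\<in>S'. b \<otimes> tensor_lift (\<lambda>a y. f b a *\<^sub>C y) s)"
      "finite S2" "\<And>S'. finite S' \<Longrightarrow> S2 \<subseteq> S' \<Longrightarrow> t = (\<Sum>b\<in>S'. b \<otimes> tensor_lift (\<lambda>a y. f b a *\<^sub>C y) t)" by blast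
    have "s + t = (\<Sum>b\<in>S'. b \<otimes> tensor_lift (\<lambda>a y. f b a *\<^sub>C y) (s + t))" if "finite S'" "S1 \<union> S2 \<subseteq> S'" for S'
      using S(2)[of S'] S(4)[of S'] that by (simp add: tensor_lift_add[OF b] tensor_add_right sum.distrib)
    then show ?case using S(1,3) by (intro exI[of _ "S1 \<union> S2"]) blast
  qed
  then show ?thesis using that f by blast
qed

text \<open>Coordinates in a basis of the first leg are slices. So \<theta>(B) inside C[G] \<otimes>
  B reduces to regularity of the slices of regular elements.\<close>

lemma tensor_on_of_slices:
  fixes t :: "('a::complex_vector, 'b::complex_vector) tensor"
  assumes "\<And>f :: 'a \<Rightarrow> complex. clinear f \<Longrightarrow> tensor_lift (\<lambda>a y. f a *\<^sub>C y) t \<in> T"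
  shows "t \<in> tensor_on UNIV T"
proof -
  obtain S and f :: "'a \<Rightarrow> 'a \<Rightarrow> complex" where S: "finite S" "\<And>b. clinear (f b)"
    "t = (\<Sum>b\<in>S. b \<otimes> tensor_lift (\<lambda>a y. f b a *\<^sub>C y) t)" by (rule tensor_basis_expansion[of t]) (rule that; assumption)
  obtain l where l: "set l = S" "distinct l" using finite_distinct_list[OF S(1)] by blast
  let ?l = "map (\<lambda>b. (b, tensor_lift (\<lambda>a y. f b a *\<^sub>C y) t)) l"
  have "t = abs_tensor ?l"
    using S(3) l by (simp add: abs_tensor_eq_pair_sum pair_sum_eq_sum_list o_def sum_list_distinct_conv_sum_set)
  moreover have "set ?l \<subseteq> UNIV \<times> T" using assms S(2) by auto
  ultimately show ?thesis unfolding tensor_on_def by blast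
qed

lemma star_one: "star (1 :: 'a::{cstar_algebra, real_normed_algebra_1}) = 1"
  by (metis mult.right_neutral mult.left_neutral star_mult star_star)

section \<open>From the continuous action to a linear coaction on regular elements\<close>

locale continuous_cqg_action = cqg G for G :: "'h::complex_vector star_bialgebra" +
  fixes tgg :: "'g::{cstar_algebra, real_normed_algebra_1} \<Rightarrow> 'g \<Rightarrow> 'gg::cstar_algebra"
    and \<Delta> :: "'g \<Rightarrow> 'gg" and \<iota> :: "'h \<Rightarrow> 'g"
    and tgb :: "'g \<Rightarrow> 'b::cstar_algebra \<Rightarrow> 'gb::cstar_algebra"
    and p :: "'gg \<Rightarrow> 'b \<Rightarrow> 'ggb::cstar_algebra" and q :: "'g \<Rightarrow> 'gb \<Rightarrow> 'ggb"
    and \<theta> :: "'b \<Rightarrow> 'gb"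
  assumes coefficients: "matrix_coefficient_algebra tgg \<Delta> G \<iota>"
    and action: "continuous_action tgg \<Delta> tgb p q \<theta>"
begin

abbreviation B where "B \<equiv> regular_elements \<iota> tgb \<theta>"

lemma \<iota>_clinear: "clinear \<iota>" and \<iota>_inj: "inj \<iota>"
  and \<iota>_mult: "\<iota> (a \<cdot> b) = \<iota> a * \<iota> b" and \<iota>_one: "\<iota> \<one> = 1" and \<iota>_st: "\<iota> (st a) = star (\<iota> a)"
  and \<Delta>_\<iota>: "\<Delta> (\<iota> a) = L (\<lambda>b c. tgg (\<iota> b) (\<iota> c)) a"
  using coefficients by (auto simp: matrix_coefficient_algebra_def)

lemma tgg_cbilinear: "cbilinear tgg" and tgb_cbilinear: "cbilinear tgb"
  and p_cbilinear: "cbilinear p" and q_cbilinear: "cbilinear q"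
  and tgb_inj: "inj (tensor_lift tgb)" and q_inj: "inj (tensor_lift q)"
  and tgb_mult: "tgb a x * tgb b y = tgb (a * b) (x * y)" and tgb_star: "star (tgb a x) = tgb (star a) (star x)"
  and p_q: "p (tgg a b) x = q a (tgb b x)"
  and \<theta>_hom: "star_hom \<theta>" and \<theta>_inj: "inj \<theta>"
  using action by (auto simp: continuous_action_def spatial_triple_product_def spatial_tensor_product_def)

lemmas \<theta>_simps = star_homD[OF \<theta>_hom]

lemma \<theta>_linear: "clinear \<theta>" using \<theta>_hom by (simp add: star_hom_def)

lemmas compose_lin [lin] = clinear_compose[OF \<iota>_clinear] clinear_compose[OF \<theta>_linear]
  clinear_compose[OF clinear_of_cbilinear(1)[OF tgg_cbilinear]] clinear_compose[OF clinear_of_cbilinear(2)[OF tgg_cbilinear]]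
  clinear_compose[OF clinear_of_cbilinear(1)[OF tgb_cbilinear]] clinear_compose[OF clinear_of_cbilinear(2)[OF tgb_cbilinear]]
  clinear_compose[OF clinear_of_cbilinear(1)[OF p_cbilinear]] clinear_compose[OF clinear_of_cbilinear(2)[OF p_cbilinear]]
  clinear_compose[OF clinear_of_cbilinear(1)[OF q_cbilinear]] clinear_compose[OF clinear_of_cbilinear(2)[OF q_cbilinear]]

definition J :: "('h, 'b) tensor \<Rightarrow> 'gb" where "J = tensor_lift (\<lambda>a y. tgb (\<iota> a) y)"

lemma J_cbilinear: "cbilinear (\<lambda>a y. tgb (\<iota> a) y)" by (intro lin)

lemma J_clinear: "clinear J" unfolding J_def by (rule clinear_tensor_lift[OF J_cbilinear])

lemma J_tensor: "J (a \<otimes> y) = tgb (\<iota> a) y" unfolding J_def by (rule tensor_lift_tensor[OF J_cbilinear])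

lemma clinear_compose_J [lin]: "clinear f \<Longrightarrow> clinear (\<lambda>x. J (f x))"
  by (rule clinear_compose[OF J_clinear])

lemma J_inj: "inj J"
  unfolding J_def using tgb_cbilinear tgb_inj \<iota>_clinear \<iota>_inj clinear_ident inj_on_id2 by (rule inj_tensor_lift_compose)

text \<open>A linear left inverse on the whole completed tensor product, unconstrained off the range
  of \<open>J\<close>. Through it the regular coaction becomes the total linear map
  \<open>\<Theta>\<close>.\<close>

definition Ji where "Ji = (SOME g. clinear g \<and> (\<forall>t. g (J t) = t))"

lemma Ji: "clinear Ji" "Ji (J t) = t"
  using someI_ex[OF clinear_left_inverse[OF J_clinear J_inj], folded Ji_def] by blast+

definition \<Theta> :: "'b \<Rightarrow> ('h, 'b) tensor" where "\<Theta> x = Ji (\<theta> x)"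

lemma \<Theta>_clinear: "clinear \<Theta>"
  unfolding \<Theta>_def by (rule clinear_compose[OF Ji(1) \<theta>_linear])

lemma clinear_compose_\<Theta> [lin]: "clinear f \<Longrightarrow> clinear (\<lambda>x. \<Theta> (f x))"
  by (rule clinear_compose[OF \<Theta>_clinear])

lemma mem_B: "x \<in> B \<longleftrightarrow> (\<exists>t. \<theta> x = J t)"
  by (simp add: regular_elements_def J_def)

lemma \<Theta>_unique: "\<theta> x = J t \<Longrightarrow> \<Theta> x = t"
  by (simp add: \<Theta>_def Ji)

lemma J_\<Theta>: "x \<in> B \<Longrightarrow> J (\<Theta> x) = \<theta> x"
  using \<Theta>_unique by (auto simp: mem_B)

lemma regular_coaction_eq: "x \<in> B \<Longrightarrow> regular_coaction \<iota> tgb \<theta> x = \<Theta> x"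
  unfolding regular_coaction_def J_def[symmetric]
  by (rule the_equality) (auto simp: J_\<Theta> \<Theta>_unique)

lemma J_mult: "J (tensor_mult (hmult G) (*) s t) = J s * J t"
proof (rule clinear_eq_on_tensors[where t = s])
  have b: "cbilinear (\<lambda>a x. tensor_lift (\<lambda>c d. (a \<cdot> c) \<otimes> (x * d)) t)" "cbilinear (\<lambda>c d. (a \<cdot> c) \<otimes> (x * d))"
    for a and x :: 'b and t :: "('h, 'b) tensor" by (intro lin)+
  show "clinear (\<lambda>s. J (tensor_mult (hmult G) (*) s t))" unfolding tensor_mult_def by (intro lin)
  show "clinear (\<lambda>s. J s * J t)" by (intro lin)
  fix a x
  show "J (tensor_mult (hmult G) (*) (a \<otimes> x) t) = J (a \<otimes> x) * J t"
  proof (rule clinear_eq_on_tensors[where t = t])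
    show "clinear (\<lambda>t. J (tensor_mult (hmult G) (*) (a \<otimes> x) t))"
      unfolding tensor_mult_def tensor_lift_tensor[OF b(1)] by (intro lin)
    show "clinear (\<lambda>t. J (a \<otimes> x) * J t)" by (intro lin)
    fix b y
    show "J (tensor_mult (hmult G) (*) (a \<otimes> x) (b \<otimes> y)) = J (a \<otimes> x) * J (b \<otimes> y)"
      unfolding tensor_mult_def unfolding tensor_lift_tensor[OF b(1)] unfolding tensor_lift_tensor[OF b(2)]
      by (simp add: J_tensor \<iota>_mult tgb_mult)
  qed
qed

lemma J_star: "J (tensor_star st star t) = star (J t)"
proof -
  have "conj_bilinear (\<lambda>a (b::'b). st a \<otimes> star b)"
    by (rule conj_bilinear_compose_stars(1)[OF cbilinear_tensor])
  then have "J (tensor_star st star t) = tensor_lift (\<lambda>a y. J (st a \<otimes> star y)) t"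
    unfolding tensor_star_def by (rule clinear_tensor_lift_conj_eq[OF J_clinear])
  also have "\<dots> = tensor_lift (\<lambda>a y. star (tgb (\<iota> a) y)) t"
    by (simp add: J_tensor \<iota>_st tgb_star)
  also have "\<dots> = star (J t)"
    unfolding J_def by (rule star_tensor_lift[symmetric]) (simp add: J_cbilinear)
  finally show ?thesis .
qed

lemma \<Theta>_mult:
  assumes "x \<in> B" "y \<in> B"
  shows "x * y \<in> B" "\<Theta> (x * y) = tensor_mult (hmult G) (*) (\<Theta> x) (\<Theta> y)"
proof -
  have "\<theta> (x * y) = J (tensor_mult (hmult G) (*) (\<Theta> x) (\<Theta> y))"
    by (simp add: J_mult J_\<Theta> assms \<theta>_simps)
  then show "x * y \<in> B" "\<Theta> (x * y) = tensor_mult (hmult G) (*) (\<Theta> x) (\<Theta> y)"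
    by (auto simp: mem_B intro: \<Theta>_unique)
qed

lemma \<Theta>_star:
  assumes "x \<in> B"
  shows "star x \<in> B" "\<Theta> (star x) = tensor_star st star (\<Theta> x)"
proof -
  have "\<theta> (star x) = J (tensor_star st star (\<Theta> x))"
    by (simp add: J_star J_\<Theta> assms \<theta>_simps)
  then show "star x \<in> B" "\<Theta> (star x) = tensor_star st star (\<Theta> x)"
    by (auto simp: mem_B intro: \<Theta>_unique)
qed

lemma B_subspace: "complex_vector.subspace B"
proof (rule complex_vector.subspaceI)
  show "0 \<in> B" unfolding mem_B by (rule exI[of _ 0]) (simp add: clinear_zero[OF \<theta>_linear] clinear_zero[OF J_clinear])
  show "x + y \<in> B" if "x \<in> B" "y \<in> B" for x y
    using that unfolding mem_B by (metis clinear_add[OF \<theta>_linear] clinear_add[OF J_clinear])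
  show "c *\<^sub>C x \<in> B" if "x \<in> B" for c x
    using that unfolding mem_B by (metis clinear_scaleC[OF \<theta>_linear] clinear_scaleC[OF J_clinear])
qed

text \<open>Coassociativity of the action restricted to algebraic tensors; both sides still live in
  the completed triple product.\<close>

lemma coassociativity:
  assumes x: "x \<in> B"
  shows "tensor_lift (\<lambda>a y. q (\<iota> a) (\<theta> y)) (\<Theta> x) =
    tensor_lift (\<lambda>a s. q (\<iota> a) (J s)) (tensor_lift (\<lambda>a y. L (\<lambda>b c. b \<otimes> (c \<otimes> y)) a) (\<Theta> x))"
proof -
  obtain \<Delta>\<iota> \<iota>\<theta> where h: "star_hom \<Delta>\<iota>" "star_hom \<iota>\<theta>" "\<And>a x. \<Delta>\<iota> (tgb a x) = p (\<Delta> a) x"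
    "\<And>a x. \<iota>\<theta> (tgb a x) = q a (\<theta> x)" "\<And>x. \<Delta>\<iota> (\<theta> x) = \<iota>\<theta> (\<theta> x)"
    using action by (auto simp: continuous_action_def cstar_coassociative_def)
  have lin_h: "clinear \<Delta>\<iota>" "clinear \<iota>\<theta>" using h(1,2) by (simp_all add: star_hom_def)
  have b: "cbilinear (\<lambda>a s. q (\<iota> a) (J s))" "cbilinear (\<lambda>a y. L (\<lambda>b c. b \<otimes> (c \<otimes> y)) a)"
    "cbilinear (\<lambda>b c. b \<otimes> (c \<otimes> y))" "cbilinear (\<lambda>b c. tgg (\<iota> b) (\<iota> c))" for y :: 'b by (intro lin)+
  have c: "clinear (\<lambda>g. p g y)" for y by (intro lin)
  note K = clinear_tensor_lift[OF b(1)]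
  have "tensor_lift (\<lambda>a y. q (\<iota> a) (\<theta> y)) (\<Theta> x) = \<iota>\<theta> (J (\<Theta> x))"
    unfolding J_def clinear_tensor_lift_eq[OF lin_h(2) J_cbilinear] h(4) ..
  also have "\<dots> = \<Delta>\<iota> (J (\<Theta> x))" by (simp add: J_\<Theta> x h(5))
  also have "\<dots> = tensor_lift (\<lambda>a y. L (\<lambda>b c. q (\<iota> b) (tgb (\<iota> c) y)) a) (\<Theta> x)"
    unfolding J_def clinear_tensor_lift_eq[OF lin_h(1) J_cbilinear] h(3) \<Delta>_\<iota> clinear_tensor_lift_eq[OF c b(4)] p_q ..
  also have "\<dots> = tensor_lift (\<lambda>a s. q (\<iota> a) (J s)) (tensor_lift (\<lambda>a y. L (\<lambda>b c. b \<otimes> (c \<otimes> y)) a) (\<Theta> x))"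
    unfolding clinear_tensor_lift_eq[OF K b(2)] clinear_tensor_lift_eq[OF K b(3)] tensor_lift_tensor[OF b(1)] J_tensor ..
  finally show ?thesis .
qed

text \<open>Extend \<open>f\<close> to C(G) through a linear left inverse of \<open>\<iota>\<close>
  and apply it to the first leg of coassociativity: \<theta> of the slice then visibly lies in the
  range of \<open>J\<close>. Injectivity of the algebraic tensor product in the completed one allows
  this even if \<open>f\<close> is unbounded.\<close>

lemma slice_mem:
  assumes x: "x \<in> B" and f: "clinear (f :: 'h \<Rightarrow> complex)"
  shows "tensor_lift (\<lambda>a y. f a *\<^sub>C y) (\<Theta> x) \<in> B"
proof -
  let ?s = "tensor_lift (\<lambda>a y. L (\<lambda>b c. b \<otimes> (c \<otimes> y)) a) (\<Theta> x)"
  obtain k where k: "clinear k" "\<And>a. k (\<iota> a) = a" 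
    using clinear_left_inverse[OF \<iota>_clinear \<iota>_inj] by blast
  note [lin] = clinear_compose[OF k(1)] clinear_compose[OF f]
  have b: "cbilinear (\<lambda>a y. \<iota> a \<otimes> \<theta> y)" "cbilinear (\<lambda>a s. \<iota> a \<otimes> J s)" "cbilinear (\<lambda>g (w::'gb). f (k g) *\<^sub>C w)"
    "cbilinear (\<lambda>a (y::'b). f a *\<^sub>C y)" "cbilinear (\<lambda>a (s::('h,'b) tensor). f a *\<^sub>C s)" by (intro lin)+
  note Q = clinear_tensor_lift[OF q_cbilinear]
  note F = clinear_tensor_lift[OF b(3)]
  have "tensor_lift q (tensor_lift (\<lambda>a y. \<iota> a \<otimes> \<theta> y) (\<Theta> x)) = tensor_lift q (tensor_lift (\<lambda>a s. \<iota> a \<otimes> J s) ?s)"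
    using coassociativity[OF x]
    unfolding clinear_tensor_lift_eq[OF Q b(1)] clinear_tensor_lift_eq[OF Q b(2)] tensor_lift_tensor[OF q_cbilinear] .
  then have "tensor_lift (\<lambda>a y. \<iota> a \<otimes> \<theta> y) (\<Theta> x) = tensor_lift (\<lambda>a s. \<iota> a \<otimes> J s) ?s"
    by (rule injD[OF q_inj])
  then have "tensor_lift (\<lambda>g w. f (k g) *\<^sub>C w) (tensor_lift (\<lambda>a y. \<iota> a \<otimes> \<theta> y) (\<Theta> x)) =
      tensor_lift (\<lambda>g w. f (k g) *\<^sub>C w) (tensor_lift (\<lambda>a s. \<iota> a \<otimes> J s) ?s)" by (rule arg_cong)
  then have "tensor_lift (\<lambda>a y. f a *\<^sub>C \<theta> y) (\<Theta> x) = tensor_lift (\<lambda>a s. f a *\<^sub>C J s) ?s"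
    unfolding clinear_tensor_lift_eq[OF F b(1)] clinear_tensor_lift_eq[OF F b(2)] tensor_lift_tensor[OF b(3)] k .
  then have "\<theta> (tensor_lift (\<lambda>a y. f a *\<^sub>C y) (\<Theta> x)) = J (tensor_lift (\<lambda>a s. f a *\<^sub>C s) ?s)"
    unfolding clinear_tensor_lift_eq[OF \<theta>_linear b(4)] clinear_tensor_lift_eq[OF J_clinear b(5)]
      clinear_scaleC[OF \<theta>_linear] clinear_scaleC[OF J_clinear] .
  then show ?thesis unfolding mem_B by blast
qed

lemma \<Theta>_range: "x \<in> B \<Longrightarrow> \<Theta> x \<in> tensor_on UNIV B"
  by (intro tensor_on_of_slices slice_mem)

lemma \<Theta>_coassoc:
  assumes x: "x \<in> B"
  shows "tensor_lift (\<lambda>a y. a \<otimes> \<Theta> y) (\<Theta> x) = tensor_lift (\<lambda>a y. L (\<lambda>b c. b \<otimes> (c \<otimes> y)) a) (\<Theta> x)"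
proof (rule injD[where f = "tensor_lift (\<lambda>a s. q (\<iota> a) (J s))"])
  show "inj (tensor_lift (\<lambda>a s. q (\<iota> a) (J s)))"
    using q_cbilinear q_inj \<iota>_clinear \<iota>_inj J_clinear J_inj by (rule inj_tensor_lift_compose)
  have b: "cbilinear (\<lambda>a s. q (\<iota> a) (J s))" "cbilinear (\<lambda>a y. a \<otimes> \<Theta> y)"
    "cbilinear (\<lambda>a y. q (\<iota> a) (J (\<Theta> y)))" "cbilinear (\<lambda>a y. q (\<iota> a) (\<theta> y))" by (intro lin)+
  have "tensor_lift (\<lambda>a s. q (\<iota> a) (J s)) (tensor_lift (\<lambda>a y. a \<otimes> \<Theta> y) (\<Theta> x)) =
      tensor_lift (\<lambda>a y. q (\<iota> a) (J (\<Theta> y))) (\<Theta> x)"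
    unfolding clinear_tensor_lift_eq[OF clinear_tensor_lift[OF b(1)] b(2)] tensor_lift_tensor[OF b(1)] ..
  also have "\<dots> = tensor_lift (\<lambda>a y. q (\<iota> a) (\<theta> y)) (\<Theta> x)"
    using \<Theta>_range[OF x] disjI1[OF b(3)] disjI1[OF b(4)] by (rule tensor_lift_cong_on) (simp add: J_\<Theta>)
  finally show "tensor_lift (\<lambda>a s. q (\<iota> a) (J s)) (tensor_lift (\<lambda>a y. a \<otimes> \<Theta> y) (\<Theta> x)) =
      tensor_lift (\<lambda>a s. q (\<iota> a) (J s)) (tensor_lift (\<lambda>a y. L (\<lambda>b c. b \<otimes> (c \<otimes> y)) a) (\<Theta> x))"
    unfolding coassociativity[OF x] .
qed

text \<open>The definition of a continuous action states no counit condition. It follows from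
  injectivity of \<theta>: by coassociativity \<open>x\<close> and its counit slice have the same
  image.\<close>

lemma \<Theta>_counit:
  assumes x: "x \<in> B"
  shows "tensor_lift (\<lambda>a y. \<epsilon> a *\<^sub>C y) (\<Theta> x) = x"
proof -
  let ?z = "tensor_lift (\<lambda>a y. \<epsilon> a *\<^sub>C y) (\<Theta> x)"
  have b: "cbilinear (\<lambda>a (s::('h,'b) tensor). \<epsilon> a *\<^sub>C s)" "cbilinear (\<lambda>a y. a \<otimes> \<Theta> y)" "cbilinear (\<lambda>a (y::'b). \<epsilon> a *\<^sub>C y)"
    "cbilinear (\<lambda>a y. L (\<lambda>b c. b \<otimes> (c \<otimes> y)) a)" "cbilinear (\<lambda>b c. b \<otimes> (c \<otimes> y))" "cbilinear (\<lambda>b c. \<epsilon> b *\<^sub>C c)"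
    for y :: 'b by (intro lin)+
  note F = clinear_tensor_lift[OF b(1)]
  have "\<Theta> ?z = tensor_lift (\<lambda>a y. \<epsilon> a *\<^sub>C \<Theta> y) (\<Theta> x)"
    unfolding clinear_tensor_lift_eq[OF \<Theta>_clinear b(3)] clinear_scaleC[OF \<Theta>_clinear] ..
  also have "\<dots> = tensor_lift (\<lambda>a s. \<epsilon> a *\<^sub>C s) (tensor_lift (\<lambda>a y. a \<otimes> \<Theta> y) (\<Theta> x))"
    unfolding clinear_tensor_lift_eq[OF F b(2)] tensor_lift_tensor[OF b(1)] ..
  also have "\<dots> = tensor_lift (\<lambda>a y. L (\<lambda>b c. \<epsilon> b *\<^sub>C (c \<otimes> y)) a) (\<Theta> x)"
    unfolding \<Theta>_coassoc[OF x] clinear_tensor_lift_eq[OF F b(4)] clinear_tensor_lift_eq[OF F b(5)] tensor_lift_tensor[OF b(1)] ..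
  also have "\<dots> = \<Theta> x"
    by (simp add: counit_left tensor_lift_tensor_const[OF b(6)] tensor_lift_ident flip: tensor_scaleC_left)
  finally have "\<theta> ?z = \<theta> x"
    using J_\<Theta>[OF x] J_\<Theta>[OF slice_mem[OF x counit_clinear]] by simp
  then show ?thesis by (rule injD[OF \<theta>_inj])
qed

text \<open>Fixed points are where the continuous maps \<theta> and x -> 1 \<otimes> x agree; every
  such x is regular.\<close>

lemma closed_fixed: "closed {x \<in> B. \<Theta> x = \<one> \<otimes> x}"
proof -
  have "{x \<in> B. \<Theta> x = \<one> \<otimes> x} = {x. \<theta> x = tgb 1 x}"
    using J_\<Theta> \<Theta>_unique[of _ "\<one> \<otimes> _"] by (auto simp: mem_B J_tensor \<iota>_one) (metis J_tensor \<iota>_one)+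
  moreover have "star_hom (tgb 1)"
    by (simp add: star_hom_def clinear_of_cbilinear[OF tgb_cbilinear] tgb_mult tgb_star star_one)
  then have "continuous_on UNIV (tgb 1)" "continuous_on UNIV \<theta>"
    using \<theta>_hom by (simp_all add: star_hom_bounded_linear linear_continuous_on)
  ultimately show ?thesis using closed_Collect_eq by metis
qed

end

theorem proposition4p4:
  fixes tgg :: "'g::{cstar_algebra, real_normed_algebra_1} \<Rightarrow> 'g \<Rightarrow> 'gg::cstar_algebra"
    and tggg_l :: "'gg \<Rightarrow> 'g \<Rightarrow> 'ggg::cstar_algebra"
    and tggg_r :: "'g \<Rightarrow> 'gg \<Rightarrow> 'ggg"
    and \<Delta> :: "'g \<Rightarrow> 'gg"
    and G :: "'h::complex_vector star_bialgebra"
    and \<iota> :: "'h \<Rightarrow> 'g"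
    and tgb :: "'g \<Rightarrow> 'b::cstar_algebra \<Rightarrow> 'gb::cstar_algebra"
    and tggb_l :: "'gg \<Rightarrow> 'b \<Rightarrow> 'ggb::cstar_algebra"
    and tggb_r :: "'g \<Rightarrow> 'gb \<Rightarrow> 'ggb"
    and \<theta> :: "'b \<Rightarrow> 'gb"
    and \<Omega> :: "('h, 'h) tensor \<Rightarrow> complex"
  defines "\<B> \<equiv> regular_elements \<iota> tgb \<theta>"
    and "\<theta>\<^sub>0 \<equiv> regular_coaction \<iota> tgb \<theta>"
  assumes "reduced_quantum_group tgg tggg_l tggg_r \<Delta> G \<iota>"
    and "continuous_action tgg \<Delta> tgb tggb_l tggb_r \<theta>"
    and "unitary_cocycle G \<Omega>"
    and "normalized_cocycle G \<Omega>"
  shows "star_algebra (deformed_algebra G \<Omega> \<B> \<theta>\<^sub>0) \<and>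
         algebraic_action (deformed_quantum_group G \<Omega>) (deformed_algebra G \<Omega> \<B> \<theta>\<^sub>0) \<theta>\<^sub>0"
proof -
  have m: "matrix_coefficient_algebra tgg \<Delta> G \<iota>" and "faithful_haar_state G \<iota>"
    using assms(3) by (simp_all add: reduced_quantum_group_def)
  then obtain \<phi> where \<phi>: "positive_functional \<phi>" "haar_state G (\<lambda>a. \<phi> (\<iota> a))" "\<And>x. \<phi> (star x * x) = 0 \<Longrightarrow> x = 0"
    by (auto simp: faithful_haar_state_def)
  interpret continuous_cqg_action G tgg \<Delta> \<iota> tgb tggb_l tggb_r \<theta>
    using m assms(4) by unfold_locales (simp_all add: matrix_coefficient_algebra_def)
  have "a = 0" if "\<phi> (\<iota> (st a \<cdot> a)) = 0" for a
    using \<phi>(3)[of "\<iota> a"] that \<iota>_inj clinear_zero[OF \<iota>_clinear] by (auto simp: \<iota>_mult \<iota>_st inj_def)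
  then interpret deformed_action G \<Omega> "\<lambda>a. \<phi> (\<iota> a)" \<B> \<Theta> \<theta>\<^sub>0
    unfolding \<B>_def \<theta>\<^sub>0_def using assms(5,6) \<phi>(2)
    by unfold_locales (simp_all add: clinear_add[OF \<Theta>_clinear] clinear_scaleC[OF \<Theta>_clinear] regular_coaction_eq B_subspace \<Theta>_mult \<Theta>_star \<Theta>_range \<Theta>_coassoc \<Theta>_counit closed_fixed)
  show ?thesis using star_algebra_D algebraic_action_D by blast
qed

end
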